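(* Let $e>0$ be fixed, let $f:\mathbb{R}\to\mathbb{R}$ be a continuous function satisfying (f1) $\lim_{|s|\to\infty} f(s)/s=0$; (f2) $\lim_{s\to 0} f(s)/s=0$; (f3) there exists $s_0\in\mathbb{R}$ with $F(s_0)>0$, where $F(s)=\int_0^s f(t)\,dt$, and let $\alpha\in L^\infty(\mathbb{R}^3)\cap L^{6/(5-q)}(\mathbb{R}^3)$ for some $q\in(0,1)$ be a non-negative, not identically zero, radially symmetric function. Let $c_f=\max_{s\neq 0}\frac{|f(s)|}{|s|+4\sqrt{\pi}\,e\,s^2}>0$. Then there exist an open interval $\Lambda\subset(\|\alpha\|_\infty^{-1}c_f^{-1},\infty)$ and a real number $\nu>0$ such that for every $\lambda\in\Lambda$ the system $$-\Delta u+u+e\phi u=\lambda\alpha(x)f(u)\ \text{in }\mathbb{R}^3,\qquad -\Delta\phi=4\pi e u^2\ \text{in }\mathbb{R}^3$$ has at least two distinct, radially symmetric, nontrivial weak solutions $(u_\lambda^i,\phi_\lambda^i)\in H^1(\mathbb{R}^3)\times\mathcal D^{1,2}(\mathbb{R}^3)$, $i\in\{1,2\}$, satisfying $\|u_\lambda^i\|_{H^1}\le\nu$ and $\|\phi_\lambda^i\|_{\mathcal D^{1,2}}\le\nu$.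
   Context: $H^1(\mathbb{R}^3)$ is the standard Sobolev space with norm $\|u\|_{H^1}=(\int_{\mathbb{R}^3}|\nabla u|^2+u^2)^{1/2}$. $\mathcal D^{1,2}(\mathbb{R}^3)$ is the completion of $C_0^\infty(\mathbb{R}^3)$ with respect to the norm $\|\phi\|_{\mathcal D^{1,2}}=(\int_{\mathbb{R}^3}|\nabla\phi|^2)^{1/2}$. A weak solution is a pair $(u,\phi)\in H^1(\mathbb{R}^3)\times\mathcal D^{1,2}(\mathbb{R}^3)$ such that $\int_{\mathbb{R}^3}(\nabla u\cdot\nabla v+uv+e\phi uv)=\lambda\int_{\mathbb{R}^3}\alpha(x)f(u)v$ for all $v\in H^1(\mathbb{R}^3)$ and $\int_{\mathbb{R}^3}\nabla\phi\cdot\nabla\psi=4\pi e\int_{\mathbb{R}^3}u^2\psi$ for all $\psi\in\mathcal D^{1,2}(\mathbb{R}^3)$. *)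

theory Defs
  imports "HOL-Analysis.Analysis"
begin

definition partial :: "(real^3 \<Rightarrow> real) \<Rightarrow> 3 \<Rightarrow> real^3 \<Rightarrow> real" where
  "partial \<psi> i x = frechet_derivative \<psi> (at x) (axis i 1)"

definition cgrad :: "(real^3 \<Rightarrow> real) \<Rightarrow> real^3 \<Rightarrow> real^3" where
  "cgrad \<psi> x = (\<chi> i. partial \<psi> i x)"

coinductive smooth3 :: "(real^3 \<Rightarrow> real) \<Rightarrow> bool" where
  "(\<forall>x. \<psi> differentiable (at x)) \<Longrightarrow> (\<forall>i. smooth3 (partial \<psi> i)) \<Longrightarrow> smooth3 \<psi>"

definition test_fun :: "(real^3 \<Rightarrow> real) \<Rightarrow> bool" where
  "test_fun \<psi> \<longleftrightarrow> smooth3 \<psi> \<and> compact (closure {x. \<psi> x \<noteq> 0})"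

definition weak_grad :: "(real^3 \<Rightarrow> real) \<Rightarrow> (real^3 \<Rightarrow> real^3) \<Rightarrow> bool" where
  "weak_grad u g \<longleftrightarrow> u \<in> borel_measurable lebesgue \<and> g \<in> borel_measurable lebesgue \<and>
     (\<forall>i \<psi>. test_fun \<psi> \<longrightarrow>
        integrable lebesgue (\<lambda>x. u x * partial \<psi> i x) \<and>
        integrable lebesgue (\<lambda>x. g x $ i * \<psi> x) \<and>
        (\<integral>x. u x * partial \<psi> i x \<partial>lebesgue) = - (\<integral>x. g x $ i * \<psi> x \<partial>lebesgue))"

definition L2_weak_grad :: "(real^3 \<Rightarrow> real) \<Rightarrow> (real^3 \<Rightarrow> real^3) \<Rightarrow> bool" where
  "L2_weak_grad u g \<longleftrightarrow> weak_grad u g \<and> integrable lebesgue (\<lambda>x. (norm (g x))\<^sup>2)"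

definition wgrad :: "(real^3 \<Rightarrow> real) \<Rightarrow> real^3 \<Rightarrow> real^3" where
  "wgrad u = (SOME g. L2_weak_grad u g)"

definition H1 :: "(real^3 \<Rightarrow> real) \<Rightarrow> bool" where
  "H1 u \<longleftrightarrow> u \<in> borel_measurable lebesgue \<and> integrable lebesgue (\<lambda>x. (u x)\<^sup>2) \<and>
     (\<exists>g. L2_weak_grad u g)"

definition H1_norm :: "(real^3 \<Rightarrow> real) \<Rightarrow> real" where
  "H1_norm u = sqrt (\<integral>x. (norm (wgrad u x))\<^sup>2 + (u x)\<^sup>2 \<partial>lebesgue)"

text \<open>D^{1,2}(R^3): completion of C_0^infinity w.r.t. the gradient norm, realised as the
  L^6 functions with square-integrable weak gradient that are limits of test functions
  in the gradient norm.\<close>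
definition D12 :: "(real^3 \<Rightarrow> real) \<Rightarrow> bool" where
  "D12 \<phi> \<longleftrightarrow> \<phi> \<in> borel_measurable lebesgue \<and> integrable lebesgue (\<lambda>x. (\<phi> x) ^ 6) \<and>
     (\<exists>g. L2_weak_grad \<phi> g \<and>
        (\<exists>\<psi>s. (\<forall>n. test_fun (\<psi>s n)) \<and>
           (\<lambda>n. \<integral>x. (norm (cgrad (\<psi>s n) x - g x))\<^sup>2 \<partial>lebesgue) \<longlonglongrightarrow> 0))"

definition D12_norm :: "(real^3 \<Rightarrow> real) \<Rightarrow> real" where
  "D12_norm \<phi> = sqrt (\<integral>x. (norm (wgrad \<phi> x))\<^sup>2 \<partial>lebesgue)"

definition weak_solution ::
  "real \<Rightarrow> real \<Rightarrow> (real^3 \<Rightarrow> real) \<Rightarrow> (real \<Rightarrow> real) \<Rightarrow> (real^3 \<Rightarrow> real) \<Rightarrow> (real^3 \<Rightarrow> real) \<Rightarrow> bool"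
  where
  "weak_solution e lam \<alpha> f u \<phi> \<longleftrightarrow> H1 u \<and> D12 \<phi> \<and>
     (\<forall>v. H1 v \<longrightarrow>
        (\<integral>x. wgrad u x \<bullet> wgrad v x + u x * v x + e * \<phi> x * u x * v x \<partial>lebesgue)
          = lam * (\<integral>x. \<alpha> x * f (u x) * v x \<partial>lebesgue)) \<and>
     (\<forall>\<psi>. D12 \<psi> \<longrightarrow>
        (\<integral>x. wgrad \<phi> x \<bullet> wgrad \<psi> x \<partial>lebesgue) = 4 * pi * e * (\<integral>x. (u x)\<^sup>2 * \<psi> x \<partial>lebesgue))"

definition radial :: "(real^3 \<Rightarrow> real) \<Rightarrow> bool" where
  "radial w \<longleftrightarrow> (\<forall>x y. norm x = norm y \<longrightarrow> w x = w y)"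

definition Linf_norm :: "(real^3 \<Rightarrow> real) \<Rightarrow> real" where
  "Linf_norm \<alpha> = Inf {M. 0 \<le> M \<and> (AE x in lebesgue. \<bar>\<alpha> x\<bar> \<le> M)}"

definition c_const :: "real \<Rightarrow> (real \<Rightarrow> real) \<Rightarrow> real" where
  "c_const e f = (SUP s\<in>{s. s \<noteq> 0}. \<bar>f s\<bar> / (\<bar>s\<bar> + 4 * sqrt pi * e * s\<^sup>2))"

end

theory Submission
  imports Defs "HOL-Complex_Analysis.Great_Picard" "HOL-Real_Asymp.Real_Asymp"
begin

text \<open>
  For radial \<open>u\<close> put \<open>w r = r u r\<close>. The system becomes the scalar equation
  \<open>- w'' + w + e \<phi> w = \<lambda> b r f(w / r)\<close> on the half-line, where \<open>\<phi> r\<close> is \<open>4 \<pi> e\<close> times the integral of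
  \<open>w s\<^sup>2 / max r s\<close>. In terms of \<open>q = w' + w\<close> its energy has the gradient \<open>q - T w\<close> with \<open>T\<close> completely
  continuous, because \<open>w\<close> is bounded and Hoelder continuous in terms of the norm of \<open>q\<close>. The energy is
  coercive since \<open>f\<close> is sublinear at infinity, has a strict local minimum at \<open>0\<close> since \<open>f\<close> is superlinear
  at \<open>0\<close>, and takes negative values for all large \<open>\<lambda>\<close> since \<open>F\<close> is positive somewhere. Hence there are a
  global minimiser of negative energy and a mountain pass point of positive energy; for the latter, paths
  are pushed down by small explicit gradient steps, so that no gradient flow is needed. A critical point
  turns into a weak solution on three-space by testing the radial fields \<open>\<nabla> u\<close> and \<open>\<nabla> \<phi>\<close>, whose
  divergences are bounded functions, against arbitrary Sobolev functions. Critical points are bounded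
  uniformly for bounded \<open>\<lambda>\<close>, so \<open>\<Lambda> = (a, a + 1)\<close> works for every large \<open>a\<close>.
\<close>

section \<open>A minimum and a mountain pass point\<close>

text \<open>Solving the Poisson equation for the potential leaves a functional of one unknown with a
  non-negative quartic nonlocal term, which can only help coercivity. As alpha is bounded and
  6/(5-q) < 2, alpha is square integrable; hence the constant in |f(s)| <= eps |s| + C costs only a
  term linear in the norm, although the domain is unbounded. The space of profiles is not complete,
  and bounded sequences may lose mass at infinity. Both obstacles vanish because q is the sum of its
  gradient and T w: when the gradient tends to 0, q converges as soon as T w does, and T w always
  lies in the space. Criticality is tested only by radial variations, whereas the weak equations
  must hold for all test functions, radial or not. Since alpha is merely measurable, u need not be
  twice differentiable. The gradient fields are therefore described by fluxes of bounded measurable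
  densities, and these are reached through polynomial densities in |x|^2, whose fluxes are smooth
  and explicit.\<close>

lemma two_critical_points:
  fixes E :: "'a::real_inner \<Rightarrow> real" and D :: "'a \<Rightarrow> 'a"
  assumes diff: "\<And>R \<epsilon>. \<epsilon> > 0 \<Longrightarrow> \<exists>\<delta>>0. \<forall>x z. norm x \<le> R \<longrightarrow> norm z \<le> \<delta> \<longrightarrow>
                    \<bar>E (x + z) - E x - D x \<bullet> z\<bar> \<le> \<epsilon> * norm z"
    and D_bounded: "\<And>R. \<exists>B. \<forall>x. norm x \<le> R \<longrightarrow> norm (D x) \<le> B"
    and D_cont: "continuous_on UNIV D" and E_cont: "continuous_on UNIV E"
    and coercive: "\<And>c. \<exists>R. \<forall>x. E x \<le> c \<longrightarrow> norm x \<le> R"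
    and below: "bdd_below (range E)"
    and PS: "\<And>(X :: nat \<Rightarrow> 'a) R. (\<And>n. norm (X n) \<le> R) \<Longrightarrow> (\<lambda>n. D (X n)) \<longlonglongrightarrow> 0 \<Longrightarrow>
               \<exists>r x. strict_mono (r :: nat \<Rightarrow> nat) \<and> (X \<circ> r) \<longlonglongrightarrow> x"
    and E0: "E 0 = 0" and \<rho>: "\<rho> > 0" and \<eta>: "\<eta> > 0"
    and ball: "\<And>x. norm x \<le> \<rho> \<Longrightarrow> 0 \<le> E x" and sphere: "\<And>x. norm x = \<rho> \<Longrightarrow> \<eta> \<le> E x"
    and x1: "E x1 < 0"
  shows "\<exists>x y. D x = 0 \<and> D y = 0 \<and> E x < 0 \<and> 0 < E y"
proof -
  \<comment> \<open>Differentiability is uniform on bounded sets, so one step length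
    \<open>t\<close> serves all points of the ball with gradient at least \<open>\<delta>\<close>.
    The remainder \<open>\<delta>/2 * norm z\<close> costs at most half of the first-order decrease
    \<open>s * (norm (D x))\<^sup>2\<close>.\<close>
  have step: "\<exists>t>0. \<forall>x s. norm x \<le> R \<longrightarrow> \<delta> \<le> norm (D x) \<longrightarrow> 0 \<le> s \<longrightarrow> s \<le> t \<longrightarrow>
                E (x - s *\<^sub>R D x) \<le> E x - s * (\<delta>\<^sup>2 / 2)" if "\<delta> > 0" for R \<delta>
  proof -
    obtain B where B: "\<And>x. norm x \<le> R \<Longrightarrow> norm (D x) \<le> B" using D_bounded by blast
    obtain d where d: "d > 0" "\<And>x z. norm x \<le> R \<Longrightarrow> norm z \<le> d \<Longrightarrow>
        \<bar>E (x + z) - E x - D x \<bullet> z\<bar> \<le> \<delta>/2 * norm z"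
      using diff[of "\<delta>/2" R] \<open>\<delta> > 0\<close> by auto
    have "E (x - s *\<^sub>R D x) \<le> E x - s * (\<delta>\<^sup>2 / 2)"
      if x: "norm x \<le> R" "\<delta> \<le> norm (D x)" and s: "0 \<le> s" "s \<le> d / (\<bar>B\<bar> + 1)" for x s
    proof -
      have "s * norm (D x) \<le> d / (\<bar>B\<bar> + 1) * (\<bar>B\<bar> + 1)"
        using B[OF x(1)] s d(1) by (intro mult_mono) auto
      then have "norm (- (s *\<^sub>R D x)) \<le> d" using s by simp
      from d(2)[OF x(1) this]
      have "\<bar>E (x - s *\<^sub>R D x) - E x + s * (norm (D x))\<^sup>2\<bar> \<le> \<delta>/2 * (s * norm (D x))"
        using s by (simp add: power2_norm_eq_inner)
      moreover have "s * (\<delta> * \<delta> / 2) \<le> s * (norm (D x) * (norm (D x) - \<delta>/2))"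
      proof -
        have "\<delta> * (\<delta> / 2) \<le> norm (D x) * (norm (D x) - \<delta>/2)"
          using x \<open>\<delta> > 0\<close> by (intro mult_mono) auto
        then show ?thesis using s by (intro mult_left_mono) auto
      qed
      ultimately have "E (x - s *\<^sub>R D x) - E x + s * (norm (D x))\<^sup>2 \<le> \<delta>/2 * (s * norm (D x))"
        "s * (\<delta> * \<delta> / 2) \<le> s * (norm (D x))\<^sup>2 - \<delta>/2 * (s * norm (D x))"
        by (blast dest: abs_le_D1, simp add: power2_eq_square algebra_simps)
      then show ?thesis by (simp add: power2_eq_square)
    qed
    moreover have "d / (\<bar>B\<bar> + 1) > 0" using d by auto
    ultimately show ?thesis by blast
  qed
  \<comment> \<open>Compactness takes the place of completeness: a subsequence converges by
    \<open>PS\<close>, and continuity of \<open>D\<close> and \<open>E\<close> identifies its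
    limit.\<close>
  have attained: "\<exists>x. D x = 0 \<and> E x = c"
    if *: "\<And>\<delta>. \<delta> > 0 \<Longrightarrow> \<exists>x. norm x \<le> R \<and> \<bar>E x - c\<bar> \<le> \<delta> \<and> norm (D x) \<le> \<delta>" for R c
  proof -
    have "\<forall>n. \<exists>x. norm x \<le> R \<and> \<bar>E x - c\<bar> \<le> 1 / real (Suc n) \<and> norm (D x) \<le> 1 / real (Suc n)"
      using * by simp
    then obtain X where X: "\<And>n. norm (X n) \<le> R" "\<And>n. \<bar>E (X n) - c\<bar> \<le> 1 / real (Suc n)"
      "\<And>n. norm (D (X n)) \<le> 1 / real (Suc n)" by metis
    have D0: "(\<lambda>n. D (X n)) \<longlonglongrightarrow> 0"
      using X(3) LIMSEQ_Suc[OF lim_1_over_n[where 'a=real]] by (rule Lim_null_comparison[OF always_eventually[OF allI]])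
    have "(\<lambda>n. E (X n) - c) \<longlonglongrightarrow> 0"
      using X(2)[folded real_norm_def] LIMSEQ_Suc[OF lim_1_over_n[where 'a=real]]
      by (rule Lim_null_comparison[OF always_eventually[OF allI]])
    then have Ec: "(\<lambda>n. E (X n)) \<longlonglongrightarrow> c" using LIM_zero_iff by blast
    from PS[OF X(1) D0] obtain r x where r: "strict_mono r" "(X \<circ> r) \<longlonglongrightarrow> x" by blast
    have "(\<lambda>n. D ((X \<circ> r) n)) \<longlonglongrightarrow> D x" "(\<lambda>n. E ((X \<circ> r) n)) \<longlonglongrightarrow> E x"
      using continuous_on_tendsto_compose[OF D_cont r(2)] continuous_on_tendsto_compose[OF E_cont r(2)]
      by simp_all
    moreover have "(\<lambda>n. D ((X \<circ> r) n)) \<longlonglongrightarrow> 0" "(\<lambda>n. E ((X \<circ> r) n)) \<longlonglongrightarrow> c"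
      using LIMSEQ_subseq_LIMSEQ[OF D0 r(1)] LIMSEQ_subseq_LIMSEQ[OF Ec r(1)] by (simp_all add: o_def)
    ultimately show ?thesis by (metis LIMSEQ_unique)
  qed
  define m where "m = Inf (range E)"
  have m_le: "m \<le> E x" for x unfolding m_def by (rule cInf_lower[OF rangeI below])
  have "m < 0" using m_le[of x1] x1 by simp
  obtain R where R: "\<And>x. E x \<le> m + 1 \<Longrightarrow> norm x \<le> R" using coercive by blast
  \<comment> \<open>The margin \<open>t * (\<delta>\<^sup>2 / 2)\<close> is exactly the gain of a
    full step, so a point this close to the infimum with a large gradient would step below
    it.\<close>
  have "\<exists>x. norm x \<le> R \<and> \<bar>E x - m\<bar> \<le> \<delta> \<and> norm (D x) \<le> \<delta>" if "\<delta> > 0" for \<delta>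
  proof (rule ccontr)
    assume no: "\<not> ?thesis"
    obtain t where t: "t > 0" "\<And>x s. norm x \<le> R \<Longrightarrow> \<delta> \<le> norm (D x) \<Longrightarrow> 0 \<le> s \<Longrightarrow> s \<le> t \<Longrightarrow>
                E (x - s *\<^sub>R D x) \<le> E x - s * (\<delta>\<^sup>2 / 2)" using step[OF \<open>\<delta> > 0\<close>] by blast
    have pos: "0 < min (min 1 \<delta>) (t * (\<delta>\<^sup>2 / 2))" using t \<open>\<delta> > 0\<close> by simp
    obtain x where x: "E x < m + min (min 1 \<delta>) (t * (\<delta>\<^sup>2 / 2))"
      using cInf_lessD[of "range E" "m + min (min 1 \<delta>) (t * (\<delta>\<^sup>2 / 2))"] pos unfolding m_def by auto
    have nx: "norm x \<le> R" using x by (intro R) auto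
    have "\<bar>E x - m\<bar> \<le> \<delta>" using x m_le[of x] by auto
    with no nx have "\<delta> \<le> norm (D x)" by force
    from t(2)[OF nx this, of t] t(1) x m_le[of "x - t *\<^sub>R D x"] show False by auto
  qed
  from attained[of R m, OF this] obtain x where x: "D x = 0" "E x = m" by blast
  \<comment> \<open>\<open>Inf S\<close> is the mountain pass level: the infimum over paths from 0
    to \<open>x1\<close> of the highest energy on the path.\<close>
  define S where "S = {c. \<exists>\<gamma>. path \<gamma> \<and> pathstart \<gamma> = 0 \<and> pathfinish \<gamma> = x1 \<and> (\<forall>t\<in>{0..1}. E (\<gamma> t) \<le> c)}"
  have S_lower: "\<eta> \<le> c" if "c \<in> S" for c
  proof -
    from that obtain \<gamma> where \<gamma>: "path \<gamma>" "pathstart \<gamma> = 0" "pathfinish \<gamma> = x1"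
      "\<And>t. t \<in> {0..1} \<Longrightarrow> E (\<gamma> t) \<le> c" unfolding S_def by blast
    have "norm x1 > \<rho>" using ball[of x1] x1 by force
    then have "\<exists>t\<ge>0. t \<le> 1 \<and> norm (\<gamma> t) = \<rho>"
      using \<gamma>(1,2,3) \<rho>
      by (intro IVT') (auto simp: path_def pathstart_def pathfinish_def intro!: continuous_on_norm)
    then obtain t where "t \<in> {0..1}" "norm (\<gamma> t) = \<rho>" by auto
    then show ?thesis using \<gamma>(4) sphere by force
  qed
  have "S \<noteq> {}"
  proof -
    have "compact (E ` path_image (linepath 0 x1))"
      by (intro compact_continuous_image continuous_on_subset[OF E_cont] compact_path_image) auto
    then have "bdd_above (E ` path_image (linepath 0 x1))" by (intro bounded_imp_bdd_above compact_imp_bounded)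
    then obtain c where "\<forall>t\<in>{0..1}. E (linepath 0 x1 t) \<le> c"
      unfolding bdd_above_def path_image_def by blast
    then have "c \<in> S" unfolding S_def by (intro CollectI exI[of _ "linepath 0 x1"]) auto
    then show ?thesis by blast
  qed
  define c where "c = Inf S"
  have bdd: "bdd_below S" using S_lower by (rule bdd_belowI)
  have "\<eta> \<le> c" unfolding c_def using \<open>S \<noteq> {}\<close> S_lower by (intro cInf_greatest) auto
  obtain R' where R': "\<And>x. E x \<le> c + 1 \<Longrightarrow> norm x \<le> R'" using coercive by blast
  have "\<exists>x. norm x \<le> R' \<and> \<bar>E x - c\<bar> \<le> \<delta>' \<and> norm (D x) \<le> \<delta>'" if "\<delta>' > 0" for \<delta>'
  proof (rule ccontr)
    assume no': "\<not> ?thesis"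
    \<comment> \<open>\<open>\<delta> \<le> \<eta> / 2\<close> keeps \<open>c - \<delta>\<close>
      above the energy of both end points, so the deformation below fixes them;
      \<open>\<delta> \<le> 1\<close> keeps the energy band inside the ball of radius
      \<open>R'\<close>.\<close>
    define \<delta> where "\<delta> = min \<delta>' (min 1 (\<eta> / 2))"
    have \<delta>: "\<delta> > 0" "\<delta> \<le> 1" "\<delta> \<le> \<eta> / 2" "\<delta> \<le> \<delta>'" using \<eta> \<open>\<delta>' > 0\<close> by (auto simp: \<delta>_def)
    have no: "\<delta> \<le> norm (D x)" if "norm x \<le> R'" "\<bar>E x - c\<bar> \<le> \<delta>" for x
      using no' that \<delta> by force
    obtain t where t: "t > 0" "\<And>x s. norm x \<le> R' \<Longrightarrow> \<delta> \<le> norm (D x) \<Longrightarrow> 0 \<le> s \<Longrightarrow> s \<le> t \<Longrightarrow>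
                E (x - s *\<^sub>R D x) \<le> E x - s * (\<delta>\<^sup>2 / 2)" using step[OF \<open>\<delta> > 0\<close>] by blast
    define \<kappa> where "\<kappa> = min \<delta> (t * \<delta>\<^sup>2 / 4)"
    have \<kappa>: "\<kappa> > 0" "\<kappa> \<le> \<delta>" "\<kappa> \<le> t * \<delta>\<^sup>2 / 4" using t \<delta> by (auto simp: \<kappa>_def)
    obtain c' where c': "c' \<in> S" "c' < c + \<kappa>"
      using cInf_lessD[of S "c + \<kappa>"] \<open>S \<noteq> {}\<close> \<kappa>(1) unfolding c_def by auto
    obtain \<gamma> where \<gamma>: "path \<gamma>" "pathstart \<gamma> = 0" "pathfinish \<gamma> = x1"
      "\<And>t. t \<in> {0..1} \<Longrightarrow> E (\<gamma> t) \<le> c'" using c'(1) unfolding S_def by blast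
    \<comment> \<open>A continuous cutoff in the energy: 0 up to level \<open>c - \<delta>\<close>,
      1 from \<open>c - \<delta>/2\<close> on. A full step lowers the energy by
      \<open>t * \<delta>\<^sup>2 / 2\<close>, while the path exceeds \<open>c\<close> by less than
      \<open>\<kappa>\<close>, at most half of that.\<close>
    define \<theta> where "\<theta> x = max 0 (min 1 ((E x - (c - \<delta>)) / (\<delta>/2)))" for x
    define \<Gamma> where "\<Gamma> x = x - (t * \<theta> x) *\<^sub>R D x" for x
    have "continuous_on UNIV \<Gamma>" unfolding \<Gamma>_def \<theta>_def
      using E_cont D_cont \<delta> by (intro continuous_intros) auto
    then have "path (\<Gamma> \<circ> \<gamma>)" using \<gamma>(1) unfolding path_def
      by (intro continuous_on_compose) (auto elim: continuous_on_subset)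
    moreover have fixed: "\<Gamma> x = x" if "E x \<le> c - \<delta>" for x
      using that \<delta> by (simp add: \<Gamma>_def \<theta>_def max_def min_def divide_simps)
    have "\<Gamma> 0 = 0" "\<Gamma> x1 = x1" using fixed E0 x1 \<open>\<eta> \<le> c\<close> \<delta> by auto
    then have "pathstart (\<Gamma> \<circ> \<gamma>) = 0" "pathfinish (\<Gamma> \<circ> \<gamma>) = x1"
      using \<gamma> by (auto simp: pathstart_def pathfinish_def)
    moreover have "E (\<Gamma> y) \<le> max (c - \<delta>/2) (c - t * \<delta>\<^sup>2 / 4)" if "E y \<le> c'" for y
    proof (cases "E y \<le> c - \<delta>")
      case True
      then show ?thesis using fixed[OF True] \<delta> by simp
    next
      case False
      have ny: "norm y \<le> R'" using that c' \<kappa> \<delta> by (intro R') auto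
      have "\<bar>E y - c\<bar> \<le> \<delta>" using False that c' \<kappa> by auto
      from no[OF ny this] have d: "\<delta> \<le> norm (D y)" .
      have "0 \<le> \<theta> y" "\<theta> y \<le> 1" by (auto simp: \<theta>_def)
      then have le: "E (\<Gamma> y) \<le> E y - (t * \<theta> y) * (\<delta>\<^sup>2 / 2)" unfolding \<Gamma>_def
        using t(1) by (intro t(2)[OF ny d]) (auto simp: mult_left_le)
      show ?thesis
      proof (cases "E y \<ge> c - \<delta>/2")
        case True
        then have "\<theta> y = 1" using \<delta> by (auto simp: \<theta>_def max_def min_def divide_simps)
        then show ?thesis using le that c' \<kappa> by (simp add: le_max_iff_disj)
      next
        case False
        have "0 \<le> (t * \<theta> y) * (\<delta>\<^sup>2 / 2)" using t \<open>0 \<le> \<theta> y\<close> by auto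
        then have "E (\<Gamma> y) \<le> c - \<delta>/2" using le False by linarith
        then show ?thesis by simp
      qed
    qed
    ultimately have "max (c - \<delta>/2) (c - t * \<delta>\<^sup>2 / 4) \<in> S" unfolding S_def using \<gamma>(4)
      by (intro CollectI exI[of _ "\<Gamma> \<circ> \<gamma>"]) auto
    then have "c \<le> max (c - \<delta>/2) (c - t * \<delta>\<^sup>2 / 4)" unfolding c_def using bdd by (rule cInf_lower)
    moreover have "0 < t * \<delta>\<^sup>2 / 4" using t \<delta> by simp
    ultimately show False using \<delta> by (auto simp: max_def split: if_splits)
  qed
  from attained[of R' c, OF this] obtain y where "D y = 0" "E y = c" by blast
  then show ?thesis using x \<open>m < 0\<close> \<open>\<eta> \<le> c\<close> \<eta> by force
qed

section \<open>Square integrable functions on the line\<close>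

definition L2 :: "(real \<Rightarrow> real) \<Rightarrow> bool" where
  "L2 f \<longleftrightarrow> f \<in> borel_measurable borel \<and> integrable lborel (\<lambda>x. (f x)\<^sup>2)"

lemma L2_measurable [measurable_dest]: "L2 f \<Longrightarrow> f \<in> borel_measurable borel"
  and L2_integrable: "L2 f \<Longrightarrow> integrable lborel (\<lambda>x. (f x)\<^sup>2)"
  by (auto simp: L2_def)

lemma L2_bound:
  assumes "L2 f" "g \<in> borel_measurable borel" "\<And>x. \<bar>g x\<bar> \<le> C * \<bar>f x\<bar>"
  shows "L2 g" "(\<integral>x. (g x)\<^sup>2 \<partial>lborel) \<le> C\<^sup>2 * (\<integral>x. (f x)\<^sup>2 \<partial>lborel)"
proof -
  have le: "(g x)\<^sup>2 \<le> C\<^sup>2 * (f x)\<^sup>2" for x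
    using power_mono[OF assms(3)[of x], of 2] by (simp add: power_mult_distrib)
  have i: "integrable lborel (\<lambda>x. C\<^sup>2 * (f x)\<^sup>2)" using assms(1) by (simp add: L2_def)
  have "integrable lborel (\<lambda>x. (g x)\<^sup>2)"
    by (rule Bochner_Integration.integrable_bound[OF i]) (use assms(2) le in auto)
  then show "L2 g" using assms(2) by (simp add: L2_def)
  show "(\<integral>x. (g x)\<^sup>2 \<partial>lborel) \<le> C\<^sup>2 * (\<integral>x. (f x)\<^sup>2 \<partial>lborel)"
    using integral_mono[OF \<open>integrable lborel (\<lambda>x. (g x)\<^sup>2)\<close> i le] by simp
qed

lemma abs_mult_le_sum_squares: "\<bar>a * b\<bar> \<le> a\<^sup>2 + (b\<^sup>2 :: real)"
proof -
  have "0 \<le> \<bar>a\<bar> * \<bar>b\<bar>" by simp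
  then show ?thesis
    using sum_squares_bound[of "\<bar>a\<bar>" "\<bar>b\<bar>"] unfolding abs_mult power2_abs by linarith
qed

lemma L2_mult:
  assumes "L2 f" "L2 g" shows "integrable lborel (\<lambda>x. f x * g x)"
proof (rule Bochner_Integration.integrable_bound)
  show "integrable lborel (\<lambda>x. (f x)\<^sup>2 + (g x)\<^sup>2)" using assms by (auto simp: L2_def)
  show "AE x in lborel. norm (f x * g x) \<le> norm ((f x)\<^sup>2 + (g x)\<^sup>2)"
    using abs_mult_le_sum_squares by simp
qed (use assms in \<open>auto simp: L2_def\<close>)

lemma L2_add: assumes "L2 f" "L2 g" shows "L2 (\<lambda>x. f x + g x)"
proof -
  have "integrable lborel (\<lambda>x. (f x)\<^sup>2 + 2 * (f x * g x) + (g x)\<^sup>2)"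
    using assms L2_mult[OF assms] by (auto simp: L2_def)
  then show ?thesis using assms by (auto simp: L2_def power2_sum algebra_simps)
qed

lemma L2_scale: "L2 f \<Longrightarrow> L2 (\<lambda>x. c * f x)"
  by (auto simp: L2_def power_mult_distrib)

lemma L2_uminus: "L2 f \<Longrightarrow> L2 (\<lambda>x. - f x)"
  by (auto simp: L2_def)

lemma L2_diff: "L2 f \<Longrightarrow> L2 g \<Longrightarrow> L2 (\<lambda>x. f x - g x)"
  using L2_add[OF _ L2_uminus] by fastforce

lemma L2_zero [simp]: "L2 (\<lambda>x. 0)" by (simp add: L2_def)

text \<open>The integral of \<open>(s * f x - t * g x)\<^sup>2\<close> is non-negative for all
  \<open>s\<close> and \<open>t\<close>. The choice \<open>s = c\<close>, \<open>t = b\<close> gives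
  the claim if \<open>c > 0\<close>; if \<open>c = 0\<close>, then \<open>s = b\<close>,
  \<open>t = a + 1\<close> makes the form negative unless \<open>b = 0\<close>.\<close>

lemma L2_Cauchy_Schwarz:
  assumes "L2 f" "L2 g"
  shows "\<bar>\<integral>x. f x * g x \<partial>lborel\<bar> \<le> sqrt (\<integral>x. (f x)\<^sup>2 \<partial>lborel) * sqrt (\<integral>x. (g x)\<^sup>2 \<partial>lborel)"
proof -
  define a b c where "a = (\<integral>x. (f x)\<^sup>2 \<partial>lborel)" and "b = (\<integral>x. f x * g x \<partial>lborel)"
    and "c = (\<integral>x. (g x)\<^sup>2 \<partial>lborel)"
  have q: "0 \<le> a * s\<^sup>2 - 2 * b * s * t + c * t\<^sup>2" for s t
  proof -
    have "0 \<le> (\<integral>x. (s * f x - t * g x)\<^sup>2 \<partial>lborel)" by (rule Bochner_Integration.integral_nonneg) simp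
    also have "(\<integral>x. (s * f x - t * g x)\<^sup>2 \<partial>lborel)
        = (\<integral>x. s\<^sup>2 * (f x)\<^sup>2 - (2 * s * t) * (f x * g x) + t\<^sup>2 * (g x)\<^sup>2 \<partial>lborel)"
      by (rule Bochner_Integration.integral_cong) (auto simp: power2_eq_square algebra_simps)
    also have "\<dots> = a * s\<^sup>2 - 2 * b * s * t + c * t\<^sup>2"
      using assms L2_mult[OF assms] unfolding a_def b_def c_def by (simp add: L2_def)
    finally show ?thesis .
  qed
  have "a \<ge> 0" "c \<ge> 0" unfolding a_def c_def by (auto intro: Bochner_Integration.integral_nonneg)
  have "b\<^sup>2 \<le> a * c"
  proof (cases "c = 0")
    case True
    have "b = 0"
    proof (rule ccontr)
      assume "b \<noteq> 0"
      have "0 \<le> a * b\<^sup>2 - 2 * b * b * (a + 1)" using q[of b "a+1"] True by simp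
      also have "\<dots> = - (a + 2) * b\<^sup>2" by (simp add: power2_eq_square algebra_simps)
      finally have "(a + 2) * b\<^sup>2 \<le> 0" by (simp add: algebra_simps)
      moreover have "(a + 2) * b\<^sup>2 > 0" using \<open>a \<ge> 0\<close> \<open>b \<noteq> 0\<close> by (intro mult_pos_pos) auto
      ultimately show False by simp
    qed
    then show ?thesis using \<open>c = 0\<close> by simp
  next
    case False
    have "0 \<le> a * c\<^sup>2 - 2 * b * c * b + c * b\<^sup>2" by (rule q)
    also have "\<dots> = c * (a * c - b\<^sup>2)" by (simp add: power2_eq_square algebra_simps)
    finally have "0 \<le> c * (a * c - b\<^sup>2)" .
    then show ?thesis using False \<open>c \<ge> 0\<close> by (simp add: zero_le_mult_iff)
  qed
  then have "sqrt (b\<^sup>2) \<le> sqrt (a * c)" by (rule real_sqrt_le_mono)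
  then show ?thesis by (simp add: real_sqrt_mult a_def b_def c_def)
qed

text \<open>Row integrals at most 1 give a pointwise Jensen inequality for a sub-probability kernel,
  and column integrals at most 1 bound its right-hand side after integration. Since the conditions
  are symmetric, the transposed kernel is covered as well and is the adjoint.\<close>

lemma Schur_test:
  fixes k :: "real \<Rightarrow> real \<Rightarrow> real"
  assumes k [measurable]: "(\<lambda>p. k (fst p) (snd p)) \<in> borel_measurable (borel \<Otimes>\<^sub>M borel)"
    and k01: "\<And>r s. 0 \<le> k r s" "\<And>r s. k r s \<le> 1"
    and row: "\<And>r. (\<integral>\<^sup>+s. ennreal (k r s) \<partial>lborel) \<le> 1"
    and col: "\<And>s. (\<integral>\<^sup>+r. ennreal (k r s) \<partial>lborel) \<le> 1"
    and f: "L2 f"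
  shows "\<And>r. integrable lborel (\<lambda>s. k r s * f s)"
    and "L2 (\<lambda>r. \<integral>s. k r s * f s \<partial>lborel)"
    and "(\<integral>r. (\<integral>s. k r s * f s \<partial>lborel)\<^sup>2 \<partial>lborel) \<le> (\<integral>s. (f s)\<^sup>2 \<partial>lborel)"
    and "L2 g \<Longrightarrow> (\<integral>r. (\<integral>s. k r s * f s \<partial>lborel) * g r \<partial>lborel)
                = (\<integral>s. f s * (\<integral>r. k r s * g r \<partial>lborel) \<partial>lborel)"
proof -
  note [measurable] = f[THEN L2_measurable]
  have km [measurable]: "case_prod k \<in> borel_measurable (borel \<Otimes>\<^sub>M borel)"
    using k by (simp add: case_prod_unfold)
  have kr [measurable]: "k r \<in> borel_measurable borel" for r
    using measurable_compose[OF measurable_Pair1'[of r borel borel] k] by simp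
  have ks [measurable]: "(\<lambda>r. k r s) \<in> borel_measurable borel" for s
    using measurable_compose[OF measurable_Pair2'[of s borel borel] k] by simp
  have ik: "integrable lborel (k r)" for r
    using row[of r] k01 by (intro integrableI_bounded) (auto simp: order_le_less_trans)
  have ikf2: "integrable lborel (\<lambda>s. k r s * (f s)\<^sup>2)" for r
    using L2_integrable[OF f] by (rule Bochner_Integration.integrable_bound) (use k01 in \<open>auto intro!: mult_left_le_one_le\<close>)
  show ikf: "integrable lborel (\<lambda>s. k r s * f s)" for r
  proof (rule Bochner_Integration.integrable_bound)
    show "integrable lborel (\<lambda>s. k r s + k r s * (f s)\<^sup>2)" using ik ikf2 by auto
    have "\<bar>a\<bar> \<le> 1 + a\<^sup>2" for a :: real using sum_squares_bound[of 1 "\<bar>a\<bar>"] by simp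
    then have "k r s * \<bar>f s\<bar> \<le> k r s * (1 + (f s)\<^sup>2)" for s using k01 by (intro mult_left_mono)
    then show "AE s in lborel. norm (k r s * f s) \<le> norm (k r s + k r s * (f s)\<^sup>2)"
      using k01 by (auto simp: abs_mult algebra_simps)
  qed auto
  have jensen: "(\<integral>s. k r s * f s \<partial>lborel)\<^sup>2 \<le> (\<integral>s. k r s * (f s)\<^sup>2 \<partial>lborel)" for r
  proof -
    define c where "c = (\<integral>s. k r s * f s \<partial>lborel)"
    have "(\<integral>s. k r s \<partial>lborel) \<le> 1"
      using row[of r] k01 ik[of r] by (simp add: nn_integral_eq_integral)
    then have "c\<^sup>2 * (\<integral>s. k r s \<partial>lborel) \<le> c\<^sup>2" by (intro mult_left_le) auto
    \<comment> \<open>The weighted variance about \<open>c\<close>; a total mass below 1 only helps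
      the inequality.\<close>
    have "0 \<le> (\<integral>s. k r s * (f s - c)\<^sup>2 \<partial>lborel)" using k01 by (intro Bochner_Integration.integral_nonneg) simp
    also have "\<dots> = (\<integral>s. k r s * (f s)\<^sup>2 - (2 * c) * (k r s * f s) + c\<^sup>2 * k r s \<partial>lborel)"
      by (rule Bochner_Integration.integral_cong) (auto simp: power2_eq_square algebra_simps)
    also have "\<dots> = (\<integral>s. k r s * (f s)\<^sup>2 \<partial>lborel) - 2 * c * c + c\<^sup>2 * (\<integral>s. k r s \<partial>lborel)"
      using ik ikf2 ikf unfolding c_def by simp
    finally show ?thesis using \<open>c\<^sup>2 * _ \<le> c\<^sup>2\<close> by (simp add: c_def[symmetric] power2_eq_square)
  qed
  have nn: "(\<integral>\<^sup>+r. ennreal ((\<integral>s. k r s * f s \<partial>lborel)\<^sup>2) \<partial>lborel) \<le> (\<integral>\<^sup>+s. ennreal ((f s)\<^sup>2) \<partial>lborel)"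
  proof -
    have "(\<integral>\<^sup>+r. ennreal ((\<integral>s. k r s * f s \<partial>lborel)\<^sup>2) \<partial>lborel)
        \<le> (\<integral>\<^sup>+r. \<integral>\<^sup>+s. ennreal (k r s) * ennreal ((f s)\<^sup>2) \<partial>lborel \<partial>lborel)"
    proof (rule nn_integral_mono)
      fix r
      have "ennreal ((\<integral>s. k r s * f s \<partial>lborel)\<^sup>2) \<le> ennreal (\<integral>s. k r s * (f s)\<^sup>2 \<partial>lborel)"
        by (intro ennreal_leI jensen)
      also have "\<dots> = (\<integral>\<^sup>+s. ennreal (k r s * (f s)\<^sup>2) \<partial>lborel)"
        using ikf2 k01 by (intro nn_integral_eq_integral[symmetric]) auto
      finally show "ennreal ((\<integral>s. k r s * f s \<partial>lborel)\<^sup>2) \<le> (\<integral>\<^sup>+s. ennreal (k r s) * ennreal ((f s)\<^sup>2) \<partial>lborel)"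
        using k01 by (simp add: ennreal_mult)
    qed
    also have "\<dots> = (\<integral>\<^sup>+s. \<integral>\<^sup>+r. ennreal (k r s) * ennreal ((f s)\<^sup>2) \<partial>lborel \<partial>lborel)"
      by (rule lborel_pair.Fubini'[symmetric]) measurable
    also have "\<dots> = (\<integral>\<^sup>+s. (\<integral>\<^sup>+r. ennreal (k r s) \<partial>lborel) * ennreal ((f s)\<^sup>2) \<partial>lborel)"
      by (intro nn_integral_cong nn_integral_multc) measurable
    also have "\<dots> \<le> (\<integral>\<^sup>+s. 1 * ennreal ((f s)\<^sup>2) \<partial>lborel)"
      by (intro nn_integral_mono mult_right_mono col) auto
    finally show ?thesis by simp
  qed
  have m [measurable]: "(\<lambda>r. \<integral>s. k r s * f s \<partial>lborel) \<in> borel_measurable borel"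
    by measurable
  have fin: "(\<integral>\<^sup>+s. ennreal ((f s)\<^sup>2) \<partial>lborel) = ennreal (\<integral>s. (f s)\<^sup>2 \<partial>lborel)"
    using L2_integrable[OF f] by (rule nn_integral_eq_integral) auto
  have i: "integrable lborel (\<lambda>r. (\<integral>s. k r s * f s \<partial>lborel)\<^sup>2)"
    using nn unfolding fin by (intro integrableI_bounded) (auto simp: order_le_less_trans)
  then show "L2 (\<lambda>r. \<integral>s. k r s * f s \<partial>lborel)" by (simp add: L2_def)
  show "(\<integral>r. (\<integral>s. k r s * f s \<partial>lborel)\<^sup>2 \<partial>lborel) \<le> (\<integral>s. (f s)\<^sup>2 \<partial>lborel)"
    using nn unfolding fin using i by (simp add: nn_integral_eq_integral)
  assume g: "L2 g"
  note [measurable] = g[THEN L2_measurable]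
  \<comment> \<open>Splitting the product into squares lets the column bound deal with
    \<open>f\<close> and the row bound with \<open>g\<close>, which justifies Fubini.\<close>
  have kle: "ennreal (norm (k r s * f s * g r)) \<le> ennreal (k r s) * ennreal ((f s)\<^sup>2) + ennreal (k r s) * ennreal ((g r)\<^sup>2)" for r s
  proof -
    have "k r s * \<bar>f s * g r\<bar> \<le> k r s * ((f s)\<^sup>2 + (g r)\<^sup>2)" using k01 by (intro mult_left_mono abs_mult_le_sum_squares)
    then have "norm (k r s * f s * g r) \<le> k r s * (f s)\<^sup>2 + k r s * (g r)\<^sup>2"
      using k01 by (simp add: abs_mult algebra_simps)
    then show ?thesis using k01 by (simp add: ennreal_mult[symmetric] ennreal_plus[symmetric] del: ennreal_plus)
  qed
  have "(\<integral>\<^sup>+p. ennreal (norm (k (fst p) (snd p) * f (snd p) * g (fst p))) \<partial>(lborel \<Otimes>\<^sub>M lborel))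
     = (\<integral>\<^sup>+r. \<integral>\<^sup>+s. ennreal (norm (k r s * f s * g r)) \<partial>lborel \<partial>lborel)"
    by (subst lborel.nn_integral_fst[symmetric]) auto
  also have "\<dots> \<le> (\<integral>\<^sup>+r. \<integral>\<^sup>+s. ennreal (k r s) * ennreal ((f s)\<^sup>2) + ennreal (k r s) * ennreal ((g r)\<^sup>2) \<partial>lborel \<partial>lborel)"
    by (intro nn_integral_mono kle)
  also have "\<dots> = (\<integral>\<^sup>+r. (\<integral>\<^sup>+s. ennreal (k r s) * ennreal ((f s)\<^sup>2) \<partial>lborel) + (\<integral>\<^sup>+s. ennreal (k r s) \<partial>lborel) * ennreal ((g r)\<^sup>2) \<partial>lborel)"
    by (intro nn_integral_cong) (simp add: nn_integral_add nn_integral_multc)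
  also have "\<dots> = (\<integral>\<^sup>+r. \<integral>\<^sup>+s. ennreal (k r s) * ennreal ((f s)\<^sup>2) \<partial>lborel \<partial>lborel) + (\<integral>\<^sup>+r. (\<integral>\<^sup>+s. ennreal (k r s) \<partial>lborel) * ennreal ((g r)\<^sup>2) \<partial>lborel)"
    by (rule nn_integral_add) measurable
  also have "\<dots> \<le> (\<integral>\<^sup>+s. 1 * ennreal ((f s)\<^sup>2) \<partial>lborel) + (\<integral>\<^sup>+r. 1 * ennreal ((g r)\<^sup>2) \<partial>lborel)"
  proof (rule add_mono)
    have "(\<integral>\<^sup>+r. \<integral>\<^sup>+s. ennreal (k r s) * ennreal ((f s)\<^sup>2) \<partial>lborel \<partial>lborel)
      = (\<integral>\<^sup>+s. \<integral>\<^sup>+r. ennreal (k r s) * ennreal ((f s)\<^sup>2) \<partial>lborel \<partial>lborel)"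
      by (rule lborel_pair.Fubini'[symmetric]) measurable
    also have "\<dots> = (\<integral>\<^sup>+s. (\<integral>\<^sup>+r. ennreal (k r s) \<partial>lborel) * ennreal ((f s)\<^sup>2) \<partial>lborel)"
      by (intro nn_integral_cong nn_integral_multc) measurable
    also have "\<dots> \<le> (\<integral>\<^sup>+s. 1 * ennreal ((f s)\<^sup>2) \<partial>lborel)"
      by (intro nn_integral_mono mult_right_mono col) auto
    finally show "(\<integral>\<^sup>+r. \<integral>\<^sup>+s. ennreal (k r s) * ennreal ((f s)\<^sup>2) \<partial>lborel \<partial>lborel) \<le> \<dots>" .
    show "(\<integral>\<^sup>+r. (\<integral>\<^sup>+s. ennreal (k r s) \<partial>lborel) * ennreal ((g r)\<^sup>2) \<partial>lborel) \<le> (\<integral>\<^sup>+r. 1 * ennreal ((g r)\<^sup>2) \<partial>lborel)"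
      by (intro nn_integral_mono mult_right_mono row) auto
  qed
  also have "\<dots> < \<infinity>"
    using L2_integrable[OF f] L2_integrable[OF g] by (simp add: nn_integral_eq_integral)
  finally have int: "integrable (lborel \<Otimes>\<^sub>M lborel) (\<lambda>p. k (fst p) (snd p) * f (snd p) * g (fst p))"
    by (intro integrableI_bounded) auto
  have "(\<integral>s. (\<integral>r. k r s * f s * g r \<partial>lborel) \<partial>lborel) = (\<integral>r. (\<integral>s. k r s * f s * g r \<partial>lborel) \<partial>lborel)"
    using int by (intro lborel_pair.Fubini_integral) (simp add: case_prod_unfold)
  moreover have "(\<integral>r. k r s * f s * g r \<partial>lborel) = f s * (\<integral>r. k r s * g r \<partial>lborel)" for s
    by (subst integral_mult_right_zero[symmetric]) (simp add: mult_ac)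
  ultimately show "(\<integral>r. (\<integral>s. k r s * f s \<partial>lborel) * g r \<partial>lborel)
                = (\<integral>s. f s * (\<integral>r. k r s * g r \<partial>lborel) \<partial>lborel)" by simp
qed

section \<open>The equation $w' + w = q$ on the half-line\<close>

text \<open>\<open>w = W q\<close> is the solution of \<open>w' + w = q\<close> on \<open>(0, \<infinity>)\<close> with \<open>w 0 = 0\<close>. Integrating \<open>(w' + w)\<^sup>2\<close>
  shows that the \<open>L\<^sup>2\<close> norm of \<open>q\<close> is the \<open>H\<^sup>1\<close> norm of \<open>w\<close>, so no derivative of \<open>w\<close> has to
  be mentioned in the variational problem.\<close>

definition kern :: "real \<Rightarrow> real \<Rightarrow> real" where
  "kern r s = (if 0 < s \<and> s < r then exp (s - r) else 0)"

definition W :: "(real \<Rightarrow> real) \<Rightarrow> real \<Rightarrow> real" where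
  "W q r = (\<integral>s. kern r s * q s \<partial>lborel)"

text \<open>For positive arguments this is the solution of - q' + q = h given by integrating from
  infinity, whereas \<open>W\<close> integrates from 0. Composing the two inverts - w'' + w.\<close>

definition W_adj :: "(real \<Rightarrow> real) \<Rightarrow> real \<Rightarrow> real" where
  "W_adj h s = (\<integral>r. kern r s * h r \<partial>lborel)"

lemma kern_measurable [measurable]: "(\<lambda>p. kern (fst p) (snd p)) \<in> borel_measurable (borel \<Otimes>\<^sub>M borel)"
  unfolding kern_def by measurable

lemma kern_measurable_swap [measurable]: "(\<lambda>p. kern (snd p) (fst p)) \<in> borel_measurable (borel \<Otimes>\<^sub>M borel)"
  unfolding kern_def by measurable

lemma kern_measurable1 [measurable]: "kern r \<in> borel_measurable borel" "(\<lambda>r. kern r s) \<in> borel_measurable borel"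
  unfolding kern_def by measurable

lemma kern_bounds: "0 \<le> kern r s" "kern r s \<le> 1"
  by (auto simp: kern_def)

lemma kern_row: "(\<integral>\<^sup>+s. ennreal (kern r s) \<partial>lborel) \<le> 1"
proof (cases "r > 0")
  case True
  have "(\<integral>\<^sup>+s. ennreal (kern r s) \<partial>lborel) \<le> (\<integral>\<^sup>+s. ennreal (exp (s - r)) * indicator {0..r} s \<partial>lborel)"
    by (intro nn_integral_mono) (auto simp: kern_def split: split_indicator)
  also have "\<dots> = exp (r - r) - exp (0 - r)"
    using True by (intro nn_integral_FTC_Icc) (auto intro!: derivative_eq_intros)
  also have "\<dots> \<le> 1" by (simp add: ennreal_le_1)
  finally show ?thesis .
next
  case False
  then have "kern r s = 0" for s by (simp add: kern_def)
  then show ?thesis by simp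
qed

lemma kern_col: "(\<integral>\<^sup>+r. ennreal (kern r s) \<partial>lborel) \<le> 1"
proof -
  have lim: "((\<lambda>x. - exp (s - x)) \<longlongrightarrow> 0) at_top"
    by real_asymp
  have "(\<integral>\<^sup>+r. ennreal (kern r s) \<partial>lborel) \<le> (\<integral>\<^sup>+x. ennreal (exp (s - x)) * indicator {s..} x \<partial>lborel)"
    by (intro nn_integral_mono) (auto simp: kern_def split: split_indicator)
  also have "\<dots> = 0 - (- exp (s - s))"
    by (intro nn_integral_FTC_atLeast[OF _ _ _ lim]) (auto intro!: derivative_eq_intros)
  finally show ?thesis by simp
qed

lemma W_integrable: "L2 q \<Longrightarrow> integrable lborel (\<lambda>s. kern r s * q s)"
  and W_L2: "L2 q \<Longrightarrow> L2 (W q)"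
  and W_L2_le: "L2 q \<Longrightarrow> (\<integral>r. (W q r)\<^sup>2 \<partial>lborel) \<le> (\<integral>r. (q r)\<^sup>2 \<partial>lborel)"
  and W_adjoint: "L2 q \<Longrightarrow> L2 g \<Longrightarrow> (\<integral>r. W q r * g r \<partial>lborel) = (\<integral>s. q s * W_adj g s \<partial>lborel)"
  using Schur_test[where k=kern, OF kern_measurable kern_bounds kern_row kern_col]
  unfolding W_def[abs_def] W_adj_def[abs_def] by blast+

lemma W_adj_integrable: "L2 h \<Longrightarrow> integrable lborel (\<lambda>r. kern r s * h r)"
  and W_adj_L2: "L2 h \<Longrightarrow> L2 (W_adj h)"
  and W_adj_L2_le: "L2 h \<Longrightarrow> (\<integral>r. (W_adj h r)\<^sup>2 \<partial>lborel) \<le> (\<integral>r. (h r)\<^sup>2 \<partial>lborel)"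
  using Schur_test[where k="\<lambda>r s. kern s r", OF kern_measurable_swap kern_bounds kern_col kern_row]
  unfolding W_adj_def[abs_def] by blast+

lemma W_add: "L2 p \<Longrightarrow> L2 q \<Longrightarrow> W (\<lambda>x. p x + q x) r = W p r + W q r"
  using W_integrable by (simp add: W_def distrib_left)

lemma W_diff: "L2 p \<Longrightarrow> L2 q \<Longrightarrow> W (\<lambda>x. p x - q x) r = W p r - W q r"
  using W_integrable by (simp add: W_def right_diff_distrib)

lemma W_adj_diff: "L2 p \<Longrightarrow> L2 q \<Longrightarrow> W_adj (\<lambda>x. p x - q x) r = W_adj p r - W_adj q r"
  using W_adj_integrable by (simp add: W_adj_def right_diff_distrib)

lemma W_nonpos: "r \<le> 0 \<Longrightarrow> W q r = 0"
  unfolding W_def kern_def by (rule Bochner_Integration.integral_eq_zero_AE) auto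

lemma W_adj_nonpos: "r \<le> 0 \<Longrightarrow> W_adj h r = 0"
  unfolding W_adj_def kern_def by (rule Bochner_Integration.integral_eq_zero_AE) auto

section \<open>Pointwise bounds and Hoelder continuity of \<open>W\<close> and
  \<open>W_adj\<close>\<close>

lemma L2_kernel:
  assumes "g \<in> borel_measurable borel" "\<And>x. \<bar>g x\<bar> \<le> 1" "(\<integral>\<^sup>+x. ennreal \<bar>g x\<bar> \<partial>lborel) \<le> ennreal c" "0 \<le> c"
  shows "L2 g" "(\<integral>x. (g x)\<^sup>2 \<partial>lborel) \<le> c"
proof -
  have "(g x)\<^sup>2 \<le> \<bar>g x\<bar>" for x
    using assms(2)[of x] mult_left_le[of "\<bar>g x\<bar>" "\<bar>g x\<bar>"] by (simp add: power2_eq_square abs_mult[symmetric])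
  then have nn: "(\<integral>\<^sup>+x. ennreal ((g x)\<^sup>2) \<partial>lborel) \<le> ennreal c"
    by (intro order_trans[OF nn_integral_mono assms(3)] ennreal_leI)
  then have i: "integrable lborel (\<lambda>x. (g x)\<^sup>2)"
    using assms(1) by (intro integrableI_bounded) (auto simp: order_le_less_trans)
  then show "L2 g" using assms(1) by (simp add: L2_def)
  show "(\<integral>x. (g x)\<^sup>2 \<partial>lborel) \<le> c"
    using nn i \<open>0 \<le> c\<close> by (simp add: nn_integral_eq_integral)
qed

text \<open>A kernel bounded by 1 has square integral at most its L1 norm, so a single L1
  computation feeds Cauchy-Schwarz. All pointwise estimates of \<open>W\<close> and
  \<open>W_adj\<close> are instances.\<close>

lemma L2_kernel_bound:
  assumes "g \<in> borel_measurable borel" "\<And>x. \<bar>g x\<bar> \<le> 1" "(\<integral>\<^sup>+x. ennreal \<bar>g x\<bar> \<partial>lborel) \<le> ennreal c" "0 \<le> c"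
    and "L2 q"
  shows "\<bar>\<integral>x. g x * q x \<partial>lborel\<bar> \<le> sqrt c * sqrt (\<integral>x. (q x)\<^sup>2 \<partial>lborel)"
  using L2_Cauchy_Schwarz[OF L2_kernel(1)[OF assms(1-4)] assms(5)] L2_kernel(2)[OF assms(1-4)]
  by (meson mult_right_mono order_trans real_sqrt_ge_zero real_sqrt_le_mono Bochner_Integration.integral_nonneg zero_le_power2)

lemma nn_integral_kernel_interval:
  assumes "a \<le> b" "\<And>x. \<bar>g x\<bar> \<le> indicator {a..b} x"
  shows "(\<integral>\<^sup>+x. ennreal \<bar>g x\<bar> \<partial>lborel) \<le> ennreal (b - a)"
proof -
  have "(\<integral>\<^sup>+x. ennreal \<bar>g x\<bar> \<partial>lborel) \<le> (\<integral>\<^sup>+x. indicator {a..b} x \<partial>lborel)"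
    by (intro nn_integral_mono order_trans[OF ennreal_leI[OF assms(2)]]) (simp add: ennreal_indicator)
  also have "\<dots> = ennreal (b - a)" using assms(1) by simp
  finally show ?thesis .
qed

lemma W_bound: assumes "L2 q" shows "\<bar>W q r\<bar> \<le> sqrt (\<integral>x. (q x)\<^sup>2 \<partial>lborel)"
  unfolding W_def using kern_row[of r] kern_bounds
  by (intro order_trans[OF L2_kernel_bound[where c=1, OF _ _ _ _ assms]]) (auto simp: abs_of_nonneg)

lemma W_bound_sqrt: assumes "L2 q" "r \<ge> 0" shows "\<bar>W q r\<bar> \<le> sqrt r * sqrt (\<integral>x. (q x)\<^sup>2 \<partial>lborel)"
proof -
  have "(\<integral>\<^sup>+x. ennreal \<bar>kern r x\<bar> \<partial>lborel) \<le> ennreal (r - 0)"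
    using assms(2) by (intro nn_integral_kernel_interval) (auto simp: kern_def split: split_indicator)
  then show ?thesis unfolding W_def using kern_bounds assms(2)
    by (intro L2_kernel_bound[where c=r, OF _ _ _ _ assms(1)]) (auto simp: abs_of_nonneg)
qed

lemma W_adj_bound: assumes "L2 h" shows "\<bar>W_adj h r\<bar> \<le> sqrt (\<integral>x. (h x)\<^sup>2 \<partial>lborel)"
  unfolding W_adj_def using kern_col[of r] kern_bounds
  by (intro order_trans[OF L2_kernel_bound[where c=1, OF _ _ _ _ assms]]) (auto simp: abs_of_nonneg)

lemma one_minus_exp_le: "s \<le> r \<Longrightarrow> \<bar>exp (s - r) - 1\<bar> \<le> r - (s::real)"
  unfolding abs_le_iff using exp_ge_add_one_self[of "s - r"] exp_le_one_iff[of "s - r"] by linarith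

text \<open>Semigroup property of the kernel: what has accumulated up to \<open>s\<close> decays by
  \<open>exp (s - r)\<close>, and the rest comes from \<open>[s, r)\<close>. The factor
  \<open>indicator {0<..} t\<close> serves the case \<open>s = 0\<close>, because
  \<open>kern r 0 = 0\<close>.\<close>

lemma W_split:
  assumes "L2 q" "0 \<le> s" "s \<le> r"
  shows "W q r = exp (s - r) * W q s + (\<integral>t. (indicator {s..<r} t * indicator {0<..} t * exp (t - r)) * q t \<partial>lborel)"
proof -
  have eq: "kern r t = exp (s - r) * kern s t + indicator {s..<r} t * indicator {0<..} t * exp (t - r)" for t
    using assms(2,3) by (auto simp: kern_def mult_exp_exp split: split_indicator)
  have "L2 (\<lambda>t. indicator {s..<r} t * indicator {0<..} t * exp (t - r))"
    using assms(3) by (intro L2_kernel(1)[OF _ _ nn_integral_kernel_interval[OF assms(3)]])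
      (auto split: split_indicator)
  then show ?thesis using W_integrable[OF assms(1)] assms(1)
    unfolding W_def eq by (simp add: distrib_right mult.assoc[of "exp (s - r)"] L2_mult)
qed

lemma W_adj_split:
  assumes "L2 h" "0 < s" "s \<le> r"
  shows "W_adj h s = exp (s - r) * W_adj h r + (\<integral>t. (indicator {s<..r} t * exp (s - t)) * h t \<partial>lborel)"
proof -
  have eq: "kern t s = exp (s - r) * kern t r + indicator {s<..r} t * exp (s - t)" for t
    using assms(2,3) by (auto simp: kern_def mult_exp_exp split: split_indicator)
  have "L2 (\<lambda>t. indicator {s<..r} t * exp (s - t))"
    using assms(3) by (intro L2_kernel(1)[OF _ _ nn_integral_kernel_interval[OF assms(3)]])
      (auto split: split_indicator)
  then show ?thesis using W_adj_integrable[OF assms(1)] assms(1)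
    unfolding W_adj_def eq by (simp add: distrib_right mult.assoc[of "exp (s - r)"] L2_mult)
qed

lemma W_Hoelder:
  assumes "L2 q" "0 \<le> s" "s \<le> r"
  shows "\<bar>W q r - W q s\<bar> \<le> (sqrt (r - s) + (r - s)) * sqrt (\<integral>x. (q x)\<^sup>2 \<partial>lborel)"
proof -
  have "\<bar>\<integral>t. (indicator {s..<r} t * indicator {0<..} t * exp (t - r)) * q t \<partial>lborel\<bar>
      \<le> sqrt (r - s) * sqrt (\<integral>x. (q x)\<^sup>2 \<partial>lborel)"
    using assms(3) by (intro L2_kernel_bound[OF _ _ nn_integral_kernel_interval[OF assms(3)] _ assms(1)])
      (auto split: split_indicator)
  moreover have "\<bar>(exp (s - r) - 1) * W q s\<bar> \<le> (r - s) * sqrt (\<integral>x. (q x)\<^sup>2 \<partial>lborel)"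
    unfolding abs_mult using assms by (intro mult_mono one_minus_exp_le W_bound) auto
  ultimately show ?thesis unfolding W_split[OF assms] by (simp add: algebra_simps)
qed

lemma W_adj_Hoelder:
  assumes "L2 h" "0 < s" "s \<le> r"
  shows "\<bar>W_adj h s - W_adj h r\<bar> \<le> (sqrt (r - s) + (r - s)) * sqrt (\<integral>x. (h x)\<^sup>2 \<partial>lborel)"
proof -
  have "\<bar>\<integral>t. (indicator {s<..r} t * exp (s - t)) * h t \<partial>lborel\<bar>
      \<le> sqrt (r - s) * sqrt (\<integral>x. (h x)\<^sup>2 \<partial>lborel)"
    using assms(3) by (intro L2_kernel_bound[OF _ _ nn_integral_kernel_interval[OF assms(3)] _ assms(1)])
      (auto split: split_indicator)
  moreover have "\<bar>(exp (s - r) - 1) * W_adj h r\<bar> \<le> (r - s) * sqrt (\<integral>x. (h x)\<^sup>2 \<partial>lborel)"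
    unfolding abs_mult using assms by (intro mult_mono one_minus_exp_le W_adj_bound) auto
  ultimately show ?thesis unfolding W_adj_split[OF assms] by (simp add: algebra_simps)
qed

section \<open>The differential equation solved by \<open>W\<close>, and its uniqueness\<close>

lemma W_adj_continuous: assumes "L2 h" shows "continuous_on {0<..} (W_adj h)"
proof -
  define N where "N = sqrt (\<integral>x. (h x)\<^sup>2 \<partial>lborel)"
  have le: "\<bar>W_adj h s - W_adj h r\<bar> \<le> (sqrt \<bar>r - s\<bar> + \<bar>r - s\<bar>) * N" if "0 < s" "0 < r" for r s
    using W_adj_Hoelder[OF assms, of s r] W_adj_Hoelder[OF assms, of r s] that
    unfolding N_def by (cases "s \<le> r") (auto simp: abs_minus_commute)
  show ?thesis unfolding continuous_on_def
  proof
    fix r :: real assume r: "r \<in> {0<..}"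
    have "((\<lambda>s. (sqrt \<bar>r - s\<bar> + \<bar>r - s\<bar>) * N) \<longlongrightarrow> (sqrt \<bar>r - r\<bar> + \<bar>r - r\<bar>) * N) (at r within {0<..})"
      by (intro tendsto_intros)
    then have lim: "((\<lambda>s. (sqrt \<bar>r - s\<bar> + \<bar>r - s\<bar>) * N) \<longlongrightarrow> 0) (at r within {0<..})" by simp
    have "\<forall>\<^sub>F s in at r within {0<..}. norm (W_adj h s - W_adj h r) \<le> (sqrt \<bar>r - s\<bar> + \<bar>r - s\<bar>) * N"
      unfolding eventually_at_filter using le r by (auto intro!: always_eventually)
    from Lim_null_comparison[OF this lim]
    show "(W_adj h \<longlongrightarrow> W_adj h r) (at r within {0<..})" by (simp add: LIM_zero_iff)
  qed
qed

text \<open>Variation of constants: \<open>exp x * W q x\<close> is an antiderivative of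
  \<open>exp t * q t\<close>. The computation starts at \<open>s = r / 2\<close> to stay away from
  0, where \<open>q\<close> need not be continuous.\<close>

lemma W_has_derivative:
  assumes "L2 q" "continuous_on {0<..} q" "r > 0"
  shows "(W q has_real_derivative q r - W q r) (at r)"
proof -
  define s where "s = r / 2"
  have s: "0 < s" "s < r" using assms(3) by (auto simp: s_def)
  have cont: "continuous_on {s..r+1} (\<lambda>t. exp t * q t)"
    using s by (intro continuous_intros continuous_on_subset[OF assms(2)]) auto
  have eq: "W q x = exp (- x) * (exp s * W q s + integral {s..x} (\<lambda>t. exp t * q t))" if "x \<in> {s<..<r+1}" for x
  proof -
    have "continuous_on {s..x} (\<lambda>t. exp t * q t)" by (rule continuous_on_subset[OF cont]) (use that in auto)
    then have si: "set_integrable lborel {s..x} (\<lambda>t. exp t * q t)" by (intro borel_integrable_atLeastAtMost')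
    have "(\<integral>t. (indicator {s..<x} t * indicator {0<..} t * exp (t - x)) * q t \<partial>lborel)
        = exp (- x) * (LINT t:{s..x}|lborel. exp t * q t)"
      unfolding set_lebesgue_integral_def
    proof (subst integral_mult_right_zero[symmetric], rule integral_cong_AE)
      show "(\<lambda>t. indicator {s..<x} t * indicator {0<..} t * exp (t - x) * q t) \<in> borel_measurable lborel"
        using assms(1) by (auto simp: L2_def)
      show "(\<lambda>t. exp (- x) * (indicator {s..x} t *\<^sub>R (exp t * q t))) \<in> borel_measurable lborel"
        using assms(1) by (auto simp: L2_def)
      have "AE t in lborel. t \<noteq> x" by (rule AE_lborel_singleton)
      then show "AE t in lborel. indicator {s..<x} t * indicator {0<..} t * exp (t - x) * q t
          = exp (- x) * (indicator {s..x} t *\<^sub>R (exp t * q t))"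
        by eventually_elim (use s in \<open>auto simp: mult_exp_exp mult.assoc[symmetric] split: split_indicator\<close>)
    qed
    also have "(LINT t:{s..x}|lborel. exp t * q t) = integral {s..x} (\<lambda>t. exp t * q t)"
      using si by (rule set_borel_integral_eq_integral(2))
    finally show ?thesis using W_split[OF assms(1), of s x] s that
      by (simp add: distrib_left mult_exp_exp mult.assoc[symmetric])
  qed
  have "((\<lambda>x. integral {s..x} (\<lambda>t. exp t * q t)) has_real_derivative exp r * q r) (at r within {s..r+1})"
    using s by (intro integral_has_real_derivative cont) auto
  then have d: "((\<lambda>x. integral {s..x} (\<lambda>t. exp t * q t)) has_real_derivative exp r * q r) (at r)"
    using s by (subst (asm) at_within_interior) auto
  have "((\<lambda>x. exp (- x) * (exp s * W q s + integral {s..x} (\<lambda>t. exp t * q t))) has_real_derivative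
      q r - exp (- r) * (exp s * W q s + integral {s..r} (\<lambda>t. exp t * q t))) (at r)"
    by (rule derivative_eq_intros d refl)+ (simp add: mult_exp_exp mult.assoc[symmetric])
  then have "((\<lambda>x. exp (- x) * (exp s * W q s + integral {s..x} (\<lambda>t. exp t * q t))) has_real_derivative
      q r - W q r) (at r)" using eq[of r] s by simp
  moreover have "\<forall>\<^sub>F x in nhds r. exp (- x) * (exp s * W q s + integral {s..x} (\<lambda>t. exp t * q t)) = W q x"
    using s eq by (intro eventually_nhds_in_open[of "{s<..<r+1}", THEN eventually_mono]) auto
  ultimately show ?thesis by (subst (asm) DERIV_cong_ev[OF refl _ refl]) 
qed

text \<open>\<open>exp r * (W q r - w r)\<close> has derivative zero and tends to 0 at the origin.
  This recovers \<open>W\<close> from an explicitly given \<open>w\<close>.\<close>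

lemma W_unique:
  assumes "L2 q" "continuous_on {0<..} q"
    and "\<And>r. r > 0 \<Longrightarrow> (w has_real_derivative q r - w r) (at r)" "(w \<longlongrightarrow> 0) (at_right 0)" "r > 0"
  shows "W q r = w r"
proof -
  define D where "D r = exp r * (W q r - w r)" for r
  have D': "(D has_real_derivative 0) (at r)" if "r > 0" for r
    unfolding D_def
    by (rule derivative_eq_intros W_has_derivative assms that refl)+ (simp add: algebra_simps)
  have "D x = D r" if "x > 0" for x
    by (rule has_field_derivative_zero_constant[of "{0<..}" D, THEN exE])
      (use D' that assms(5) in \<open>auto intro: has_field_derivative_at_within\<close>)
  then have "\<forall>\<^sub>F x in at_right 0. D x = D r" by (auto simp: eventually_at_filter)
  then have "(D \<longlongrightarrow> D r) (at_right 0)" by (rule tendsto_eventually)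
  moreover have "(W q \<longlongrightarrow> 0) (at_right 0)"
  proof (rule Lim_null_comparison)
    show "\<forall>\<^sub>F x in at_right 0. norm (W q x) \<le> sqrt x * sqrt (\<integral>x. (q x)\<^sup>2 \<partial>lborel)"
      using W_bound_sqrt[OF assms(1)] by (auto simp: eventually_at_filter)
    have "((\<lambda>x. sqrt x * sqrt (\<integral>x. (q x)\<^sup>2 \<partial>lborel)) \<longlongrightarrow> sqrt 0 * sqrt (\<integral>x. (q x)\<^sup>2 \<partial>lborel)) (at_right 0)"
      by (intro tendsto_intros)
    then show "((\<lambda>x. sqrt x * sqrt (\<integral>x. (q x)\<^sup>2 \<partial>lborel)) \<longlongrightarrow> 0) (at_right 0)" by simp
  qed
  then have "(D \<longlongrightarrow> exp 0 * (0 - 0)) (at_right 0)" unfolding D_def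
    by (intro tendsto_intros assms)
  ultimately have "D r = 0" using tendsto_unique trivial_limit_at_right_real by fastforce
  then show ?thesis by (simp add: D_def)
qed

lemma L2_indicator: "L2 (indicator {a..b})"
proof -
  have "(indicator {a..b} x :: real)\<^sup>2 = indicator {a..b} x" for x :: real by (simp split: split_indicator)
  then show ?thesis by (cases "a \<le> b") (auto simp: L2_def)
qed

text \<open>The negative half-line, where \<open>W q\<close> vanishes, is included so that the
  functions are equicontinuous on the whole line, as the diagonal argument below demands.\<close>

lemma W_modulus:
  assumes "L2 q"
  shows "\<bar>W q r - W q s\<bar> \<le> (sqrt \<bar>r - s\<bar> + \<bar>r - s\<bar>) * sqrt (\<integral>x. (q x)\<^sup>2 \<partial>lborel)"
proof -
  have "\<bar>W q r - W q s\<bar> \<le> (sqrt (r - s) + (r - s)) * sqrt (\<integral>x. (q x)\<^sup>2 \<partial>lborel)" if "s \<le> r" for r s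
  proof (cases "0 \<le> s")
    case True then show ?thesis using W_Hoelder[OF assms True that] by simp
  next
    case False
    have "\<bar>W q r - W q s\<bar> \<le> sqrt (max 0 r) * sqrt (\<integral>x. (q x)\<^sup>2 \<partial>lborel)"
      using W_bound_sqrt[OF assms, of "max 0 r"] False W_nonpos[of s q] W_nonpos[of r q] by (auto simp: max_def)
    also have "\<dots> \<le> (sqrt (r - s) + (r - s)) * sqrt (\<integral>x. (q x)\<^sup>2 \<partial>lborel)"
      using False that by (intro mult_right_mono add_increasing2 real_sqrt_le_mono) auto
    finally show ?thesis .
  qed
  from this[of s r] this[of r s] show ?thesis by (cases "s \<le> r") (auto simp: abs_minus_commute)
qed

lemma W_continuous: assumes "L2 q" shows "continuous_on S (W q)"
proof -
  define N where "N = sqrt (\<integral>x. (q x)\<^sup>2 \<partial>lborel)"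
  have "(W q \<longlongrightarrow> W q r) (at r)" for r
  proof -
    have "((\<lambda>s. (sqrt \<bar>s - r\<bar> + \<bar>s - r\<bar>) * N) \<longlongrightarrow> (sqrt \<bar>r - r\<bar> + \<bar>r - r\<bar>) * N) (at r)"
      by (intro tendsto_intros)
    then have "((\<lambda>s. (sqrt \<bar>s - r\<bar> + \<bar>s - r\<bar>) * N) \<longlongrightarrow> 0) (at r)" by simp
    moreover have "\<forall>\<^sub>F s in at r. norm (W q s - W q r) \<le> (sqrt \<bar>s - r\<bar> + \<bar>s - r\<bar>) * N"
      using W_modulus[OF assms] by (auto simp: N_def intro!: always_eventually)
    ultimately have "((\<lambda>s. W q s - W q r) \<longlongrightarrow> 0) (at r)" by (rule Lim_null_comparison[rotated])
    then show ?thesis by (simp add: LIM_zero_iff)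
  qed
  then show ?thesis by (meson continuous_on_def tendsto_within_subset subset_UNIV)
qed

lemma integral_indicator_Ioo_Icc:
  fixes f :: "real \<Rightarrow> real"
  assumes "f \<in> borel_measurable borel"
  shows "(\<integral>t. indicator {a<..<b} t * f t \<partial>lborel) = (\<integral>t. indicator {a..b} t * f t \<partial>lborel)"
proof (rule integral_cong_AE)
  have "AE t in lborel. t \<noteq> a \<and> t \<noteq> b" using AE_lborel_singleton[of a] AE_lborel_singleton[of b] by auto
  then show "AE t in lborel. indicator {a<..<b} t * f t = indicator {a..b} t * f t"
    by eventually_elim (auto split: split_indicator)
qed (use assms in auto)

text \<open>The derivative is asked for only inside the interval, because functions built from
  \<open>W q\<close> are known to be differentiable only for positive arguments.\<close>

lemma FTC_Lebesgue:
  fixes f f' :: "real \<Rightarrow> real"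
  assumes "a \<le> b" "continuous_on {a..b} f" "\<And>x. a < x \<Longrightarrow> x < b \<Longrightarrow> (f has_real_derivative f' x) (at x)"
    and "f' \<in> borel_measurable borel" "integrable lborel (\<lambda>t. indicator {a..b} t * f' t)"
  shows "(\<integral>t. indicator {a<..<b} t * f' t \<partial>lborel) = f b - f a"
proof -
  have "(f' has_integral f b - f a) {a..b}"
    using assms by (intro fundamental_theorem_of_calculus_interior)
      (auto simp: has_real_derivative_iff_has_vector_derivative)
  moreover have "set_integrable lborel {a..b} f'" using assms(5) by (simp add: set_integrable_def)
  ultimately have "(LINT t:{a..b}|lborel. f' t) = f b - f a"
    using set_borel_integral_eq_integral(2) by (metis integral_unique)
  then show ?thesis using integral_indicator_Ioo_Icc[OF assms(4)] by (simp add: set_lebesgue_integral_def)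
qed

lemma integrable_indicator_L2:
  assumes "L2 q" shows "integrable lborel (\<lambda>t. indicator {a..b} t * q t)"
  by (rule L2_mult[OF L2_indicator assms])

lemma integrable_indicator_id_L2:
  assumes "L2 q" shows "integrable lborel (\<lambda>t. indicator {0..b} t * (t * q t))"
proof -
  have "L2 (\<lambda>t. indicator {0..b} t * t)"
    by (rule L2_bound(1)[OF L2_indicator[of 0 b], where C="\<bar>b\<bar>"]) (auto split: split_indicator)
  from L2_mult[OF this assms] show ?thesis by (simp add: mult.assoc)
qed

text \<open>For \<open>q = W_adj h\<close> the function \<open>w = W q\<close> solves \<open>w'' = w - h\<close>, and the left-hand side is
  \<open>r w' - w = r\<^sup>2 (w / r)'\<close>, the flux of the gradient of \<open>w / r\<close>.\<close>

lemma flux_identity: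
  assumes h: "L2 h" and r: "r > 0"
  shows "r * W_adj h r - (r + 1) * W (W_adj h) r
       = (\<integral>t. indicator {0<..<r} t * (t * (W (W_adj h) t - h t)) \<partial>lborel)"
proof -
  let ?q = "W_adj h" let ?w = "W (W_adj h)"
  have q: "L2 ?q" and w: "L2 ?w" using h W_L2 W_adj_L2 by auto
  note [measurable] = h[THEN L2_measurable] q[THEN L2_measurable] w[THEN L2_measurable]
  \<comment> \<open>Chosen so that \<open>W g\<close> is explicit: on \<open>[0, r]\<close> the
    function \<open>w s = s\<close> solves \<open>w' + w = 1 + s\<close>, and beyond
    \<open>r\<close> it decays as \<open>r * kern s r\<close>. Adjointness then produces
    \<open>r * W_adj h r\<close> together with the integral of \<open>s * h s\<close>.\<close>
  define g where "g t = indicator {0..r} t * (1 + t)" for t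
  have g: "L2 g" unfolding g_def
    by (rule L2_bound(1)[OF L2_indicator[of 0 r], where C="1 + r"]) (use r in \<open>auto split: split_indicator\<close>)
  have Wg: "W g s = indicator {0..r} s * s + r * kern s r" for s
  proof (cases "s > 0")
    case False then show ?thesis using r W_nonpos[of s g] by (auto simp: kern_def split: split_indicator)
  next
    case True
    define m where "m = min r s"
    have "W g s = (\<integral>t. indicator {0<..<m} t * (exp (- s) * ((1 + t) * exp t)) \<partial>lborel)"
      unfolding W_def
    proof (rule integral_cong_AE)
      have "AE t in lborel. t \<noteq> r" by (rule AE_lborel_singleton)
      then show "AE t in lborel. kern s t * g t = indicator {0<..<m} t * (exp (- s) * ((1 + t) * exp t))"
        by eventually_elim (auto simp: kern_def g_def m_def exp_diff exp_minus field_simps split: split_indicator)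
    qed (use g in \<open>auto simp: L2_def\<close>)
    also have "\<dots> = exp (- s) * (m * exp m) - exp (- s) * (0 * exp 0)"
    proof (rule FTC_Lebesgue)
      show "integrable lborel (\<lambda>t. indicator {0..m} t * (exp (- s) * ((1 + t) * exp t)))"
        by (rule borel_integrable_atLeastAtMost'[of 0 m "\<lambda>t. exp (- s) * ((1 + t) * exp t)",
            unfolded set_integrable_def real_scaleR_def]) (intro continuous_intros)
    qed (use r True in \<open>auto simp: m_def algebra_simps intro!: continuous_intros derivative_eq_intros\<close>)
    also have "\<dots> = indicator {0..r} s * s + r * kern s r"
      using True r by (auto simp: m_def min_def kern_def exp_diff exp_minus field_simps split: split_indicator)
    finally show ?thesis .
  qed
  have i1: "integrable lborel (\<lambda>s. indicator {0..r} s * (s * h s))" by (rule integrable_indicator_id_L2[OF h])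
  have i2: "integrable lborel (\<lambda>s. indicator {0..r} s * (s * ?q s))" by (rule integrable_indicator_id_L2[OF q])
  have i3: "integrable lborel (\<lambda>s. indicator {0..r} s * (s * ?w s))" by (rule integrable_indicator_id_L2[OF w])
  have i4: "integrable lborel (\<lambda>s. indicator {0..r} s * ?q s)" by (rule integrable_indicator_L2[OF q])
  have "(\<integral>s. g s * ?q s \<partial>lborel) = (\<integral>s. W g s * h s \<partial>lborel)"
    by (rule W_adjoint[OF g h, symmetric])
  also have "\<dots> = (\<integral>s. indicator {0..r} s * (s * h s) + r * (kern s r * h s) \<partial>lborel)"
    unfolding Wg by (simp add: algebra_simps)
  also have "\<dots> = (\<integral>s. indicator {0..r} s * (s * h s) \<partial>lborel) + r * ?q r"
    using i1 W_adj_integrable[OF h] by (simp add: W_adj_def)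
  finally have 1: "r * ?q r = (\<integral>s. g s * ?q s \<partial>lborel) - (\<integral>s. indicator {0..r} s * (s * h s) \<partial>lborel)" by simp
  \<comment> \<open>The derivative of \<open>(t + 1) * w t\<close> is
    \<open>(t + 1) * q t - t * w t\<close>, whose first part is again \<open>g * q\<close>; this
    integral cancels between the two formulas.\<close>
  have "(\<integral>t. indicator {0<..<r} t * ((t + 1) * ?q t - t * ?w t) \<partial>lborel) = (r + 1) * ?w r - (0 + 1) * ?w 0"
  proof (rule FTC_Lebesgue)
    show "continuous_on {0..r} (\<lambda>t. (t + 1) * ?w t)" by (intro continuous_intros W_continuous q)
    show "((\<lambda>t. (t + 1) * ?w t) has_real_derivative (x + 1) * ?q x - x * ?w x) (at x)" if "0 < x" for x
      by (rule derivative_eq_intros W_has_derivative q W_adj_continuous h that refl)+ (simp add: algebra_simps)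
    have "integrable lborel (\<lambda>t. indicator {0..r} t * (t * ?q t) + indicator {0..r} t * ?q t - indicator {0..r} t * (t * ?w t))"
      using i2 i3 i4 by auto
    then show "integrable lborel (\<lambda>t. indicator {0..r} t * ((t + 1) * ?q t - t * ?w t))"
      by (simp add: algebra_simps)
  qed (use r in auto)
  then have "(r + 1) * ?w r = (\<integral>t. indicator {0..r} t * ((t + 1) * ?q t - t * ?w t) \<partial>lborel)"
    using integral_indicator_Ioo_Icc[of "\<lambda>t. (t + 1) * ?q t - t * ?w t" 0 r] W_nonpos[of 0 ?q] by simp
  also have "\<dots> = (\<integral>t. g t * ?q t - indicator {0..r} t * (t * ?w t) \<partial>lborel)"
    by (simp add: g_def algebra_simps)
  also have "\<dots> = (\<integral>t. g t * ?q t \<partial>lborel) - (\<integral>t. indicator {0..r} t * (t * ?w t) \<partial>lborel)"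
    using L2_mult[OF g q] i3 by simp
  finally have 2: "(r + 1) * ?w r = \<dots>" .
  have "(\<integral>t. indicator {0<..<r} t * (t * (?w t - h t)) \<partial>lborel) = (\<integral>t. indicator {0..r} t * (t * (?w t - h t)) \<partial>lborel)"
    by (rule integral_indicator_Ioo_Icc) measurable
  also have "\<dots> = (\<integral>t. indicator {0..r} t * (t * ?w t) - indicator {0..r} t * (t * h t) \<partial>lborel)"
    by (simp add: algebra_simps)
  also have "\<dots> = (\<integral>t. indicator {0..r} t * (t * ?w t) \<partial>lborel) - (\<integral>t. indicator {0..r} t * (t * h t) \<partial>lborel)"
    using i1 i3 by simp
  finally show ?thesis using 1 2 by simp
qed

text \<open>The Arzela-Ascoli argument on the whole line: a diagonal subsequence converges at all
  rationals, and equicontinuity carries this to every point. Pointwise limits suffice, as later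
  limits are taken by dominated convergence or by Fatou.\<close>

lemma pointwise_convergent_subsequence:
  fixes f :: "nat \<Rightarrow> real \<Rightarrow> real"
  assumes bdd: "\<And>n x. \<bar>f n x\<bar> \<le> M"
    and equi: "\<And>\<epsilon>. \<epsilon> > 0 \<Longrightarrow> \<exists>\<delta>>0. \<forall>n x y. \<bar>x - y\<bar> < \<delta> \<longrightarrow> \<bar>f n x - f n y\<bar> < \<epsilon>"
  obtains k g where "strict_mono (k :: nat \<Rightarrow> nat)" "\<And>x. (\<lambda>n. f (k n) x) \<longlonglongrightarrow> g x"
proof -
  define P where "P i s \<longleftrightarrow> convergent (\<lambda>n. f (s n) (of_rat (from_nat i)))" for i and s :: "nat \<Rightarrow> nat"
  obtain k where k: "strict_mono (k :: nat \<Rightarrow> nat)" "\<And>i. P i (id \<circ> k)"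
  proof (rule subsequence_diagonalization_lemma[of P id])
    fix i and r :: "nat \<Rightarrow> nat"
    have "bounded (range (\<lambda>n. f (r n) (of_rat (from_nat i))))"
      unfolding bounded_iff by (rule exI[of _ M]) (use bdd in auto)
    from bounded_imp_convergent_subsequence[OF this]
    obtain l k where "strict_mono (k :: nat \<Rightarrow> nat)" "((\<lambda>n. f (r n) (of_rat (from_nat i))) \<circ> k) \<longlonglongrightarrow> l" by blast
    then show "\<exists>k. strict_mono (k :: nat \<Rightarrow> nat) \<and> P i (r \<circ> k)"
      unfolding P_def convergent_def by (auto simp: o_def)
  next
    fix i and r k1 k2 :: "nat \<Rightarrow> nat" and N
    assume P: "P i (r \<circ> k1)" and sub: "\<And>j. N \<le> j \<Longrightarrow> \<exists>j'. j \<le> j' \<and> k2 j = k1 j'"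
    from P obtain l where l: "(\<lambda>n. f (r (k1 n)) (of_rat (from_nat i))) \<longlonglongrightarrow> l"
      unfolding P_def convergent_def by auto
    have "(\<lambda>n. f (r (k2 n)) (of_rat (from_nat i))) \<longlonglongrightarrow> l"
    proof (rule LIMSEQ_I)
      fix e :: real assume "0 < e"
      from LIMSEQ_D[OF l this] obtain n0 where n0: "\<And>n. n \<ge> n0 \<Longrightarrow> norm (f (r (k1 n)) (of_rat (from_nat i)) - l) < e"
        by blast
      have "norm (f (r (k2 n)) (of_rat (from_nat i)) - l) < e" if n: "n \<ge> max N n0" for n
      proof -
        from sub[of n] n obtain j' where "n \<le> j'" "k2 n = k1 j'" by auto
        then show ?thesis using n0[of j'] n by simp
      qed
      then show "\<exists>no. \<forall>n\<ge>no. norm (f (r (k2 n)) (of_rat (from_nat i)) - l) < e" by blast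
    qed
    then show "P i (r \<circ> k2)" unfolding P_def convergent_def by auto
  qed (rule that, assumption, blast)
  have "convergent (\<lambda>n. f (k n) x)" for x
  proof (rule Cauchy_convergent, rule metric_CauchyI)
    fix e :: real assume "0 < e"
    then obtain d where d: "d > 0" "\<And>n x y. \<bar>x - y\<bar> < d \<Longrightarrow> \<bar>f n x - f n y\<bar> < e / 3"
      using equi[of "e / 3"] by auto
    obtain q :: rat where q: "x < of_rat q" "of_rat q < x + d" using of_rat_dense[of x "x + d"] d by auto
    have "P (to_nat q) k" using k(2)[of "to_nat q"] by simp
    then have "Cauchy (\<lambda>n. f (k n) (of_rat q))" unfolding P_def by (simp add: convergent_Cauchy)
    then obtain N where N: "\<And>m n. m \<ge> N \<Longrightarrow> n \<ge> N \<Longrightarrow> \<bar>f (k m) (of_rat q) - f (k n) (of_rat q)\<bar> < e / 3"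
      using \<open>0 < e\<close> metric_CauchyD[of "\<lambda>n. f (k n) (of_rat q)" "e / 3"] by (auto simp: dist_real_def)
    have near: "\<bar>f n x - f n (of_rat q)\<bar> < e / 3" for n using q by (intro d(2)) auto
    have "dist (f (k m) x) (f (k n) x) < e" if "m \<ge> N" "n \<ge> N" for m n
      using N[OF that] near[of "k m"] near[of "k n"] unfolding dist_real_def by linarith
    then show "\<exists>M. \<forall>m\<ge>M. \<forall>n\<ge>M. dist (f (k m) x) (f (k n) x) < e" by blast
  qed
  then obtain g where "\<And>x. (\<lambda>n. f (k n) x) \<longlonglongrightarrow> g x" unfolding convergent_def by metis
  with k(1) show ?thesis by (rule that)
qed

lemma W_subsequence:
  assumes q: "\<And>n. L2 (q n)" and N: "\<And>n. (\<integral>x. (q n x)\<^sup>2 \<partial>lborel) \<le> N\<^sup>2" "0 \<le> N"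
  obtains k w where "strict_mono (k :: nat \<Rightarrow> nat)" "\<And>r. (\<lambda>n. W (q (k n)) r) \<longlonglongrightarrow> w r"
proof (rule pointwise_convergent_subsequence[of "\<lambda>n. W (q n)" N])
  have sq: "sqrt (\<integral>x. (q n x)\<^sup>2 \<partial>lborel) \<le> N" for n using N by (intro real_le_lsqrt) auto
  then show "\<bar>W (q n) x\<bar> \<le> N" for n x using W_bound[OF q] order_trans by blast
  fix \<epsilon> :: real assume "\<epsilon> > 0"
  have "((\<lambda>d. (sqrt \<bar>d\<bar> + \<bar>d\<bar>) * N) \<longlongrightarrow> (sqrt \<bar>0\<bar> + \<bar>0\<bar>) * N) (at 0)" by (intro tendsto_intros)
  then have "((\<lambda>d. (sqrt \<bar>d\<bar> + \<bar>d\<bar>) * N) \<longlongrightarrow> 0) (at 0)" by simp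
  from LIM_D[OF this \<open>\<epsilon> > 0\<close>] obtain \<delta> where \<delta>: "\<delta> > 0"
    "\<And>d. d \<noteq> 0 \<Longrightarrow> \<bar>d\<bar> < \<delta> \<Longrightarrow> \<bar>(sqrt \<bar>d\<bar> + \<bar>d\<bar>) * N\<bar> < \<epsilon>" by auto
  have "\<bar>W (q n) x - W (q n) y\<bar> < \<epsilon>" if "\<bar>x - y\<bar> < \<delta>" for n x y
  proof (cases "x = y")
    case True then show ?thesis using \<open>\<epsilon> > 0\<close> by simp
  next
    case False
    have "\<bar>W (q n) x - W (q n) y\<bar> \<le> (sqrt \<bar>x - y\<bar> + \<bar>x - y\<bar>) * sqrt (\<integral>x. (q n x)\<^sup>2 \<partial>lborel)"
      by (rule W_modulus[OF q])
    also have "\<dots> \<le> (sqrt \<bar>x - y\<bar> + \<bar>x - y\<bar>) * N" by (intro mult_left_mono sq) auto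
    also have "\<dots> < \<epsilon>" using \<delta>(2)[of "x - y"] False that by auto
    finally show ?thesis .
  qed
  with \<delta>(1) show "\<exists>\<delta>>0. \<forall>n x y. \<bar>x - y\<bar> < \<delta> \<longrightarrow> \<bar>W (q n) x - W (q n) y\<bar> < \<epsilon>" by blast
qed (rule that, assumption, blast)

text \<open>The set where \<open>f\<close> is nonzero would be open and negligible, hence empty.
  This makes the inner product of profiles definite and later separates solutions.\<close>

lemma continuous_AE_eq_0:
  fixes f :: "'a::euclidean_space \<Rightarrow> real"
  assumes "open S" "continuous_on S f" "AE x in lborel. f x = 0" "x \<in> S"
  shows "f x = 0"
proof -
  define U where "U = S \<inter> f -` (- {0})"
  have "open U" unfolding U_def by (rule continuous_open_preimage[OF assms(2,1)]) auto
  have "AE x in lebesgue. x \<notin> U"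
    using AE_completion[OF assms(3)] by eventually_elim (auto simp: U_def)
  then have "negligible U"
    unfolding negligible_iff_null_sets by (subst AE_iff_null_sets) (use \<open>open U\<close> in auto)
  then have "U = {}" using open_not_negligible[OF \<open>open U\<close>] by blast
  then show ?thesis using assms(4) by (auto simp: U_def)
qed

section \<open>The space of profiles\<close>

text \<open>Continuity picks one representative of each class, so that the \<open>L\<^sup>2\<close> inner product is definite.
  The space is not complete; all compactness comes from \<open>W_subsequence\<close>.\<close>

typedef profile = "{q :: real \<Rightarrow> real. L2 q \<and> continuous_on {0<..} q \<and> (\<forall>r\<le>0. q r = 0)}"
  morphisms prof Abs_profile
  by (rule exI[of _ "\<lambda>x. 0"]) auto

setup_lifting type_definition_profile

lemma prof: "L2 (prof q)" "continuous_on {0<..} (prof q)" "r \<le> 0 \<Longrightarrow> prof q r = 0"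
  using prof[of q] by auto

instantiation profile :: real_vector
begin

lift_definition zero_profile :: profile is "\<lambda>x. 0" by simp
lift_definition plus_profile :: "profile \<Rightarrow> profile \<Rightarrow> profile" is "\<lambda>p q x. p x + q x"
  by (auto intro: L2_add continuous_intros)
lift_definition minus_profile :: "profile \<Rightarrow> profile \<Rightarrow> profile" is "\<lambda>p q x. p x - q x"
  by (auto intro: L2_diff continuous_intros)
lift_definition uminus_profile :: "profile \<Rightarrow> profile" is "\<lambda>p x. - p x"
  by (auto intro: L2_uminus continuous_intros)
lift_definition scaleR_profile :: "real \<Rightarrow> profile \<Rightarrow> profile" is "\<lambda>c p x. c * p x"
  by (auto intro: L2_scale continuous_intros)

instance
proof
  fix x y z :: profile and a b :: real
  show "x + y + z = x + (y + z)" by transfer (auto simp: algebra_simps)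
  show "x + y = y + x" by transfer (auto simp: algebra_simps)
  show "0 + x = x" by transfer auto
  show "- x + x = 0" by transfer auto
  show "x - y = x + - y" by transfer auto
  show "a *\<^sub>R (x + y) = a *\<^sub>R x + a *\<^sub>R y" by transfer (auto simp: algebra_simps)
  show "(a + b) *\<^sub>R x = a *\<^sub>R x + b *\<^sub>R x" by transfer (auto simp: algebra_simps)
  show "a *\<^sub>R b *\<^sub>R x = (a * b) *\<^sub>R x" by transfer (auto simp: algebra_simps)
  show "1 *\<^sub>R x = x" by transfer auto
qed

end

instantiation profile :: real_inner
begin

definition inner_profile :: "profile \<Rightarrow> profile \<Rightarrow> real" where
  "inner_profile p q = (\<integral>x. prof p x * prof q x \<partial>lborel)"
definition norm_profile :: "profile \<Rightarrow> real" where "norm_profile p = sqrt (inner p p)"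
definition sgn_profile :: "profile \<Rightarrow> profile" where "sgn_profile p = p /\<^sub>R norm p"
definition dist_profile :: "profile \<Rightarrow> profile \<Rightarrow> real" where "dist_profile p q = norm (p - q)"
definition uniformity_profile :: "(profile \<times> profile) filter" where
  "uniformity_profile = (INF e\<in>{0<..}. principal {(x, y). dist x y < e})"
definition open_profile :: "profile set \<Rightarrow> bool" where
  "open_profile U \<longleftrightarrow> (\<forall>x\<in>U. \<forall>\<^sub>F (x', y) in uniformity. x' = x \<longrightarrow> y \<in> U)"

instance
proof
  fix x y z :: profile and a :: real
  show "dist x y = norm (x - y)" by (rule dist_profile_def)
  show "sgn x = x /\<^sub>R norm x" by (rule sgn_profile_def)
  show "uniformity = (INF e\<in>{0<..}. principal {(x, y :: profile). dist x y < e})" by (rule uniformity_profile_def)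
  show "open U = (\<forall>x\<in>U. \<forall>\<^sub>F (x', y) in uniformity. x' = x \<longrightarrow> y \<in> U)" for U :: "profile set"
    by (rule open_profile_def)
  show "inner x y = inner y x" by (simp add: inner_profile_def mult.commute)
  show "inner (x + y) z = inner x z + inner y z"
    using L2_mult[OF prof(1) prof(1)] by (simp add: inner_profile_def plus_profile.rep_eq distrib_right)
  show "inner (a *\<^sub>R x) y = a * inner x y"
    by (simp add: inner_profile_def scaleR_profile.rep_eq mult.assoc)
  show "0 \<le> inner x x" by (simp add: inner_profile_def)
  show "norm x = sqrt (inner x x)" by (rule norm_profile_def)
  show "(inner x x = 0) = (x = 0)"
  proof
    assume "inner x x = 0"
    then have "AE t in lborel. prof x t * prof x t = 0"
      using L2_mult[OF prof(1) prof(1)] by (subst (asm) inner_profile_def) (simp add: integral_nonneg_eq_0_iff_AE)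
    then have "AE t in lborel. prof x t = 0" by simp
    from continuous_AE_eq_0[OF open_greaterThan prof(2) this]
    have "prof x r = 0" for r by (cases "r > 0") (auto simp: prof)
    then show "x = 0" by transfer auto
  next
    assume "x = 0" then show "inner x x = 0" by (simp add: inner_profile_def zero_profile.rep_eq)
  qed
qed

end

lemma norm_profile_square: "(norm p)\<^sup>2 = (\<integral>x. (prof p x)\<^sup>2 \<partial>lborel)"
  by (simp add: power2_norm_eq_inner inner_profile_def) (simp add: power2_eq_square)

lemma norm_profile_eq: "norm p = sqrt (\<integral>x. (prof p x)\<^sup>2 \<partial>lborel)"
  by (simp add: norm_eq_sqrt_inner inner_profile_def power2_eq_square)

section \<open>Newtonian potentials of radial densities\<close>

text \<open>For \<open>g s = s\<^sup>2 \<rho> s\<close> this is the Newtonian potential of the radial density \<open>\<rho>\<close> in three dimensions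
  (Newton's shell theorem).\<close>

definition pot :: "(real \<Rightarrow> real) \<Rightarrow> real \<Rightarrow> real" where
  "pot g r = (\<integral>s. g s / max r s \<partial>lborel)"

text \<open>The densities whose potential is bounded: the linear bound controls
  \<open>g s / s\<close> near 0 and the integral controls the tail. One constant serves both, as it
  does for \<open>(w s)\<^sup>2\<close> with \<open>A = N\<^sup>2\<close>.\<close>

definition source :: "real \<Rightarrow> (real \<Rightarrow> real) \<Rightarrow> bool" where
  "source A g \<longleftrightarrow> g \<in> borel_measurable borel \<and> (\<forall>s\<le>0. g s = 0) \<and> (\<forall>s>0. \<bar>g s\<bar> \<le> A * s) \<and>
     integrable lborel g \<and> (\<integral>s. \<bar>g s\<bar> \<partial>lborel) \<le> A"

lemma sourceD:
  assumes "source A g"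
  shows "g \<in> borel_measurable borel" "s \<le> 0 \<Longrightarrow> g s = 0" "s > 0 \<Longrightarrow> \<bar>g s\<bar> \<le> A * s"
    "integrable lborel g" "integrable lborel (\<lambda>s. \<bar>g s\<bar>)" "(\<integral>s. \<bar>g s\<bar> \<partial>lborel) \<le> A" "0 \<le> A"
proof -
  have "0 \<le> (\<integral>s. \<bar>g s\<bar> \<partial>lborel)" by (rule Bochner_Integration.integral_nonneg) simp
  also have "\<dots> \<le> A" using assms by (simp add: source_def)
  finally show "0 \<le> A" .
qed (use assms in \<open>auto simp: source_def\<close>)

lemma source_add: assumes "source A g" "source B k" shows "source (A + B) (\<lambda>s. g s + k s)"
  unfolding source_def
proof (intro conjI allI impI)
  show "\<bar>g s + k s\<bar> \<le> (A + B) * s" if "s > 0" for s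
    using sourceD(3)[OF assms(1) that] sourceD(3)[OF assms(2) that] by (simp add: distrib_right)
  have "(\<integral>s. \<bar>g s + k s\<bar> \<partial>lborel) \<le> (\<integral>s. \<bar>g s\<bar> + \<bar>k s\<bar> \<partial>lborel)"
    using assms sourceD(4,5) by (intro integral_mono) auto
  also have "\<dots> \<le> A + B" using assms sourceD(5,6) by (simp add: add_mono)
  finally show "(\<integral>s. \<bar>g s + k s\<bar> \<partial>lborel) \<le> A + B" .
qed (use assms in \<open>auto simp: source_def\<close>)

text \<open>\<open>max r s \<ge> s\<close>, so the linear bound on \<open>g\<close> is used up to 1,
  and beyond 1 the division only decreases \<open>\<bar>g s\<bar>\<close>. The bound does not depend
  on \<open>r\<close>.\<close>

lemma source_kernel_bound:
  assumes "source A g"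
  shows "\<bar>g s / max r s\<bar> \<le> A * indicator {0..1} s + \<bar>g s\<bar>"
proof (cases "s > 0")
  case False then show ?thesis using sourceD(2,7)[OF assms] by (auto split: split_indicator)
next
  case s: True
  show ?thesis
  proof (cases "s \<le> 1")
    case True
    have "\<bar>g s\<bar> / max r s \<le> A * s / s"
      using s sourceD(3,7)[OF assms] by (intro frac_le) auto
    then show ?thesis using s True by (simp add: abs_divide)
  next
    case False
    then have "\<bar>g s\<bar> / max r s \<le> \<bar>g s\<bar> / 1" by (intro frac_le) auto
    then show ?thesis using s False by (simp add: abs_divide)
  qed
qed

lemma pot_integrable:
  assumes "source A g" shows "integrable lborel (\<lambda>s. g s / max r s)"
proof (rule Bochner_Integration.integrable_bound)
  show "integrable lborel (\<lambda>s. A * indicator {0..1} s + \<bar>g s\<bar>)" using sourceD(5)[OF assms] by simp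
  show "AE s in lborel. norm (g s / max r s) \<le> norm (A * indicator {0..1} s + \<bar>g s\<bar>)"
    using source_kernel_bound[OF assms] by (intro AE_I2) (metis abs_ge_self order_trans real_norm_def)
qed (use sourceD(1)[OF assms] in measurable)

lemma pot_abs:
  assumes "source A g" shows "(\<integral>s. \<bar>g s / max r s\<bar> \<partial>lborel) \<le> 2 * A"
proof -
  have "(\<integral>s. \<bar>g s / max r s\<bar> \<partial>lborel) \<le> (\<integral>s. A * indicator {0..1} s + \<bar>g s\<bar> \<partial>lborel)"
    by (intro integral_mono integrable_abs[OF pot_integrable[OF assms]] source_kernel_bound[OF assms])
      (use sourceD(5)[OF assms] in simp)
  also have "\<dots> = A + (\<integral>s. \<bar>g s\<bar> \<partial>lborel)" using sourceD(5)[OF assms] by simp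
  finally show ?thesis using sourceD(6)[OF assms] by simp
qed

lemma pot_bound: assumes "source A g" shows "\<bar>pot g r\<bar> \<le> 2 * A"
  unfolding pot_def using order_trans[OF integral_abs_bound pot_abs[OF assms]] .

lemma pot_bound_inverse: assumes "source A g" "r > 0" shows "\<bar>pot g r\<bar> \<le> A / r"
proof -
  have "\<bar>pot g r\<bar> \<le> (\<integral>s. \<bar>g s / max r s\<bar> \<partial>lborel)" unfolding pot_def by (rule integral_abs_bound)
  also have "\<dots> \<le> (\<integral>s. \<bar>g s\<bar> / r \<partial>lborel)"
    by (intro integral_mono integrable_abs[OF pot_integrable[OF assms(1)]])
      (use sourceD(5)[OF assms(1)] assms(2) in \<open>auto simp: abs_divide intro!: frac_le\<close>)
  also have "\<dots> \<le> A / r" using sourceD(6)[OF assms(1)] assms(2) by (simp add: divide_right_mono)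
  finally show ?thesis .
qed

lemma pot_measurable [measurable]: assumes [measurable]: "g \<in> borel_measurable borel" shows "pot g \<in> borel_measurable borel"
  unfolding pot_def[abs_def] by measurable

lemma pot_add: "source A g \<Longrightarrow> source B k \<Longrightarrow> pot (\<lambda>s. g s + k s) r = pot g r + pot k r"
  unfolding pot_def using pot_integrable by (simp add: add_divide_distrib)

lemma pot_nonneg: assumes "\<And>s. 0 \<le> g s" "\<And>s. s \<le> 0 \<Longrightarrow> g s = 0" shows "0 \<le> pot g r"
  unfolding pot_def
proof (rule Bochner_Integration.integral_nonneg)
  fix s show "0 \<le> g s / max r s" using assms(1)[of s] assms(2)[of s] by (cases "s \<le> 0") auto
qed

lemma pot_mult_integrable:
  assumes "source A g" "integrable lborel k"
  shows "integrable lborel (\<lambda>r. pot g r * k r)" "\<bar>\<integral>r. pot g r * k r \<partial>lborel\<bar> \<le> 2 * A * (\<integral>r. \<bar>k r\<bar> \<partial>lborel)"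
proof -
  note [measurable] = sourceD(1)[OF assms(1)]
  have le: "\<bar>pot g r * k r\<bar> \<le> 2 * A * \<bar>k r\<bar>" for r
    unfolding abs_mult by (intro mult_right_mono pot_bound[OF assms(1)]) simp
  have i: "integrable lborel (\<lambda>r. 2 * A * \<bar>k r\<bar>)" using assms(2) by auto
  show i': "integrable lborel (\<lambda>r. pot g r * k r)"
    by (rule Bochner_Integration.integrable_bound[OF i]) (use assms(2) le sourceD(7)[OF assms(1)] in \<open>auto simp: abs_mult\<close>)
  have "\<bar>\<integral>r. pot g r * k r \<partial>lborel\<bar> \<le> (\<integral>r. \<bar>pot g r * k r\<bar> \<partial>lborel)" by (rule integral_abs_bound)
  also have "\<dots> \<le> (\<integral>r. 2 * A * \<bar>k r\<bar> \<partial>lborel)" using i i' le by (intro integral_mono) auto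
  finally show "\<bar>\<integral>r. pot g r * k r \<partial>lborel\<bar> \<le> 2 * A * (\<integral>r. \<bar>k r\<bar> \<partial>lborel)" by simp
qed

text \<open>The kernel \<open>1 / max r s\<close> is symmetric, and \<open>pot_abs\<close> bounds
  its absolute integral uniformly in \<open>r\<close>, so Fubini applies.\<close>

lemma pot_symmetric:
  assumes g: "source A g" and k: "source B k"
  shows "(\<integral>r. pot g r * k r \<partial>lborel) = (\<integral>s. pot k s * g s \<partial>lborel)"
proof -
  note [measurable] = sourceD(1)[OF g] sourceD(1)[OF k]
  have "(\<integral>\<^sup>+p. ennreal (norm (k (fst p) * (g (snd p) / max (fst p) (snd p)))) \<partial>(lborel \<Otimes>\<^sub>M lborel))
     = (\<integral>\<^sup>+r. \<integral>\<^sup>+s. ennreal (norm (k r * (g s / max r s))) \<partial>lborel \<partial>lborel)"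
    by (subst lborel.nn_integral_fst[symmetric]) auto
  also have "\<dots> = (\<integral>\<^sup>+r. ennreal \<bar>k r\<bar> * (\<integral>\<^sup>+s. ennreal \<bar>g s / max r s\<bar> \<partial>lborel) \<partial>lborel)"
    by (intro nn_integral_cong) (simp add: nn_integral_cmult[symmetric] ennreal_mult[symmetric] abs_mult)
  also have "\<dots> \<le> (\<integral>\<^sup>+r. ennreal \<bar>k r\<bar> * ennreal (2 * A) \<partial>lborel)"
  proof (intro nn_integral_mono mult_left_mono)
    fix r
    have "(\<integral>\<^sup>+s. ennreal \<bar>g s / max r s\<bar> \<partial>lborel) = ennreal (\<integral>s. \<bar>g s / max r s\<bar> \<partial>lborel)"
      by (intro nn_integral_eq_integral integrable_abs[OF pot_integrable[OF g]]) auto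
    then show "(\<integral>\<^sup>+s. ennreal \<bar>g s / max r s\<bar> \<partial>lborel) \<le> ennreal (2 * A)"
      using pot_abs[OF g] by (simp add: ennreal_leI)
  qed auto
  also have "\<dots> = ennreal (\<integral>r. \<bar>k r\<bar> \<partial>lborel) * ennreal (2 * A)"
    using sourceD(5)[OF k] by (simp add: nn_integral_multc nn_integral_eq_integral)
  also have "\<dots> < \<infinity>" by (simp add: ennreal_mult_less_top)
  finally have "integrable (lborel \<Otimes>\<^sub>M lborel) (\<lambda>p. k (fst p) * (g (snd p) / max (fst p) (snd p)))"
    by (intro integrableI_bounded) auto
  then have "(\<integral>s. (\<integral>r. k r * (g s / max r s) \<partial>lborel) \<partial>lborel) = (\<integral>r. (\<integral>s. k r * (g s / max r s) \<partial>lborel) \<partial>lborel)"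
    by (intro lborel_pair.Fubini_integral) (simp add: case_prod_unfold)
  moreover have "(\<integral>r. k r * (g s / max r s) \<partial>lborel) = pot k s * g s" for s
    unfolding pot_def by (subst integral_mult_left_zero[symmetric]) (simp add: max.commute)
  moreover have "(\<integral>s. k r * (g s / max r s) \<partial>lborel) = pot g r * k r" for r
    unfolding pot_def by (subst integral_mult_left_zero[symmetric]) (simp add: mult.commute)
  ultimately show ?thesis by simp
qed

text \<open>All that is used about \<open>W (prof q)\<close> with \<open>norm q \<le> N\<close>. The
  clauses survive pointwise limits, whereas such a limit need not come from a profile.\<close>

definition admissible :: "real \<Rightarrow> (real \<Rightarrow> real) \<Rightarrow> bool" where
  "admissible N w \<longleftrightarrow> 0 \<le> N \<and> L2 w \<and> (\<integral>r. (w r)\<^sup>2 \<partial>lborel) \<le> N\<^sup>2 \<and> (\<forall>r\<le>0. w r = 0) \<and>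
     (\<forall>r. \<bar>w r\<bar> \<le> N) \<and> (\<forall>r\<ge>0. \<bar>w r\<bar> \<le> sqrt r * N)"

lemma admissibleD:
  assumes "admissible N w"
  shows "0 \<le> N" "L2 w" "w \<in> borel_measurable borel" "(\<integral>r. (w r)\<^sup>2 \<partial>lborel) \<le> N\<^sup>2"
    "r \<le> 0 \<Longrightarrow> w r = 0" "\<bar>w r\<bar> \<le> N" "r \<ge> 0 \<Longrightarrow> \<bar>w r\<bar> \<le> sqrt r * N" "sqrt (\<integral>r. (w r)\<^sup>2 \<partial>lborel) \<le> N"
  using assms by (auto simp: admissible_def L2_def intro!: real_le_lsqrt)

lemma admissible_mono: "admissible N w \<Longrightarrow> N \<le> N' \<Longrightarrow> admissible N' w"
  unfolding admissible_def by (auto intro: order_trans power_mono mult_left_mono) (meson mult_left_mono order_trans real_sqrt_ge_zero)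

lemma admissible_W: "admissible (norm q) (W (prof q))"
  unfolding admissible_def norm_profile_square
  using W_L2_le[OF prof(1)] W_bound[OF prof(1)] W_bound_sqrt[OF prof(1)]
  by (auto simp: W_L2 prof W_nonpos norm_profile_eq)

lemma integral_abs_mult_le:
  assumes "L2 w" "L2 z"
  shows "(\<integral>r. \<bar>w r * z r\<bar> \<partial>lborel) \<le> sqrt (\<integral>r. (w r)\<^sup>2 \<partial>lborel) * sqrt (\<integral>r. (z r)\<^sup>2 \<partial>lborel)"
proof -
  have "L2 (\<lambda>r. \<bar>w r\<bar>)" "L2 (\<lambda>r. \<bar>z r\<bar>)" using assms by (auto simp: L2_def)
  from L2_Cauchy_Schwarz[OF this] show ?thesis by (simp add: abs_mult)
qed

text \<open>The two factors \<open>sqrt s\<close> multiply to the linear bound that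
  \<open>source\<close> asks for, and Cauchy-Schwarz gives the integral.\<close>

lemma source_mult:
  assumes "admissible N w" "admissible P z" shows "source (N * P) (\<lambda>r. w r * z r)"
  unfolding source_def
proof (intro conjI allI impI)
  note w = admissibleD[OF assms(1)] and z = admissibleD[OF assms(2)]
  show "\<bar>w s * z s\<bar> \<le> N * P * s" if "s > 0" for s
  proof -
    have "\<bar>w s * z s\<bar> \<le> (sqrt s * N) * (sqrt s * P)"
      unfolding abs_mult using w(7)[of s] z(7)[of s] that w(1) by (intro mult_mono) auto
    also have "\<dots> = N * P * s" using that by simp
    finally show ?thesis .
  qed
  show "(\<integral>r. \<bar>w r * z r\<bar> \<partial>lborel) \<le> N * P"
    using integral_abs_mult_le[OF w(2) z(2)]
    by (rule order_trans) (intro mult_mono w z; simp)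
  show "integrable lborel (\<lambda>r. w r * z r)" by (rule L2_mult[OF w(2) z(2)])
  show "(\<lambda>r. w r * z r) \<in> borel_measurable borel" using w(3) z(3) by measurable
qed (simp add: admissibleD(5)[OF assms(1)])

lemma source_square: "admissible N w \<Longrightarrow> source (N\<^sup>2) (\<lambda>r. (w r)\<^sup>2)"
  using source_mult[of N w N w] by (simp add: power2_eq_square)

lemma source_scale: assumes "source A g" shows "source (\<bar>c\<bar> * A) (\<lambda>s. c * g s)"
  using assms unfolding source_def by (auto simp: abs_mult mult.assoc intro: mult_left_mono)

text \<open>With \<open>g = w\<^sup>2\<close> and \<open>k = 2 * w * z + z\<^sup>2\<close> the
  quartic term is a symmetric bilinear form evaluated at \<open>g + k\<close>. The two equal mixed
  terms give the coefficient 4 of the linear part; what remains is quadratic in \<open>P\<close> for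
  bounded \<open>P\<close>.\<close>

lemma quartic_expansion:
  assumes w: "admissible N w" and z: "admissible P z"
  shows "\<bar>(\<integral>r. pot (\<lambda>s. (w s + z s)\<^sup>2) r * (w r + z r)\<^sup>2 \<partial>lborel) - (\<integral>r. pot (\<lambda>s. (w s)\<^sup>2) r * (w r)\<^sup>2 \<partial>lborel)
           - 4 * (\<integral>r. pot (\<lambda>s. (w s)\<^sup>2) r * w r * z r \<partial>lborel)\<bar> \<le> 4 * N\<^sup>2 * P\<^sup>2 + 2 * (P * (2 * N + P))\<^sup>2"
proof -
  define g where "g s = (w s)\<^sup>2" for s
  define k where "k s = 2 * (w s * z s) + (z s)\<^sup>2" for s
  have g: "source (N\<^sup>2) g" unfolding g_def by (rule source_square[OF w])
  have z2: "source (P\<^sup>2) (\<lambda>s. (z s)\<^sup>2)" by (rule source_square[OF z])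
  have wz: "source (N * P) (\<lambda>s. w s * z s)" by (rule source_mult[OF w z])
  define K where "K = P * (2 * N + P)"
  have K: "K = \<bar>2\<bar> * (N * P) + P\<^sup>2" by (simp add: K_def power2_eq_square algebra_simps)
  have k: "source K k" unfolding k_def K by (intro source_add source_scale wz z2)
  have gk: "(w s + z s)\<^sup>2 = g s + k s" for s by (simp add: g_def k_def power2_sum)
  have "(\<integral>r. pot (\<lambda>s. g s + k s) r * (g r + k r) \<partial>lborel)
      = (\<integral>r. pot g r * g r + pot g r * k r + (pot k r * g r + pot k r * k r) \<partial>lborel)"
    using pot_add[OF g k] by (simp add: algebra_simps)
  also have "\<dots> = (\<integral>r. pot g r * g r \<partial>lborel) + (\<integral>r. pot g r * k r \<partial>lborel)
      + ((\<integral>r. pot k r * g r \<partial>lborel) + (\<integral>r. pot k r * k r \<partial>lborel))"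
    using g k pot_mult_integrable(1) sourceD(4) by simp
  also have "(\<integral>r. pot k r * g r \<partial>lborel) = (\<integral>r. pot g r * k r \<partial>lborel)" by (rule pot_symmetric[OF k g])
  finally have 1: "(\<integral>r. pot (\<lambda>s. g s + k s) r * (g r + k r) \<partial>lborel)
     = (\<integral>r. pot g r * g r \<partial>lborel) + 2 * (\<integral>r. pot g r * k r \<partial>lborel) + (\<integral>r. pot k r * k r \<partial>lborel)" by simp
  have "(\<integral>r. pot g r * k r \<partial>lborel) = (\<integral>r. 2 * (pot g r * (w r * z r)) + pot g r * (z r)\<^sup>2 \<partial>lborel)"
    by (simp add: k_def algebra_simps)
  also have "\<dots> = 2 * (\<integral>r. pot g r * (w r * z r) \<partial>lborel) + (\<integral>r. pot g r * (z r)\<^sup>2 \<partial>lborel)"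
    using pot_mult_integrable(1)[OF g sourceD(4)[OF wz]] pot_mult_integrable(1)[OF g sourceD(4)[OF z2]] by simp
  finally have 2: "(\<integral>r. pot g r * k r \<partial>lborel) = 2 * (\<integral>r. pot g r * w r * z r \<partial>lborel) + (\<integral>r. pot g r * (z r)\<^sup>2 \<partial>lborel)"
    by (simp add: mult.assoc)
  have 3: "\<bar>\<integral>r. pot g r * (z r)\<^sup>2 \<partial>lborel\<bar> \<le> 2 * N\<^sup>2 * P\<^sup>2"
    by (rule order_trans[OF pot_mult_integrable(2)[OF g sourceD(4)[OF z2]]], intro mult_left_mono sourceD(6)[OF z2]) simp
  have 4: "\<bar>\<integral>r. pot k r * k r \<partial>lborel\<bar> \<le> 2 * K * K"
    by (rule order_trans[OF pot_mult_integrable(2)[OF k sourceD(4)[OF k]]], intro mult_left_mono sourceD(6)[OF k])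
      (use sourceD(7)[OF k] in simp)
  have "(\<integral>r. pot (\<lambda>s. (w s + z s)\<^sup>2) r * (w r + z r)\<^sup>2 \<partial>lborel) - (\<integral>r. pot (\<lambda>s. (w s)\<^sup>2) r * (w r)\<^sup>2 \<partial>lborel)
           - 4 * (\<integral>r. pot (\<lambda>s. (w s)\<^sup>2) r * w r * z r \<partial>lborel)
      = 2 * (\<integral>r. pot g r * (z r)\<^sup>2 \<partial>lborel) + (\<integral>r. pot k r * k r \<partial>lborel)"
    unfolding gk 1 2 g_def[symmetric] by simp
  moreover have "2 * K * K = 2 * (P * (2 * N + P))\<^sup>2" by (simp add: K_def power2_eq_square)
  ultimately show ?thesis using 3 4 by linarith
qed

text \<open>Fatou bounds the L2 norm of the limit; every other clause passes pointwise.\<close>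

lemma admissible_limit:
  assumes "\<And>n. admissible N (w n)" "\<And>r. (\<lambda>n. w n r) \<longlonglongrightarrow> v r"
  shows "admissible N v"
proof -
  note w = admissibleD[OF assms(1)]
  have m [measurable]: "v \<in> borel_measurable borel"
    by (rule borel_measurable_LIMSEQ_real[OF assms(2)]) (rule w)
  have nn: "(\<integral>\<^sup>+r. ennreal ((v r)\<^sup>2) \<partial>lborel) \<le> ennreal (N\<^sup>2)"
  proof -
    have "(\<integral>\<^sup>+r. ennreal ((v r)\<^sup>2) \<partial>lborel) = (\<integral>\<^sup>+r. liminf (\<lambda>n. ennreal ((w n r)\<^sup>2)) \<partial>lborel)"
      by (intro nn_integral_cong lim_imp_Liminf[symmetric]) (auto intro!: tendsto_intros assms)
    also have "\<dots> \<le> liminf (\<lambda>n. \<integral>\<^sup>+r. ennreal ((w n r)\<^sup>2) \<partial>lborel)"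
      by (rule nn_integral_liminf) (use w(3) in measurable)
    also have "\<dots> \<le> ennreal (N\<^sup>2)"
    proof (rule order_trans[OF Liminf_le_Limsup Limsup_bounded])
      show "\<forall>\<^sub>F n in sequentially. (\<integral>\<^sup>+r. ennreal ((w n r)\<^sup>2) \<partial>lborel) \<le> ennreal (N\<^sup>2)"
        using w(4) L2_integrable[OF w(2)] by (auto simp: nn_integral_eq_integral ennreal_leI)
    qed simp
    finally show ?thesis .
  qed
  then have i: "integrable lborel (\<lambda>r. (v r)\<^sup>2)"
    by (intro integrableI_bounded) (auto simp: order_le_less_trans)
  have "(\<integral>r. (v r)\<^sup>2 \<partial>lborel) \<le> N\<^sup>2" using nn i by (simp add: nn_integral_eq_integral)
  moreover have "v r = 0" if "r \<le> 0" for r using assms(2)[of r] w(5)[OF that] by (simp add: LIMSEQ_const_iff)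
  moreover have "\<bar>v r\<bar> \<le> N" for r
    by (rule LIMSEQ_le_const2[OF tendsto_rabs[OF assms(2)]]) (use w(6) in auto)
  moreover have "\<bar>v r\<bar> \<le> sqrt r * N" if "r \<ge> 0" for r
    by (rule LIMSEQ_le_const2[OF tendsto_rabs[OF assms(2)]]) (use w(7)[OF that] in auto)
  ultimately show ?thesis using i w(1) by (auto simp: admissible_def L2_def)
qed

text \<open>Mass may escape to infinity, but beyond \<open>S\<close> the kernel is at most
  \<open>1 / S\<close>, so the escaping mass is not felt. On \<open>[0, S]\<close> the uniform bound
  \<open>N\<close> permits dominated convergence.\<close>

lemma pot_convergence:
  assumes "\<And>n. admissible N (w n)" "\<And>r. (\<lambda>n. w n r) \<longlonglongrightarrow> v r" "r > 0"
  shows "(\<lambda>n. pot (\<lambda>s. (w n s)\<^sup>2) r) \<longlonglongrightarrow> pot (\<lambda>s. (v s)\<^sup>2) r"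
proof (rule LIMSEQ_I)
  fix \<epsilon> :: real assume "\<epsilon> > 0"
  note w = admissibleD[OF assms(1)]
  have v: "admissible N v" by (rule admissible_limit[OF assms(1,2)])
  note [measurable] = w(3) admissibleD(3)[OF v]
  have sw: "source (N\<^sup>2) (\<lambda>s. (w n s)\<^sup>2)" for n by (rule source_square[OF assms(1)])
  have sv: "source (N\<^sup>2) (\<lambda>s. (v s)\<^sup>2)" by (rule source_square[OF v])
  \<comment> \<open>Both tails together then contribute at most \<open>\<epsilon> / 2\<close>; the
    summand 1 keeps \<open>S\<close> positive when \<open>N = 0\<close>.\<close>
  define S where "S = 4 * N\<^sup>2 / \<epsilon> + 1"
  have S: "S > 0" "2 * N\<^sup>2 / S \<le> \<epsilon> / 2" using \<open>\<epsilon> > 0\<close> by (auto simp: S_def field_simps add_pos_nonneg)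
  define d where "d n s = indicator {0..S} s * \<bar>(w n s)\<^sup>2 - (v s)\<^sup>2\<bar> / r" for n s
  have d_le: "\<bar>d n s\<bar> \<le> 2 * N\<^sup>2 / r * indicator {0..S} s" for n s
  proof -
    have "(w n s)\<^sup>2 \<le> N\<^sup>2" "(v s)\<^sup>2 \<le> N\<^sup>2"
      using power_mono[OF w(6)[of n s], of 2] power_mono[OF admissibleD(6)[OF v, of s], of 2] by auto
    then have "\<bar>(w n s)\<^sup>2 - (v s)\<^sup>2\<bar> \<le> 2 * N\<^sup>2" using zero_le_power2[of "w n s"] zero_le_power2[of "v s"] by linarith
    then show ?thesis using assms(3) by (auto simp: d_def field_simps split: split_indicator)
  qed
  have [measurable]: "d n \<in> borel_measurable borel" for n unfolding d_def by measurable
  have dom: "integrable lborel (\<lambda>s. 2 * N\<^sup>2 / r * indicator {0..S} s)"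
    using S by (intro integrable_mult_right) auto
  have di: "integrable lborel (d n)" for n
    by (rule Bochner_Integration.integrable_bound[OF dom])
      (use d_le[of n] order_trans[OF d_le[of n] abs_ge_self] in auto)
  have "(\<lambda>n. \<integral>s. d n s \<partial>lborel) \<longlonglongrightarrow> integral\<^sup>L lborel (\<lambda>s::real. 0 :: real)"
  proof (rule integral_dominated_convergence)
    show "integrable lborel (\<lambda>s. 2 * N\<^sup>2 / r * indicator {0..S} s)" by (rule dom)
    have "(\<lambda>n. d n s) \<longlonglongrightarrow> indicator {0..S} s * \<bar>(v s)\<^sup>2 - (v s)\<^sup>2\<bar> / r" for s
      unfolding d_def using assms(3) by (intro tendsto_intros assms(2)) auto
    then show "AE s in lborel. (\<lambda>n. d n s) \<longlonglongrightarrow> 0" by simp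
    show "AE s in lborel. norm (d n s) \<le> 2 * N\<^sup>2 / r * indicator {0..S} s" for n
      unfolding real_norm_def by (intro AE_I2 d_le)
  qed auto
  from LIMSEQ_D[OF this[simplified], of "\<epsilon> / 2"] \<open>\<epsilon> > 0\<close> obtain n0 where
    n0: "\<And>n. n \<ge> n0 \<Longrightarrow> \<bar>\<integral>s. d n s \<partial>lborel\<bar> < \<epsilon> / 2" by auto
  have "norm (pot (\<lambda>s. (w n s)\<^sup>2) r - pot (\<lambda>s. (v s)\<^sup>2) r) < \<epsilon>" if "n \<ge> n0" for n
  proof -
    have i: "integrable lborel (\<lambda>s. (w n s)\<^sup>2 / S + (v s)\<^sup>2 / S)"
      using L2_integrable[OF w(2)[of n]] L2_integrable[OF admissibleD(2)[OF v]] by auto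
    have "\<bar>pot (\<lambda>s. (w n s)\<^sup>2) r - pot (\<lambda>s. (v s)\<^sup>2) r\<bar> = \<bar>\<integral>s. (w n s)\<^sup>2 / max r s - (v s)\<^sup>2 / max r s \<partial>lborel\<bar>"
      unfolding pot_def using pot_integrable[OF sw] pot_integrable[OF sv] by simp
    also have "\<dots> \<le> (\<integral>s. \<bar>(w n s)\<^sup>2 / max r s - (v s)\<^sup>2 / max r s\<bar> \<partial>lborel)" by (rule integral_abs_bound)
    also have "\<dots> \<le> (\<integral>s. d n s + ((w n s)\<^sup>2 / S + (v s)\<^sup>2 / S) \<partial>lborel)"
    proof (rule integral_mono)
      show "integrable lborel (\<lambda>s. \<bar>(w n s)\<^sup>2 / max r s - (v s)\<^sup>2 / max r s\<bar>)"
        using pot_integrable[OF sw] pot_integrable[OF sv] by auto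
      show "integrable lborel (\<lambda>s. d n s + ((w n s)\<^sup>2 / S + (v s)\<^sup>2 / S))" using di i by auto
      fix s
      have eq: "\<bar>(w n s)\<^sup>2 / max r s - (v s)\<^sup>2 / max r s\<bar> = \<bar>(w n s)\<^sup>2 - (v s)\<^sup>2\<bar> / max r s"
        using assms(3) by (simp add: diff_divide_distrib[symmetric] abs_divide)
      consider "s < 0" | "0 \<le> s" "s \<le> S" | "S < s" by linarith
      then show "\<bar>(w n s)\<^sup>2 / max r s - (v s)\<^sup>2 / max r s\<bar> \<le> d n s + ((w n s)\<^sup>2 / S + (v s)\<^sup>2 / S)"
      proof cases
        case 1 then show ?thesis using w(5)[of s n] admissibleD(5)[OF v, of s] by (simp add: d_def)
      next
        case 2
        have "\<bar>(w n s)\<^sup>2 - (v s)\<^sup>2\<bar> / max r s \<le> \<bar>(w n s)\<^sup>2 - (v s)\<^sup>2\<bar> / r"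
          using assms(3) by (intro frac_le) auto
        then show ?thesis unfolding eq using 2 S by (simp add: d_def add_increasing2)
      next
        case 3
        have "\<bar>(w n s)\<^sup>2 - (v s)\<^sup>2\<bar> / max r s \<le> ((w n s)\<^sup>2 + (v s)\<^sup>2) / S"
          using 3 S by (intro frac_le) (auto simp: abs_le_iff)
        then show ?thesis unfolding eq using 3 by (simp add: d_def add_divide_distrib)
      qed
    qed
    also have "\<dots> = (\<integral>s. d n s \<partial>lborel) + ((\<integral>s. (w n s)\<^sup>2 \<partial>lborel) / S + (\<integral>s. (v s)\<^sup>2 \<partial>lborel) / S)"
      using di i L2_integrable[OF w(2)[of n]] L2_integrable[OF admissibleD(2)[OF v]] by simp
    also have "\<dots> \<le> (\<integral>s. d n s \<partial>lborel) + (N\<^sup>2 / S + N\<^sup>2 / S)"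
      using S w(4)[of n] admissibleD(4)[OF v] by (intro add_mono divide_right_mono) auto
    also have "\<dots> < \<epsilon>" using n0[OF that] S(2) by auto
    finally show ?thesis by simp
  qed
  then show "\<exists>no. \<forall>n\<ge>no. norm (pot (\<lambda>s. (w n s)\<^sup>2) r - pot (\<lambda>s. (v s)\<^sup>2) r) < \<epsilon>" by blast
qed

section \<open>The reduced problem\<close>

text \<open>Here \<open>b\<close> is the profile of \<open>\<alpha>\<close>; the last condition on \<open>b\<close> says that \<open>\<alpha>\<close> is square integrable on three-space.\<close>

locale reduced_system =
  fixes e M :: real and f F b :: "real \<Rightarrow> real"
  assumes e: "e > 0"
    and f_cont: "continuous_on UNIV f"
    and f_inf: "((\<lambda>s. f s / s) \<longlongrightarrow> 0) at_infinity"
    and f_zero: "((\<lambda>s. f s / s) \<longlongrightarrow> 0) (at 0)"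
    and F: "\<And>s. (F has_real_derivative f s) (at s)" "F 0 = 0"
    and b: "b \<in> borel_measurable borel" "\<And>r. 0 \<le> b r" "\<And>r. b r \<le> M" "\<And>r. r \<le> 0 \<Longrightarrow> b r = 0"
      "L2 (\<lambda>r. b r * r)"
    and M: "M > 0"
begin

lemma [measurable]: "f \<in> borel_measurable borel" "F \<in> borel_measurable borel" "b \<in> borel_measurable borel"
proof -
  have "continuous_on UNIV F" using F(1) by (meson DERIV_continuous_on has_field_derivative_at_within)
  then show "F \<in> borel_measurable borel" by (rule borel_measurable_continuous_onI)
qed (use f_cont b in \<open>auto intro: borel_measurable_continuous_onI\<close>)

section \<open>Growth of the nonlinearity and of its primitive\<close>

lemma f_0: "f 0 = 0"
proof -
  have "((\<lambda>s. f s / s * s) \<longlongrightarrow> 0 * 0) (at 0)" by (intro tendsto_intros f_zero)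
  moreover have "\<forall>\<^sub>F s in at 0. f s / s * s = f s" by (auto simp: eventually_at_filter)
  ultimately have "(f \<longlongrightarrow> 0) (at 0)" by (simp add: tendsto_cong)
  moreover have "(f \<longlongrightarrow> f 0) (at 0)" using f_cont by (simp add: continuous_on_def)
  ultimately show ?thesis using LIM_unique by blast
qed

lemma f_affine_bound: assumes "\<epsilon> > 0" obtains C where "C \<ge> 0" "\<And>s. \<bar>f s\<bar> \<le> \<epsilon> * \<bar>s\<bar> + C"
proof -
  have "\<forall>\<^sub>F s in at_infinity. norm (f s / s - 0) < \<epsilon>"
    using f_inf assms by (simp add: tendsto_iff dist_norm)
  then obtain R where R: "\<And>s. \<bar>s\<bar> \<ge> R \<Longrightarrow> \<bar>f s / s\<bar> < \<epsilon>" by (auto simp: eventually_at_infinity)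
  have "compact (f ` cball 0 (max R 1))" by (intro compact_continuous_image continuous_on_subset[OF f_cont]) auto
  then obtain C where C: "\<And>s. \<bar>s\<bar> \<le> max R 1 \<Longrightarrow> \<bar>f s\<bar> \<le> C"
    using compact_imp_bounded[of "f ` cball 0 (max R 1)"] unfolding bounded_iff
    by (metis imageI mem_cball_0 real_norm_def)
  have "\<bar>f s\<bar> \<le> \<epsilon> * \<bar>s\<bar> + C" for s
  proof (cases "\<bar>s\<bar> \<le> max R 1")
    case True then show ?thesis using C[OF True] assms by (simp add: add_increasing)
  next
    case False
    then have "\<bar>f s\<bar> / \<bar>s\<bar> < \<epsilon>" using R[of s] by (simp add: abs_divide)
    moreover have "0 \<le> C" using C[of 0] abs_ge_zero[of "f 0"] by linarith
    ultimately show ?thesis using False by (simp add: divide_less_eq add_increasing2 split: if_splits)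
  qed
  moreover have "0 \<le> C" using C[of 0] abs_ge_zero[of "f 0"] by linarith
  ultimately show ?thesis using that by blast
qed

lemma f_near_0: assumes "\<epsilon> > 0" obtains \<delta> where "\<delta> > 0" "\<And>s. \<bar>s\<bar> < \<delta> \<Longrightarrow> \<bar>f s\<bar> \<le> \<epsilon> * \<bar>s\<bar>"
proof -
  from LIM_D[OF f_zero assms] obtain \<delta> where \<delta>: "\<delta> > 0" "\<And>s. s \<noteq> 0 \<Longrightarrow> \<bar>s\<bar> < \<delta> \<Longrightarrow> \<bar>f s / s\<bar> < \<epsilon>" by auto
  have "\<bar>f s\<bar> \<le> \<epsilon> * \<bar>s\<bar>" if "\<bar>s\<bar> < \<delta>" for s
    using \<delta>(2)[OF _ that] f_0 by (cases "s = 0") (auto simp: abs_divide divide_less_eq)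
  then show ?thesis using that \<delta>(1) by blast
qed

lemma f_linear_bound_ex: "\<exists>C\<ge>0. \<forall>s. \<bar>f s\<bar> \<le> C * \<bar>s\<bar>"
proof -
  obtain C where C: "C \<ge> 0" "\<And>s. \<bar>f s\<bar> \<le> 1 * \<bar>s\<bar> + C" using f_affine_bound[of 1] by auto
  obtain \<delta> where \<delta>: "\<delta> > 0" "\<And>s. \<bar>s\<bar> < \<delta> \<Longrightarrow> \<bar>f s\<bar> \<le> 1 * \<bar>s\<bar>" using f_near_0[of 1] by auto
  have "\<bar>f s\<bar> \<le> (1 + C / \<delta>) * \<bar>s\<bar>" for s
  proof (cases "\<bar>s\<bar> < \<delta>")
    case True
    have "0 \<le> C / \<delta> * \<bar>s\<bar>" using C \<delta> by simp
    then show ?thesis using \<delta>(2)[OF True] by (simp add: distrib_right)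
  next
    case False
    then have "C * 1 \<le> C * (\<bar>s\<bar> / \<delta>)" using \<delta> C(1) by (intro mult_left_mono) auto
    then show ?thesis using C(2)[of s] by (simp add: distrib_right)
  qed
  then show ?thesis using C \<delta> by (intro exI[of _ "1 + C / \<delta>"]) auto
qed

text \<open>Fixed once for all, so that bounds stated in different lemmas, including the final
  \<open>\<nu>\<close>, refer to the same constant.\<close>

definition Cf where "Cf = (SOME C. C \<ge> 0 \<and> (\<forall>s. \<bar>f s\<bar> \<le> C * \<bar>s\<bar>))"

lemma Cf: "Cf \<ge> 0" "\<bar>f s\<bar> \<le> Cf * \<bar>s\<bar>"
  using someI_ex[of "\<lambda>C. C \<ge> 0 \<and> (\<forall>s. \<bar>f s\<bar> \<le> C * \<bar>s\<bar>)"] f_linear_bound_ex unfolding Cf_def by blast+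

text \<open>The quadratic term makes the corresponding part of the energy cubic, which is how 0
  becomes a strict local minimum.\<close>

lemma f_quadratic_bound: assumes "\<epsilon> > 0" obtains C where "C \<ge> 0" "\<And>s. \<bar>f s\<bar> \<le> \<epsilon> * \<bar>s\<bar> + C * s\<^sup>2"
proof -
  obtain \<delta> where \<delta>: "\<delta> > 0" "\<And>s. \<bar>s\<bar> < \<delta> \<Longrightarrow> \<bar>f s\<bar> \<le> \<epsilon> * \<bar>s\<bar>" using f_near_0[OF assms] by auto
  have "\<bar>f s\<bar> \<le> \<epsilon> * \<bar>s\<bar> + Cf / \<delta> * s\<^sup>2" for s
  proof (cases "\<bar>s\<bar> < \<delta>")
    case True
    have "0 \<le> Cf / \<delta> * s\<^sup>2" using Cf(1) \<delta> by simp
    then show ?thesis using \<delta>(2)[OF True] by simp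
  next
    case False
    then have "Cf * \<bar>s\<bar> * 1 \<le> Cf * \<bar>s\<bar> * (\<bar>s\<bar> / \<delta>)" using \<delta> Cf(1) by (intro mult_left_mono) auto
    also have "\<dots> = Cf / \<delta> * s\<^sup>2" by (simp add: power2_eq_square)
    finally show ?thesis using Cf(2)[of s] assms by (simp add: add_increasing)
  qed
  moreover have "Cf / \<delta> \<ge> 0" using Cf(1) \<delta> by simp
  ultimately show ?thesis using that by blast
qed

text \<open>A substitute for a Lipschitz bound, which a merely continuous \<open>f\<close> need not
  have: uniform continuity on a large ball, sublinearity outside it, and the affine bound for points
  that are far apart. It makes the energy differentiable uniformly on bounded sets.\<close>

lemma f_modulus:
  assumes "\<epsilon> > 0" obtains C where "C \<ge> 0" "\<And>x y. \<bar>f x - f y\<bar> \<le> \<epsilon> * (1 + \<bar>x\<bar> + \<bar>y\<bar>) + C * \<bar>x - y\<bar>"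
proof -
  obtain C where C: "C \<ge> 0" "\<And>s. \<bar>f s\<bar> \<le> \<epsilon>/2 * \<bar>s\<bar> + C" using f_affine_bound[of "\<epsilon>/2"] assms by auto
  define R where "R = 2 * C / \<epsilon>"
  have big: "\<bar>f s\<bar> \<le> \<epsilon> * \<bar>s\<bar>" if "\<bar>s\<bar> \<ge> R" for s
  proof -
    have "C \<le> \<epsilon>/2 * \<bar>s\<bar>" using that assms by (simp add: R_def divide_le_eq mult.commute)
    then show ?thesis using C(2)[of s] by simp
  qed
  have "uniformly_continuous_on (cball 0 (R + 1)) f"
    by (intro compact_uniformly_continuous continuous_on_subset[OF f_cont]) auto
  then obtain d where d: "d > 0" "\<And>x y. \<bar>x\<bar> \<le> R + 1 \<Longrightarrow> \<bar>y\<bar> \<le> R + 1 \<Longrightarrow> \<bar>x - y\<bar> < d \<Longrightarrow> \<bar>f x - f y\<bar> < \<epsilon>"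
    unfolding uniformly_continuous_on_def using assms by (auto simp: dist_real_def abs_minus_commute dest!: spec[of _ \<epsilon>]) 
  \<comment> \<open>\<open>\<delta> \<le> 1\<close> ensures that if one of two close points lies
    outside radius \<open>R + 1\<close>, both lie outside radius \<open>R\<close>, where
    \<open>big\<close> applies.\<close>
  define \<delta> where "\<delta> = min d 1"
  have \<delta>: "\<delta> > 0" using d by (simp add: \<delta>_def)
  have "\<bar>f x - f y\<bar> \<le> \<epsilon> * (1 + \<bar>x\<bar> + \<bar>y\<bar>) + 2 * C / \<delta> * \<bar>x - y\<bar>" for x y
  proof (cases "\<bar>x - y\<bar> < \<delta>")
    case True
    have p: "0 \<le> 2 * C / \<delta> * \<bar>x - y\<bar>" using C \<delta> by simp
    have xy: "0 \<le> \<epsilon> * \<bar>x\<bar>" "0 \<le> \<epsilon> * \<bar>y\<bar>" using assms by auto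
    show ?thesis
    proof (cases "\<bar>x\<bar> \<le> R + 1 \<and> \<bar>y\<bar> \<le> R + 1")
      case inside: True
      then have "\<bar>f x - f y\<bar> < \<epsilon>" using True by (intro d(2)) (auto simp: \<delta>_def)
      then show ?thesis using p xy unfolding distrib_left by linarith
    next
      case False
      then have "\<bar>x\<bar> \<ge> R" "\<bar>y\<bar> \<ge> R" using True by (auto simp: \<delta>_def)
      from big[OF this(1)] big[OF this(2)] show ?thesis using p assms by (simp add: distrib_left)
    qed
  next
    case False
    then have "2 * C * 1 \<le> 2 * C * (\<bar>x - y\<bar> / \<delta>)" using \<delta> C(1) by (intro mult_left_mono) auto
    then have "2 * C \<le> 2 * C / \<delta> * \<bar>x - y\<bar>" by simp
    moreover have "\<bar>f x - f y\<bar> \<le> (\<epsilon>/2 * \<bar>x\<bar> + C) + (\<epsilon>/2 * \<bar>y\<bar> + C)" using C(2)[of x] C(2)[of y] by linarith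
    moreover have "0 \<le> \<epsilon> * \<bar>x\<bar>" "0 \<le> \<epsilon> * \<bar>y\<bar>" using assms by auto
    ultimately show ?thesis using assms unfolding distrib_left by linarith
  qed
  moreover have "0 \<le> 2 * C / \<delta>" using C \<delta> by simp
  ultimately show ?thesis using that by blast
qed

lemma F_mean_value: "\<exists>\<xi>. \<bar>\<xi>\<bar> \<le> \<bar>y\<bar> \<and> F (x + y) - F x = y * f (x + \<xi>)"
proof -
  consider "y = 0" | "y > 0" | "y < 0" by linarith
  then show ?thesis
  proof cases
    case 1 then show ?thesis by (intro exI[of _ 0]) auto
  next
    case 2
    obtain z where z: "x < z" "z < x + y" "F (x + y) - F x = (x + y - x) * f z"
      using MVT2[of x "x + y" F f] F(1) 2 by auto
    then show ?thesis by (intro exI[of _ "z - x"]) auto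
  next
    case 3
    obtain z where z: "x + y < z" "z < x" "F x - F (x + y) = (x - (x + y)) * f z"
      using MVT2[of "x + y" x F f] F(1) 3 by auto
    then show ?thesis by (intro exI[of _ "z - x"]) (auto simp: algebra_simps)
  qed
qed

lemma F_bound: assumes "\<And>s. \<bar>f s\<bar> \<le> g \<bar>s\<bar>" "\<And>s t. 0 \<le> s \<Longrightarrow> s \<le> t \<Longrightarrow> g s \<le> g t" shows "\<bar>F s\<bar> \<le> \<bar>s\<bar> * g \<bar>s\<bar>"
proof -
  obtain \<xi> where \<xi>: "\<bar>\<xi>\<bar> \<le> \<bar>s\<bar>" "F s = s * f \<xi>" using F_mean_value[of s 0] F(2) by auto
  have "\<bar>f \<xi>\<bar> \<le> g \<bar>s\<bar>" using assms(1)[of \<xi>] assms(2)[of "\<bar>\<xi>\<bar>" "\<bar>s\<bar>"] \<xi>(1) by simp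
  then show ?thesis unfolding \<xi>(2) abs_mult by (intro mult_left_mono) auto
qed

lemma F_remainder:
  assumes "\<And>x y. \<bar>f x - f y\<bar> \<le> \<epsilon> * (1 + \<bar>x\<bar> + \<bar>y\<bar>) + C * \<bar>x - y\<bar>" "0 \<le> \<epsilon>" "0 \<le> C"
  shows "\<bar>F (x + y) - F x - f x * y\<bar> \<le> \<bar>y\<bar> * (\<epsilon> * (1 + 2 * \<bar>x\<bar> + \<bar>y\<bar>) + C * \<bar>y\<bar>)"
proof -
  obtain \<xi> where \<xi>: "\<bar>\<xi>\<bar> \<le> \<bar>y\<bar>" "F (x + y) - F x = y * f (x + \<xi>)" using F_mean_value by blast
  have "\<bar>f (x + \<xi>) - f x\<bar> \<le> \<epsilon> * (1 + \<bar>x + \<xi>\<bar> + \<bar>x\<bar>) + C * \<bar>\<xi>\<bar>" using assms(1)[of "x + \<xi>" x] by simp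
  also have "\<dots> \<le> \<epsilon> * (1 + 2 * \<bar>x\<bar> + \<bar>y\<bar>) + C * \<bar>y\<bar>"
  proof (rule add_mono)
    have "1 + \<bar>x + \<xi>\<bar> + \<bar>x\<bar> \<le> 1 + 2 * \<bar>x\<bar> + \<bar>y\<bar>" using \<xi>(1) by linarith
    then show "\<epsilon> * (1 + \<bar>x + \<xi>\<bar> + \<bar>x\<bar>) \<le> \<epsilon> * (1 + 2 * \<bar>x\<bar> + \<bar>y\<bar>)" using assms(2) by (rule mult_left_mono)
    show "C * \<bar>\<xi>\<bar> \<le> C * \<bar>y\<bar>" using \<xi>(1) assms(3) by (rule mult_left_mono)
  qed
  finally have "\<bar>f (x + \<xi>) - f x\<bar> \<le> \<epsilon> * (1 + 2 * \<bar>x\<bar> + \<bar>y\<bar>) + C * \<bar>y\<bar>" .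
  then have "\<bar>y\<bar> * \<bar>f (x + \<xi>) - f x\<bar> \<le> \<bar>y\<bar> * (\<epsilon> * (1 + 2 * \<bar>x\<bar> + \<bar>y\<bar>) + C * \<bar>y\<bar>)"
    by (intro mult_left_mono) auto
  moreover have "F (x + y) - F x - f x * y = y * (f (x + \<xi>) - f x)" unfolding \<xi>(2) by (simp add: algebra_simps)
  ultimately show ?thesis by (simp add: abs_mult)
qed

text \<open>Up to the factor \<open>sqrt (4 * pi)\<close>, the L2 norm of alpha on
  three-space.\<close>

definition \<beta> where "\<beta> = sqrt (\<integral>r. (b r * r)\<^sup>2 \<partial>lborel)"

text \<open>The integral of alpha F(u) over three-space divided by \<open>4 * pi\<close>, for the
  radial function \<open>u = w / r\<close>.\<close>

definition J where "J w = (\<integral>r. b r * (r\<^sup>2 * F (w r / r)) \<partial>lborel)"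

text \<open>The right-hand side of - w'' + w = h. The constant is \<open>e\<close> from the first
  equation times \<open>4 * pi * e\<close> from the second.\<close>

definition nl where
  "nl lam w r = lam * (b r * (r * f (w r / r))) - 4 * pi * e\<^sup>2 * (pot (\<lambda>s. (w s)\<^sup>2) r * w r)"

section \<open>Estimates and first-order expansion of the nonlinear terms\<close>

lemma \<beta>_nonneg: "0 \<le> \<beta>" by (simp add: \<beta>_def)

text \<open>The place where square integrability of alpha enters: constants in the growth bounds for
  \<open>f\<close> become terms linear in \<open>N\<close>.\<close>

lemma integral_br_le:
  assumes "admissible N z" shows "integrable lborel (\<lambda>r. b r * r * \<bar>z r\<bar>)" "(\<integral>r. b r * r * \<bar>z r\<bar> \<partial>lborel) \<le> \<beta> * N"
proof -
  note z = admissibleD[OF assms]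
  have z': "L2 (\<lambda>r. \<bar>z r\<bar>)" using z(2) by (auto simp: L2_def)
  show "integrable lborel (\<lambda>r. b r * r * \<bar>z r\<bar>)" by (rule L2_mult[OF b(5) z'])
  have "(\<integral>r. b r * r * \<bar>z r\<bar> \<partial>lborel) \<le> \<beta> * sqrt (\<integral>r. (z r)\<^sup>2 \<partial>lborel)"
    using L2_Cauchy_Schwarz[OF b(5) z'] by (simp add: \<beta>_def)
  also have "\<dots> \<le> \<beta> * N" by (intro mult_left_mono z(8) \<beta>_nonneg)
  finally show "(\<integral>r. b r * r * \<bar>z r\<bar> \<partial>lborel) \<le> \<beta> * N" .
qed

lemma rf_le: "\<bar>b r * (r * f (w r / r))\<bar> \<le> M * Cf * \<bar>w r\<bar>"
proof (cases "r > 0")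
  case True
  have "\<bar>r * f (w r / r)\<bar> \<le> r * (Cf * \<bar>w r / r\<bar>)"
    unfolding abs_mult using True by (intro mult_mono Cf(2)) auto
  also have "\<dots> = Cf * \<bar>w r\<bar>" using True by (simp add: abs_divide)
  finally have "\<bar>b r\<bar> * \<bar>r * f (w r / r)\<bar> \<le> M * (Cf * \<bar>w r\<bar>)"
    using b Cf(1) M by (intro mult_mono) auto
  then show ?thesis by (simp add: abs_mult mult.assoc)
qed (use b M Cf in simp)

lemma rf_L2: assumes "L2 w" shows "L2 (\<lambda>r. b r * (r * f (w r / r)))"
proof -
  note [measurable] = L2_measurable[OF assms]
  show ?thesis by (rule L2_bound(1)[OF assms _ rf_le[of _ w]]) measurable
qed

lemma pot_w_L2: assumes "admissible N w" shows "L2 (\<lambda>r. pot (\<lambda>s. (w s)\<^sup>2) r * w r)"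
  and "\<bar>pot (\<lambda>s. (w s)\<^sup>2) r * w r\<bar> \<le> 2 * N\<^sup>2 * \<bar>w r\<bar>"
proof -
  note w = admissibleD[OF assms]
  note [measurable] = w(3)
  show le: "\<bar>pot (\<lambda>s. (w s)\<^sup>2) r * w r\<bar> \<le> 2 * N\<^sup>2 * \<bar>w r\<bar>" for r
    unfolding abs_mult by (intro mult_right_mono pot_bound source_square[OF assms]) simp
  show "L2 (\<lambda>r. pot (\<lambda>s. (w s)\<^sup>2) r * w r)" by (rule L2_bound(1)[OF w(2) _ le]) measurable
qed

text \<open>Pointwise and linear in \<open>w\<close>, so that it not only puts \<open>nl\<close>
  into L2 but later also bounds the Laplacian of the solution.\<close>

lemma nl_le: assumes "admissible N w" shows "\<bar>nl lam w r\<bar> \<le> (\<bar>lam\<bar> * M * Cf + 8 * pi * e\<^sup>2 * N\<^sup>2) * \<bar>w r\<bar>"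
proof -
  have "\<bar>nl lam w r\<bar> \<le> \<bar>lam\<bar> * \<bar>b r * (r * f (w r / r))\<bar> + 4 * pi * e\<^sup>2 * \<bar>pot (\<lambda>s. (w s)\<^sup>2) r * w r\<bar>"
    unfolding nl_def by (rule order_trans[OF abs_triangle_ineq4]) (simp add: abs_mult)
  also have "\<dots> \<le> \<bar>lam\<bar> * (M * Cf * \<bar>w r\<bar>) + 4 * pi * e\<^sup>2 * (2 * N\<^sup>2 * \<bar>w r\<bar>)"
    by (intro add_mono mult_left_mono rf_le pot_w_L2[OF assms]) auto
  also have "\<dots> = (\<bar>lam\<bar> * M * Cf + 8 * pi * e\<^sup>2 * N\<^sup>2) * \<bar>w r\<bar>" by (simp add: algebra_simps)
  finally show ?thesis .
qed

lemma nl_L2: assumes "admissible N w" shows "L2 (nl lam w)"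
  unfolding nl_def[abs_def]
  by (intro L2_diff L2_scale rf_L2 pot_w_L2(1)[OF assms] admissibleD(2)[OF assms])

text \<open>\<open>g\<close> is left open so that the affine and the quadratic growth bounds are
  treated together. The factor \<open>r\<close> next to \<open>b r\<close> is what
  \<open>r\<^sup>2 * \<bar>w r / r\<bar>\<close> leaves over.\<close>

lemma J_le:
  assumes "\<And>s. \<bar>F s\<bar> \<le> \<bar>s\<bar> * (\<epsilon> * \<bar>s\<bar> + g \<bar>s\<bar>)" "0 \<le> \<epsilon>" "r > 0"
  shows "\<bar>b r * (r\<^sup>2 * F (w r / r))\<bar> \<le> M * \<epsilon> * (w r)\<^sup>2 + b r * r * (\<bar>w r\<bar> * g (\<bar>w r\<bar> / r))"
proof -
  have "\<bar>b r * (r\<^sup>2 * F (w r / r))\<bar> \<le> b r * (r\<^sup>2 * (\<bar>w r / r\<bar> * (\<epsilon> * \<bar>w r / r\<bar> + g \<bar>w r / r\<bar>)))"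
    unfolding abs_mult using b(2)[of r] by (intro mult_mono assms(1)) auto
  also have "\<dots> = b r * (\<epsilon> * (w r)\<^sup>2) + b r * r * (\<bar>w r\<bar> * g (\<bar>w r\<bar> / r))"
    using assms(3) by (simp add: abs_divide field_simps power2_eq_square)
  also have "\<dots> \<le> M * (\<epsilon> * (w r)\<^sup>2) + b r * r * (\<bar>w r\<bar> * g (\<bar>w r\<bar> / r))"
    using b(3) assms(2) by (intro add_right_mono mult_right_mono) auto
  finally show ?thesis by (simp add: mult.assoc)
qed

lemma J_integrable: assumes "L2 w" shows "integrable lborel (\<lambda>r. b r * (r\<^sup>2 * F (w r / r)))"
proof -
  note [measurable] = L2_measurable[OF assms]
  have "\<bar>F s\<bar> \<le> \<bar>s\<bar> * (Cf * \<bar>s\<bar> + 0)" for s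
    using F_bound[of "\<lambda>s. Cf * s"] Cf by (auto intro: mult_left_mono)
  note le = J_le[OF this Cf(1), where w=w]
  have i: "integrable lborel (\<lambda>r. M * Cf * (w r)\<^sup>2)" using L2_integrable[OF assms] by simp
  have "\<bar>b r * (r\<^sup>2 * F (w r / r))\<bar> \<le> M * Cf * (w r)\<^sup>2" for r
    using le[of r] b(4)[of r] M Cf(1) by (cases "r > 0") auto
  then show ?thesis using M Cf(1) by (intro Bochner_Integration.integrable_bound[OF i]) auto
qed

text \<open>\<open>C\<close> depends on \<open>\<epsilon>\<close> alone, hence uniformity on bounded
  sets. The part of the error without the small factor \<open>\<epsilon>\<close> is quadratic in
  \<open>P\<close>.\<close>

lemma J_expansion:
  assumes "\<epsilon> > 0"
  obtains C where "C \<ge> 0" "\<And>N P w z. admissible N w \<Longrightarrow> admissible P z \<Longrightarrow>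
     \<bar>J (\<lambda>r. w r + z r) - J w - (\<integral>r. b r * (r * f (w r / r)) * z r \<partial>lborel)\<bar>
       \<le> P * (\<epsilon> * (\<beta> + 2 * M * N) + (\<epsilon> + C) * M * P)"
proof -
  obtain C where C: "C \<ge> 0" "\<And>x y. \<bar>f x - f y\<bar> \<le> \<epsilon> * (1 + \<bar>x\<bar> + \<bar>y\<bar>) + C * \<bar>x - y\<bar>"
    using f_modulus[OF assms] by blast
  have "\<bar>J (\<lambda>r. w r + z r) - J w - (\<integral>r. b r * (r * f (w r / r)) * z r \<partial>lborel)\<bar>
       \<le> P * (\<epsilon> * (\<beta> + 2 * M * N) + (\<epsilon> + C) * M * P)"
    if w: "admissible N w" and z: "admissible P z" for N P w z
  proof -
    note wD = admissibleD[OF w] and zD = admissibleD[OF z]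
    have i1: "integrable lborel (\<lambda>r. b r * (r\<^sup>2 * F ((w r + z r) / r)))"
      by (rule J_integrable[OF L2_add[OF wD(2) zD(2)]])
    have i2: "integrable lborel (\<lambda>r. b r * (r\<^sup>2 * F (w r / r)))" by (rule J_integrable[OF wD(2)])
    have i3: "integrable lborel (\<lambda>r. b r * (r * f (w r / r)) * z r)" by (rule L2_mult[OF rf_L2[OF wD(2)] zD(2)])
    define D where "D r = b r * (r\<^sup>2 * F ((w r + z r) / r)) - b r * (r\<^sup>2 * F (w r / r)) - b r * (r * f (w r / r)) * z r" for r
    have Di: "integrable lborel D" unfolding D_def using i1 i2 i3 by auto
    have D_le: "\<bar>D r\<bar> \<le> \<epsilon> * (b r * r * \<bar>z r\<bar>) + (2 * \<epsilon> * M * \<bar>w r * z r\<bar> + (\<epsilon> + C) * M * (z r)\<^sup>2)" for r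
    proof (cases "r > 0")
      case True
      define x y where "x = w r / r" and "y = z r / r"
      have xy: "w r = r * x" "z r = r * y" using True by (auto simp: x_def y_def)
      have "D r = b r * r\<^sup>2 * (F (x + y) - F x - f x * y)"
        using True unfolding D_def xy by (simp add: add_divide_distrib power2_eq_square algebra_simps)
      also have "\<bar>\<dots>\<bar> \<le> b r * r\<^sup>2 * (\<bar>y\<bar> * (\<epsilon> * (1 + 2 * \<bar>x\<bar> + \<bar>y\<bar>) + C * \<bar>y\<bar>))"
        using F_remainder[OF C(2) _ C(1), of x y] assms b(2)[of r]
        by (simp add: abs_mult mult_left_mono)
      also have "\<dots> = \<epsilon> * (b r * r * \<bar>z r\<bar>) + b r * (2 * \<epsilon> * \<bar>w r * z r\<bar> + (\<epsilon> + C) * (z r)\<^sup>2)"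
        unfolding xy using True by (simp add: abs_mult power_mult_distrib power2_eq_square algebra_simps abs_mult_self_eq)
      also have "\<dots> \<le> \<epsilon> * (b r * r * \<bar>z r\<bar>) + M * (2 * \<epsilon> * \<bar>w r * z r\<bar> + (\<epsilon> + C) * (z r)\<^sup>2)"
        using b(3) assms C(1) by (intro add_left_mono mult_right_mono) auto
      finally show ?thesis by (simp add: algebra_simps)
    next
      case False
      then show ?thesis using b(4)[of r] wD(5)[of r] zD(5)[of r] by (simp add: D_def)
    qed
    have iw: "integrable lborel (\<lambda>r. \<bar>w r * z r\<bar>)" by (rule integrable_abs[OF L2_mult[OF wD(2) zD(2)]])
    have "J (\<lambda>r. w r + z r) - J w - (\<integral>r. b r * (r * f (w r / r)) * z r \<partial>lborel) = (\<integral>r. D r \<partial>lborel)"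
      unfolding J_def D_def using i1 i2 i3 by simp
    also have "\<bar>\<dots>\<bar> \<le> (\<integral>r. \<bar>D r\<bar> \<partial>lborel)" by (rule integral_abs_bound)
    also have "\<dots> \<le> (\<integral>r. \<epsilon> * (b r * r * \<bar>z r\<bar>) + (2 * \<epsilon> * M * \<bar>w r * z r\<bar> + (\<epsilon> + C) * M * (z r)\<^sup>2) \<partial>lborel)"
      using Di integral_br_le(1)[OF z] iw L2_integrable[OF zD(2)] D_le
      by (intro integral_mono Bochner_Integration.integrable_add integrable_mult_right) auto
    also have "\<dots> = \<epsilon> * (\<integral>r. b r * r * \<bar>z r\<bar> \<partial>lborel) + (2 * \<epsilon> * M * (\<integral>r. \<bar>w r * z r\<bar> \<partial>lborel) + (\<epsilon> + C) * M * (\<integral>r. (z r)\<^sup>2 \<partial>lborel))"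
      using integral_br_le(1)[OF z] iw L2_integrable[OF zD(2)] by (simp add: Bochner_Integration.integral_add)
    also have "\<dots> \<le> \<epsilon> * (\<beta> * P) + (2 * \<epsilon> * M * (N * P) + (\<epsilon> + C) * M * P\<^sup>2)"
      using assms C(1) M sourceD(6)[OF source_mult[OF w z]] zD(4)
      by (intro add_mono mult_left_mono integral_br_le(2)[OF z]) auto
    also have "\<dots> = P * (\<epsilon> * (\<beta> + 2 * M * N) + (\<epsilon> + C) * M * P)" by (simp add: power2_eq_square algebra_simps)
    finally show ?thesis .
  qed
  with C(1) show ?thesis using that by blast
qed

end

text \<open>The majorant at infinity for potentials and their fields, which decay like
  \<open>1 / r\<close> in the relevant scale.\<close>

lemma L2_inverse_tail: "L2 (\<lambda>r. indicator {1..} r * (1 / r))"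
proof -
  have lim: "((\<lambda>x::real. - (1 / x)) \<longlongrightarrow> 0) at_top" by real_asymp
  have "(\<integral>\<^sup>+x. ennreal (1 / x\<^sup>2) * indicator {1..} x \<partial>lborel) = ennreal (0 - (- (1 / 1)))"
  proof (intro nn_integral_FTC_atLeast[OF _ _ _ lim])
    fix x :: real assume "1 \<le> x"
    then show "((\<lambda>x. - (1 / x)) has_real_derivative 1 / x\<^sup>2) (at x)"
      by (auto intro!: derivative_eq_intros simp: power2_eq_square)
  qed auto
  moreover have "(\<integral>\<^sup>+x. ennreal (norm ((indicator {1..} x * (1 / x :: real))\<^sup>2)) \<partial>lborel)
      = (\<integral>\<^sup>+x. ennreal (1 / x\<^sup>2) * indicator {1..} x \<partial>lborel)"
    by (intro nn_integral_cong) (auto simp: power_divide split: split_indicator)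
  ultimately show ?thesis unfolding L2_def by (intro conjI integrableI_bounded) auto
qed

section \<open>Complete continuity of the nonlinear operator\<close>

context reduced_system
begin

text \<open>Boundedness of \<open>b\<close> deals with \<open>[0, 1]\<close>, and
  \<open>b r \<le> b r * r\<close> with the rest; thus \<open>b\<close> itself can serve as an L2
  majorant.\<close>

lemma b_L2: "L2 b"
proof (rule L2_bound(1)[where C=1])
  show "L2 (\<lambda>r. M * indicator {0..1} r + b r * r)" by (intro L2_add L2_scale L2_indicator b(5))
  fix r show "\<bar>b r\<bar> \<le> 1 * \<bar>M * indicator {0..1} r + b r * r\<bar>"
  proof (cases "r \<le> 0")
    case False
    have "0 \<le> b r * r" using b(2)[of r] False by simp
    moreover have "b r * 1 \<le> b r * r" if "r > 1" using b(2)[of r] that by (intro mult_left_mono) auto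
    ultimately show ?thesis using b(2)[of r] b(3)[of r] False M
      by (cases "r \<le> 1") (auto simp: add_increasing2)
  qed (simp add: b)
qed (rule b)

text \<open>The source of all compactness. The \<open>w n\<close> need not converge in L2, but their
  images under \<open>nl\<close> share the L2 majorant \<open>G\<close>: the weight \<open>b\<close>
  is square integrable and the potential decays like \<open>1 / r\<close>, while \<open>w n\<close>
  itself is only used through its bound \<open>N\<close>.\<close>

lemma nl_convergence:
  assumes w: "\<And>n. admissible N (w n)" and lim: "\<And>r. (\<lambda>n. w n r) \<longlonglongrightarrow> v r"
  shows "(\<lambda>n. \<integral>r. (nl lam (w n) r - nl lam v r)\<^sup>2 \<partial>lborel) \<longlonglongrightarrow> 0"
proof -
  have v: "admissible N v" by (rule admissible_limit[OF w lim])
  \<comment> \<open>The two summands come from \<open>pot_bound\<close> and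
    \<open>pot_bound_inverse\<close>, with the factor \<open>N\<^sup>2\<close> taken out.\<close>
  define \<kappa> where "\<kappa> r = 2 * indicator {0..1} r + indicator {1..} r * (1 / r)" for r :: real
  define G where "G r = \<bar>lam\<bar> * (Cf * N) * b r + 4 * pi * e\<^sup>2 * N ^ 3 * \<kappa> r" for r
  have "L2 \<kappa>" unfolding \<kappa>_def[abs_def] by (intro L2_add L2_scale L2_indicator L2_inverse_tail)
  then have G: "L2 G" unfolding G_def[abs_def] by (intro L2_add L2_scale b_L2)
  have "0 \<le> N" by (rule admissibleD(1)[OF v])
  have le: "\<bar>nl lam z r\<bar> \<le> G r" if z: "admissible N z" for z r
  proof (cases "r > 0")
    case True
    note zD = admissibleD[OF z]
    have "r * \<bar>f (z r / r)\<bar> \<le> r * (Cf * \<bar>z r / r\<bar>)" using True by (intro mult_left_mono Cf(2)) auto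
    also have "\<dots> = Cf * \<bar>z r\<bar>" using True by (simp add: abs_divide)
    also have "\<dots> \<le> Cf * N" by (intro mult_left_mono zD(6) Cf(1))
    finally have "b r * (r * \<bar>f (z r / r)\<bar>) \<le> b r * (Cf * N)" by (intro mult_left_mono b(2))
    then have 1: "\<bar>b r * (r * f (z r / r))\<bar> \<le> Cf * N * b r"
      using True b(2)[of r] by (simp add: abs_mult mult_ac)
    have src: "source (N\<^sup>2) (\<lambda>s. (z s)\<^sup>2)" by (rule source_square[OF z])
    have "\<bar>pot (\<lambda>s. (z s)\<^sup>2) r\<bar> \<le> N\<^sup>2 * \<kappa> r"
    proof (cases "r \<le> 1")
      case True
      have "0 \<le> indicator {1..} r * (1 / r)" using \<open>r > 0\<close> by simp
      then have "2 \<le> \<kappa> r" using True \<open>r > 0\<close> by (simp add: \<kappa>_def)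
      then have "N\<^sup>2 * 2 \<le> N\<^sup>2 * \<kappa> r" by (intro mult_left_mono) auto
      then show ?thesis using pot_bound[OF src, of r] by simp
    next
      case False
      then show ?thesis using pot_bound_inverse[OF src, of r] by (simp add: \<kappa>_def)
    qed
    then have "\<bar>pot (\<lambda>s. (z s)\<^sup>2) r * z r\<bar> \<le> N\<^sup>2 * \<kappa> r * N"
      unfolding abs_mult by (intro mult_mono zD(6)) (auto intro: order_trans[OF abs_ge_zero])
    then have 2: "\<bar>pot (\<lambda>s. (z s)\<^sup>2) r * z r\<bar> \<le> N ^ 3 * \<kappa> r" by (simp add: power2_eq_square power3_eq_cube mult_ac)
    have "\<bar>nl lam z r\<bar> \<le> \<bar>lam\<bar> * \<bar>b r * (r * f (z r / r))\<bar> + 4 * pi * e\<^sup>2 * \<bar>pot (\<lambda>s. (z s)\<^sup>2) r * z r\<bar>"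
      unfolding nl_def by (rule order_trans[OF abs_triangle_ineq4]) (simp add: abs_mult)
    also have "\<dots> \<le> \<bar>lam\<bar> * (Cf * N * b r) + 4 * pi * e\<^sup>2 * (N ^ 3 * \<kappa> r)"
      by (intro add_mono mult_left_mono 1 2) auto
    finally show ?thesis by (simp add: G_def mult_ac)
  next
    case False
    then have "nl lam z r = 0" using b(4)[of r] admissibleD(5)[OF z, of r] by (simp add: nl_def)
    moreover have "0 \<le> G r"
      using False b(4)[of r] \<open>0 \<le> N\<close> by (auto simp: G_def \<kappa>_def split: split_indicator)
    ultimately show ?thesis by simp
  qed
  have "(\<lambda>n. \<integral>r. (nl lam (w n) r - nl lam v r)\<^sup>2 \<partial>lborel) \<longlonglongrightarrow> integral\<^sup>L lborel (\<lambda>r::real. 0 :: real)"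
  proof (rule integral_dominated_convergence)
    show "integrable lborel (\<lambda>r. 4 * (G r)\<^sup>2)" using L2_integrable[OF G] by simp
    show "(\<lambda>r. (nl lam (w n) r - nl lam v r)\<^sup>2) \<in> borel_measurable lborel" for n
      using L2_measurable[OF nl_L2[OF w]] L2_measurable[OF nl_L2[OF v]] by measurable
    have "\<bar>nl lam (w n) r - nl lam v r\<bar> \<le> 2 * G r" for n r
      using le[OF w, of n r] le[OF v, of r] by linarith
    then have "\<bar>nl lam (w n) r - nl lam v r\<bar>\<^sup>2 \<le> (2 * G r)\<^sup>2" for n r by (intro power_mono) auto
    then show "AE r in lborel. norm ((nl lam (w n) r - nl lam v r)\<^sup>2) \<le> 4 * (G r)\<^sup>2" for n
      by (simp add: power_mult_distrib)
    have "(\<lambda>n. (nl lam (w n) r - nl lam v r)\<^sup>2) \<longlonglongrightarrow> 0" for r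
    proof (cases "r > 0")
      case True
      have "(\<lambda>n. f (w n r / r)) \<longlonglongrightarrow> f (v r / r)"
        using f_cont True lim[of r]
        by (intro isCont_tendsto_compose[of _ f] tendsto_intros) (auto simp: continuous_on_eq_continuous_at)
      then have "(\<lambda>n. nl lam (w n) r) \<longlonglongrightarrow> nl lam v r"
        unfolding nl_def by (intro tendsto_intros pot_convergence[OF w lim True] lim)
      then have "(\<lambda>n. (nl lam (w n) r - nl lam v r)\<^sup>2) \<longlonglongrightarrow> (nl lam v r - nl lam v r)\<^sup>2"
        by (intro tendsto_intros)
      then show ?thesis by simp
    next
      case False
      then have "nl lam z r = 0" if "admissible N z" for z
        using b(4)[of r] admissibleD(5)[OF that, of r] by (simp add: nl_def)
      then show ?thesis using w v by simp
    qed
    then show "AE r in lborel. (\<lambda>n. (nl lam (w n) r - nl lam v r)\<^sup>2) \<longlonglongrightarrow> 0" by simp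
  qed auto
  then show ?thesis by simp
qed

text \<open>Defined on functions rather than profiles, because it must also be applied to pointwise
  limits. For admissible \<open>w\<close> the argument of \<open>Abs_profile\<close> really is a
  profile.\<close>

definition T :: "real \<Rightarrow> (real \<Rightarrow> real) \<Rightarrow> profile" where
  "T lam w = Abs_profile (W_adj (nl lam w))"

lemma prof_T: assumes "admissible N w" shows "prof (T lam w) = W_adj (nl lam w)"
  unfolding T_def using nl_L2[OF assms]
  by (subst Abs_profile_inverse) (auto intro: W_adj_L2 W_adj_continuous W_adj_nonpos)

lemma T_diff_le:
  assumes "admissible N w" "admissible N v"
  shows "(norm (T lam w - T lam v))\<^sup>2 \<le> (\<integral>r. (nl lam w r - nl lam v r)\<^sup>2 \<partial>lborel)"
proof -
  note L = nl_L2[OF assms(1), of lam] nl_L2[OF assms(2), of lam]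
  have "(norm (T lam w - T lam v))\<^sup>2 = (\<integral>r. (W_adj (\<lambda>r. nl lam w r - nl lam v r) r)\<^sup>2 \<partial>lborel)"
    unfolding norm_profile_square minus_profile.rep_eq prof_T[OF assms(1)] prof_T[OF assms(2)]
    using W_adj_diff[OF L] by simp
  also have "\<dots> \<le> (\<integral>r. (nl lam w r - nl lam v r)\<^sup>2 \<partial>lborel)"
    by (rule W_adj_L2_le[OF L2_diff[OF L]])
  finally show ?thesis .
qed

lemma T_convergence:
  assumes w: "\<And>n. admissible N (w n)" and lim: "\<And>r. (\<lambda>n. w n r) \<longlonglongrightarrow> v r"
  shows "(\<lambda>n. T lam (w n)) \<longlonglongrightarrow> T lam v"
proof -
  have "(\<lambda>n. (norm (T lam (w n) - T lam v))\<^sup>2) \<longlonglongrightarrow> 0"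
    by (rule Lim_null_comparison[OF _ nl_convergence[OF w lim, of lam]])
      (use T_diff_le[OF w admissible_limit[OF w lim]] in simp)
  from tendsto_real_sqrt[OF this] have "(\<lambda>n. norm (T lam (w n) - T lam v)) \<longlonglongrightarrow> 0" by simp
  then show ?thesis by (simp add: tendsto_norm_zero_iff LIM_zero_iff)
qed

text \<open>Adjointness exhibits \<open>T lam w\<close> as the Riesz representative of integration
  against \<open>nl\<close>, which an incomplete space would not supply by itself.\<close>

lemma inner_T: assumes "admissible N w" shows "T lam w \<bullet> p = (\<integral>r. nl lam w r * W (prof p) r \<partial>lborel)"
proof -
  have "T lam w \<bullet> p = (\<integral>r. prof p r * W_adj (nl lam w) r \<partial>lborel)"
    by (simp add: inner_profile_def prof_T[OF assms] mult.commute)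
  also have "\<dots> = (\<integral>r. W (prof p) r * nl lam w r \<partial>lborel)"
    by (rule W_adjoint[OF prof(1) nl_L2[OF assms], symmetric])
  finally show ?thesis by (simp add: mult.commute)
qed

text \<open>The action of the system with the potential eliminated, divided by
  \<open>4 * pi\<close>. The coefficient \<open>pi * e\<^sup>2\<close> is a quarter of the one in
  \<open>nl\<close> because its term is quartic.\<close>

definition energy :: "real \<Rightarrow> profile \<Rightarrow> real" where
  "energy lam q = (norm q)\<^sup>2 / 2
     + pi * e\<^sup>2 * (\<integral>r. pot (\<lambda>s. (W (prof q) s)\<^sup>2) r * (W (prof q) r)\<^sup>2 \<partial>lborel) - lam * J (W (prof q))"

definition grad :: "real \<Rightarrow> profile \<Rightarrow> profile" where
  "grad lam q = q - T lam (W (prof q))"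

section \<open>Differentiability of the energy and the Palais-Smale condition\<close>

lemma W_plus: "W (prof (p + q)) = (\<lambda>r. W (prof p) r + W (prof q) r)"
  by (auto simp: plus_profile.rep_eq W_add[OF prof(1) prof(1)])

lemma W_minus: "W (prof (p - q)) r = W (prof p) r - W (prof q) r"
  by (auto simp: minus_profile.rep_eq W_diff[OF prof(1) prof(1)])

lemma energy_differentiable:
  assumes "\<epsilon> > 0"
  shows "\<exists>\<delta>>0. \<forall>q p. norm q \<le> R \<longrightarrow> norm p \<le> \<delta> \<longrightarrow>
            \<bar>energy lam (q + p) - energy lam q - grad lam q \<bullet> p\<bar> \<le> \<epsilon> * norm p"
proof -
  define R' where "R' = \<bar>R\<bar>"
  define A where "A = \<beta> + 2 * M * R'"
  have A: "A \<ge> 0" using \<beta>_nonneg M by (simp add: A_def R'_def)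
  \<comment> \<open>Makes \<open>\<bar>lam\<bar> * \<epsilon>' * A \<le> \<epsilon> / 2\<close>; the
    summand 1 covers \<open>\<bar>lam\<bar> * A = 0\<close>.\<close>
  define \<epsilon>' where "\<epsilon>' = \<epsilon> / (2 * (\<bar>lam\<bar> * A + 1))"
  have pos: "2 * (\<bar>lam\<bar> * A + 1) > 0" using A by (simp add: add_nonneg_pos)
  have \<epsilon>': "\<epsilon>' > 0" unfolding \<epsilon>'_def using pos assms by simp
  obtain C where C: "C \<ge> 0" "\<And>N P w z. admissible N w \<Longrightarrow> admissible P z \<Longrightarrow>
     \<bar>J (\<lambda>r. w r + z r) - J w - (\<integral>r. b r * (r * f (w r / r)) * z r \<partial>lborel)\<bar>
       \<le> P * (\<epsilon>' * (\<beta> + 2 * M * N) + (\<epsilon>' + C) * M * P)" using J_expansion[OF \<epsilon>'] by blast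
  \<comment> \<open>Collects the coefficients of \<open>P\<^sup>2\<close>: the norm, the quartic
    term and the non-small part of \<open>J_expansion\<close>. The bound \<open>P \<le> 1\<close>
    turns \<open>2 * R' + P\<close> into \<open>2 * R' + 1\<close>.\<close>
  define K where "K = 1/2 + pi * e\<^sup>2 * (4 * R'\<^sup>2 + 2 * (2 * R' + 1)\<^sup>2) + \<bar>lam\<bar> * ((\<epsilon>' + C) * M)"
  have K: "K > 0" unfolding K_def using \<epsilon>' C(1) M by (intro add_pos_nonneg) auto
  define \<delta> where "\<delta> = min 1 (\<epsilon> / (2 * K))"
  have \<delta>: "\<delta> > 0" "\<delta> \<le> 1" "K * \<delta> \<le> \<epsilon> / 2" using K assms by (auto simp: \<delta>_def min_def field_simps)
  have "\<bar>energy lam (q + p) - energy lam q - grad lam q \<bullet> p\<bar> \<le> \<epsilon> * norm p"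
    if q: "norm q \<le> R" and p: "norm p \<le> \<delta>" for q p
  proof -
    define w z P where "w = W (prof q)" and "z = W (prof p)" and "P = norm p"
    have w: "admissible R' w" unfolding w_def by (rule admissible_mono[OF admissible_W]) (use q in \<open>simp add: R'_def\<close>)
    have z: "admissible P z" unfolding z_def P_def by (rule admissible_W)
    have P: "0 \<le> P" "P \<le> 1" "P \<le> \<delta>" using p \<delta> by (auto simp: P_def)
    have R': "0 \<le> R'" by (simp add: R'_def)
    have i1: "integrable lborel (\<lambda>r. b r * (r * f (w r / r)) * z r)"
      by (rule L2_mult[OF rf_L2[OF admissibleD(2)[OF w]] admissibleD(2)[OF z]])
    have i2: "integrable lborel (\<lambda>r. pot (\<lambda>s. (w s)\<^sup>2) r * w r * z r)"
      by (rule L2_mult[OF pot_w_L2(1)[OF w] admissibleD(2)[OF z]])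
    have "T lam w \<bullet> p = (\<integral>r. lam * (b r * (r * f (w r / r)) * z r) - 4 * pi * e\<^sup>2 * (pot (\<lambda>s. (w s)\<^sup>2) r * w r * z r) \<partial>lborel)"
      unfolding inner_T[OF w] z_def nl_def by (simp add: algebra_simps)
    also have "\<dots> = lam * (\<integral>r. b r * (r * f (w r / r)) * z r \<partial>lborel) - 4 * pi * e\<^sup>2 * (\<integral>r. pot (\<lambda>s. (w s)\<^sup>2) r * w r * z r \<partial>lborel)"
      using i1 i2 by simp
    finally have T: "T lam w \<bullet> p = \<dots>" .
    define Q where "Q = (\<integral>r. pot (\<lambda>s. (w s + z s)\<^sup>2) r * (w r + z r)\<^sup>2 \<partial>lborel) - (\<integral>r. pot (\<lambda>s. (w s)\<^sup>2) r * (w r)\<^sup>2 \<partial>lborel)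
           - 4 * (\<integral>r. pot (\<lambda>s. (w s)\<^sup>2) r * w r * z r \<partial>lborel)"
    define Y where "Y = J (\<lambda>r. w r + z r) - J w - (\<integral>r. b r * (r * f (w r / r)) * z r \<partial>lborel)"
    have "(norm (q + p))\<^sup>2 = (norm q)\<^sup>2 + 2 * (q \<bullet> p) + P\<^sup>2"
      by (simp add: P_def power2_norm_eq_inner inner_add_left inner_add_right inner_commute)
    then have eq: "energy lam (q + p) - energy lam q - grad lam q \<bullet> p = P\<^sup>2 / 2 + pi * e\<^sup>2 * Q - lam * Y"
      unfolding energy_def grad_def inner_diff_left w_def[symmetric] T W_plus z_def[symmetric] Q_def Y_def
      by (simp add: algebra_simps)
    have "\<bar>Q\<bar> \<le> 4 * R'\<^sup>2 * P\<^sup>2 + 2 * (P * (2 * R' + P))\<^sup>2"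
      unfolding Q_def by (rule quartic_expansion[OF w z])
    also have "\<dots> \<le> 4 * R'\<^sup>2 * P\<^sup>2 + 2 * (P * (2 * R' + 1))\<^sup>2"
      using P R' by (intro add_left_mono mult_left_mono power_mono) auto
    also have "\<dots> = P * P * (4 * R'\<^sup>2 + 2 * (2 * R' + 1)\<^sup>2)" by (simp add: power_mult_distrib power2_eq_square algebra_simps)
    finally have "pi * e\<^sup>2 * \<bar>Q\<bar> \<le> pi * e\<^sup>2 * (P * P * (4 * R'\<^sup>2 + 2 * (2 * R' + 1)\<^sup>2))"
      by (intro mult_left_mono) auto
    moreover have "\<bar>lam\<bar> * \<bar>Y\<bar> \<le> \<bar>lam\<bar> * (P * (\<epsilon>' * A + (\<epsilon>' + C) * M * P))"
      unfolding A_def Y_def by (intro mult_left_mono C(2)[OF w z]) auto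
    moreover have "\<bar>P\<^sup>2 / 2 + pi * e\<^sup>2 * Q - lam * Y\<bar> \<le> P\<^sup>2 / 2 + pi * e\<^sup>2 * \<bar>Q\<bar> + \<bar>lam\<bar> * \<bar>Y\<bar>"
    proof -
      have "\<bar>P\<^sup>2 / 2\<bar> = P\<^sup>2 / 2" "\<bar>pi * e\<^sup>2 * Q\<bar> = pi * e\<^sup>2 * \<bar>Q\<bar>" "\<bar>lam * Y\<bar> = \<bar>lam\<bar> * \<bar>Y\<bar>"
        by (simp_all add: abs_mult)
      then show ?thesis by linarith
    qed
    ultimately have "\<bar>P\<^sup>2 / 2 + pi * e\<^sup>2 * Q - lam * Y\<bar> \<le> P * (K * P + \<bar>lam\<bar> * (\<epsilon>' * A))"
      unfolding K_def by (simp add: power2_eq_square algebra_simps)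
    also have "\<dots> \<le> P * (\<epsilon> / 2 + \<epsilon> / 2)"
    proof (intro mult_left_mono add_mono P)
      show "K * P \<le> \<epsilon> / 2" using mult_left_mono[OF P(3), of K] K \<delta>(3) by linarith
      have "\<epsilon>' * (2 * (\<bar>lam\<bar> * A + 1)) = \<epsilon>" using pos by (simp add: \<epsilon>'_def)
      then show "\<bar>lam\<bar> * (\<epsilon>' * A) \<le> \<epsilon> / 2" using \<epsilon>' by (simp add: algebra_simps)
    qed
    finally show ?thesis unfolding eq by (simp add: P_def mult.commute)
  qed
  with \<delta>(1) show ?thesis by blast
qed

lemma grad_bounded: "\<exists>B. \<forall>q. norm q \<le> R \<longrightarrow> norm (grad lam q) \<le> B"
proof -
  define R' where "R' = \<bar>R\<bar>"
  define K where "K = \<bar>lam\<bar> * M * Cf + 8 * pi * e\<^sup>2 * R'\<^sup>2"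
  have "norm (grad lam q) \<le> R' + K * R'" if q: "norm q \<le> R" for q
  proof -
    have w: "admissible R' (W (prof q))" by (rule admissible_mono[OF admissible_W]) (use q in \<open>simp add: R'_def\<close>)
    have "K \<ge> 0" using M Cf(1) by (simp add: K_def)
    have "(norm (T lam (W (prof q))))\<^sup>2 \<le> (\<integral>r. (nl lam (W (prof q)) r)\<^sup>2 \<partial>lborel)"
      unfolding norm_profile_square prof_T[OF w] by (rule W_adj_L2_le[OF nl_L2[OF w]])
    also have "\<dots> \<le> K\<^sup>2 * (\<integral>r. (W (prof q) r)\<^sup>2 \<partial>lborel)"
      unfolding K_def by (rule L2_bound(2)[OF admissibleD(2)[OF w] L2_measurable[OF nl_L2[OF w]] nl_le[OF w]])
    also have "\<dots> \<le> K\<^sup>2 * R'\<^sup>2" by (intro mult_left_mono admissibleD(4)[OF w]) auto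
    also have "\<dots> = (K * R')\<^sup>2" by (simp add: power_mult_distrib)
    finally have "norm (T lam (W (prof q))) \<le> K * R'"
      by (rule power2_le_imp_le) (use \<open>K \<ge> 0\<close> in \<open>simp add: R'_def\<close>)
    moreover have "norm q \<le> R'" using q by (simp add: R'_def)
    ultimately show ?thesis unfolding grad_def using norm_triangle_ineq4[of q "T lam (W (prof q))"] by linarith
  qed
  then show ?thesis by blast
qed

text \<open>Norm convergence of profiles forces pointwise convergence of their \<open>W\<close>, and
  \<open>T_convergence\<close> asks for nothing more.\<close>

lemma grad_continuous: "continuous_on UNIV (grad lam)"
  unfolding continuous_on_sequentially
proof (intro ballI allI impI, elim conjE)
  fix q :: profile and X :: "nat \<Rightarrow> profile"
  assume X: "X \<longlonglongrightarrow> q"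
  obtain N where N: "\<And>n. norm (X n) \<le> N"
    using convergent_imp_bounded[OF X] unfolding bounded_iff by auto
  have a: "admissible N (W (prof (X n)))" for n by (rule admissible_mono[OF admissible_W N])
  have "(\<lambda>n. norm (X n - q)) \<longlonglongrightarrow> 0" using X by (simp add: LIM_zero_iff tendsto_norm_zero)
  then have "(\<lambda>n. W (prof (X n)) r - W (prof q) r) \<longlonglongrightarrow> 0" for r
    by (rule Lim_null_comparison[rotated])
      (use W_bound[OF prof(1)] in \<open>auto simp: W_minus[symmetric] norm_profile_eq\<close>)
  then have "(\<lambda>n. W (prof (X n)) r) \<longlonglongrightarrow> W (prof q) r" for r by (simp add: LIM_zero_iff)
  from T_convergence[OF a this, of lam]
  show "(grad lam \<circ> X) \<longlonglongrightarrow> grad lam q" unfolding grad_def o_def by (intro tendsto_intros X)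
qed

lemma energy_continuous: "continuous_on UNIV (energy lam)"
  unfolding continuous_on_eq_continuous_at[OF open_UNIV]
proof
  fix q :: profile
  obtain \<delta> where \<delta>: "\<delta> > 0" "\<And>p. norm p \<le> \<delta> \<Longrightarrow> \<bar>energy lam (q + p) - energy lam q - grad lam q \<bullet> p\<bar> \<le> 1 * norm p"
    using energy_differentiable[of 1 "norm q" lam] by auto
  have "((\<lambda>p. energy lam (q + p) - energy lam q) \<longlongrightarrow> 0) (at 0)"
  proof (rule Lim_null_comparison)
    show "\<forall>\<^sub>F p in at 0. norm (energy lam (q + p) - energy lam q) \<le> (norm (grad lam q) + 1) * norm p"
      unfolding eventually_at
    proof (intro exI[of _ \<delta>] conjI \<delta>(1) ballI impI, elim conjE)
      fix p :: profile assume "dist p 0 < \<delta>"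
      then have "\<bar>energy lam (q + p) - energy lam q - grad lam q \<bullet> p\<bar> \<le> norm p" using \<delta>(2)[of p] by simp
      moreover have "\<bar>grad lam q \<bullet> p\<bar> \<le> norm (grad lam q) * norm p" by (rule Cauchy_Schwarz_ineq2)
      ultimately show "norm (energy lam (q + p) - energy lam q) \<le> (norm (grad lam q) + 1) * norm p"
        by (simp add: distrib_right)
    qed
    have "((\<lambda>p::profile. (norm (grad lam q) + 1) * norm p) \<longlongrightarrow> (norm (grad lam q) + 1) * norm (0::profile)) (at 0)"
      by (rule tendsto_mult_left[OF tendsto_norm[OF tendsto_ident_at]])
    then show "((\<lambda>p. (norm (grad lam q) + 1) * norm p) \<longlongrightarrow> 0) (at (0::profile))" by simp
  qed
  then have "((\<lambda>p. energy lam (q + p)) \<longlongrightarrow> energy lam q) (at 0)" by (simp add: LIM_zero_iff)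
  then show "isCont (energy lam) q" unfolding isCont_def by (rule LIM_offset_zero_cancel)
qed

text \<open>Along a subsequence the \<open>W (prof (X n))\<close> converge pointwise to some
  \<open>w\<close>, hence their images under \<open>T\<close> converge in norm. Adding the
  gradients, which tend to 0, gives \<open>X n\<close> itself; its limit \<open>T lam w\<close> is a
  profile even if \<open>w\<close> does not come from one.\<close>

lemma palais_smale:
  assumes X: "\<And>n. norm (X n) \<le> R" and D: "(\<lambda>n. grad lam (X n)) \<longlonglongrightarrow> 0"
  shows "\<exists>r x. strict_mono (r :: nat \<Rightarrow> nat) \<and> (X \<circ> r) \<longlonglongrightarrow> x"
proof -
  have R: "0 \<le> R" using X[of 0] norm_ge_zero order_trans by blast
  have "(\<integral>x. (prof (X n) x)\<^sup>2 \<partial>lborel) \<le> R\<^sup>2" for n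
    using power_mono[OF X[of n], of 2] by (simp add: norm_profile_square)
  from W_subsequence[of "\<lambda>n. prof (X n)", OF prof(1) this R]
  obtain k w where k: "strict_mono (k :: nat \<Rightarrow> nat)" "\<And>r. (\<lambda>n. W (prof (X (k n))) r) \<longlonglongrightarrow> w r" by blast
  have a: "admissible R (W (prof (X (k n))))" for n by (rule admissible_mono[OF admissible_W X])
  have "(\<lambda>n. grad lam (X (k n)) + T lam (W (prof (X (k n))))) \<longlonglongrightarrow> 0 + T lam w"
    using LIMSEQ_subseq_LIMSEQ[OF D k(1)] by (intro tendsto_add T_convergence[OF a k(2)]) (simp add: o_def)
  then have "(X \<circ> k) \<longlonglongrightarrow> T lam w" by (simp add: grad_def o_def)
  then show ?thesis using k(1) by blast
qed

section \<open>Coercivity, the local minimum at 0, and bounds for critical points\<close>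

lemma J_abs_le:
  assumes w: "admissible N w" and "\<epsilon> \<ge> 0" "C \<ge> 0" and f: "\<And>s. \<bar>f s\<bar> \<le> \<epsilon> * \<bar>s\<bar> + C"
  shows "\<bar>J w\<bar> \<le> M * \<epsilon> * N\<^sup>2 + C * (\<beta> * N)"
proof -
  note wD = admissibleD[OF w]
  have "\<bar>F s\<bar> \<le> \<bar>s\<bar> * (\<epsilon> * \<bar>s\<bar> + C)" for s
    using F_bound[of "\<lambda>s. \<epsilon> * s + C"] f \<open>\<epsilon> \<ge> 0\<close> by (auto intro: mult_left_mono)
  note le = J_le[of \<epsilon> "\<lambda>_. C", OF this \<open>\<epsilon> \<ge> 0\<close>, where w=w]
  have "\<bar>J w\<bar> \<le> (\<integral>r. \<bar>b r * (r\<^sup>2 * F (w r / r))\<bar> \<partial>lborel)" unfolding J_def by (rule integral_abs_bound)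
  also have "\<dots> \<le> (\<integral>r. M * \<epsilon> * (w r)\<^sup>2 + C * (b r * r * \<bar>w r\<bar>) \<partial>lborel)"
  proof (rule integral_mono)
    show "integrable lborel (\<lambda>r. \<bar>b r * (r\<^sup>2 * F (w r / r))\<bar>)" by (rule integrable_abs[OF J_integrable[OF wD(2)]])
    show "integrable lborel (\<lambda>r. M * \<epsilon> * (w r)\<^sup>2 + C * (b r * r * \<bar>w r\<bar>))"
      using L2_integrable[OF wD(2)] integral_br_le(1)[OF w] by (intro Bochner_Integration.integrable_add integrable_mult_right) auto
    show "\<bar>b r * (r\<^sup>2 * F (w r / r))\<bar> \<le> M * \<epsilon> * (w r)\<^sup>2 + C * (b r * r * \<bar>w r\<bar>)" for r
      using le[of r] b(4)[of r] M \<open>\<epsilon> \<ge> 0\<close> by (cases "r > 0") (auto simp: mult_ac)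
  qed
  also have "\<dots> = M * \<epsilon> * (\<integral>r. (w r)\<^sup>2 \<partial>lborel) + C * (\<integral>r. b r * r * \<bar>w r\<bar> \<partial>lborel)"
    using L2_integrable[OF wD(2)] integral_br_le(1)[OF w] by (simp add: Bochner_Integration.integral_add)
  also have "\<dots> \<le> M * \<epsilon> * N\<^sup>2 + C * (\<beta> * N)"
    using M \<open>\<epsilon> \<ge> 0\<close> \<open>C \<ge> 0\<close> by (intro add_mono mult_left_mono wD(4) integral_br_le(2)[OF w]) auto
  finally show ?thesis .
qed

text \<open>The term \<open>\<bar>w r\<bar> ^ 3 / r\<close> is tamed on \<open>(0, 1]\<close> by
  \<open>\<bar>w r\<bar> \<le> sqrt r * N\<close> and beyond 1 by
  \<open>\<bar>w r\<bar> \<le> N\<close>. Either range contributes \<open>N ^ 3\<close>, hence the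
  factor 2.\<close>

lemma J_abs_le_cubic:
  assumes w: "admissible N w" and "\<epsilon> \<ge> 0" "C \<ge> 0" and f: "\<And>s. \<bar>f s\<bar> \<le> \<epsilon> * \<bar>s\<bar> + C * s\<^sup>2"
  shows "\<bar>J w\<bar> \<le> M * \<epsilon> * N\<^sup>2 + 2 * M * C * N ^ 3"
proof -
  note wD = admissibleD[OF w]
  have "\<bar>F s\<bar> \<le> \<bar>s\<bar> * (\<epsilon> * \<bar>s\<bar> + C * \<bar>s\<bar>\<^sup>2)" for s
    using F_bound[of "\<lambda>s. \<epsilon> * s + C * s\<^sup>2"] f \<open>\<epsilon> \<ge> 0\<close> \<open>C \<ge> 0\<close>
    by (auto intro!: add_mono mult_left_mono power_mono)
  note le = J_le[of \<epsilon> "\<lambda>s. C * s\<^sup>2", OF this \<open>\<epsilon> \<ge> 0\<close>, where w=w]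
  have le2: "\<bar>b r * (r\<^sup>2 * F (w r / r))\<bar> \<le> M * \<epsilon> * (w r)\<^sup>2 + M * C * (N ^ 3 * indicator {0..1} r + N * (w r)\<^sup>2)" for r
  proof (cases "r > 0")
    case True
    have "b r * r * (\<bar>w r\<bar> * (C * (\<bar>w r\<bar> / r)\<^sup>2)) = b r * (C * (\<bar>w r\<bar> * (w r)\<^sup>2 / r))"
      using True by (simp add: power_divide power2_eq_square)
    also have "\<dots> \<le> M * (C * (N ^ 3 * indicator {0..1} r + N * (w r)\<^sup>2))"
    proof (intro mult_mono mult_left_mono b(3))
      show "\<bar>w r\<bar> * (w r)\<^sup>2 / r \<le> N ^ 3 * indicator {0..1} r + N * (w r)\<^sup>2"
      proof (cases "r \<le> 1")
        case r1: True
        have "\<bar>w r\<bar>\<^sup>2 \<le> (sqrt r * N)\<^sup>2" using wD(7)[of r] True by (intro power_mono) auto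
        then have "(w r)\<^sup>2 / r \<le> N\<^sup>2" using True by (simp add: power_mult_distrib divide_le_eq mult.commute)
        then have "\<bar>w r\<bar> * ((w r)\<^sup>2 / r) \<le> N * N\<^sup>2" using True wD(1,6) by (intro mult_mono) auto
        moreover have "0 \<le> N * (w r)\<^sup>2" using wD(1) by simp
        ultimately show ?thesis using r1 True by (simp add: power3_eq_cube power2_eq_square mult.assoc)
      next
        case False
        have "\<bar>w r\<bar> * (w r)\<^sup>2 / r \<le> N * (w r)\<^sup>2 / 1"
          using False wD(1,6) by (intro frac_le mult_right_mono) auto
        then show ?thesis using False by simp
      qed
    qed (use True M wD(1) b(2)[of r] \<open>C \<ge> 0\<close> in auto)
    finally show ?thesis using le[OF True] by (simp add: mult.assoc)
  next
    case False
    then show ?thesis using b(4)[of r] M \<open>\<epsilon> \<ge> 0\<close> \<open>C \<ge> 0\<close> wD(1) by (simp add: add_nonneg_nonneg)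
  qed
  have "\<bar>J w\<bar> \<le> (\<integral>r. \<bar>b r * (r\<^sup>2 * F (w r / r))\<bar> \<partial>lborel)" unfolding J_def by (rule integral_abs_bound)
  also have "\<dots> \<le> (\<integral>r. M * \<epsilon> * (w r)\<^sup>2 + M * C * (N ^ 3 * indicator {0..1} r + N * (w r)\<^sup>2) \<partial>lborel)"
    by (intro integral_mono le2 integrable_abs[OF J_integrable[OF wD(2)]])
      (use L2_integrable[OF wD(2)] in simp)
  also have "\<dots> = M * \<epsilon> * (\<integral>r. (w r)\<^sup>2 \<partial>lborel) + M * C * (N ^ 3 + N * (\<integral>r. (w r)\<^sup>2 \<partial>lborel))"
    using L2_integrable[OF wD(2)] by simp
  also have "\<dots> \<le> M * \<epsilon> * N\<^sup>2 + M * C * (N ^ 3 + N * N\<^sup>2)"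
    using M \<open>\<epsilon> \<ge> 0\<close> \<open>C \<ge> 0\<close> wD(1) by (intro add_mono mult_left_mono wD(4)) auto
  also have "\<dots> = M * \<epsilon> * N\<^sup>2 + 2 * M * C * N ^ 3" by (simp add: power3_eq_cube power2_eq_square algebra_simps)
  finally show ?thesis .
qed

lemma energy_ge:
  assumes "lam \<ge> 0" shows "(norm q)\<^sup>2 / 2 - lam * \<bar>J (W (prof q))\<bar> \<le> energy lam q"
proof -
  have "0 \<le> pi * e\<^sup>2 * (\<integral>r. pot (\<lambda>s. (W (prof q) s)\<^sup>2) r * (W (prof q) r)\<^sup>2 \<partial>lborel)"
    by (intro mult_nonneg_nonneg Bochner_Integration.integral_nonneg pot_nonneg) (auto simp: W_nonpos)
  moreover have "lam * J (W (prof q)) \<le> lam * \<bar>J (W (prof q))\<bar>" using assms by (intro mult_left_mono) auto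
  ultimately show ?thesis unfolding energy_def by linarith
qed

lemma energy_coercive:
  assumes "lam \<ge> 0" obtains K where "K \<ge> 0" "\<And>q. (norm q)\<^sup>2 / 4 - K * norm q \<le> energy lam q"
proof -
  \<comment> \<open>Then \<open>lam * M * \<epsilon> \<le> 1 / 4\<close>, so half of the quadratic
    term \<open>(norm q)\<^sup>2 / 2\<close> survives.\<close>
  define \<epsilon> where "\<epsilon> = 1 / (4 * (lam * M + 1))"
  have "lam * M \<ge> 0" using assms M by simp
  then have \<epsilon>: "\<epsilon> > 0" "lam * M * \<epsilon> \<le> 1 / 4" by (auto simp: \<epsilon>_def divide_simps)
  obtain C where C: "C \<ge> 0" "\<And>s. \<bar>f s\<bar> \<le> \<epsilon> * \<bar>s\<bar> + C" using f_affine_bound[OF \<epsilon>(1)] by blast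
  have "(norm q)\<^sup>2 / 4 - lam * C * \<beta> * norm q \<le> energy lam q" for q
  proof -
    have "lam * \<bar>J (W (prof q))\<bar> \<le> lam * (M * \<epsilon> * (norm q)\<^sup>2 + C * (\<beta> * norm q))"
      using \<epsilon> C by (intro mult_left_mono J_abs_le[OF admissible_W] assms) auto
    also have "\<dots> = lam * M * \<epsilon> * (norm q)\<^sup>2 + lam * C * \<beta> * norm q" by (simp add: algebra_simps)
    also have "\<dots> \<le> 1 / 4 * (norm q)\<^sup>2 + lam * C * \<beta> * norm q"
      using \<epsilon> by (intro add_right_mono mult_right_mono) auto
    finally show ?thesis using energy_ge[OF assms, of q] by simp
  qed
  moreover have "0 \<le> lam * C * \<beta>" using assms C \<beta>_nonneg by simp
  ultimately show ?thesis using that by blast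
qed

lemma energy_near_0:
  assumes "lam \<ge> 0"
  obtains \<rho> \<eta> where "\<rho> > 0" "\<eta> > 0" "\<And>q. norm q \<le> \<rho> \<Longrightarrow> 0 \<le> energy lam q" "\<And>q. norm q = \<rho> \<Longrightarrow> \<eta> \<le> energy lam q"
proof -
  define \<epsilon> where "\<epsilon> = 1 / (4 * (lam * M + 1))"
  have "lam * M \<ge> 0" using assms M by simp
  then have \<epsilon>: "\<epsilon> > 0" "lam * M * \<epsilon> \<le> 1 / 4" by (auto simp: \<epsilon>_def divide_simps)
  obtain C where C: "C \<ge> 0" "\<And>s. \<bar>f s\<bar> \<le> \<epsilon> * \<bar>s\<bar> + C * s\<^sup>2" using f_quadratic_bound[OF \<epsilon>(1)] by blast
  define K where "K = 2 * lam * M * C"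
  have K: "K \<ge> 0" using assms M C by (simp add: K_def)
  \<comment> \<open>Of the coefficient 1/2 of the quadratic term, \<open>\<epsilon>\<close> uses up
    1/4 and \<open>\<rho>\<close> another 1/8, so 1/8 remains.\<close>
  define \<rho> where "\<rho> = 1 / (8 * (K + 1))"
  have \<rho>: "\<rho> > 0" "K * \<rho> \<le> 1 / 8" using K by (auto simp: \<rho>_def divide_simps)
  have le: "(norm q)\<^sup>2 / 8 \<le> energy lam q" if "norm q \<le> \<rho>" for q
  proof -
    have "lam * \<bar>J (W (prof q))\<bar> \<le> lam * (M * \<epsilon> * (norm q)\<^sup>2 + 2 * M * C * norm q ^ 3)"
      using \<epsilon> C by (intro mult_left_mono J_abs_le_cubic[OF admissible_W] assms) auto
    also have "\<dots> = (lam * M * \<epsilon> + K * norm q) * (norm q)\<^sup>2"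
      by (simp add: K_def power3_eq_cube power2_eq_square algebra_simps)
    also have "\<dots> \<le> (1 / 4 + 1 / 8) * (norm q)\<^sup>2"
      using \<epsilon>(2) \<rho>(2) mult_left_mono[OF that K] by (intro mult_right_mono add_mono) auto
    finally show ?thesis using energy_ge[OF assms, of q] by simp
  qed
  show ?thesis
  proof (rule that[OF \<rho>(1), of "\<rho>\<^sup>2 / 8"])
    show "0 \<le> energy lam q" if "norm q \<le> \<rho>" for q using le[OF that] zero_le_power2[of "norm q"] by linarith
  qed (use \<rho> le in auto)
qed

lemma energy_0: "energy lam 0 = 0"
proof -
  have "W (prof 0) = (\<lambda>r. 0)" by (auto simp: zero_profile.rep_eq W_def)
  then show ?thesis by (simp add: energy_def J_def F(2))
qed

text \<open>The two critical points and 0 are told apart by their energies: negative, positive and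
  zero.\<close>

lemma critical_points:
  assumes lam: "lam \<ge> 0" and neg: "energy lam q1 < 0"
  shows "\<exists>p q. grad lam p = 0 \<and> grad lam q = 0 \<and> p \<noteq> q \<and> p \<noteq> 0 \<and> q \<noteq> 0"
proof -
  obtain K where K: "K \<ge> 0" "\<And>q. (norm q)\<^sup>2 / 4 - K * norm q \<le> energy lam q" using energy_coercive[OF lam] by blast
  obtain \<rho> \<eta> where ball: "\<rho> > 0" "\<eta> > 0" "\<And>q. norm q \<le> \<rho> \<Longrightarrow> 0 \<le> energy lam q"
    "\<And>q. norm q = \<rho> \<Longrightarrow> \<eta> \<le> energy lam q" using energy_near_0[OF lam] by blast
  have coercive: "\<exists>R. \<forall>q. energy lam q \<le> c \<longrightarrow> norm q \<le> R" for c
  proof (rule exI[of _ "4 * K + 4 * (\<bar>c\<bar> + 1)"], intro allI impI, rule ccontr)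
    fix q assume q: "energy lam q \<le> c" "\<not> norm q \<le> 4 * K + 4 * (\<bar>c\<bar> + 1)"
    then have "1 * (\<bar>c\<bar> + 1) \<le> norm q * (norm q / 4 - K)" using K(1) by (intro mult_mono) auto
    also have "\<dots> = (norm q)\<^sup>2 / 4 - K * norm q" by (simp add: power2_eq_square algebra_simps)
    finally have "\<bar>c\<bar> + 1 \<le> energy lam q" using K(2)[of q] by simp
    then show False using q(1) abs_ge_self[of c] by linarith
  qed
  have "- K\<^sup>2 \<le> energy lam q" for q
  proof -
    have "0 \<le> (norm q / 2 - K)\<^sup>2" by simp
    also have "\<dots> = (norm q)\<^sup>2 / 4 - K * norm q + K\<^sup>2" by (simp add: power2_eq_square algebra_simps)
    finally show ?thesis using K(2)[of q] by linarith
  qed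
  then have below: "bdd_below (range (energy lam))" by (auto intro!: bdd_belowI)
  have "\<exists>p q. grad lam p = 0 \<and> grad lam q = 0 \<and> energy lam p < 0 \<and> 0 < energy lam q"
    by (rule two_critical_points[where E="energy lam" and D="grad lam" and \<rho>=\<rho> and \<eta>=\<eta> and ?x1.0=q1])
      (fact energy_differentiable grad_bounded grad_continuous energy_continuous coercive below palais_smale
          energy_0 ball neg)+
  then obtain p q where "grad lam p = 0" "grad lam q = 0" "energy lam p < 0" "0 < energy lam q" by blast
  then show ?thesis using energy_0[of lam] by (intro exI[of _ p] exI[of _ q]) auto
qed

text \<open>Pair \<open>q = T lam w\<close> with \<open>q\<close>: the potential term has the
  favourable sign, and \<open>\<epsilon>\<close> absorbs half of \<open>N\<^sup>2\<close>. Only the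
  upper bound \<open>L\<close> on \<open>lam\<close> enters, which gives one \<open>\<nu>\<close>
  for a whole interval.\<close>

lemma critical_point_bound:
  assumes "L \<ge> 0" obtains B where "B \<ge> 0" "\<And>lam q. 0 \<le> lam \<Longrightarrow> lam \<le> L \<Longrightarrow> grad lam q = 0 \<Longrightarrow> norm q \<le> B"
proof -
  define \<epsilon> where "\<epsilon> = 1 / (2 * (L * M + 1))"
  have "L * M \<ge> 0" using assms M by simp
  then have \<epsilon>: "\<epsilon> > 0" "L * M * \<epsilon> \<le> 1 / 2" by (auto simp: \<epsilon>_def divide_simps)
  obtain C where C: "C \<ge> 0" "\<And>s. \<bar>f s\<bar> \<le> \<epsilon> * \<bar>s\<bar> + C" using f_affine_bound[OF \<epsilon>(1)] by blast
  have "norm q \<le> 2 * (L * C * \<beta>)" if lam: "0 \<le> lam" "lam \<le> L" and crit: "grad lam q = 0" for lam q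
  proof -
    define w N where "w = W (prof q)" and "N = norm q"
    have w: "admissible N w" unfolding w_def N_def by (rule admissible_W)
    note wD = admissibleD[OF w]
    have "q = T lam w" using crit by (simp add: grad_def w_def)
    then have "N\<^sup>2 = T lam w \<bullet> q" by (simp add: N_def power2_norm_eq_inner)
    also have "\<dots> = (\<integral>r. nl lam w r * w r \<partial>lborel)" unfolding inner_T[OF w] by (simp add: w_def)
    also have "\<dots> \<le> (\<integral>r. lam * (M * \<epsilon> * (w r)\<^sup>2 + C * (b r * r * \<bar>w r\<bar>)) \<partial>lborel)"
    proof (rule integral_mono)
      show "integrable lborel (\<lambda>r. nl lam w r * w r)" by (rule L2_mult[OF nl_L2[OF w] wD(2)])
      show "integrable lborel (\<lambda>r. lam * (M * \<epsilon> * (w r)\<^sup>2 + C * (b r * r * \<bar>w r\<bar>)))"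
        using L2_integrable[OF wD(2)] integral_br_le(1)[OF w]
        by (intro Bochner_Integration.integrable_add integrable_mult_right) auto
      fix r
      have "0 \<le> 4 * pi * e\<^sup>2 * (pot (\<lambda>s. (w s)\<^sup>2) r * (w r)\<^sup>2)"
        by (intro mult_nonneg_nonneg pot_nonneg) (auto simp: wD(5))
      then have "nl lam w r * w r \<le> lam * (b r * (r * f (w r / r)) * w r)"
        by (simp add: nl_def power2_eq_square algebra_simps)
      also have "\<dots> \<le> lam * (M * \<epsilon> * (w r)\<^sup>2 + C * (b r * r * \<bar>w r\<bar>))"
      proof (intro mult_left_mono lam(1))
        show "b r * (r * f (w r / r)) * w r \<le> M * \<epsilon> * (w r)\<^sup>2 + C * (b r * r * \<bar>w r\<bar>)"
        proof (cases "r > 0")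
          case True
          have "b r * (r * f (w r / r)) * w r \<le> b r * (r * \<bar>f (w r / r)\<bar>) * \<bar>w r\<bar>"
            using abs_ge_self[of "b r * (r * f (w r / r)) * w r"] True b(2)[of r] by (simp add: abs_mult)
          also have "\<dots> \<le> b r * (r * (\<epsilon> * \<bar>w r / r\<bar> + C)) * \<bar>w r\<bar>"
            using True b(2)[of r] by (intro mult_right_mono mult_left_mono C(2)) auto
          also have "\<dots> = b r * (\<epsilon> * (w r)\<^sup>2) + C * (b r * r * \<bar>w r\<bar>)"
            using True by (simp add: abs_divide distrib_left distrib_right power2_eq_square)
          also have "\<dots> \<le> M * (\<epsilon> * (w r)\<^sup>2) + C * (b r * r * \<bar>w r\<bar>)"
            using \<epsilon>(1) by (intro add_right_mono mult_right_mono b(3)) auto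
          finally show ?thesis by simp
        qed (simp add: b wD)
      qed
      finally show "nl lam w r * w r \<le> lam * (M * \<epsilon> * (w r)\<^sup>2 + C * (b r * r * \<bar>w r\<bar>))" .
    qed
    also have "\<dots> = lam * (M * \<epsilon> * (\<integral>r. (w r)\<^sup>2 \<partial>lborel) + C * (\<integral>r. b r * r * \<bar>w r\<bar> \<partial>lborel))"
      using L2_integrable[OF wD(2)] integral_br_le(1)[OF w] by (simp add: Bochner_Integration.integral_add)
    also have "\<dots> \<le> L * (M * \<epsilon> * N\<^sup>2 + C * (\<beta> * N))"
    proof (rule order_trans[OF mult_left_mono[OF _ lam(1)] mult_right_mono[OF lam(2)]])
      show "M * \<epsilon> * (\<integral>r. (w r)\<^sup>2 \<partial>lborel) + C * (\<integral>r. b r * r * \<bar>w r\<bar> \<partial>lborel) \<le> M * \<epsilon> * N\<^sup>2 + C * (\<beta> * N)"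
        using M \<epsilon> C by (intro add_mono mult_left_mono wD(4) integral_br_le(2)[OF w]) auto
      show "0 \<le> M * \<epsilon> * N\<^sup>2 + C * (\<beta> * N)" using M \<epsilon> C \<beta>_nonneg wD(1) by simp
    qed
    also have "\<dots> = L * M * \<epsilon> * N\<^sup>2 + L * C * \<beta> * N" by (simp add: algebra_simps)
    also have "\<dots> \<le> 1 / 2 * N\<^sup>2 + L * C * \<beta> * N" using \<epsilon>(2) by (intro add_right_mono mult_right_mono) auto
    finally have "N * N \<le> 2 * (L * C * \<beta>) * N" by (simp add: power2_eq_square)
    moreover have "0 \<le> L * C * \<beta>" using assms C \<beta>_nonneg by simp
    ultimately show ?thesis using wD(1) unfolding N_def[symmetric] by (cases "N = 0") auto
  qed
  moreover have "0 \<le> 2 * (L * C * \<beta>)" using assms C \<beta>_nonneg by simp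
  ultimately show ?thesis using that by blast
qed

end

section \<open>Smooth functions\<close>

text \<open>The powers in the denominator close the family under differentiation: the derivative of
  a member is a combination of two others.\<close>

definition flat_exp :: "nat \<Rightarrow> real \<Rightarrow> real" where
  "flat_exp n t = (if t > 0 then exp (- (1 / t)) / t ^ n else 0)"

lemma continuous_on_bounded_Icc:
  fixes g :: "real \<Rightarrow> real"
  assumes "continuous_on {a..b} g" obtains B where "\<And>x. x \<in> {a..b} \<Longrightarrow> \<bar>g x\<bar> \<le> B"
proof -
  have "bounded (g ` {a..b})" by (intro compact_imp_bounded compact_continuous_image assms compact_Icc)
  then obtain B where "\<forall>y\<in>g ` {a..b}. norm y \<le> B" unfolding bounded_iff by blast
  then show ?thesis by (intro that[of B]) auto
qed

text \<open>A class closed under differentiation is what the coinductive definition of \<open>smooth3\<close> asks for; the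
  generators \<open>flat_exp\<close> provide cutoff functions.\<close>

inductive smooth1 :: "(real \<Rightarrow> real) \<Rightarrow> bool" where
  const: "smooth1 (\<lambda>t. c)"
| ident: "smooth1 (\<lambda>t. t)"
| flat: "smooth1 (flat_exp n)"
| add: "smooth1 g \<Longrightarrow> smooth1 h \<Longrightarrow> smooth1 (\<lambda>t. g t + h t)"
| mult: "smooth1 g \<Longrightarrow> smooth1 h \<Longrightarrow> smooth1 (\<lambda>t. g t * h t)"
| affine: "smooth1 g \<Longrightarrow> smooth1 (\<lambda>t. g (c * t + d))"
| antideriv: "smooth1 g \<Longrightarrow> (\<And>t. (G has_real_derivative g t) (at t)) \<Longrightarrow> smooth1 G"

lemmas smooth1_intros = smooth1.const smooth1.ident smooth1.flat smooth1.add smooth1.mult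

lemma flat_exp_tendsto: "(flat_exp n \<longlongrightarrow> 0) (at_right 0)"
proof -
  have "((\<lambda>t. (inverse t) ^ n / exp (inverse t)) \<longlongrightarrow> 0) (at_right (0::real))"
    by (rule filterlim_compose[OF tendsto_power_div_exp_0 filterlim_inverse_at_top_right])
  moreover have "\<forall>\<^sub>F t in at_right 0. (inverse t) ^ n / exp (inverse t) = flat_exp n t"
    by (auto simp: eventually_at_filter flat_exp_def exp_minus field_simps)
  ultimately show ?thesis by (simp add: tendsto_cong)
qed

lemma flat_exp_derivative:
  "(flat_exp n has_real_derivative flat_exp (n + 2) t + - real n * flat_exp (n + 1) t) (at t)"
proof -
  consider "t > 0" | "t < 0" | "t = 0" by linarith
  then show ?thesis
  proof cases
    case 1
    have ev: "\<forall>\<^sub>F x in nhds t. exp (- (1 / x)) / x ^ n = flat_exp n x"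
      using 1 by (intro eventually_nhds_in_open[of "{0<..}", THEN eventually_mono]) (auto simp: flat_exp_def)
    have "((\<lambda>x. exp (- (1 / x)) / x ^ n) has_real_derivative
        (exp (- (1 / t)) * (1 / t\<^sup>2) * t ^ n - exp (- (1 / t)) * (real n * t ^ (n - 1))) / (t ^ n * t ^ n)) (at t)"
      using 1 by (auto intro!: derivative_eq_intros simp: power2_eq_square)
    also have "(exp (- (1 / t)) * (1 / t\<^sup>2) * t ^ n - exp (- (1 / t)) * (real n * t ^ (n - 1))) / (t ^ n * t ^ n)
        = flat_exp (n + 2) t + - real n * flat_exp (n + 1) t"
      using 1 by (cases n) (auto simp: flat_exp_def field_simps power2_eq_square)
    finally show ?thesis by (subst (asm) DERIV_cong_ev[OF refl ev refl])
  next
    case 2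
    have "\<forall>\<^sub>F x in nhds t. 0 = flat_exp n x"
      using 2 by (intro eventually_nhds_in_open[of "{..<0}", THEN eventually_mono]) (auto simp: flat_exp_def)
    then show ?thesis using 2 DERIV_cong_ev[OF refl, where x=t and f="\<lambda>_. 0" and g="flat_exp n" and u=0 and v=0]
      by (auto simp: flat_exp_def)
  next
    case 3
    \<comment> \<open>At the origin the difference quotient from the right is
      \<open>flat_exp (n + 1)\<close> itself, which tends to 0; from the left it is 0.\<close>
    have "((\<lambda>x. flat_exp n x / x) \<longlongrightarrow> 0) (at_right 0)"
    proof (rule Lim_transform_eventually[OF flat_exp_tendsto[of "Suc n"]])
      show "\<forall>\<^sub>F x in at_right 0. flat_exp (Suc n) x = flat_exp n x / x"
        by (auto simp: eventually_at_filter flat_exp_def)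
    qed
    moreover have "((\<lambda>x. flat_exp n x / x) \<longlongrightarrow> 0) (at_left 0)"
      by (rule tendsto_eventually) (auto simp: eventually_at_filter flat_exp_def)
    ultimately have "((\<lambda>x. flat_exp n x / x) \<longlongrightarrow> 0) (at 0)" using filterlim_split_at_real by blast
    then show ?thesis using 3 by (simp add: has_field_derivative_iff flat_exp_def)
  qed
qed

lemma smooth1_derivative: "smooth1 g \<Longrightarrow> \<exists>g'. smooth1 g' \<and> (\<forall>t. (g has_real_derivative g' t) (at t))"
proof (induction rule: smooth1.induct)
  case (const c)
  then show ?case using smooth1.const[of 0] by (auto intro!: exI[of _ "\<lambda>t. 0"])
next
  case ident
  then show ?case using smooth1.const[of 1] by (auto intro!: exI[of _ "\<lambda>t. 1"])
next
  case (flat n)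
  show ?case
    by (rule exI[of _ "\<lambda>t. flat_exp (n + 2) t + - real n * flat_exp (n + 1) t"])
      (intro conjI allI flat_exp_derivative smooth1_intros)
next
  case (add g h)
  then obtain g' h' where "smooth1 g'" "smooth1 h'" and d: "\<And>t. (g has_real_derivative g' t) (at t)"
    "\<And>t. (h has_real_derivative h' t) (at t)" by blast
  moreover have "((\<lambda>t. g t + h t) has_real_derivative g' t + h' t) (at t)" for t by (intro derivative_intros d)
  ultimately show ?case by (intro exI[of _ "\<lambda>t. g' t + h' t"]) (auto intro: smooth1.add)
next
  case (mult g h)
  then obtain g' h' where s: "smooth1 g'" "smooth1 h'" and d: "\<And>t. (g has_real_derivative g' t) (at t)"
    "\<And>t. (h has_real_derivative h' t) (at t)" by blast
  have "((\<lambda>t. g t * h t) has_real_derivative g' t * h t + h' t * g t) (at t)" for t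
    by (intro DERIV_mult d)
  then show ?case using s mult.hyps
    by (intro exI[of _ "\<lambda>t. g' t * h t + h' t * g t"]) (auto intro: smooth1_intros)
next
  case (affine g c d)
  then obtain g' where s: "smooth1 g'" and g': "\<And>t. (g has_real_derivative g' t) (at t)" by blast
  have "((\<lambda>t. g (c * t + d)) has_real_derivative g' (c * t + d) * c) (at t)" for t
    by (rule DERIV_chain2[OF g']) (auto intro!: derivative_eq_intros)
  moreover have "smooth1 (\<lambda>t. g' (c * t + d) * c)"
    by (rule smooth1.mult[OF smooth1.affine[OF s] smooth1.const])
  ultimately show ?case by blast
next
  case (antideriv g G)
  then show ?case by blast
qed

lemma smooth1_continuous: assumes "smooth1 g" shows "continuous_on S g"
proof -
  obtain g' where "\<And>t. (g has_real_derivative g' t) (at t)" using smooth1_derivative[OF assms] by blast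
  then show ?thesis by (meson DERIV_continuous_on has_field_derivative_at_within)
qed

text \<open>Ties the interval integral in which positivity of F is stated to a primitive normalised
  at 0.\<close>

lemma continuous_primitive:
  fixes f :: "real \<Rightarrow> real"
  assumes "continuous_on UNIV f"
  obtains F where "\<And>s. (F has_real_derivative f s) (at s)" "F 0 = 0" "\<And>s. (LBINT t=ereal 0..ereal s. f t) = F s"
proof -
  have "\<exists>F. \<forall>x::real. -\<infinity> < ereal x \<longrightarrow> ereal x < \<infinity> \<longrightarrow> (F has_vector_derivative f x) (at x)"
    using assms by (intro einterval_antiderivative) (auto simp: continuous_on_eq_continuous_at)
  then obtain G where G: "\<And>t. (G has_real_derivative f t) (at t)"
    by (auto simp: has_real_derivative_iff_has_vector_derivative)
  show ?thesis
  proof (rule that[of "\<lambda>s. G s - G 0"])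
    show "((\<lambda>s. G s - G 0) has_real_derivative f s) (at s)" for s using DERIV_diff[OF G DERIV_const] by simp
    show "(LBINT t=ereal 0..ereal s. f t) = G s - G 0" for s
    proof (rule interval_integral_FTC_finite)
      show "continuous_on {min 0 s..max 0 s} f" using assms by (rule continuous_on_subset) simp
      show "(G has_vector_derivative f x) (at x within {min 0 s..max 0 s})" for x
        using G has_real_derivative_iff_has_vector_derivative has_vector_derivative_at_within by blast
    qed
  qed simp
qed

lemma smooth1_antiderivative: assumes "smooth1 g" obtains G where "smooth1 G" "\<And>t. (G has_real_derivative g t) (at t)"
  using continuous_primitive[OF smooth1_continuous[OF assms, of UNIV]] smooth1.antideriv[OF assms] by metis

section \<open>Cutoff functions and test functions\<close>

lemma smooth1_cmult: "smooth1 g \<Longrightarrow> smooth1 (\<lambda>t. c * g t)"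
  by (intro smooth1_intros)

lemma smooth1_power: "smooth1 (\<lambda>t. t ^ n)"
  by (induction n) (auto intro: smooth1_intros)

lemma smooth1_sum: "finite A \<Longrightarrow> (\<And>i. i \<in> A \<Longrightarrow> smooth1 (g i)) \<Longrightarrow> smooth1 (\<lambda>t. \<Sum>i\<in>A. g i t)"
  by (induction A rule: finite_induct) (auto intro: smooth1_intros)

lemma flat_exp_bounds: "0 \<le> flat_exp 0 t" "flat_exp 0 t \<le> 1"
  by (auto simp: flat_exp_def)

text \<open>The normalised primitive of a bump supported in \<open>[0, 1]\<close>, turned upside
  down. Its total mass \<open>c\<close> is positive, since otherwise the primitive would be constant
  on the open interval although the bump is nonzero at 1/2.\<close>

lemma smooth_step:
  obtains \<sigma> \<sigma>' :: "real \<Rightarrow> real" and C where "smooth1 \<sigma>" "smooth1 \<sigma>'" "\<And>t. (\<sigma> has_real_derivative \<sigma>' t) (at t)"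
    "\<And>t. t \<le> 0 \<Longrightarrow> \<sigma> t = 1" "\<And>t. 1 \<le> t \<Longrightarrow> \<sigma> t = 0" "\<And>t. 0 \<le> \<sigma> t" "\<And>t. \<sigma> t \<le> 1"
    "\<And>t. t \<le> 0 \<Longrightarrow> \<sigma>' t = 0" "\<And>t. 1 \<le> t \<Longrightarrow> \<sigma>' t = 0" "\<And>t. \<bar>\<sigma>' t\<bar> \<le> C"
proof -
  define k where "k t = flat_exp 0 t * flat_exp 0 (-1 * t + 1)" for t
  have sk: "smooth1 k" unfolding k_def[abs_def] by (intro smooth1_intros smooth1.affine[OF smooth1.flat])
  then obtain G where G: "smooth1 G" "\<And>t. (G has_real_derivative k t) (at t)" using smooth1_antiderivative by blast
  have k01: "0 \<le> k t" "k t \<le> 1" for t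
    unfolding k_def using flat_exp_bounds by (auto intro: mult_le_one)
  have k0: "k t = 0" if "t \<le> 0 \<or> 1 \<le> t" for t using that by (auto simp: k_def flat_exp_def)
  have mono: "G s \<le> G t" if "s \<le> t" for s t
    by (rule DERIV_nonneg_imp_nondecreasing[OF that]) (use G(2) k01 in blast)
  have left: "G t = G 0" if "t \<le> 0" for t
    by (rule antisym[OF mono[OF that]], rule DERIV_nonpos_imp_nonincreasing[OF that]) (use G(2) k0 in force)
  have right: "G t = G 1" if "1 \<le> t" for t
    by (rule antisym[OF _ mono[OF that]], rule DERIV_nonpos_imp_nonincreasing[OF that]) (use G(2) k0 in force)
  define c where "c = G 1 - G 0"
  have "c > 0"
  proof (rule ccontr)
    assume "\<not> c > 0"
    then have "G 1 = G 0" using mono[of 0 1] by (simp add: c_def)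
    then have "G t = G 0" if "0 < t" "t < 1" for t using mono[of 0 t] mono[of t 1] that by auto
    then have "\<forall>\<^sub>F t in nhds (1/2). G t = G 0"
      by (intro eventually_nhds_in_open[of "{0<..<1}", THEN eventually_mono]) auto
    then have "(G has_real_derivative 0) (at (1/2))" by (subst DERIV_cong_ev[OF refl _ refl, where g="\<lambda>_. G 0"]) auto
    then have "k (1/2) = 0" using G(2)[of "1/2"] DERIV_unique by blast
    then show False by (simp add: k_def flat_exp_def)
  qed
  show ?thesis
  proof (rule that[of "\<lambda>t. G 1 / c + (- (1 / c)) * G t" "\<lambda>t. (- (1 / c)) * k t" "1 / c"])
    show "smooth1 (\<lambda>t. G 1 / c + (- (1 / c)) * G t)" "smooth1 (\<lambda>t. (- (1 / c)) * k t)"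
      by (intro smooth1_intros G(1) sk)+
    show "((\<lambda>t. G 1 / c + (- (1 / c)) * G t) has_real_derivative (- (1 / c)) * k t) (at t)" for t
      by (rule derivative_eq_intros G(2) refl)+ simp
    show "G 1 / c + (- (1 / c)) * G t = 1" if "t \<le> 0" for t
      using left[OF that] \<open>c > 0\<close> by (simp add: diff_divide_distrib[symmetric] c_def[symmetric])
    show "G 1 / c + (- (1 / c)) * G t = 0" if "1 \<le> t" for t using right[OF that] by simp
    have "G t \<le> G 1" "G 0 \<le> G t" for t using left[of t] right[of t] mono[of 0 t] mono[of t 1] mono[of 0 1]
      by (cases "t \<le> 0"; cases "1 \<le> t"; auto)+
    then show "0 \<le> G 1 / c + (- (1 / c)) * G t" "G 1 / c + (- (1 / c)) * G t \<le> 1" for t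
      using \<open>c > 0\<close> by (auto simp: diff_divide_distrib[symmetric] c_def divide_le_eq)
    show "(- (1 / c)) * k t = 0" if "t \<le> 0" for t using k0 that by simp
    show "(- (1 / c)) * k t = 0" if "1 \<le> t" for t using k0 that by simp
    show "\<bar>(- (1 / c)) * k t\<bar> \<le> 1 / c" for t using k01[of t] \<open>c > 0\<close> by (simp add: abs_mult divide_right_mono)
  qed
qed

text \<open>A class closed under partial derivatives, as coinduction for \<open>smooth3\<close>
  requires. Radial functions enter through \<open>x \<bullet> x\<close>, which unlike the norm is
  smooth at the origin.\<close>

inductive smooth_class :: "(real^3 \<Rightarrow> real) \<Rightarrow> bool" where
  radial: "smooth1 g \<Longrightarrow> smooth_class (\<lambda>x. g (x \<bullet> x))"
| coord: "smooth_class (\<lambda>x. x $ i)"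
| const: "smooth_class (\<lambda>x. c)"
| add: "smooth_class \<phi> \<Longrightarrow> smooth_class \<psi> \<Longrightarrow> smooth_class (\<lambda>x. \<phi> x + \<psi> x)"
| mult: "smooth_class \<phi> \<Longrightarrow> smooth_class \<psi> \<Longrightarrow> smooth_class (\<lambda>x. \<phi> x * \<psi> x)"

lemma radial_has_derivative:
  fixes x :: "'a::real_inner"
  assumes "(g has_real_derivative g') (at (x \<bullet> x))"
  shows "((\<lambda>x. g (x \<bullet> x)) has_derivative (\<lambda>h. g' * (2 * (x \<bullet> h)))) (at x)"
proof -
  have "((\<lambda>x. x \<bullet> x) has_derivative (\<lambda>h. 2 * (x \<bullet> h))) (at x)"
    by (auto intro!: derivative_eq_intros simp: inner_commute)
  from has_derivative_compose[OF this has_field_derivative_imp_has_derivative[OF assms]]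
  show ?thesis by (simp add: mult.commute)
qed

lemma smooth_class_derivative:
  "smooth_class \<psi> \<Longrightarrow> \<exists>D. (\<forall>x. (\<psi> has_derivative D x) (at x)) \<and> (\<forall>i. smooth_class (\<lambda>x. D x (axis i 1)))"
proof (induction rule: smooth_class.induct)
  case (radial g)
  then obtain g' where g': "smooth1 g'" "\<And>t. (g has_real_derivative g' t) (at t)" using smooth1_derivative by blast
  show ?case
  proof (intro exI[of _ "\<lambda>x h. g' (x \<bullet> x) * (2 * (x \<bullet> h))"] conjI allI)
    show "((\<lambda>x. g (x \<bullet> x)) has_derivative (\<lambda>h. g' (x \<bullet> x) * (2 * (x \<bullet> h)))) (at x)" for x :: "real^3"
      by (rule radial_has_derivative[OF g'(2)])
    show "smooth_class (\<lambda>x. g' (x \<bullet> x) * (2 * (x \<bullet> axis i 1)))" for i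
      unfolding inner_axis
      by (intro smooth_class.mult smooth_class.radial g'(1) smooth_class.const) (simp add: smooth_class.coord)
  qed
next
  case (coord i)
  have "((\<lambda>x :: real^3. x $ i) has_derivative (\<lambda>h. h $ i)) (at x)" for x
    by (rule bounded_linear_imp_has_derivative[OF bounded_linear_vec_nth])
  then show ?case by (intro exI[of _ "\<lambda>x h. h $ i"]) (auto intro: smooth_class.const)
next
  case (const c)
  show ?case by (intro exI[of _ "\<lambda>x h. 0"]) (auto intro: smooth_class.const)
next
  case (add \<phi> \<psi>)
  then obtain D E where D: "\<And>x. (\<phi> has_derivative D x) (at x)" "\<And>i. smooth_class (\<lambda>x. D x (axis i 1))"
    and E: "\<And>x. (\<psi> has_derivative E x) (at x)" "\<And>i. smooth_class (\<lambda>x. E x (axis i 1))" by metis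
  have "((\<lambda>x. \<phi> x + \<psi> x) has_derivative (\<lambda>h. D x h + E x h)) (at x)" for x
    by (rule has_derivative_add[OF D(1) E(1)])
  moreover have "smooth_class (\<lambda>x. D x (axis i 1) + E x (axis i 1))" for i by (rule smooth_class.add[OF D(2) E(2)])
  ultimately show ?case by (intro exI[of _ "\<lambda>x h. D x h + E x h"]) blast
next
  case (mult \<phi> \<psi>)
  then obtain D E where D: "\<And>x. (\<phi> has_derivative D x) (at x)" "\<And>i. smooth_class (\<lambda>x. D x (axis i 1))"
    and E: "\<And>x. (\<psi> has_derivative E x) (at x)" "\<And>i. smooth_class (\<lambda>x. E x (axis i 1))" by metis
  have "((\<lambda>x. \<phi> x * \<psi> x) has_derivative (\<lambda>h. \<phi> x * E x h + D x h * \<psi> x)) (at x)" for x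
    by (rule has_derivative_mult[OF D(1) E(1)])
  moreover have "smooth_class (\<lambda>x. \<phi> x * E x (axis i 1) + D x (axis i 1) * \<psi> x)" for i
    by (rule smooth_class.add[OF smooth_class.mult[OF mult.hyps(1) E(2)] smooth_class.mult[OF D(2) mult.hyps(2)]])
  ultimately show ?case by (intro exI[of _ "\<lambda>x h. \<phi> x * E x h + D x h * \<psi> x"]) blast
qed

lemma smooth_class_partial: assumes "smooth_class \<psi>" shows "\<psi> differentiable at x" "smooth_class (partial \<psi> i)"
proof -
  obtain D where D: "\<And>x. (\<psi> has_derivative D x) (at x)" "\<And>i. smooth_class (\<lambda>x. D x (axis i 1))"
    using smooth_class_derivative[OF assms] by blast
  then show "\<psi> differentiable at x" by (auto simp: differentiable_def)
  have "partial \<psi> i = (\<lambda>x. D x (axis i 1))"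
    using frechet_derivative_at[OF D(1)] by (auto simp: partial_def[abs_def])
  then show "smooth_class (partial \<psi> i)" using D(2) by simp
qed

lemma smooth_class_imp_smooth3: "smooth_class \<psi> \<Longrightarrow> smooth3 \<psi>"
proof (coinduction arbitrary: \<psi> rule: smooth3.coinduct)
  case smooth3 then show ?case using smooth_class_partial by blast
qed

lemma smooth_class_sum: "finite A \<Longrightarrow> (\<And>i. i \<in> A \<Longrightarrow> smooth_class (g i)) \<Longrightarrow> smooth_class (\<lambda>t. \<Sum>i\<in>A. g i t)"
  by (induction A rule: finite_induct) (auto intro: smooth_class.const smooth_class.add)

text \<open>Lets Stone-Weierstrass approximants, multiplied by a cutoff, serve as test
  functions.\<close>

lemma real_polynomial_smooth_class: "real_polynomial_function p \<Longrightarrow> smooth_class p"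
proof (induction rule: real_polynomial_function.induct)
  case (linear f)
  have "f x = (\<Sum>i\<in>UNIV. f (axis i 1) * x $ i)" for x :: "real^3"
  proof -
    have "f x = f (\<Sum>i\<in>UNIV. x $ i *\<^sub>R axis i 1)" by (simp add: basis_expansion scalar_mult_eq_scaleR[symmetric])
    also have "\<dots> = (\<Sum>i\<in>UNIV. f (axis i 1) * x $ i)"
      using linear by (simp add: bounded_linear.linear linear_sum linear_cmul mult.commute)
    finally show ?thesis .
  qed
  then have "f = (\<lambda>x. \<Sum>i\<in>UNIV. f (axis i 1) * x $ i)" by (rule ext)
  moreover have "smooth_class (\<lambda>x. \<Sum>i\<in>UNIV. f (axis i 1) * x $ i)"
    by (intro smooth_class_sum smooth_class.mult smooth_class.const smooth_class.coord) auto
  ultimately show ?case by metis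
qed (auto intro: smooth_class.const smooth_class.add smooth_class.mult)

lemma test_fun_cutoff:
  assumes "smooth1 g" "\<And>t. T \<le> t \<Longrightarrow> g t = 0" "smooth_class p"
  shows "test_fun (\<lambda>x. g (x \<bullet> x) * p x)"
proof -
  have "norm x \<le> \<bar>T\<bar> + 1" if "g (x \<bullet> x) * p x \<noteq> 0" for x
  proof (rule ccontr)
    assume n: "\<not> norm x \<le> \<bar>T\<bar> + 1"
    then have "\<bar>T\<bar> * 1 \<le> norm x * norm x" by (intro mult_mono) auto
    then have "T \<le> x \<bullet> x" by (simp add: norm_eq_sqrt_inner)
    then show False using that assms(2) by simp
  qed
  then have "bounded {x. g (x \<bullet> x) * p x \<noteq> 0}" unfolding bounded_iff by blast
  then have "compact (closure {x. g (x \<bullet> x) * p x \<noteq> 0})" by (simp add: compact_closure)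
  then show ?thesis unfolding test_fun_def
    using smooth_class_imp_smooth3[OF smooth_class.mult[OF smooth_class.radial[OF assms(1)] assms(3)]] by blast
qed

section \<open>A profile of negative energy\<close>

context reduced_system
begin

text \<open>Take \<open>w r = s0 * r\<close> on \<open>[0, R]\<close>, cut off within length
  \<open>1 / n\<close>; then \<open>u\<close> equals \<open>s0\<close> on the ball. As
  \<open>F\<close> may be negative between 0 and \<open>s0\<close>, the transition layer is made
  thin, and \<open>J\<close> tends to \<open>F s0\<close> times the mass of \<open>b\<close> in the
  ball.\<close>

lemma J_pos_witness:
  assumes s0: "F s0 > 0" and R: "R > 0" "(\<integral>r. indicator {0..R} r * (b r * r\<^sup>2) \<partial>lborel) > 0"
  obtains q where "J (W (prof q)) > 0"
proof -
  obtain \<sigma> \<sigma>' :: "real \<Rightarrow> real" and C where \<sigma>: "smooth1 \<sigma>" "smooth1 \<sigma>'" "\<And>t. (\<sigma> has_real_derivative \<sigma>' t) (at t)"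
    "\<And>t. t \<le> 0 \<Longrightarrow> \<sigma> t = 1" "\<And>t. 1 \<le> t \<Longrightarrow> \<sigma> t = 0" "\<And>t. 0 \<le> \<sigma> t" "\<And>t. \<sigma> t \<le> 1"
    "\<And>t. 1 \<le> t \<Longrightarrow> \<sigma>' t = 0" using smooth_step by metis
  have cont [continuous_intros]: "continuous_on S (\<lambda>r. \<sigma> (g r))" "continuous_on S (\<lambda>r. \<sigma>' (g r))" if "continuous_on S g" for g and S :: "real set"
    using continuous_on_compose2[OF smooth1_continuous[OF \<sigma>(1), of UNIV] that] continuous_on_compose2[OF smooth1_continuous[OF \<sigma>(2), of UNIV] that]
    by auto
  define w where "w n r = s0 * r * \<sigma> (real n * (r - R))" for n r
  define w' where "w' n r = s0 * (\<sigma> (real n * (r - R)) + r * (real n * \<sigma>' (real n * (r - R))))" for n r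
  \<comment> \<open>The profile that generates \<open>w n\<close>, namely \<open>w' + w\<close>, set
    to 0 on the non-positive half-line as profiles must be.\<close>
  define p where "p n r = (if r > 0 then w' n r + w n r else 0)" for n r
  have d: "(w n has_real_derivative w' n r) (at r)" for n r
    unfolding w_def[abs_def] w'_def
    by (rule derivative_eq_intros DERIV_chain2[OF \<sigma>(3)] refl)+ (simp add: algebra_simps)
  have pc: "continuous_on S (\<lambda>r. w' n r + w n r)" for S n unfolding w_def w'_def by (intro continuous_intros)
  have p0: "continuous_on {0<..} (p n)" for n
    using pc[of "{0<..}" n] by (rule continuous_on_eq) (simp add: p_def)
  have pm: "p n \<in> borel_measurable borel" for n
    unfolding p_def[abs_def] using borel_measurable_continuous_onI[OF pc[of UNIV n]] by measurable
  have supp: "p n r = 0" if "r > R + 1" "n \<ge> 1" for n r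
  proof -
    have "1 * 1 \<le> real n * (r - R)" using that by (intro mult_mono) auto
    then show ?thesis using \<sigma> by (simp add: p_def w_def w'_def)
  qed
  have L2p: "L2 (p n)" if "n \<ge> 1" for n
  proof -
    obtain B where B: "\<And>r. r \<in> {0..R+1} \<Longrightarrow> \<bar>w' n r + w n r\<bar> \<le> B"
      using continuous_on_bounded_Icc[OF pc[of "{0..R+1}" n]] by blast
    have "\<bar>p n r\<bar> \<le> B * \<bar>indicator {0..R+1} r\<bar>" for r
      using supp[OF _ that, of r] B[of r] by (auto simp: p_def split: split_indicator)
    then show ?thesis by (rule L2_bound(1)[OF L2_indicator pm])
  qed
  have "\<exists>q. prof q = p n" if "n \<ge> 1" for n
    using Abs_profile_inverse[of "p n"] L2p[OF that] p0[of n] by (auto simp: p_def)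
  then obtain q where q: "\<And>n. n \<ge> 1 \<Longrightarrow> prof (q n) = p n" by metis
  have Wq: "W (prof (q n)) r = w n r" if "n \<ge> 1" "r > 0" for n r
    unfolding q[OF that(1)]
  proof (rule W_unique[OF L2p[OF that(1)] p0 _ _ that(2)])
    show "(w n has_real_derivative p n r - w n r) (at r)" if "r > 0" for r using d[of n r] that by (simp add: p_def)
    have "(w n \<longlongrightarrow> w n 0) (at 0)" using DERIV_isCont[OF d[of n 0]] by (simp add: isCont_def)
    then show "(w n \<longlongrightarrow> 0) (at_right 0)" by (simp add: w_def filterlim_at_split)
  qed
  have "continuous_on {- \<bar>s0\<bar>..\<bar>s0\<bar>} F" using F(1) by (meson DERIV_continuous_on has_field_derivative_at_within)
  then obtain B where B': "\<And>s. s \<in> {- \<bar>s0\<bar>..\<bar>s0\<bar>} \<Longrightarrow> \<bar>F s\<bar> \<le> B" using continuous_on_bounded_Icc by blast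
  have B: "\<bar>F s\<bar> \<le> B" if "\<bar>s\<bar> \<le> \<bar>s0\<bar>" for s using that by (intro B') auto
  have "B \<ge> 0" using B[of 0] abs_ge_zero[of "F 0"] by simp
  have br: "integrable lborel (\<lambda>r. indicator {0..R+1} r * (b r * r\<^sup>2))"
  proof -
    have "L2 (\<lambda>r. indicator {0..R+1} r * r)"
      by (rule L2_bound(1)[OF L2_indicator[of 0 "R+1"], where C="R+1"]) (use R in \<open>auto split: split_indicator\<close>)
    from L2_mult[OF this b(5)] show ?thesis by (simp add: power2_eq_square mult_ac)
  qed
  have "(\<lambda>n. \<integral>r. b r * (r\<^sup>2 * F (W (prof (q (Suc n))) r / r)) \<partial>lborel)
      \<longlonglongrightarrow> (\<integral>r. F s0 * (indicator {0..R} r * (b r * r\<^sup>2)) \<partial>lborel)"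
  proof (rule integral_dominated_convergence)
    show "integrable lborel (\<lambda>r. B * (indicator {0..R+1} r * (b r * r\<^sup>2)))" using br by simp
    show "(\<lambda>r. b r * (r\<^sup>2 * F (W (prof (q (Suc n))) r / r))) \<in> borel_measurable lborel" for n
      using L2_measurable[OF W_L2[OF prof(1)[of "q (Suc n)"]]] by measurable
    have eq: "b r * (r\<^sup>2 * F (W (prof (q (Suc n))) r / r)) = b r * (r\<^sup>2 * F (s0 * \<sigma> (real (Suc n) * (r - R))))" for n r
      using Wq[of "Suc n" r] b(4)[of r] by (cases "r > 0") (auto simp: w_def)
    show "AE r in lborel. norm (b r * (r\<^sup>2 * F (W (prof (q (Suc n))) r / r))) \<le> B * (indicator {0..R+1} r * (b r * r\<^sup>2))" for n
    proof (intro AE_I2)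
      fix r :: real
      consider "r \<le> 0" | "0 < r" "r \<le> R + 1" | "r > R + 1" by linarith
      then show "norm (b r * (r\<^sup>2 * F (W (prof (q (Suc n))) r / r))) \<le> B * (indicator {0..R+1} r * (b r * r\<^sup>2))"
      proof cases
        case 1 then show ?thesis by (simp add: b(4))
      next
        case 2
        have "\<bar>s0 * \<sigma> (real (Suc n) * (r - R))\<bar> \<le> \<bar>s0\<bar>" using \<sigma>(6,7) by (simp add: abs_mult mult_left_le)
        from mult_left_mono[OF B[OF this], of "b r * r\<^sup>2"] show ?thesis
          unfolding eq using 2 b(2)[of r] by (simp add: abs_mult mult_ac)
      next
        case 3
        have "1 * 1 \<le> real (Suc n) * (r - R)" using 3 by (intro mult_mono) auto
        then show ?thesis unfolding eq using 3 \<sigma>(5) by (simp add: F(2))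
      qed
    qed
    show "AE r in lborel. (\<lambda>n. b r * (r\<^sup>2 * F (W (prof (q (Suc n))) r / r))) \<longlonglongrightarrow> F s0 * (indicator {0..R} r * (b r * r\<^sup>2))"
    proof (intro AE_I2)
      fix r :: real
      show "(\<lambda>n. b r * (r\<^sup>2 * F (W (prof (q (Suc n))) r / r))) \<longlonglongrightarrow> F s0 * (indicator {0..R} r * (b r * r\<^sup>2))"
      proof (cases "r \<le> R")
        case True
        then have "\<sigma> (real (Suc n) * (r - R)) = 1" for n by (intro \<sigma>(4) mult_nonneg_nonpos) auto
        then show ?thesis unfolding eq using True b(4)[of r] by (cases "r < 0") (auto simp: mult_ac)
      next
        case False
        obtain n0 where n0: "1 < real n0 * (r - R)" using reals_Archimedean3[of "r - R"] False by auto
        have "b r * (r\<^sup>2 * F (s0 * \<sigma> (real (Suc n) * (r - R)))) = 0" if "n \<ge> n0" for n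
        proof -
          have "real n0 * (r - R) \<le> real (Suc n) * (r - R)" using that False by (intro mult_right_mono) auto
          then show ?thesis using n0 \<sigma>(5)[of "real (Suc n) * (r - R)"] F(2) by simp
        qed
        then have "\<forall>\<^sub>F n in sequentially. b r * (r\<^sup>2 * F (s0 * \<sigma> (real (Suc n) * (r - R)))) = 0"
          unfolding eventually_sequentially by blast
        then show ?thesis unfolding eq using False by (simp add: tendsto_eventually)
      qed
    qed
  qed measurable
  moreover have "(\<integral>r. F s0 * (indicator {0..R} r * (b r * r\<^sup>2)) \<partial>lborel) > 0" using s0 R(2) by simp
  ultimately have "\<forall>\<^sub>F n in sequentially. 0 < (\<integral>r. b r * (r\<^sup>2 * F (W (prof (q (Suc n))) r / r)) \<partial>lborel)"
    by (rule order_tendstoD(1))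
  then obtain n where "0 < J (W (prof (q (Suc n))))" unfolding J_def eventually_sequentially by auto
  then show ?thesis by (rule that)
qed

text \<open>Only the last term of the energy contains \<open>lam\<close>, and it contains it
  linearly.\<close>

lemma energy_negative:
  assumes "J (W (prof q)) > 0" obtains L where "\<And>lam. lam > L \<Longrightarrow> energy lam q < 0"
proof -
  define A where "A = (norm q)\<^sup>2 / 2 + pi * e\<^sup>2 * (\<integral>r. pot (\<lambda>s. (W (prof q) s)\<^sup>2) r * (W (prof q) r)\<^sup>2 \<partial>lborel)"
  have "energy lam q < 0" if "lam > A / J (W (prof q))" for lam
    using that assms by (simp add: energy_def A_def[symmetric] divide_less_eq)
  then show ?thesis using that by blast
qed

end

section \<open>Radial functions on three-space\<close>

text \<open>Polar coordinates for radial functions: the half-lines \<open>{..t}\<close> form a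
  generating pi-system, and on them both measures give the ball volume
  \<open>4 / 3 * pi * t ^ 3\<close>.\<close>

lemma distr_norm_real3:
  "distr lborel borel (norm :: real^3 \<Rightarrow> real) = density lborel (\<lambda>r. ennreal (indicator {0..} r * (4 * pi * r\<^sup>2)))"
    (is "?M = ?N")
proof (rule measure_eqI_generator_eq[where E="range atMost" and \<Omega>=UNIV and A="\<lambda>i. {..real i}"])
  show "Int_stable (range (atMost :: real \<Rightarrow> _))" by (auto simp: Int_stable_def)
  show "sets ?M = sigma_sets UNIV (range atMost)" "sets ?N = sigma_sets UNIV (range atMost)"
    by (simp_all add: borel_eq_atMost)
  show "(\<Union>i. {..real i}) = UNIV" using real_arch_simple by auto
  have M: "emeasure ?M {..t} = (if t < 0 then 0 else ennreal (4 / 3 * pi * t ^ 3))" for t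
  proof -
    have "norm -` {..t} = cball (0::real^3) t" by auto
    then have "emeasure ?M {..t} = emeasure lborel (cball (0::real^3) t)" by (subst emeasure_distr) auto
    then show ?thesis by (auto simp: emeasure_cball unit_ball_vol_3)
  qed
  have N: "emeasure ?N {..t} = (if t < 0 then 0 else ennreal (4 / 3 * pi * t ^ 3))" for t
  proof (cases "t < 0")
    case True
    then have z: "ennreal (indicator {0..} r * (4 * pi * r\<^sup>2)) * indicator {..t} r = 0" for r
      by (auto split: split_indicator)
    have "emeasure ?N {..t} = (\<integral>\<^sup>+r. ennreal (indicator {0..} r * (4 * pi * r\<^sup>2)) * indicator {..t} r \<partial>lborel)"
      by (rule emeasure_density) auto
    then show ?thesis using True unfolding z by simp
  next
    case False
    have "emeasure ?N {..t} = (\<integral>\<^sup>+r. ennreal (4 * pi * r\<^sup>2) * indicator {0..t} r \<partial>lborel)"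
      by (subst emeasure_density) (auto intro!: nn_integral_cong split: split_indicator)
    also have "\<dots> = ennreal (4 / 3 * pi * t ^ 3 - 4 / 3 * pi * 0 ^ 3)"
      using False by (intro nn_integral_FTC_Icc) (auto intro!: derivative_eq_intros)
    finally show ?thesis using False by simp
  qed
  show "emeasure ?M X = emeasure ?N X" if "X \<in> range atMost" for X using that M N by auto
  show "emeasure ?M {..real i} \<noteq> \<infinity>" for i using M by simp
qed auto

lemma radial_integral:
  fixes h :: "real \<Rightarrow> real"
  assumes [measurable]: "h \<in> borel_measurable borel"
  shows radial_integrable_iff: "integrable lborel (\<lambda>x::real^3. h (norm x)) \<longleftrightarrow> integrable lborel (\<lambda>r. indicator {0..} r * (4 * pi * r\<^sup>2) * h r)"
    and radial_integral_eq: "(\<integral>x. h (norm (x::real^3)) \<partial>lborel) = (\<integral>r. indicator {0..} r * (4 * pi * r\<^sup>2) * h r \<partial>lborel)"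
proof -
  show "integrable lborel (\<lambda>x::real^3. h (norm x)) \<longleftrightarrow> integrable lborel (\<lambda>r. indicator {0..} r * (4 * pi * r\<^sup>2) * h r)"
    by (subst integrable_distr_eq[of norm lborel borel h, symmetric]) (simp_all add: distr_norm_real3 integrable_density)
  show "(\<integral>x. h (norm (x::real^3)) \<partial>lborel) = (\<integral>r. indicator {0..} r * (4 * pi * r\<^sup>2) * h r \<partial>lborel)"
    by (subst integral_distr[of norm lborel borel h, symmetric]) (simp_all add: distr_norm_real3 integral_density)
qed

text \<open>The image of volume under the norm has a density, so null sets of radii pull back to
  null sets.\<close>

lemma AE_radial:
  assumes "AE r in lborel. r > 0 \<longrightarrow> Q r"
  shows "AE x::real^3 in lborel. x \<noteq> 0 \<longrightarrow> Q (norm x)"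
proof -
  from assms obtain N where N: "N \<in> null_sets lborel" "{r. \<not> (r > 0 \<longrightarrow> Q r)} \<subseteq> N"
    by (auto simp: eventually_ae_filter)
  then have [measurable]: "N \<in> sets borel" by auto
  have "emeasure (distr lborel borel (norm :: real^3 \<Rightarrow> real)) N = (\<integral>\<^sup>+r. ennreal (indicator {0..} r * (4 * pi * r\<^sup>2)) * indicator N r \<partial>lborel)"
    unfolding distr_norm_real3 by (rule emeasure_density) auto
  also have "\<dots> = 0" using N(1) by (rule nn_integral_null_set)
  finally have "emeasure lborel (norm -` N :: (real^3) set) = 0" by (subst (asm) emeasure_distr) auto
  then have "norm -` N \<in> null_sets (lborel :: (real^3) measure)"
    using measurable_sets[of norm borel borel N] by (auto simp: null_sets_def)
  from AE_not_in[OF this] show ?thesis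
  proof eventually_elim
    case (elim x)
    show ?case
    proof
      assume "x \<noteq> 0"
      then have "norm x > 0" by simp
      then show "Q (norm x)" using N(2) elim by blast
    qed
  qed
qed

text \<open>A measurable function is an almost everywhere limit of continuous ones. Truncating these
  at \<open>B\<close> and approximating them uniformly on the ball costs at most 1 in the bound, so
  dominated convergence remains available.\<close>

lemma bounded_polynomial_approximation:
  fixes f :: "'a::euclidean_space \<Rightarrow> real"
  assumes f: "f \<in> borel_measurable lebesgue" "\<And>x. \<bar>f x\<bar> \<le> B"
  obtains p where "\<And>n::nat. real_polynomial_function (p n)" "\<And>n x. x \<in> cball 0 R \<Longrightarrow> \<bar>p n x\<bar> \<le> B + 1"
    "AE x in lebesgue. x \<in> cball 0 R \<longrightarrow> (\<lambda>n. p n x) \<longlonglongrightarrow> f x"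
proof -
  have "f measurable_on UNIV" by (rule lebesgue_measurable_imp_measurable_on[OF f(1)]) auto
  then obtain N g where N: "negligible N" and g: "\<And>n. continuous_on UNIV (g n)"
    "\<And>x. x \<notin> N \<Longrightarrow> (\<lambda>n. g n x) \<longlonglongrightarrow> f x" unfolding measurable_on_def by auto
  have B: "0 \<le> B" using f(2)[of undefined] abs_ge_zero order_trans by blast
  define c where "c n x = max (- B) (min B (g n x))" for n x
  have "\<exists>p. real_polynomial_function p \<and> (\<forall>x\<in>cball 0 R. \<bar>c n x - p x\<bar> < 1 / real (Suc n))" for n
  proof -
    have "continuous_on (cball 0 R) (c n)" unfolding c_def
      by (intro continuous_intros continuous_on_subset[OF g(1)]) auto
    from Stone_Weierstrass_real_polynomial_function[OF compact_cball this, of "1 / real (Suc n)"]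
    obtain p where "real_polynomial_function p" "\<And>x. x \<in> cball 0 R \<Longrightarrow> \<bar>c n x - p x\<bar> < 1 / real (Suc n)" by auto
    then show ?thesis by blast
  qed
  then obtain p where p: "\<And>n. real_polynomial_function (p n)"
    "\<And>n x. x \<in> cball 0 R \<Longrightarrow> \<bar>c n x - p n x\<bar> < 1 / real (Suc n)" by metis
  show ?thesis
  proof (rule that[of p, OF p(1)])
    fix n and x :: 'a assume x: "x \<in> cball 0 R"
    have "\<bar>c n x\<bar> \<le> B" using B by (auto simp: c_def)
    moreover have "1 / real (Suc n) \<le> 1" by simp
    ultimately show "\<bar>p n x\<bar> \<le> B + 1" using p(2)[OF x, of n] by linarith
  next
    have "(\<lambda>n. p n x) \<longlonglongrightarrow> f x" if x: "x \<notin> N" "x \<in> cball 0 R" for x :: 'a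
    proof -
      have "(\<lambda>n. c n x) \<longlonglongrightarrow> max (- B) (min B (f x))" unfolding c_def
        by (intro tendsto_intros g(2) x)
      moreover have "max (- B) (min B (f x)) = f x" using f(2)[of x] by (auto simp: abs_le_iff max_def min_def)
      ultimately have c: "(\<lambda>n. c n x) \<longlonglongrightarrow> f x" by simp
      have "(\<lambda>n. c n x - p n x) \<longlonglongrightarrow> 0"
        by (rule Lim_null_comparison[OF _ LIMSEQ_Suc[OF lim_1_over_n]]) (use p(2)[OF x(2)] in \<open>auto intro!: always_eventually less_imp_le\<close>)
      from tendsto_diff[OF c this] show ?thesis by simp
    qed
    moreover have "AE x in lebesgue. x \<notin> N"
      using N by (intro AE_not_in) (simp add: negligible_iff_null_sets)
    ultimately show "AE x in lebesgue. x \<in> cball 0 R \<longrightarrow> (\<lambda>n. p n x) \<longlonglongrightarrow> f x" by auto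
  qed
qed

text \<open>A superlevel set of \<open>\<alpha>\<close> agrees almost everywhere with an F-sigma set
  \<open>C\<close>. The norm maps \<open>C\<close> to a Borel set of radii, and radial symmetry
  shows that these radii decide membership in the superlevel set. The function is then rebuilt as a
  supremum over rational levels.\<close>

lemma radial_Borel_representative:
  fixes \<alpha> :: "real^3 \<Rightarrow> real"
  assumes \<alpha>: "\<alpha> \<in> borel_measurable lebesgue" "radial \<alpha>" "\<And>x. 0 \<le> \<alpha> x" "AE x in lebesgue. \<alpha> x \<le> M" and M: "0 \<le> M"
  obtains b where "b \<in> borel_measurable borel" "\<And>r. 0 \<le> b r" "\<And>r. b r \<le> M" "\<And>r. r \<le> 0 \<Longrightarrow> b r = 0"
    "AE x in lebesgue. \<alpha> x = b (norm x)"
proof -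
  define q :: "nat \<Rightarrow> real" where "q n = of_rat (from_nat n)" for n
  have "\<exists>B. B \<in> sets borel \<and> (AE x in lebesgue. \<alpha> x > q n \<longleftrightarrow> norm x \<in> B)" for n
  proof -
    have S: "{x. \<alpha> x > q n} \<in> sets lebesgue" using measurable_sets[OF \<alpha>(1), of "{q n<..}"] by (simp add: vimage_def)
    obtain C T where C: "fsigma C" "T \<in> null_sets lebesgue" "C \<union> T = {x. \<alpha> x > q n}"
      using lebesgue_set_almost_fsigma[OF S] by metis
    from C(1) obtain F where F: "\<And>i::nat. closed (F i)" "C = (\<Union>i. F i)" by (auto elim!: fsigma.cases)
    \<comment> \<open>Cutting the closed pieces by balls makes them compact, and compactness
      survives the passage to the image under the norm.\<close>
    have "C = (\<Union>i. \<Union>m::nat. F i \<inter> cball 0 (real m))" unfolding F(2) using real_arch_simple by auto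
    then have eq: "norm ` C = (\<Union>i. \<Union>m::nat. norm ` (F i \<inter> cball 0 (real m)))" by blast
    have "closed (norm ` (F i \<inter> cball 0 (real m)))" for i m
      using F(1) by (intro compact_imp_closed compact_continuous_image) (auto intro!: continuous_intros closed_Int_compact)
    then have "norm ` C \<in> sets borel" unfolding eq by (intro sets.countable_UN borel_closed) auto
    moreover have "AE x in lebesgue. \<alpha> x > q n \<longleftrightarrow> norm x \<in> norm ` C"
      using AE_not_in[OF C(2)]
    proof eventually_elim
      case (elim x)
      show ?case
      proof
        assume "\<alpha> x > q n" then have "x \<in> C" using C(3) elim by blast
        then show "norm x \<in> norm ` C" by simp
      next
        assume "norm x \<in> norm ` C"
        then obtain y where y: "y \<in> C" "norm x = norm y" by auto
        then have "\<alpha> x = \<alpha> y" using \<alpha>(2) unfolding radial_def by blast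
        moreover have "\<alpha> y > q n" using C(3) y(1) by blast
        ultimately show "\<alpha> x > q n" by simp
      qed
    qed
    ultimately show ?thesis by blast
  qed
  then obtain B where B [measurable]: "\<And>n. B n \<in> sets borel" and B': "\<And>n. AE x in lebesgue. \<alpha> x > q n \<longleftrightarrow> norm x \<in> B n"
    by metis
  \<comment> \<open>Clamping the levels to \<open>[0, M]\<close> makes the supremum bounded, and
    places it in \<open>[0, M]\<close> at every radius rather than almost everywhere.\<close>
  define cl where "cl t = max 0 (min M t)" for t
  define b0 where "b0 r = (SUP n. indicator (B n) r * cl (q n))" for r
  have le: "0 \<le> indicator (B n) r * cl (q n)" "indicator (B n) r * cl (q n) \<le> M" for n r
    using M by (auto simp: cl_def split: split_indicator)
  have bdd: "bdd_above (range (\<lambda>n. indicator (B n) r * cl (q n)))" for r using le by (auto intro!: bdd_aboveI)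
  have [measurable]: "b0 \<in> borel_measurable borel" unfolding b0_def[abs_def]
    by (rule borel_measurable_cSUP) (use bdd in auto)
  have b0: "0 \<le> b0 r" "b0 r \<le> M" for r
  proof -
    show "0 \<le> b0 r" unfolding b0_def by (rule order_trans[OF le(1)[where n=0] cSUP_upper[OF UNIV_I bdd]])
    show "b0 r \<le> M" unfolding b0_def by (rule cSUP_least) (auto intro: le(2))
  qed
  have "AE x in lebesgue. \<forall>n. \<alpha> x > q n \<longleftrightarrow> norm x \<in> B n" using B' by (simp add: AE_all_countable)
  then have ae: "AE x in lebesgue. \<alpha> x = b0 (norm x)" using \<alpha>(4)
  proof eventually_elim
    case (elim x)
    have eq: "indicator (B n) (norm x) * cl (q n) = (if \<alpha> x > q n then cl (q n) else 0)" for n using elim(1) by simp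
    show ?case
    proof (rule antisym)
      show "b0 (norm x) \<le> \<alpha> x" unfolding b0_def eq using \<alpha>(3)[of x] M
        by (intro cSUP_least) (auto simp: cl_def)
      show "\<alpha> x \<le> b0 (norm x)"
      proof (rule ccontr)
        assume "\<not> ?thesis"
        then have "b0 (norm x) < \<alpha> x" by simp
        then obtain r :: rat where r: "b0 (norm x) < of_rat r" "of_rat r < \<alpha> x" using of_rat_dense by blast
        define n where "n = to_nat r"
        have n: "q n = of_rat r" by (simp add: q_def n_def)
        have "indicator (B n) (norm x) * cl (q n) \<le> b0 (norm x)" unfolding b0_def by (rule cSUP_upper[OF _ bdd]) simp
        moreover have "indicator (B n) (norm x) * cl (q n) = of_rat r"
          unfolding eq using r b0(1)[of "norm x"] elim(2) by (auto simp: n cl_def)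
        ultimately show False using r by simp
      qed
    qed
  qed
  have ae0: "AE x in lebesgue. x \<noteq> (0::real^3)" by (intro AE_completion AE_lborel_singleton)
  show ?thesis
  proof (rule that[of "\<lambda>r. if r \<le> 0 then 0 else b0 r"])
    show "AE x in lebesgue. \<alpha> x = (if norm x \<le> 0 then 0 else b0 (norm x))" using ae ae0 by eventually_elim auto
  qed (use b0 M in auto)
qed

section \<open>Weak gradients\<close>

lemma borel_measurable_vec_nth [measurable]: "(\<lambda>x::real^'n. x $ i) \<in> borel_measurable borel"
  by (intro borel_measurable_continuous_onI continuous_intros)

lemma weak_gradD:
  assumes "weak_grad u g"
  shows "u \<in> borel_measurable lebesgue" "g \<in> borel_measurable lebesgue"
    and "test_fun \<psi> \<Longrightarrow> integrable lebesgue (\<lambda>x. u x * partial \<psi> i x)"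
    and "test_fun \<psi> \<Longrightarrow> integrable lebesgue (\<lambda>x. g x $ i * \<psi> x)"
    and "test_fun \<psi> \<Longrightarrow> (\<integral>x. u x * partial \<psi> i x \<partial>lebesgue) = - (\<integral>x. g x $ i * \<psi> x \<partial>lebesgue)"
  using assms unfolding weak_grad_def by blast+

text \<open>The fundamental lemma of the calculus of variations: test the difference
  \<open>k\<close> of two components with a cutoff \<open>S\<close> times polynomials that converge
  boundedly to \<open>sgn (k x)\<close>. In the limit the integral of
  \<open>\<bar>k x * S x\<bar>\<close> vanishes.\<close>

lemma weak_grad_unique:
  assumes g: "weak_grad u g" and h: "weak_grad u h"
  shows "AE x in lebesgue. g x = h x"
proof -
  obtain \<sigma> :: "real \<Rightarrow> real" where \<sigma>: "smooth1 \<sigma>" "\<And>t. t \<le> 0 \<Longrightarrow> \<sigma> t = 1" "\<And>t. 1 \<le> t \<Longrightarrow> \<sigma> t = 0"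
    "\<And>t. 0 \<le> \<sigma> t" "\<And>t. \<sigma> t \<le> 1" using smooth_step by metis
  have gm: "g \<in> borel_measurable lebesgue" "h \<in> borel_measurable lebesgue" using g h by (auto simp: weak_grad_def)
  have comp: "AE x in lebesgue. norm x \<le> R \<longrightarrow> g x $ i = h x $ i" if R: "R > 0" for R i
  proof -
    define k where "k x = g x $ i - h x $ i" for x
    have km [measurable]: "k \<in> borel_measurable lebesgue" unfolding k_def
      using gm by (intro borel_measurable_diff measurable_compose[OF _ borel_measurable_vec_nth]) auto
    have k: "integrable lebesgue (\<lambda>x. k x * \<psi> x)" "(\<integral>x. k x * \<psi> x \<partial>lebesgue) = 0" if "test_fun \<psi>" for \<psi>
    proof -
      have i: "integrable lebesgue (\<lambda>x. g x $ i * \<psi> x)" "integrable lebesgue (\<lambda>x. h x $ i * \<psi> x)"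
        and e: "(\<integral>x. g x $ i * \<psi> x \<partial>lebesgue) = (\<integral>x. h x $ i * \<psi> x \<partial>lebesgue)"
        using weak_gradD(4,5)[OF g that, of i] weak_gradD(4,5)[OF h that, of i] by simp_all
      then show "integrable lebesgue (\<lambda>x. k x * \<psi> x)" "(\<integral>x. k x * \<psi> x \<partial>lebesgue) = 0"
        by (simp_all add: k_def left_diff_distrib)
    qed
    define S where "S x = \<sigma> ((1 / R\<^sup>2) * (x \<bullet> x) + - 1)" for x :: "real^3"
    have sS: "smooth1 (\<lambda>t. \<sigma> ((1 / R\<^sup>2) * t + - 1))" by (rule smooth1.affine[OF \<sigma>(1)])
    have S0: "\<sigma> ((1 / R\<^sup>2) * t + - 1) = 0" if "2 * R\<^sup>2 \<le> t" for t
      using that R by (intro \<sigma>(3)) (simp add: field_simps)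
    have S: "test_fun (\<lambda>x. S x * p x)" if "real_polynomial_function p" for p
      unfolding S_def by (rule test_fun_cutoff[OF sS S0 real_polynomial_smooth_class[OF that]])
    have Sm [measurable]: "S \<in> borel_measurable lebesgue"
    proof -
      have "continuous_on UNIV S" unfolding S_def
        by (rule continuous_on_compose2[OF smooth1_continuous[OF \<sigma>(1), of UNIV]])
          (use R in \<open>auto intro!: continuous_intros\<close>)
      then show ?thesis by (intro measurable_completion) (auto intro: borel_measurable_continuous_onI)
    qed
    have Sout: "S x = 0" if "x \<notin> cball 0 (2 * R)" for x
    proof -
      have "(2 * R) * (2 * R) \<le> norm x * norm x" using that R by (intro mult_mono) auto
      moreover have "0 \<le> R * R" by simp
      ultimately have "2 * R\<^sup>2 \<le> x \<bullet> x" unfolding power2_norm_eq_inner[symmetric] power2_eq_square by linarith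
      then show ?thesis unfolding S_def by (rule S0)
    qed
    have sm: "(\<lambda>x. sgn (k x)) \<in> borel_measurable lebesgue" by measurable
    have s1: "\<bar>sgn (k x)\<bar> \<le> 1" for x by (simp add: sgn_if)
    obtain p where p: "\<And>n::nat. real_polynomial_function (p n)" "\<And>n x. x \<in> cball 0 (2 * R) \<Longrightarrow> \<bar>p n x\<bar> \<le> 1 + 1"
      "AE x in lebesgue. x \<in> cball 0 (2 * R) \<longrightarrow> (\<lambda>n. p n x) \<longlonglongrightarrow> sgn (k x)"
      using bounded_polynomial_approximation[OF sm s1, of "2 * R"] by blast
    have kS: "integrable lebesgue (\<lambda>x. k x * S x)"
      using k(1)[OF S[of "\<lambda>_. 1"]] real_polynomial_function.intros(2)[of 1] by simp
    have "(\<lambda>n. \<integral>x. k x * (S x * p n x) \<partial>lebesgue) \<longlonglongrightarrow> (\<integral>x. \<bar>k x * S x\<bar> \<partial>lebesgue)"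
    proof (rule integral_dominated_convergence)
      show "integrable lebesgue (\<lambda>x. 2 * \<bar>k x * S x\<bar>)" using kS by auto
      show "(\<lambda>x. k x * (S x * p n x)) \<in> borel_measurable lebesgue" for n using k(1)[OF S[OF p(1)]] by auto
      show "AE x in lebesgue. (\<lambda>n. k x * (S x * p n x)) \<longlonglongrightarrow> \<bar>k x * S x\<bar>" using p(3)
      proof eventually_elim
        case (elim x)
        show ?case
        proof (cases "x \<in> cball 0 (2 * R)")
          case True
          have "(\<lambda>n. k x * (S x * p n x)) \<longlonglongrightarrow> k x * (S x * sgn (k x))" using elim True by (intro tendsto_intros) auto
          also have "k x * (S x * sgn (k x)) = \<bar>k x * S x\<bar>" using \<sigma>(4) by (simp add: abs_mult S_def sgn_if)
          finally show ?thesis .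
        qed (simp add: Sout)
      qed
      show "AE x in lebesgue. norm (k x * (S x * p n x)) \<le> 2 * \<bar>k x * S x\<bar>" for n
      proof (intro AE_I2)
        fix x
        show "norm (k x * (S x * p n x)) \<le> 2 * \<bar>k x * S x\<bar>"
        proof (cases "x \<in> cball 0 (2 * R)")
          case True
          then show ?thesis using mult_left_mono[OF p(2)[OF True, of n], of "\<bar>k x * S x\<bar>"] by (simp add: abs_mult mult_ac)
        qed (simp add: Sout)
      qed
    qed measurable
    then have "(\<integral>x. \<bar>k x * S x\<bar> \<partial>lebesgue) = 0" using k(2)[OF S[OF p(1)]] by (simp add: LIMSEQ_const_iff)
    then have "AE x in lebesgue. \<bar>k x * S x\<bar> = 0"
      using kS by (subst (asm) integral_nonneg_eq_0_iff_AE) auto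
    then show ?thesis
    proof eventually_elim
      case (elim x)
      have "S x = 1" if "norm x \<le> R"
      proof -
        have "norm x * norm x \<le> R * R" using that R by (intro mult_mono) auto
        then have "x \<bullet> x \<le> R\<^sup>2" unfolding power2_norm_eq_inner[symmetric] by (simp add: power2_eq_square)
        then show ?thesis unfolding S_def using R by (intro \<sigma>(2)) (simp add: field_simps)
      qed
      then show ?case using elim by (auto simp: k_def)
    qed
  qed
  have "AE x in lebesgue. \<forall>n i. norm x \<le> real (Suc n) \<longrightarrow> g x $ i = h x $ i"
    unfolding AE_all_countable using comp by simp
  then show ?thesis
  proof eventually_elim
    case (elim x)
    obtain n :: nat where "norm x \<le> real n" using real_arch_simple by blast
    then have "norm x \<le> real (Suc n)" by simp
    then show ?case using elim by (auto simp: vec_eq_iff)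
  qed
qed

lemma test_fun_differentiable:
  assumes "test_fun \<psi>"
  shows "(\<psi> has_derivative (\<lambda>h. \<Sum>i\<in>UNIV. h $ i * partial \<psi> i x)) (at x)" "continuous_on UNIV (partial \<psi> i)"
proof -
  have s: "smooth3 \<psi>" using assms by (simp add: test_fun_def)
  then have d: "\<psi> differentiable at x" for x by (auto elim: smooth3.cases)
  have sp: "smooth3 (partial \<psi> i)" using s by (auto elim: smooth3.cases)
  then have "partial \<psi> i differentiable at x" for x by (auto elim: smooth3.cases)
  then show "continuous_on UNIV (partial \<psi> i)"
    by (meson continuous_at_imp_continuous_on differentiable_imp_continuous_within)
  have f: "(\<psi> has_derivative frechet_derivative \<psi> (at x)) (at x)" using d by (simp add: frechet_derivative_works)
  then have lin: "linear (frechet_derivative \<psi> (at x))" by (simp add: has_derivative_linear)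
  have "frechet_derivative \<psi> (at x) h = (\<Sum>i\<in>UNIV. h $ i * partial \<psi> i x)" for h
  proof -
    have "frechet_derivative \<psi> (at x) h = frechet_derivative \<psi> (at x) (\<Sum>i\<in>UNIV. h $ i *\<^sub>R axis i 1)"
      by (simp add: basis_expansion scalar_mult_eq_scaleR[symmetric])
    also have "\<dots> = (\<Sum>i\<in>UNIV. h $ i * partial \<psi> i x)"
      using lin by (simp add: linear_sum linear_cmul partial_def)
    finally show ?thesis .
  qed
  then have "frechet_derivative \<psi> (at x) = (\<lambda>h. \<Sum>i\<in>UNIV. h $ i * partial \<psi> i x)" by (rule ext)
  then show "(\<psi> has_derivative (\<lambda>h. \<Sum>i\<in>UNIV. h $ i * partial \<psi> i x)) (at x)" using f by metis
qed

lemma test_fun_bounds: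
  assumes "test_fun \<psi>"
  obtains \<rho> L where "\<rho> > 0" "L \<ge> 0" "\<And>x. norm x > \<rho> \<Longrightarrow> \<psi> x = 0" "\<And>i x. norm x > \<rho> \<Longrightarrow> partial \<psi> i x = 0"
    "\<And>x. \<bar>\<psi> x\<bar> \<le> L" "\<And>i x. \<bar>partial \<psi> i x\<bar> \<le> L" "\<And>x y. \<bar>\<psi> x - \<psi> y\<bar> \<le> L * norm (x - y)"
proof -
  have "bounded {x. \<psi> x \<noteq> 0}" using assms compact_imp_bounded bounded_subset closure_subset unfolding test_fun_def by metis
  then obtain \<rho>0 where "\<And>x. \<psi> x \<noteq> 0 \<Longrightarrow> norm x \<le> \<rho>0" unfolding bounded_iff by auto
  then obtain \<rho> where \<rho>: "\<rho> > 0" "\<And>x. norm x > \<rho> \<Longrightarrow> \<psi> x = 0"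
    by (metis abs_ge_self abs_ge_zero add_pos_nonneg add.commute less_add_one not_le order_le_less_trans zero_less_one)
  have pz: "partial \<psi> i x = 0" if "norm x > \<rho>" for i x
  proof -
    have "\<forall>\<^sub>F y in nhds x. norm y > \<rho>"
      using that by (intro eventually_nhds_in_open[of "{y. \<rho> < norm y}", THEN eventually_mono] open_Collect_less continuous_intros) auto
    then have "\<forall>\<^sub>F y in nhds x. 0 = \<psi> y" by eventually_elim (simp add: \<rho>(2))
    then have "\<forall>\<^sub>F y in at x. 0 = \<psi> y" by (auto simp: eventually_at_filter elim: eventually_mono)
    from has_derivative_transform_eventually[OF has_derivative_const this] \<rho>(2)[OF that]
    have "(\<psi> has_derivative (\<lambda>h. 0)) (at x)" by simp
    then have "frechet_derivative \<psi> (at x) = (\<lambda>h. 0)" by (metis frechet_derivative_at)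
    then show ?thesis by (simp add: partial_def)
  qed
  have bd: "\<exists>B. \<forall>x. \<bar>f x\<bar> \<le> B" if c: "continuous_on UNIV f" and z: "\<And>x. norm x > \<rho> \<Longrightarrow> f x = 0" for f :: "real^3 \<Rightarrow> real"
  proof -
    have "bounded (f ` cball 0 \<rho>)" using c
      by (intro compact_imp_bounded compact_continuous_image) (auto intro: continuous_on_subset)
    then obtain B where B: "\<And>x. norm x \<le> \<rho> \<Longrightarrow> \<bar>f x\<bar> \<le> B" unfolding bounded_iff by (metis imageI mem_cball_0 real_norm_def)
    have "\<bar>f x\<bar> \<le> \<bar>B\<bar>" for x using B[of x] z[of x] by (cases "norm x \<le> \<rho>") auto
    then show ?thesis by blast
  qed
  have "continuous_on UNIV \<psi>"
    using has_derivative_continuous[OF test_fun_differentiable(1)[OF assms]] by (simp add: continuous_at_imp_continuous_on)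
  then obtain B0 where B0: "\<And>x. \<bar>\<psi> x\<bar> \<le> B0" using bd \<rho>(2) by blast
  have "\<exists>B. \<forall>x. \<bar>partial \<psi> i x\<bar> \<le> B" for i by (rule bd[OF test_fun_differentiable(2)[OF assms] pz])
  then obtain B where B: "\<And>i x. \<bar>partial \<psi> i x\<bar> \<le> B i" by metis
  define L where "L = B0 + (\<Sum>i\<in>UNIV. B i)"
  have Bi: "0 \<le> B i" for i using B[where i=i] abs_ge_zero order_trans by blast
  have B00: "0 \<le> B0" using B0 abs_ge_zero order_trans by blast
  have lip: "\<bar>\<psi> x - \<psi> y\<bar> \<le> L * norm (x - y)" for x y
  proof -
    have "norm (\<psi> x - \<psi> y) \<le> L * norm (x - y)"
    proof (rule differentiable_bound[where S=UNIV and f'="\<lambda>x h. \<Sum>i\<in>UNIV. h $ i * partial \<psi> i x"])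
      fix z :: "real^3"
      show "onorm (\<lambda>h. \<Sum>i\<in>UNIV. h $ i * partial \<psi> i z) \<le> L"
      proof (rule onorm_le)
        fix h :: "real^3"
        have "norm (\<Sum>i\<in>UNIV. h $ i * partial \<psi> i z) \<le> (\<Sum>i\<in>UNIV. norm h * B i)"
          by (intro sum_norm_le) (auto simp: abs_mult intro!: mult_mono component_le_norm_cart B)
        also have "\<dots> \<le> norm h * L" unfolding sum_distrib_left[symmetric] L_def
          using B00 by (intro mult_left_mono) auto
        also have "\<dots> = L * norm h" by (rule mult.commute)
        finally show "norm (\<Sum>i\<in>UNIV. h $ i * partial \<psi> i z) \<le> L * norm h" .
      qed
    qed (auto intro: test_fun_differentiable(1)[OF assms])
    then show ?thesis by simp
  qed
  show ?thesis
  proof (rule that[OF \<rho>(1) _ \<rho>(2) pz _ _ lip])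
    have "0 \<le> (\<Sum>i\<in>UNIV. B i)" using Bi by (intro sum_nonneg) auto
    then show "L \<ge> 0" "\<bar>\<psi> x\<bar> \<le> L" for x using B0[of x] B00 by (auto simp: L_def)
    have "B i \<le> (\<Sum>i\<in>UNIV. B i)" for i using Bi by (intro member_le_sum) auto
    then show "\<bar>partial \<psi> i x\<bar> \<le> L" for i x using B[of i x] B00 unfolding L_def by (meson add_increasing order_trans)
  qed auto
qed

section \<open>Integration by parts for functions that are singular at the origin\<close>

lemma lborel_integral_translation:
  fixes f :: "'a::euclidean_space \<Rightarrow> real"
  assumes [measurable]: "f \<in> borel_measurable borel"
  shows "integrable lborel (\<lambda>x. f (c + x)) \<longleftrightarrow> integrable lborel f" "(\<integral>x. f (c + x) \<partial>lborel) = (\<integral>x. f x \<partial>lborel)"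
  using integrable_distr_eq[of "(+) c" lborel borel f] integral_distr[of "(+) c" lborel borel f]
  by (simp_all add: lborel_distr_plus)

lemma integrable_lebesgue_Borel:
  fixes f :: "'a::euclidean_space \<Rightarrow> real"
  assumes "f \<in> borel_measurable borel"
  shows "integrable lebesgue f \<longleftrightarrow> integrable lborel f" "(\<integral>x. f x \<partial>lebesgue) = (\<integral>x. f x \<partial>lborel)"
  using assms by (auto simp: integrable_completion integral_completion)

lemma integrable_indicator_cball: "integrable lborel (indicator (cball (c::'a::euclidean_space) r) :: _ \<Rightarrow> real)"
  using emeasure_bounded_finite[OF bounded_cball] by (intro integrable_real_indicator) auto

text \<open>Difference quotients have integral zero by translation invariance, and the Lipschitz
  bound dominates them. Regularity is required only away from the origin, where radial functions may
  fail to be differentiable, and only for points at distance at most 1, because the increments are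
  at most 1.\<close>

lemma integral_partial_eq_0:
  fixes \<zeta> :: "real^3 \<Rightarrow> real"
  assumes m: "\<zeta> \<in> borel_measurable borel" "\<zeta>' \<in> borel_measurable borel"
    and d: "\<And>x. x \<noteq> 0 \<Longrightarrow> ((\<lambda>t. \<zeta> (x + t *\<^sub>R axis i 1)) has_real_derivative \<zeta>' x) (at 0)"
    and bd: "\<And>x. x \<noteq> 0 \<Longrightarrow> \<bar>\<zeta> x\<bar> \<le> L" and out: "\<And>x. norm x > \<rho> \<Longrightarrow> \<zeta> x = 0" and \<rho>: "\<rho> > 0"
    and lip: "\<And>x y. x \<noteq> 0 \<Longrightarrow> y \<noteq> 0 \<Longrightarrow> norm (x - y) \<le> 1 \<Longrightarrow> \<bar>\<zeta> x - \<zeta> y\<bar> \<le> L * norm (x - y)"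
  shows "integrable lborel \<zeta>' \<and> (\<integral>x. \<zeta>' x \<partial>lborel) = 0"
proof
  note [measurable] = m
  define t where "t n = 1 / real (Suc n)" for n
  have t: "t n > 0" "t n \<le> 1" for n by (auto simp: t_def)
  define c where "c n = t n *\<^sub>R (axis i 1 :: real^3)" for n
  have nc: "norm (c n) = t n" for n using less_imp_le[OF t(1)[of n]] by (simp add: c_def)
  define Q where "Q n x = (\<zeta> (c n + x) - \<zeta> x) / t n" for n x
  have ae0: "AE x in lborel. x \<noteq> (0::real^3)" by (rule AE_lborel_singleton)
  have L: "L \<ge> 0" using bd[of "axis i 1"] abs_ge_zero[of "\<zeta> (axis i 1)"] by (simp add: axis_eq_0_iff)
  have ib: "integrable lborel (indicator (cball (0::real^3) r) :: _ \<Rightarrow> real)" for r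
    by (rule integrable_indicator_cball)
  have iz: "integrable lborel \<zeta>"
  proof (rule Bochner_Integration.integrable_bound)
    show "integrable lborel (\<lambda>x::real^3. L * indicator (cball 0 \<rho>) x)" using ib by simp
    show "AE x in lborel. norm (\<zeta> x) \<le> norm (L * indicator (cball 0 \<rho>) x)"
      using ae0 by eventually_elim (use bd out L in \<open>auto split: split_indicator\<close>)
  qed measurable
  have Q0: "(\<integral>x. Q n x \<partial>lborel) = 0" for n
    unfolding Q_def using iz lborel_integral_translation[OF m(1), of "c n"] by simp
  \<comment> \<open>Both points of a difference quotient must avoid the origin, for all
    \<open>n\<close> simultaneously.\<close>
  have "AE x in lborel. \<forall>n. x \<noteq> - c n" unfolding AE_all_countable by (auto intro: AE_lborel_singleton)
  with ae0 have ae: "AE x in lborel. x \<noteq> 0 \<and> (\<forall>n. x \<noteq> - c n)" by eventually_elim auto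
  have conv: "AE x in lborel. (\<lambda>n. Q n x) \<longlonglongrightarrow> \<zeta>' x"
    using ae0
  proof eventually_elim
    case (elim x)
    have "((\<lambda>h. (\<zeta> (x + h *\<^sub>R axis i 1) - \<zeta> x) / h) \<longlongrightarrow> \<zeta>' x) (at 0)"
      using d[OF elim] by (simp add: has_field_derivative_iff)
    moreover have "filterlim t (at 0) sequentially"
      unfolding filterlim_at using LIMSEQ_Suc[OF lim_1_over_n[where 'a=real]] t
      by (auto simp: t_def[abs_def] less_imp_neq[symmetric])
    ultimately have "((\<lambda>n. (\<zeta> (x + t n *\<^sub>R axis i 1) - \<zeta> x) / t n) \<longlonglongrightarrow> \<zeta>' x)"
      by (rule filterlim_compose)
    then show ?case by (simp add: Q_def c_def add.commute)
  qed
  have dom: "AE x in lborel. norm (Q n x) \<le> L * indicator (cball 0 (\<rho> + 1)) x" for n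
    using ae
  proof eventually_elim
    case (elim x)
    show ?case
    proof (cases "norm x \<le> \<rho> + 1")
      case True
      have "c n + x \<noteq> 0" using elim by (metis add.commute add_eq_0_iff)
      then have "\<bar>\<zeta> (c n + x) - \<zeta> x\<bar> \<le> L * t n" using lip[of "c n + x" x] elim nc[of n] t[of n] by simp
      then show ?thesis using True t[of n] by (simp add: Q_def abs_divide divide_le_eq)
    next
      case False
      then have "norm (c n + x) > \<rho>" using norm_diff_ineq[of x "c n"] nc[of n] t[of n] by (simp add: add.commute)
      then show ?thesis using False out by (simp add: Q_def)
    qed
  qed
  have iL: "integrable lborel (\<lambda>x::real^3. L * indicator (cball 0 (\<rho> + 1)) x)" using ib by simp
  have Qm: "Q n \<in> borel_measurable lborel" for n unfolding Q_def by measurable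
  show "integrable lborel \<zeta>'"
    by (rule integrable_dominated_convergence[OF _ Qm iL conv dom]) measurable
  have "(\<lambda>n. \<integral>x. Q n x \<partial>lborel) \<longlonglongrightarrow> (\<integral>x. \<zeta>' x \<partial>lborel)"
    by (rule integral_dominated_convergence[OF _ Qm iL conv dom]) measurable
  then show "(\<integral>x. \<zeta>' x \<partial>lborel) = 0" by (simp add: Q0 LIMSEQ_const_iff)
qed

section \<open>Radial vector fields\<close>

text \<open>The field \<open>k(|x|) x\<close> has divergence \<open>d(|x|)\<close>, as \<open>4 \<pi> \<Phi> r\<close> is its flux through the sphere of radius \<open>r\<close>.\<close>

locale radial_flux =
  fixes d :: "real \<Rightarrow> real" and B :: real
  assumes d_meas [measurable]: "d \<in> borel_measurable borel" and d_bound: "\<And>r. \<bar>d r\<bar> \<le> B"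
begin

definition \<Phi> :: "real \<Rightarrow> real" where "\<Phi> r = (\<integral>s. indicator {0<..<r} s * (s\<^sup>2 * d s) \<partial>lborel)"
definition k :: "real \<Rightarrow> real" where "k r = \<Phi> r / r ^ 3"

lemma B_nonneg: "0 \<le> B" using d_bound[of 0] abs_ge_zero order_trans by blast

text \<open>Stated for an arbitrary density \<open>h\<close>, since the fluxes of the polynomial
  approximations need the same bound.\<close>

lemma flux_bound:
  fixes h :: "real \<Rightarrow> real"
  assumes "h \<in> borel_measurable borel" "\<And>s. 0 < s \<Longrightarrow> s < r \<Longrightarrow> \<bar>h s\<bar> \<le> C" "r > 0" "C \<ge> 0"
  shows "integrable lborel (\<lambda>s. indicator {0<..<r} s * (s\<^sup>2 * h s))"
    "\<bar>\<integral>s. indicator {0<..<r} s * (s\<^sup>2 * h s) \<partial>lborel\<bar> \<le> C * r ^ 3"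
proof -
  have le: "\<bar>indicator {0<..<r} s * (s\<^sup>2 * h s)\<bar> \<le> (r\<^sup>2 * C) * indicator {0..r} s" for s
  proof (cases "0 < s \<and> s < r")
    case True
    have "\<bar>h s\<bar> \<le> C" using assms(2) True by blast
    then have "s\<^sup>2 * \<bar>h s\<bar> \<le> r\<^sup>2 * C" using True by (intro mult_mono power_mono) auto
    then show ?thesis using True by (simp add: abs_mult)
  next
    case False
    then show ?thesis using assms(4) by auto
  qed
  have i: "integrable lborel (\<lambda>s. (r\<^sup>2 * C) * indicator {0..r} s)"
    using assms(3) by (intro integrable_mult_right integrable_real_indicator) auto
  show i': "integrable lborel (\<lambda>s. indicator {0<..<r} s * (s\<^sup>2 * h s))"
    by (rule Bochner_Integration.integrable_bound[OF i]) (use assms(1) le assms(4) in \<open>auto simp: abs_mult\<close>)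
  have "\<bar>\<integral>s. indicator {0<..<r} s * (s\<^sup>2 * h s) \<partial>lborel\<bar> \<le> (\<integral>s. \<bar>indicator {0<..<r} s * (s\<^sup>2 * h s)\<bar> \<partial>lborel)"
    by (rule integral_abs_bound)
  also have "\<dots> \<le> (\<integral>s. (r\<^sup>2 * C) * indicator {0..r} s \<partial>lborel)"
    by (intro integral_mono le i integrable_abs[OF i'])
  also have "\<dots> = C * r ^ 3" using assms(3) by (simp add: power2_eq_square power3_eq_cube)
  finally show "\<bar>\<integral>s. indicator {0<..<r} s * (s\<^sup>2 * h s) \<partial>lborel\<bar> \<le> C * r ^ 3" .
qed

lemma k_bound: "\<bar>k r\<bar> \<le> B"
proof (cases "r > 0")
  case True
  then show ?thesis using flux_bound(2)[of d r B] d_bound B_nonneg by (simp add: k_def \<Phi>_def abs_divide divide_le_eq)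
next
  case False
  then have "\<Phi> r = 0" unfolding \<Phi>_def
    by (intro Bochner_Integration.integral_eq_zero_AE) auto
  then show ?thesis using B_nonneg by (simp add: k_def)
qed

lemma k_meas [measurable]: "k \<in> borel_measurable borel"
proof -
  have "(\<lambda>p. indicator {0<..<fst p} (snd p) * ((snd p)\<^sup>2 * d (snd p)))
      = (\<lambda>p. (if 0 < snd p \<and> snd p < fst p then 1 else 0) * ((snd p)\<^sup>2 * d (snd p)))"
    by (auto split: split_indicator)
  moreover have "(\<lambda>p :: real \<times> real. (if 0 < snd p \<and> snd p < fst p then 1 else 0) * ((snd p)\<^sup>2 * d (snd p))) \<in> borel_measurable (borel \<Otimes>\<^sub>M borel)"
    by measurable
  ultimately have "(\<lambda>(r, s). indicator {0<..<r} s * (s\<^sup>2 * d s)) \<in> borel_measurable (borel \<Otimes>\<^sub>M lborel)"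
    by (simp add: case_prod_unfold)
  then have "\<Phi> \<in> borel_measurable borel" unfolding \<Phi>_def[abs_def] by (rule lborel.borel_measurable_lebesgue_integral)
  then show ?thesis unfolding k_def[abs_def] by measurable
qed

text \<open>Since \<open>k\<close> is bounded, \<open>V\<close> is Lipschitz on bounded intervals of
  positive radii. So \<open>V (norm x) * \<psi> x\<close> satisfies the hypotheses of
  \<open>integral_partial_eq_0\<close>, and the product rule yields the weak identity.\<close>

lemma weak_grad_radial:
  assumes V [measurable]: "V \<in> borel_measurable borel" and V': "\<And>r. r > 0 \<Longrightarrow> (V has_real_derivative k r * r) (at r)"
  shows "weak_grad (\<lambda>x. V (norm x)) (\<lambda>x. k (norm x) *\<^sub>R x)"
  unfolding weak_grad_def
proof (intro conjI allI impI)
  show "(\<lambda>x::real^3. V (norm x)) \<in> borel_measurable lebesgue" "(\<lambda>x::real^3. k (norm x) *\<^sub>R x) \<in> borel_measurable lebesgue"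
    by (intro measurable_completion; measurable)+
  fix i :: 3 and \<psi> assume t: "test_fun \<psi>"
  obtain \<rho> L where \<rho>: "\<rho> > 0" "L \<ge> 0" "\<And>x. norm x > \<rho> \<Longrightarrow> \<psi> x = 0" "\<And>i x. norm x > \<rho> \<Longrightarrow> partial \<psi> i x = 0"
    "\<And>x. \<bar>\<psi> x\<bar> \<le> L" "\<And>i x. \<bar>partial \<psi> i x\<bar> \<le> L" "\<And>x y. \<bar>\<psi> x - \<psi> y\<bar> \<le> L * norm (x - y)"
    using test_fun_bounds[OF t] by metis
  have [measurable]: "\<psi> \<in> borel_measurable borel" "partial \<psi> i \<in> borel_measurable borel"
    using has_derivative_continuous[OF test_fun_differentiable(1)[OF t]] test_fun_differentiable(2)[OF t]
    by (auto intro!: borel_measurable_continuous_onI simp: continuous_at_imp_continuous_on)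
  \<comment> \<open>One unit more than the support of \<open>\<psi>\<close>, because the Lipschitz
    estimate compares points at distance up to 1, one of which may lie outside.\<close>
  define R where "R = \<rho> + 1"
  have R: "R > 0" using \<rho> by (simp add: R_def)
  have Vlip: "\<bar>V r - V s\<bar> \<le> B * R * \<bar>r - s\<bar>" if "0 < r" "r \<le> R" "0 < s" "s \<le> R" for r s
  proof -
    have "norm (V r - V s) \<le> B * R * norm (r - s)"
    proof (rule field_differentiable_bound[of "{0<..R}" V "\<lambda>r. k r * r"])
      show "(V has_real_derivative k z * z) (at z within {0<..R})" if "z \<in> {0<..R}" for z
        using V' that by (auto intro: has_field_derivative_at_within)
      show "norm (k z * z) \<le> B * R" if "z \<in> {0<..R}" for z
        using k_bound[of z] that B_nonneg by (auto simp: abs_mult intro!: mult_mono)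
    qed (use that in auto)
    then show ?thesis by simp
  qed
  define U where "U = \<bar>V R\<bar> + B * R * R"
  have VU: "\<bar>V r\<bar> \<le> U" if "0 < r" "r \<le> R" for r
  proof -
    have "B * R * \<bar>r - R\<bar> \<le> B * R * R" using that B_nonneg R by (intro mult_left_mono) auto
    then show ?thesis using Vlip[OF that R order_refl] by (simp add: U_def)
  qed
  have U0: "U \<ge> 0" using B_nonneg R by (simp add: U_def)
  define \<zeta> where "\<zeta> x = V (norm x) * \<psi> x" for x
  define \<zeta>' where "\<zeta>' x = V (norm x) * partial \<psi> i x + (k (norm x) *\<^sub>R x) $ i * \<psi> x" for x
  have ib: "integrable lborel (indicator (cball (0::real^3) r) :: _ \<Rightarrow> real)" for r
    by (rule integrable_indicator_cball)
  have ae0: "AE x in lborel. x \<noteq> (0::real^3)" by (rule AE_lborel_singleton)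
  have i1: "integrable lborel (\<lambda>x. V (norm x) * partial \<psi> i x)"
  proof (rule Bochner_Integration.integrable_bound)
    show "integrable lborel (\<lambda>x::real^3. U * L * indicator (cball 0 \<rho>) x)" using ib by simp
    show "AE x in lborel. norm (V (norm x) * partial \<psi> i x) \<le> norm (U * L * indicator (cball 0 \<rho>) x)"
      using ae0
    proof eventually_elim
      case (elim x)
      show ?case
      proof (cases "norm x \<le> \<rho>")
        case True
        then have "\<bar>V (norm x)\<bar> \<le> U" using elim by (intro VU) (auto simp: R_def)
        then have "\<bar>V (norm x)\<bar> * \<bar>partial \<psi> i x\<bar> \<le> U * L" using \<rho>(6) U0 by (intro mult_mono) auto
        then show ?thesis using True U0 \<rho>(2) by (simp add: abs_mult)
      qed (simp add: \<rho>(4))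
    qed
  qed measurable
  have "integrable lborel \<zeta>' \<and> (\<integral>x. \<zeta>' x \<partial>lborel) = 0"
  proof (rule integral_partial_eq_0[where \<zeta>=\<zeta> and i=i and \<rho>=\<rho> and L="U * L + L * (B * R)"])
    show "\<zeta> \<in> borel_measurable borel" unfolding \<zeta>_def[abs_def] by measurable
    show "\<zeta>' \<in> borel_measurable borel" unfolding \<zeta>'_def[abs_def] vector_scaleR_component by measurable
    fix x :: "real^3" assume x: "x \<noteq> 0"
    have "(norm has_derivative (\<lambda>h. (x \<bullet> h) / norm x)) (at x)"
      using has_derivative_norm[OF x] by (simp add: sgn_div_norm inner_commute divide_inverse mult.commute)
    from has_derivative_compose[OF this has_field_derivative_imp_has_derivative[OF V']] x
    have dV: "((\<lambda>x. V (norm x)) has_derivative (\<lambda>h. k (norm x) * (x \<bullet> h))) (at x)" by simp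
    have "(\<zeta> has_derivative (\<lambda>h. V (norm x) * (\<Sum>i\<in>UNIV. h $ i * partial \<psi> i x) + (k (norm x) * (x \<bullet> h)) * \<psi> x)) (at x)"
      unfolding \<zeta>_def[abs_def] by (rule has_derivative_mult[OF dV test_fun_differentiable(1)[OF t]])
    then have dz: "(\<zeta> has_derivative (\<lambda>h. V (norm x) * (\<Sum>i\<in>UNIV. h $ i * partial \<psi> i x) + (k (norm x) * (x \<bullet> h)) * \<psi> x)) (at (x + 0 *\<^sub>R axis i 1))"
      by simp
    have "((\<lambda>t. x + t *\<^sub>R axis i 1) has_derivative (\<lambda>t. t *\<^sub>R axis i 1)) (at 0)" by (auto intro!: derivative_eq_intros)
    from has_derivative_compose[OF this dz]
    have "((\<lambda>t. \<zeta> (x + t *\<^sub>R axis i 1)) has_derivative (\<lambda>t. V (norm x) * (\<Sum>j\<in>UNIV. (t *\<^sub>R axis i 1 :: real^3) $ j * partial \<psi> j x) + (k (norm x) * (x \<bullet> (t *\<^sub>R axis i 1))) * \<psi> x)) (at 0)" .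
    moreover have "V (norm x) * (\<Sum>j\<in>UNIV. (t *\<^sub>R axis i 1 :: real^3) $ j * partial \<psi> j x) + (k (norm x) * (x \<bullet> (t *\<^sub>R axis i 1))) * \<psi> x
        = \<zeta>' x * t" for t
    proof -
      have "(\<Sum>j\<in>UNIV. (t *\<^sub>R axis i 1 :: real^3) $ j * partial \<psi> j x) = t * partial \<psi> i x"
        by (simp add: axis_def if_distrib[where f="\<lambda>z. t * z * partial \<psi> _ x"] sum.delta cong: if_cong)
      then show ?thesis by (simp only: \<zeta>'_def) (simp add: inner_axis algebra_simps)
    qed
    ultimately show "((\<lambda>t. \<zeta> (x + t *\<^sub>R axis i 1)) has_real_derivative \<zeta>' x) (at 0)"
      unfolding has_field_derivative_def by (simp only:)
    show "\<bar>\<zeta> x\<bar> \<le> U * L + L * (B * R)"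
    proof (cases "norm x \<le> \<rho>")
      case True
      then have "\<bar>V (norm x)\<bar> \<le> U" using x by (intro VU) (auto simp: R_def)
      then have "\<bar>V (norm x)\<bar> * \<bar>\<psi> x\<bar> \<le> U * L" using \<rho>(5) U0 by (intro mult_mono) auto
      moreover have "0 \<le> L * (B * R)" using \<rho>(2) B_nonneg R by simp
      ultimately show ?thesis by (simp add: \<zeta>_def abs_mult)
    qed (use \<rho>(2) B_nonneg R U0 in \<open>simp add: \<zeta>_def \<rho>(3)\<close>)
    fix y :: "real^3" assume y: "y \<noteq> 0" and xy: "norm (x - y) \<le> 1"
    show "\<bar>\<zeta> x - \<zeta> y\<bar> \<le> (U * L + L * (B * R)) * norm (x - y)"
    proof (cases "norm x > \<rho> \<and> norm y > \<rho>")
      case True then show ?thesis using \<rho>(2,3) B_nonneg R U0 by (simp add: \<zeta>_def)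
    next
      case False
      then have le: "norm x \<le> R" "norm y \<le> R"
        using xy norm_triangle_ineq2[of x y] norm_triangle_ineq2[of y x] by (auto simp: R_def norm_minus_commute)
      have "\<zeta> x - \<zeta> y = V (norm x) * (\<psi> x - \<psi> y) + \<psi> y * (V (norm x) - V (norm y))"
        by (simp add: \<zeta>_def algebra_simps)
      also have "\<bar>\<dots>\<bar> \<le> \<bar>V (norm x)\<bar> * \<bar>\<psi> x - \<psi> y\<bar> + \<bar>\<psi> y\<bar> * \<bar>V (norm x) - V (norm y)\<bar>"
        by (metis abs_mult abs_triangle_ineq)
      also have "\<dots> \<le> U * (L * norm (x - y)) + L * (B * R * norm (x - y))"
      proof (intro add_mono mult_mono)
        have "\<bar>V (norm x) - V (norm y)\<bar> \<le> B * R * \<bar>norm x - norm y\<bar>" using x y le by (intro Vlip) auto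
        also have "\<dots> \<le> B * R * norm (x - y)" using B_nonneg R norm_triangle_ineq3[of x y] by (intro mult_left_mono) auto
        finally show "\<bar>V (norm x) - V (norm y)\<bar> \<le> B * R * norm (x - y)" .
      qed (use x le VU \<rho>(2,5,7) U0 in auto)
      finally show ?thesis by (simp add: algebra_simps)
    qed
  qed (use \<rho> in \<open>auto simp: \<zeta>_def\<close>)
  then have i: "integrable lborel \<zeta>'" and z: "(\<integral>x. \<zeta>' x \<partial>lborel) = 0" by auto
  have "integrable lborel (\<lambda>x. \<zeta>' x - V (norm x) * partial \<psi> i x)" using i i1 by (rule Bochner_Integration.integrable_diff)
  then have i2: "integrable lborel (\<lambda>x. (k (norm x) *\<^sub>R x) $ i * \<psi> x)" by (simp add: \<zeta>'_def)
  have z': "(\<integral>x. V (norm x) * partial \<psi> i x \<partial>lborel) + (\<integral>x. (k (norm x) *\<^sub>R x) $ i * \<psi> x \<partial>lborel) = 0"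
    using z i1 i2 unfolding \<zeta>'_def by simp
  have m1: "(\<lambda>x. V (norm x) * partial \<psi> i x) \<in> borel_measurable borel" by measurable
  have m2: "(\<lambda>x. (k (norm x) *\<^sub>R x) $ i * \<psi> x) \<in> borel_measurable borel" unfolding vector_scaleR_component by measurable
  show "integrable lebesgue (\<lambda>x. V (norm x) * partial \<psi> i x)" using i1 integrable_lebesgue_Borel(1)[OF m1] by simp
  show "integrable lebesgue (\<lambda>x. (k (norm x) *\<^sub>R x) $ i * \<psi> x)" using i2 integrable_lebesgue_Borel(1)[OF m2] by simp
  show "(\<integral>x. V (norm x) * partial \<psi> i x \<partial>lebesgue) = - (\<integral>x. (k (norm x) *\<^sub>R x) $ i * \<psi> x \<partial>lebesgue)"
    using z' integrable_lebesgue_Borel(2)[OF m1] integrable_lebesgue_Borel(2)[OF m2] by simp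
qed

end

section \<open>Smooth radial fields as test fields\<close>

lemma partial_radial:
  assumes "\<And>t. (m has_real_derivative m' t) (at t)"
  shows "partial (\<lambda>x. m (x \<bullet> x)) i x = m' (x \<bullet> x) * (2 * x $ i)"
    and "partial (\<lambda>x. m (x \<bullet> x) * x $ i) i x = m (x \<bullet> x) + m' (x \<bullet> x) * (2 * (x $ i)\<^sup>2)"
proof -
  have d: "((\<lambda>x. m (x \<bullet> x)) has_derivative (\<lambda>h. m' (x \<bullet> x) * (2 * (x \<bullet> h)))) (at x)" by (rule radial_has_derivative[OF assms])
  from frechet_derivative_at[OF d] show "partial (\<lambda>x. m (x \<bullet> x)) i x = m' (x \<bullet> x) * (2 * x $ i)"
    by (simp add: partial_def inner_axis flip: fun_cong[OF frechet_derivative_at[OF d]])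
  have "((\<lambda>x :: real^3. x $ i) has_derivative (\<lambda>h. h $ i)) (at x)"
    by (rule bounded_linear_imp_has_derivative[OF bounded_linear_vec_nth])
  from frechet_derivative_at[OF has_derivative_mult[OF d this]]
  show "partial (\<lambda>x. m (x \<bullet> x) * x $ i) i x = m (x \<bullet> x) + m' (x \<bullet> x) * (2 * (x $ i)\<^sup>2)"
    unfolding partial_def
    by (subst fun_cong[OF frechet_derivative_at[OF has_derivative_mult[OF d \<open>((\<lambda>x. x $ i) has_derivative (\<lambda>h. h $ i)) (at x)\<close>]], symmetric])
      (simp add: inner_axis power2_eq_square)
qed

text \<open>Summing the weak identities for the components \<open>m (x \<bullet> x) * x $ i\<close>
  tests \<open>v\<close> against the divergence of the field \<open>m(|x|^2) x\<close>.\<close>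

lemma weak_divergence_smooth:
  assumes w: "weak_grad v g" and m: "smooth1 m" "\<And>t. (m has_real_derivative m' t) (at t)" "\<And>t. T \<le> t \<Longrightarrow> m t = 0"
  shows "(\<integral>x. v x * (3 * m (x \<bullet> x) + 2 * (x \<bullet> x) * m' (x \<bullet> x)) \<partial>lebesgue) = - (\<integral>x. m (x \<bullet> x) * (g x \<bullet> x) \<partial>lebesgue)"
proof -
  define \<psi> where "\<psi> i x = m (x \<bullet> x) * x $ i" for i and x :: "real^3"
  have t: "test_fun (\<psi> i)" for i unfolding \<psi>_def[abs_def] by (rule test_fun_cutoff[OF m(1,3) smooth_class.coord])
  have p: "partial (\<psi> i) i x = m (x \<bullet> x) + m' (x \<bullet> x) * (2 * (x $ i)\<^sup>2)" for i x
    unfolding \<psi>_def[abs_def] by (rule partial_radial(2)[OF m(2)])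
  have inner: "x \<bullet> y = (\<Sum>i\<in>UNIV. x $ i * y $ i)" for x y :: "real^3" by (simp add: inner_vec_def)
  have "(\<Sum>i\<in>UNIV. partial (\<psi> i) i x) = 3 * m (x \<bullet> x) + 2 * (x \<bullet> x) * m' (x \<bullet> x)" for x
  proof -
    have "(\<Sum>i\<in>UNIV. partial (\<psi> i) i x) = 3 * m (x \<bullet> x) + m' (x \<bullet> x) * (2 * (\<Sum>i\<in>UNIV. (x $ i)\<^sup>2))"
      by (simp add: p sum.distrib sum_distrib_left)
    also have "(\<Sum>i\<in>UNIV. (x $ i)\<^sup>2) = x \<bullet> x" by (simp add: inner power2_eq_square)
    finally show ?thesis by simp
  qed
  then have "(\<integral>x. v x * (3 * m (x \<bullet> x) + 2 * (x \<bullet> x) * m' (x \<bullet> x)) \<partial>lebesgue) = (\<integral>x. (\<Sum>i\<in>UNIV. v x * partial (\<psi> i) i x) \<partial>lebesgue)"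
    by (simp add: sum_distrib_left[symmetric])
  also have "\<dots> = (\<Sum>i\<in>UNIV. \<integral>x. v x * partial (\<psi> i) i x \<partial>lebesgue)"
    by (rule Bochner_Integration.integral_sum) (rule weak_gradD(3)[OF w t])
  also have "\<dots> = (\<Sum>i\<in>UNIV. - (\<integral>x. g x $ i * \<psi> i x \<partial>lebesgue))" by (simp only: weak_gradD(5)[OF w t])
  also have "\<dots> = - (\<Sum>i\<in>UNIV. \<integral>x. g x $ i * \<psi> i x \<partial>lebesgue)" by (rule sum_negf)
  also have "(\<Sum>i\<in>UNIV. \<integral>x. g x $ i * \<psi> i x \<partial>lebesgue) = (\<integral>x. (\<Sum>i\<in>UNIV. g x $ i * \<psi> i x) \<partial>lebesgue)"
    by (rule Bochner_Integration.integral_sum[symmetric]) (rule weak_gradD(4)[OF w t])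
  also have "\<dots> = (\<integral>x. m (x \<bullet> x) * (g x \<bullet> x) \<partial>lebesgue)"
    unfolding \<psi>_def inner[of "g _"] sum_distrib_left by (simp add: mult_ac)
  finally show ?thesis .
qed

text \<open>Needed because polynomial approximation takes place in the variable \<open>t = |x|\<^sup>2\<close>.\<close>

lemma AE_lborel_sqrt:
  fixes Q :: "real \<Rightarrow> bool"
  assumes "AE t in lborel. Q t" shows "AE r in lborel. r > 0 \<longrightarrow> Q (r\<^sup>2)"
proof -
  from AE_completion[OF assms] obtain N where N: "N \<in> null_sets lebesgue" "{t. \<not> Q t} \<subseteq> N"
    by (auto simp: eventually_ae_filter)
  have "negligible (N \<inter> {0<..})" using N(1) negligible_iff_null_sets negligible_Int by blast
  moreover have "sqrt differentiable_on (N \<inter> {0<..})"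
    unfolding differentiable_on_def using DERIV_real_sqrt differentiable_at_withinI real_differentiable_def
    by (metis IntE greaterThan_iff)
  ultimately have "negligible (sqrt ` (N \<inter> {0<..}))" by (intro negligible_differentiable_image_negligible) auto
  then have "AE r in lebesgue. r \<notin> sqrt ` (N \<inter> {0<..})" by (intro AE_not_in) (simp add: negligible_iff_null_sets)
  then have "AE r in lebesgue. r > 0 \<longrightarrow> Q (r\<^sup>2)"
  proof eventually_elim
    case (elim r)
    show ?case
    proof (rule impI, rule ccontr)
      assume "r > 0" "\<not> Q (r\<^sup>2)"
      then have "r\<^sup>2 \<in> N \<inter> {0<..}" "r = sqrt (r\<^sup>2)" using N(2) by auto
      then show False using elim by blast
    qed
  qed
  then show ?thesis by (simp add: AE_completion_iff)
qed

text \<open>The vector field \<open>Q(|x|\<^sup>2) x\<close> has divergence \<open>3 Q(t) + 2 t Q'(t)\<close> at \<open>t = |x|\<^sup>2\<close>; for polynomial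
  \<open>P\<close> the smooth solution \<open>Q\<close> of \<open>div = P\<close> is explicit.\<close>

lemma polynomial_flux:
  assumes "real_polynomial_function (P :: real \<Rightarrow> real)"
  obtains Q Q' where "smooth1 Q" "\<And>t. (Q has_real_derivative Q' t) (at t)" "\<And>t. 3 * Q t + 2 * t * Q' t = P t"
    "\<And>r. r > 0 \<Longrightarrow> Q (r\<^sup>2) = (\<integral>s. indicator {0<..<r} s * (s\<^sup>2 * P (s\<^sup>2)) \<partial>lborel) / r ^ 3"
proof -
  obtain a n where P: "P = (\<lambda>x. \<Sum>i\<le>n. a i * x ^ i)" using assms real_polynomial_function_iff_sum by blast
  \<comment> \<open>The field \<open>t ^ i\<close> times \<open>x\<close> has divergence
    \<open>(2 * i + 3) * t ^ i\<close>, hence the denominators.\<close>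
  define Q where "Q t = (\<Sum>i\<le>n. a i / (2 * real i + 3) * t ^ i)" for t
  define Q' where "Q' t = (\<Sum>i\<le>n. a i / (2 * real i + 3) * (real i * t ^ (i - 1)))" for t
  have Q: "(Q has_real_derivative Q' t) (at t)" for t
    unfolding Q_def[abs_def] Q'_def by (auto intro!: derivative_eq_intros sum.cong)
  have ode: "3 * Q t + 2 * t * Q' t = P t" for t
  proof -
    have "3 * Q t + 2 * t * Q' t = (\<Sum>i\<le>n. 3 * (a i / (2 * real i + 3) * t ^ i) + 2 * t * (a i / (2 * real i + 3) * (real i * t ^ (i - 1))))"
      by (simp add: Q_def Q'_def sum_distrib_left sum.distrib)
    also have "\<dots> = (\<Sum>i\<le>n. a i * t ^ i)"
    proof (rule sum.cong[OF refl])
      fix i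
      define X where "X = real i * t ^ (i - 1)"
      have X: "X * t = real i * t ^ i" unfolding X_def by (cases i) auto
      have "3 * (a i / (2 * real i + 3) * t ^ i) + 2 * t * (a i / (2 * real i + 3) * X)
          = (a i / (2 * real i + 3)) * (3 * t ^ i + 2 * (X * t))" by (simp add: algebra_simps)
      then have "3 * (a i / (2 * real i + 3) * t ^ i) + 2 * t * (a i / (2 * real i + 3) * (real i * t ^ (i - 1)))
          = (a i / (2 * real i + 3)) * (3 * t ^ i + 2 * (real i * t ^ i))" unfolding X by (simp add: X_def)
      also have "3 * t ^ i + 2 * (real i * t ^ i) = (2 * real i + 3) * t ^ i" by (simp add: algebra_simps)
      also have "a i / (2 * real i + 3) * ((2 * real i + 3) * t ^ i) = a i * t ^ i"
        using of_nat_0_le_iff[of i, where 'a=real] by (simp add: add_nonneg_eq_0_iff)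
      finally show "3 * (a i / (2 * real i + 3) * t ^ i) + 2 * t * (a i / (2 * real i + 3) * (real i * t ^ (i - 1))) = a i * t ^ i" .
    qed
    finally show ?thesis by (simp add: P)
  qed
  have sQ: "smooth1 Q" unfolding Q_def[abs_def] by (intro smooth1_sum smooth1_cmult smooth1_power) auto
  have Pc: "continuous_on S P" for S unfolding P by (intro continuous_intros)
  show ?thesis
  proof (rule that[OF sQ Q ode])
    fix r :: real assume r: "r > 0"
    have "(\<integral>s. indicator {0<..<r} s * (s\<^sup>2 * P (s\<^sup>2)) \<partial>lborel) = r ^ 3 * Q (r\<^sup>2) - 0 ^ 3 * Q (0\<^sup>2)"
    proof (rule FTC_Lebesgue)
      show "((\<lambda>r. r ^ 3 * Q (r\<^sup>2)) has_real_derivative s\<^sup>2 * P (s\<^sup>2)) (at s)" for s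
      proof -
        have "((\<lambda>r. Q (r\<^sup>2)) has_real_derivative Q' (s\<^sup>2) * (2 * s)) (at s)"
          by (rule DERIV_chain2[OF Q]) (auto intro!: derivative_eq_intros)
        then have "((\<lambda>r. r ^ 3 * Q (r\<^sup>2)) has_real_derivative (3 * s\<^sup>2) * Q (s\<^sup>2) + Q' (s\<^sup>2) * (2 * s) * s ^ 3) (at s)"
          by (intro DERIV_mult) (auto intro!: derivative_eq_intros)
        also have "(3 * s\<^sup>2) * Q (s\<^sup>2) + Q' (s\<^sup>2) * (2 * s) * s ^ 3 = s\<^sup>2 * P (s\<^sup>2)"
          unfolding ode[symmetric] by (simp add: power2_eq_square power3_eq_cube algebra_simps)
        finally show ?thesis .
      qed
      show "continuous_on {0..r} (\<lambda>r. r ^ 3 * Q (r\<^sup>2))"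
        by (intro continuous_intros continuous_on_compose2[OF smooth1_continuous[OF sQ, of UNIV]]) auto
      have c: "continuous_on S (\<lambda>s. s\<^sup>2 * P (s\<^sup>2))" for S
        by (intro continuous_intros continuous_on_compose2[OF Pc[of UNIV]]) auto
      show "(\<lambda>s. s\<^sup>2 * P (s\<^sup>2)) \<in> borel_measurable borel" by (rule borel_measurable_continuous_onI[OF c])
      show "integrable lborel (\<lambda>t. indicator {0..r} t * (t\<^sup>2 * P (t\<^sup>2)))"
        by (rule borel_integrable_atLeastAtMost'[OF c, unfolded set_integrable_def real_scaleR_def])
    qed (use r in auto)
    then show "Q (r\<^sup>2) = (\<integral>s. indicator {0<..<r} s * (s\<^sup>2 * P (s\<^sup>2)) \<partial>lborel) / r ^ 3" using r by simp
  qed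
qed

section \<open>Cutoffs, and the passage from polynomial to bounded measurable divergences\<close>

lemma norm_sq_eq: "x \<bullet> x = (norm x)\<^sup>2" by (simp add: power2_norm_eq_inner)

text \<open>In the variable t = |x|^2 the cutoff disturbs the divergence by the term with
  \<open>2 * t * S' t\<close>. The bound \<open>C\<close> on it is independent of the radius
  \<open>\<rho>\<close>, by scaling.\<close>

definition is_cutoff :: "real \<Rightarrow> real \<Rightarrow> (real \<Rightarrow> real) \<Rightarrow> (real \<Rightarrow> real) \<Rightarrow> bool" where
  "is_cutoff C \<rho> S S' \<longleftrightarrow> smooth1 S \<and> smooth1 S' \<and> (\<forall>t. (S has_real_derivative S' t) (at t)) \<and>
    (\<forall>t. t \<le> \<rho>\<^sup>2 \<longrightarrow> S t = 1 \<and> S' t = 0) \<and> (\<forall>t. 2 * \<rho>\<^sup>2 \<le> t \<longrightarrow> S t = 0 \<and> S' t = 0) \<and>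
    (\<forall>t. 0 \<le> S t \<and> S t \<le> 1) \<and> (\<forall>t. \<bar>2 * t * S' t\<bar> \<le> C)"

lemma is_cutoffD:
  assumes "is_cutoff C \<rho> S S'"
  shows "smooth1 S" "smooth1 S'" "(S has_real_derivative S' t) (at t)" "t \<le> \<rho>\<^sup>2 \<Longrightarrow> S t = 1" "t \<le> \<rho>\<^sup>2 \<Longrightarrow> S' t = 0"
    "2 * \<rho>\<^sup>2 \<le> t \<Longrightarrow> S t = 0" "2 * \<rho>\<^sup>2 \<le> t \<Longrightarrow> S' t = 0" "0 \<le> S t" "S t \<le> 1" "\<bar>2 * t * S' t\<bar> \<le> C"
  using assms unfolding is_cutoff_def by auto

lemma cutoff_exists: obtains C where "C \<ge> 0" "\<And>\<rho>. \<rho> > 0 \<Longrightarrow> \<exists>S S'. is_cutoff C \<rho> S S'"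
proof -
  obtain \<sigma> \<sigma>' :: "real \<Rightarrow> real" and C where \<sigma>: "smooth1 \<sigma>" "smooth1 \<sigma>'" "\<And>t. (\<sigma> has_real_derivative \<sigma>' t) (at t)"
    "\<And>t. t \<le> 0 \<Longrightarrow> \<sigma> t = 1" "\<And>t. 1 \<le> t \<Longrightarrow> \<sigma> t = 0" "\<And>t. 0 \<le> \<sigma> t" "\<And>t. \<sigma> t \<le> 1"
    "\<And>t. t \<le> 0 \<Longrightarrow> \<sigma>' t = 0" "\<And>t. 1 \<le> t \<Longrightarrow> \<sigma>' t = 0" "\<And>t. \<bar>\<sigma>' t\<bar> \<le> C" using smooth_step by metis
  have C: "C \<ge> 0" using \<sigma>(10)[of 0] by linarith
  have "\<exists>S S'. is_cutoff (4 * C) \<rho> S S'" if \<rho>: "\<rho> > 0" for \<rho>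
  proof -
    define S S' where "S t = \<sigma> ((1 / \<rho>\<^sup>2) * t + - 1)" and "S' t = (1 / \<rho>\<^sup>2) * \<sigma>' ((1 / \<rho>\<^sup>2) * t + - 1)" for t
    have s: "smooth1 S" "smooth1 S'" unfolding S_def[abs_def] S'_def[abs_def]
      by (rule smooth1.affine[OF \<sigma>(1)]) (rule smooth1_cmult[OF smooth1.affine[OF \<sigma>(2)]])
    have der: "(S has_real_derivative S' t) (at t)" for t
    proof -
      have "((\<lambda>t. c * t + - 1) has_real_derivative c) (at t)" for c by (auto intro!: derivative_eq_intros)
      from DERIV_chain2[OF \<sigma>(3) this[of "1 / \<rho>\<^sup>2"]] show ?thesis by (simp add: S_def[abs_def] S'_def mult.commute)
    qed
    have 1: "(1 / \<rho>\<^sup>2) * t + - 1 \<le> 0" if "t \<le> \<rho>\<^sup>2" for t using that \<rho> by (simp add: field_simps)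
    have 2: "1 \<le> (1 / \<rho>\<^sup>2) * t + - 1" if "2 * \<rho>\<^sup>2 \<le> t" for t using that \<rho> by (simp add: field_simps)
    have in1: "S t = 1 \<and> S' t = 0" if "t \<le> \<rho>\<^sup>2" for t using \<sigma>(4,8)[OF 1[OF that]] by (simp add: S_def S'_def)
    have out: "S t = 0 \<and> S' t = 0" if "2 * \<rho>\<^sup>2 \<le> t" for t using \<sigma>(5,9)[OF 2[OF that]] by (simp add: S_def S'_def)
    have "0 \<le> S t \<and> S t \<le> 1" for t using \<sigma>(6,7) by (simp add: S_def)
    moreover have "\<bar>2 * t * S' t\<bar> \<le> 4 * C" for t
    proof (cases "t \<le> \<rho>\<^sup>2 \<or> 2 * \<rho>\<^sup>2 \<le> t")
      case True then show ?thesis using in1 out C by auto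
    next
      case False
      moreover have "0 \<le> \<rho>\<^sup>2" by simp
      ultimately have "\<bar>2 * t / \<rho>\<^sup>2\<bar> \<le> 4" using \<rho> by (simp add: abs_le_iff divide_le_eq)
      then have "\<bar>2 * t / \<rho>\<^sup>2\<bar> * \<bar>\<sigma>' ((1 / \<rho>\<^sup>2) * t + - 1)\<bar> \<le> 4 * C" using \<sigma>(10) C by (intro mult_mono) auto
      then show ?thesis by (simp add: abs_mult S'_def)
    qed
    ultimately have "is_cutoff (4 * C) \<rho> S S'" unfolding is_cutoff_def using s der in1 out by simp
    then show ?thesis by blast
  qed
  from that[OF _ this] C show ?thesis by simp
qed

lemma smooth1_measurable: "smooth1 g \<Longrightarrow> g \<in> borel_measurable borel"
  by (rule borel_measurable_continuous_onI[OF smooth1_continuous])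

context radial_flux
begin

text \<open>Polynomials approximate the density in the variable t = |x|^2, where their fluxes are
  again polynomial. Densities and fluxes share the bound \<open>B + 1\<close>, and the fluxes
  converge by dominated convergence in the flux integral.\<close>

lemma polynomial_flux_approximation:
  assumes "T > 0"
  obtains P Q Q' where "\<And>n::nat. smooth1 (Q n)" "\<And>n t. (Q n has_real_derivative Q' n t) (at t)"
    "\<And>n t. 3 * Q n t + 2 * t * Q' n t = P n t"
    "\<And>n r. 0 < r \<Longrightarrow> r\<^sup>2 \<le> T \<Longrightarrow> \<bar>P n (r\<^sup>2)\<bar> \<le> B + 1" "\<And>n r. 0 < r \<Longrightarrow> r\<^sup>2 \<le> T \<Longrightarrow> \<bar>Q n (r\<^sup>2)\<bar> \<le> B + 1"
    "\<And>r. 0 < r \<Longrightarrow> r\<^sup>2 \<le> T \<Longrightarrow> (\<lambda>n. Q n (r\<^sup>2)) \<longlonglongrightarrow> k r"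
    "AE x::real^3 in lebesgue. x \<noteq> 0 \<longrightarrow> x \<bullet> x \<le> T \<longrightarrow> (\<lambda>n. P n (x \<bullet> x)) \<longlonglongrightarrow> d (norm x)"
    "\<And>n. P n \<in> borel_measurable borel"
proof -
  have m: "(\<lambda>t. d (sqrt t)) \<in> borel_measurable lebesgue" by (intro measurable_completion) measurable
  have bd: "\<bar>d (sqrt t)\<bar> \<le> B" for t by (rule d_bound)
  obtain P where P: "\<And>n::nat. real_polynomial_function (P n)" "\<And>n t. t \<in> cball 0 T \<Longrightarrow> \<bar>P n t\<bar> \<le> B + 1"
    "AE t in lebesgue. t \<in> cball 0 T \<longrightarrow> (\<lambda>n. P n t) \<longlonglongrightarrow> d (sqrt t)"
    using bounded_polynomial_approximation[OF m bd, of T] by blast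
  define R where "R n Q Q' \<longleftrightarrow> smooth1 Q \<and> (\<forall>t. (Q has_real_derivative Q' t) (at t)) \<and> (\<forall>t. 3 * Q t + 2 * t * Q' t = P n t) \<and>
    (\<forall>r>0. Q (r\<^sup>2) = (\<integral>s. indicator {0<..<r} s * (s\<^sup>2 * P n (s\<^sup>2)) \<partial>lborel) / r ^ 3)" for n Q Q'
  have "\<exists>Q Q'. R n Q Q'" for n
    by (rule polynomial_flux[OF P(1)[of n]]) (unfold R_def, blast)
  then obtain Q Q' where "\<And>n. R n (Q n) (Q' n)" by metis
  then have Q: "\<And>n. smooth1 (Q n)" "\<And>n t. (Q n has_real_derivative Q' n t) (at t)"
    "\<And>n t. 3 * Q n t + 2 * t * Q' n t = P n t"
    "\<And>n r. r > 0 \<Longrightarrow> Q n (r\<^sup>2) = (\<integral>s. indicator {0<..<r} s * (s\<^sup>2 * P n (s\<^sup>2)) \<partial>lborel) / r ^ 3" 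
    unfolding R_def by auto
  have Pm [measurable]: "P n \<in> borel_measurable borel" for n
    using continuous_real_polymonial_function[OF P(1)]
    by (intro borel_measurable_continuous_onI continuous_at_imp_continuous_on) auto
  have Pb: "\<bar>P n (r\<^sup>2)\<bar> \<le> B + 1" if "r\<^sup>2 \<le> T" for n r using that by (intro P(2)) auto
  have ae: "AE r in lborel. r > 0 \<longrightarrow> (r\<^sup>2 \<in> cball 0 T \<longrightarrow> (\<lambda>n. P n (r\<^sup>2)) \<longlonglongrightarrow> d (sqrt (r\<^sup>2)))"
    by (rule AE_lborel_sqrt) (use P(3) in \<open>simp add: AE_completion_iff\<close>)
  show ?thesis
  proof (rule that[OF Q(1-3) Pb])
    show "\<bar>Q n (r\<^sup>2)\<bar> \<le> B + 1" if r: "0 < r" "r\<^sup>2 \<le> T" for n r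
    proof -
      have "\<bar>\<integral>s. indicator {0<..<r} s * (s\<^sup>2 * P n (s\<^sup>2)) \<partial>lborel\<bar> \<le> (B + 1) * r ^ 3"
      proof (rule flux_bound(2))
        show "\<bar>P n (s\<^sup>2)\<bar> \<le> B + 1" if "0 < s" "s < r" for s
        proof (rule Pb)
          have "s\<^sup>2 \<le> r\<^sup>2" using that by (intro power_mono) auto
          then show "s\<^sup>2 \<le> T" using r by simp
        qed
      qed (use r B_nonneg in auto)
      then show ?thesis using r by (simp add: Q(4) abs_divide divide_le_eq)
    qed
    show "(\<lambda>n. Q n (r\<^sup>2)) \<longlonglongrightarrow> k r" if r: "0 < r" "r\<^sup>2 \<le> T" for r
    proof -
      have "(\<lambda>n. \<integral>s. indicator {0<..<r} s * (s\<^sup>2 * P n (s\<^sup>2)) \<partial>lborel) \<longlonglongrightarrow> \<Phi> r"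
        unfolding \<Phi>_def
      proof (rule integral_dominated_convergence)
        show "integrable lborel (\<lambda>s. (r\<^sup>2 * (B + 1)) * indicator {0..r} s)"
          using r by (intro integrable_mult_right integrable_real_indicator) auto
        show "AE s in lborel. (\<lambda>n. indicator {0<..<r} s * (s\<^sup>2 * P n (s\<^sup>2))) \<longlonglongrightarrow> indicator {0<..<r} s * (s\<^sup>2 * d s)"
          using ae
        proof eventually_elim
          case (elim s)
          show ?case
          proof (cases "0 < s \<and> s < r")
            case True
            then have "s\<^sup>2 < r\<^sup>2" by (intro power_strict_mono) auto
            then have "s\<^sup>2 \<le> T" using r by simp
            then have "(\<lambda>n. P n (s\<^sup>2)) \<longlonglongrightarrow> d s" using elim True by simp
            then show ?thesis using True by (auto intro!: tendsto_intros)
          qed auto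
        qed
        show "AE s in lborel. norm (indicator {0<..<r} s * (s\<^sup>2 * P n (s\<^sup>2))) \<le> (r\<^sup>2 * (B + 1)) * indicator {0..r} s" for n
        proof (intro AE_I2)
          fix s
          show "norm (indicator {0<..<r} s * (s\<^sup>2 * P n (s\<^sup>2))) \<le> (r\<^sup>2 * (B + 1)) * indicator {0..r} s"
          proof (cases "0 < s \<and> s < r")
            case True
            then have "s\<^sup>2 \<le> r\<^sup>2" by (intro power_mono) auto
            then have "s\<^sup>2 * \<bar>P n (s\<^sup>2)\<bar> \<le> r\<^sup>2 * (B + 1)" using r by (intro mult_mono Pb) auto
            then show ?thesis using True by (simp add: abs_mult)
          qed (use B_nonneg in auto)
        qed
      qed measurable
      then have "(\<lambda>n. (\<integral>s. indicator {0<..<r} s * (s\<^sup>2 * P n (s\<^sup>2)) \<partial>lborel) / r ^ 3) \<longlonglongrightarrow> \<Phi> r / r ^ 3"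
        using r by (intro tendsto_intros) auto
      then show ?thesis using r by (simp add: Q(4) k_def)
    qed
    have "AE x::real^3 in lborel. x \<noteq> 0 \<longrightarrow> ((norm x)\<^sup>2 \<in> cball 0 T \<longrightarrow> (\<lambda>n. P n ((norm x)\<^sup>2)) \<longlonglongrightarrow> d (sqrt ((norm x)\<^sup>2)))"
      by (rule AE_radial[OF ae])
    then show "AE x::real^3 in lebesgue. x \<noteq> 0 \<longrightarrow> x \<bullet> x \<le> T \<longrightarrow> (\<lambda>n. P n (x \<bullet> x)) \<longlonglongrightarrow> d (norm x)"
      by (intro AE_completion) (auto simp: norm_sq_eq elim!: eventually_mono)
  qed (auto intro: Pm)
qed

end

lemma borel_measurable_lebesgueI: "f \<in> borel_measurable borel \<Longrightarrow> f \<in> borel_measurable lebesgue"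
  by (rule measurable_completion) simp

lemma ball_of_square: assumes "x \<bullet> x \<le> 2 * \<rho>\<^sup>2" "\<rho> > 0" shows "norm x \<le> 2 * \<rho>"
proof (rule power2_le_imp_le)
  have "(norm x)\<^sup>2 \<le> 2 * \<rho>\<^sup>2" using assms(1) by (simp add: norm_sq_eq)
  also have "\<dots> \<le> (2 * \<rho>)\<^sup>2" by (simp add: power_mult_distrib)
  finally show "(norm x)\<^sup>2 \<le> (2 * \<rho>)\<^sup>2" .
qed (use assms in auto)

context radial_flux
begin

text \<open>For a polynomial flux times the cutoff the identity is an instance of
  \<open>weak_divergence_smooth\<close>. Everything lives in the ball of radius
  \<open>2 * \<rho>\<close>, so local integrability of \<open>v\<close> and \<open>g\<close>
  suffices to let the polynomials converge.\<close>

lemma divergence_cutoff: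
  assumes w: "weak_grad v g"
    and locv: "\<And>r. integrable lebesgue (\<lambda>x. indicator (cball 0 r) x * v x)"
    and locg: "\<And>r. integrable lebesgue (\<lambda>x. indicator (cball 0 r) x * norm (g x))"
    and \<rho>: "\<rho> > 0" and S: "is_cutoff C \<rho> S S'"
  shows "(\<integral>x. v x * (S (x \<bullet> x) * d (norm x) + 2 * (x \<bullet> x) * S' (x \<bullet> x) * k (norm x)) \<partial>lebesgue)
       = - (\<integral>x. S (x \<bullet> x) * k (norm x) * (g x \<bullet> x) \<partial>lebesgue)"
proof -
  define T where "T = 2 * \<rho>\<^sup>2"
  have T: "T > 0" using \<rho> by (simp add: T_def)
  obtain P Q Q' where Q: "\<And>n::nat. smooth1 (Q n)" "\<And>n t. (Q n has_real_derivative Q' n t) (at t)"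
    "\<And>n t. 3 * Q n t + 2 * t * Q' n t = P n t"
    "\<And>n r. 0 < r \<Longrightarrow> r\<^sup>2 \<le> T \<Longrightarrow> \<bar>P n (r\<^sup>2)\<bar> \<le> B + 1" "\<And>n r. 0 < r \<Longrightarrow> r\<^sup>2 \<le> T \<Longrightarrow> \<bar>Q n (r\<^sup>2)\<bar> \<le> B + 1"
    "\<And>r. 0 < r \<Longrightarrow> r\<^sup>2 \<le> T \<Longrightarrow> (\<lambda>n. Q n (r\<^sup>2)) \<longlonglongrightarrow> k r"
    "AE x::real^3 in lebesgue. x \<noteq> 0 \<longrightarrow> x \<bullet> x \<le> T \<longrightarrow> (\<lambda>n. P n (x \<bullet> x)) \<longlonglongrightarrow> d (norm x)"
    "\<And>n. P n \<in> borel_measurable borel" by (rule polynomial_flux_approximation[OF T]) blast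
  note S = is_cutoffD[OF S]
  note [measurable] = S(1,2)[THEN smooth1_measurable] Q(1)[THEN smooth1_measurable] Q(8)
  have vm [measurable]: "v \<in> borel_measurable lebesgue" and gm [measurable]: "g \<in> borel_measurable lebesgue"
    using weak_gradD(1,2)[OF w] by auto
  have C: "C \<ge> 0" using S(10)[of 0] by simp
  have ae0: "AE x in lebesgue. x \<noteq> (0::real^3)" by (intro AE_completion AE_lborel_singleton)
  have id: "(\<integral>x. v x * (S (x \<bullet> x) * P n (x \<bullet> x) + 2 * (x \<bullet> x) * S' (x \<bullet> x) * Q n (x \<bullet> x)) \<partial>lebesgue)
      = - (\<integral>x. S (x \<bullet> x) * Q n (x \<bullet> x) * (g x \<bullet> x) \<partial>lebesgue)" for n
  proof -
    have "((\<lambda>t. S t * Q n t) has_real_derivative S' t * Q n t + Q' n t * S t) (at t)" for t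
      by (rule DERIV_mult[OF S(3) Q(2)])
    from weak_divergence_smooth[OF w smooth1.mult[OF S(1) Q(1)] this, of T]
    have "(\<integral>x. v x * (3 * (S (x \<bullet> x) * Q n (x \<bullet> x)) + 2 * (x \<bullet> x) * (S' (x \<bullet> x) * Q n (x \<bullet> x) + Q' n (x \<bullet> x) * S (x \<bullet> x))) \<partial>lebesgue)
        = - (\<integral>x. S (x \<bullet> x) * Q n (x \<bullet> x) * (g x \<bullet> x) \<partial>lebesgue)" using S(6) by (simp add: T_def)
    moreover have "3 * (S t * Q n t) + 2 * t * (S' t * Q n t + Q' n t * S t) = S t * P n t + 2 * t * S' t * Q n t" for t
      unfolding Q(3)[symmetric] by (simp add: algebra_simps)
    ultimately show ?thesis by simp
  qed
  have "(\<lambda>n. \<integral>x. v x * (S (x \<bullet> x) * P n (x \<bullet> x) + 2 * (x \<bullet> x) * S' (x \<bullet> x) * Q n (x \<bullet> x)) \<partial>lebesgue)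
      \<longlonglongrightarrow> (\<integral>x. v x * (S (x \<bullet> x) * d (norm x) + 2 * (x \<bullet> x) * S' (x \<bullet> x) * k (norm x)) \<partial>lebesgue)"
  proof (rule integral_dominated_convergence)
    show "(\<lambda>x. v x * (S (x \<bullet> x) * d (norm x) + 2 * (x \<bullet> x) * S' (x \<bullet> x) * k (norm x))) \<in> borel_measurable lebesgue"
      by (rule borel_measurable_times[OF vm borel_measurable_lebesgueI]) measurable
    show "(\<lambda>x. v x * (S (x \<bullet> x) * P n (x \<bullet> x) + 2 * (x \<bullet> x) * S' (x \<bullet> x) * Q n (x \<bullet> x))) \<in> borel_measurable lebesgue" for n
      by (rule borel_measurable_times[OF vm borel_measurable_lebesgueI]) measurable
    show "integrable lebesgue (\<lambda>x. (B + 1) * (1 + C) * \<bar>indicator (cball 0 (2 * \<rho>)) x * v x\<bar>)"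
      by (intro integrable_mult_right integrable_abs locv)
    show "AE x in lebesgue. (\<lambda>n. v x * (S (x \<bullet> x) * P n (x \<bullet> x) + 2 * (x \<bullet> x) * S' (x \<bullet> x) * Q n (x \<bullet> x)))
        \<longlonglongrightarrow> v x * (S (x \<bullet> x) * d (norm x) + 2 * (x \<bullet> x) * S' (x \<bullet> x) * k (norm x))"
      using Q(7) ae0
    proof eventually_elim
      case (elim x)
      show ?case
      proof (cases "x \<bullet> x \<le> T")
        case True
        then have "(\<lambda>n. P n (x \<bullet> x)) \<longlonglongrightarrow> d (norm x)" using elim by blast
        moreover have "(\<lambda>n. Q n (x \<bullet> x)) \<longlonglongrightarrow> k (norm x)" using Q(6)[of "norm x"] True elim by (simp add: norm_sq_eq)
        ultimately show ?thesis by (intro tendsto_intros)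
      next
        case False
        then show ?thesis using S(6,7)[of "x \<bullet> x"] by (simp add: T_def)
      qed
    qed
    show "AE x in lebesgue. norm (v x * (S (x \<bullet> x) * P n (x \<bullet> x) + 2 * (x \<bullet> x) * S' (x \<bullet> x) * Q n (x \<bullet> x)))
        \<le> (B + 1) * (1 + C) * \<bar>indicator (cball 0 (2 * \<rho>)) x * v x\<bar>" for n
      using ae0
    proof eventually_elim
      case (elim x)
      show ?case
      proof (cases "x \<bullet> x \<le> T")
        case True
        have pq: "\<bar>P n (x \<bullet> x)\<bar> \<le> B + 1" "\<bar>Q n (x \<bullet> x)\<bar> \<le> B + 1"
          using Q(4,5)[of "norm x" n] True elim by (simp_all add: norm_sq_eq)
        have "\<bar>S (x \<bullet> x) * P n (x \<bullet> x)\<bar> \<le> 1 * (B + 1)"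
          unfolding abs_mult using S(8,9)[of "x \<bullet> x"] by (intro mult_mono pq) auto
        moreover have "\<bar>2 * (x \<bullet> x) * S' (x \<bullet> x) * Q n (x \<bullet> x)\<bar> \<le> C * (B + 1)"
          unfolding abs_mult[of "2 * (x \<bullet> x) * S' (x \<bullet> x)"] using C by (intro mult_mono pq S(10)) auto
        ultimately have "\<bar>S (x \<bullet> x) * P n (x \<bullet> x) + 2 * (x \<bullet> x) * S' (x \<bullet> x) * Q n (x \<bullet> x)\<bar> \<le> (B + 1) * (1 + C)"
          by (simp add: algebra_simps)
        from mult_right_mono[OF this, of "\<bar>v x\<bar>"] show ?thesis
          using ball_of_square[OF True[unfolded T_def] \<rho>] by (simp add: abs_mult mult.commute)
      next
        case False
        then show ?thesis using S(6,7)[of "x \<bullet> x"] B_nonneg C by (simp add: T_def)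
      qed
    qed
  qed
  moreover have "(\<lambda>n. \<integral>x. S (x \<bullet> x) * Q n (x \<bullet> x) * (g x \<bullet> x) \<partial>lebesgue)
      \<longlonglongrightarrow> (\<integral>x. S (x \<bullet> x) * k (norm x) * (g x \<bullet> x) \<partial>lebesgue)"
  proof (rule integral_dominated_convergence)
    have gx: "(\<lambda>x. g x \<bullet> x) \<in> borel_measurable lebesgue"
      by (intro borel_measurable_inner gm borel_measurable_lebesgueI) measurable
    show "(\<lambda>x. S (x \<bullet> x) * k (norm x) * (g x \<bullet> x)) \<in> borel_measurable lebesgue"
      by (rule borel_measurable_times[OF borel_measurable_lebesgueI gx]) measurable
    show "(\<lambda>x. S (x \<bullet> x) * Q n (x \<bullet> x) * (g x \<bullet> x)) \<in> borel_measurable lebesgue" for n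
      by (rule borel_measurable_times[OF borel_measurable_lebesgueI gx]) measurable
    show "integrable lebesgue (\<lambda>x. (B + 1) * (2 * \<rho>) * (indicator (cball 0 (2 * \<rho>)) x * norm (g x)))"
      by (intro integrable_mult_right locg)
    show "AE x in lebesgue. (\<lambda>n. S (x \<bullet> x) * Q n (x \<bullet> x) * (g x \<bullet> x)) \<longlonglongrightarrow> S (x \<bullet> x) * k (norm x) * (g x \<bullet> x)"
      using ae0
    proof eventually_elim
      case (elim x)
      show ?case
      proof (cases "x \<bullet> x \<le> T")
        case True
        then have "(\<lambda>n. Q n (x \<bullet> x)) \<longlonglongrightarrow> k (norm x)" using Q(6)[of "norm x"] elim by (simp add: norm_sq_eq)
        then show ?thesis by (intro tendsto_intros)
      next
        case False
        then show ?thesis using S(6,7)[of "x \<bullet> x"] by (simp add: T_def)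
      qed
    qed
    show "AE x in lebesgue. norm (S (x \<bullet> x) * Q n (x \<bullet> x) * (g x \<bullet> x)) \<le> (B + 1) * (2 * \<rho>) * (indicator (cball 0 (2 * \<rho>)) x * norm (g x))" for n
      using ae0
    proof eventually_elim
      case (elim x)
      show ?case
      proof (cases "x \<bullet> x \<le> T")
        case True
        have q: "\<bar>Q n (x \<bullet> x)\<bar> \<le> B + 1" using Q(5)[of "norm x" n] True elim by (simp add: norm_sq_eq)
        have nx: "norm x \<le> 2 * \<rho>" using ball_of_square[OF True[unfolded T_def] \<rho>] .
        have "\<bar>S (x \<bullet> x) * Q n (x \<bullet> x)\<bar> \<le> 1 * (B + 1)"
          unfolding abs_mult using S(8,9)[of "x \<bullet> x"] by (intro mult_mono q) auto
        moreover have "\<bar>g x \<bullet> x\<bar> \<le> norm (g x) * (2 * \<rho>)"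
          by (rule order_trans[OF Cauchy_Schwarz_ineq2]) (use nx in \<open>intro mult_left_mono, auto\<close>)
        ultimately have "\<bar>S (x \<bullet> x) * Q n (x \<bullet> x)\<bar> * \<bar>g x \<bullet> x\<bar> \<le> (1 * (B + 1)) * (norm (g x) * (2 * \<rho>))"
          using B_nonneg by (intro mult_mono) auto
        then show ?thesis using nx by (simp add: abs_mult algebra_simps)
      next
        case False
        then show ?thesis using S(6)[of "x \<bullet> x"] B_nonneg \<rho> by (simp add: T_def)
      qed
    qed
  qed
  ultimately show ?thesis unfolding id using tendsto_minus LIMSEQ_unique by blast
qed

text \<open>The cutoffs are removed along radii \<open>Suc n\<close>. The extra term is dominated by
  \<open>C * \<bar>v x * k (norm x)\<bar>\<close> and is eventually zero at each point, so it
  disappears in the limit.\<close>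

lemma divergence_identity:
  assumes w: "weak_grad v g"
    and locv: "\<And>r. integrable lebesgue (\<lambda>x. indicator (cball 0 r) x * v x)"
    and locg: "\<And>r. integrable lebesgue (\<lambda>x. indicator (cball 0 r) x * norm (g x))"
    and vd: "integrable lebesgue (\<lambda>x. v x * d (norm x))"
    and vk: "integrable lebesgue (\<lambda>x. v x * k (norm x))"
    and gk: "integrable lebesgue (\<lambda>x. k (norm x) * (g x \<bullet> x))"
  shows "(\<integral>x. k (norm x) * (g x \<bullet> x) \<partial>lebesgue) = - (\<integral>x. v x * d (norm x) \<partial>lebesgue)"
proof -
  obtain C where C: "C \<ge> 0" "\<And>\<rho>. \<rho> > 0 \<Longrightarrow> \<exists>S S'. is_cutoff C \<rho> S S'" by (rule cutoff_exists) blast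
  have "\<exists>S S'. is_cutoff C (real (Suc n)) S S'" for n by (rule C(2)) simp
  then obtain S S' where S: "\<And>n. is_cutoff C (real (Suc n)) (S n) (S' n)" by metis
  note SD = is_cutoffD[OF S]
  note [measurable] = SD(1,2)[THEN smooth1_measurable]
  have vm: "v \<in> borel_measurable lebesgue" and gm: "g \<in> borel_measurable lebesgue"
    using weak_gradD(1,2)[OF w] by auto
  have ev: "\<forall>\<^sub>F n in sequentially. x \<bullet> x \<le> (real (Suc n))\<^sup>2" for x :: "real^3"
  proof -
    obtain n0 :: nat where n0: "norm x \<le> real n0" using real_arch_simple by blast
    have "x \<bullet> x \<le> (real (Suc n))\<^sup>2" if "n \<ge> n0" for n
      unfolding norm_sq_eq using n0 that by (intro power_mono) auto
    then show ?thesis unfolding eventually_sequentially by blast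
  qed
  have "(\<lambda>n. \<integral>x. v x * (S n (x \<bullet> x) * d (norm x) + 2 * (x \<bullet> x) * S' n (x \<bullet> x) * k (norm x)) \<partial>lebesgue)
      \<longlonglongrightarrow> (\<integral>x. v x * d (norm x) \<partial>lebesgue)"
  proof (rule integral_dominated_convergence)
    show "(\<lambda>x. v x * d (norm x)) \<in> borel_measurable lebesgue" using vd by auto
    show "(\<lambda>x. v x * (S n (x \<bullet> x) * d (norm x) + 2 * (x \<bullet> x) * S' n (x \<bullet> x) * k (norm x))) \<in> borel_measurable lebesgue" for n
      by (rule borel_measurable_times[OF vm borel_measurable_lebesgueI]) measurable
    show "integrable lebesgue (\<lambda>x. \<bar>v x * d (norm x)\<bar> + C * \<bar>v x * k (norm x)\<bar>)"
      by (intro Bochner_Integration.integrable_add integrable_mult_right integrable_abs vd vk)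
    show "AE x in lebesgue. (\<lambda>n. v x * (S n (x \<bullet> x) * d (norm x) + 2 * (x \<bullet> x) * S' n (x \<bullet> x) * k (norm x))) \<longlonglongrightarrow> v x * d (norm x)"
    proof (intro AE_I2 tendsto_eventually)
      fix x :: "real^3"
      show "\<forall>\<^sub>F n in sequentially. v x * (S n (x \<bullet> x) * d (norm x) + 2 * (x \<bullet> x) * S' n (x \<bullet> x) * k (norm x)) = v x * d (norm x)"
        using ev[of x] by eventually_elim (simp add: SD(4,5))
    qed
    show "AE x in lebesgue. norm (v x * (S n (x \<bullet> x) * d (norm x) + 2 * (x \<bullet> x) * S' n (x \<bullet> x) * k (norm x)))
        \<le> \<bar>v x * d (norm x)\<bar> + C * \<bar>v x * k (norm x)\<bar>" for n
    proof (intro AE_I2)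
      fix x :: "real^3"
      have "\<bar>S n (x \<bullet> x) * d (norm x)\<bar> \<le> 1 * \<bar>d (norm x)\<bar>"
        unfolding abs_mult using SD(8,9)[of n "x \<bullet> x"] by (intro mult_right_mono) auto
      moreover have "\<bar>2 * (x \<bullet> x) * S' n (x \<bullet> x) * k (norm x)\<bar> \<le> C * \<bar>k (norm x)\<bar>"
        unfolding abs_mult[of "2 * (x \<bullet> x) * S' n (x \<bullet> x)"] by (intro mult_right_mono SD(10)) auto
      ultimately have "\<bar>S n (x \<bullet> x) * d (norm x) + 2 * (x \<bullet> x) * S' n (x \<bullet> x) * k (norm x)\<bar> \<le> \<bar>d (norm x)\<bar> + C * \<bar>k (norm x)\<bar>"
        by linarith
      from mult_left_mono[OF this, of "\<bar>v x\<bar>"]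
      have "norm (v x * (S n (x \<bullet> x) * d (norm x) + 2 * (x \<bullet> x) * S' n (x \<bullet> x) * k (norm x)))
        \<le> \<bar>v x\<bar> * (\<bar>d (norm x)\<bar> + C * \<bar>k (norm x)\<bar>)" unfolding real_norm_def abs_mult[of "v x"] by simp
      also have "\<dots> = \<bar>v x * d (norm x)\<bar> + C * \<bar>v x * k (norm x)\<bar>" by (simp add: abs_mult algebra_simps)
      finally show "norm (v x * (S n (x \<bullet> x) * d (norm x) + 2 * (x \<bullet> x) * S' n (x \<bullet> x) * k (norm x)))
        \<le> \<bar>v x * d (norm x)\<bar> + C * \<bar>v x * k (norm x)\<bar>" .
    qed
  qed
  moreover have "(\<lambda>n. \<integral>x. S n (x \<bullet> x) * k (norm x) * (g x \<bullet> x) \<partial>lebesgue) \<longlonglongrightarrow> (\<integral>x. k (norm x) * (g x \<bullet> x) \<partial>lebesgue)"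
  proof (rule integral_dominated_convergence)
    have gx: "(\<lambda>x. g x \<bullet> x) \<in> borel_measurable lebesgue"
      by (intro borel_measurable_inner gm borel_measurable_lebesgueI) measurable
    show "(\<lambda>x. k (norm x) * (g x \<bullet> x)) \<in> borel_measurable lebesgue" using gk by auto
    show "(\<lambda>x. S n (x \<bullet> x) * k (norm x) * (g x \<bullet> x)) \<in> borel_measurable lebesgue" for n
      by (rule borel_measurable_times[OF borel_measurable_lebesgueI gx]) measurable
    show "integrable lebesgue (\<lambda>x. \<bar>k (norm x) * (g x \<bullet> x)\<bar>)" by (rule integrable_abs[OF gk])
    show "AE x in lebesgue. (\<lambda>n. S n (x \<bullet> x) * k (norm x) * (g x \<bullet> x)) \<longlonglongrightarrow> k (norm x) * (g x \<bullet> x)"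
    proof (intro AE_I2 tendsto_eventually)
      fix x :: "real^3"
      show "\<forall>\<^sub>F n in sequentially. S n (x \<bullet> x) * k (norm x) * (g x \<bullet> x) = k (norm x) * (g x \<bullet> x)"
        using ev[of x] by eventually_elim (simp add: SD(4))
    qed
    show "AE x in lebesgue. norm (S n (x \<bullet> x) * k (norm x) * (g x \<bullet> x)) \<le> \<bar>k (norm x) * (g x \<bullet> x)\<bar>" for n
    proof (intro AE_I2)
      fix x :: "real^3"
      have "\<bar>S n (x \<bullet> x)\<bar> * \<bar>k (norm x) * (g x \<bullet> x)\<bar> \<le> 1 * \<bar>k (norm x) * (g x \<bullet> x)\<bar>"
        using SD(8,9)[of n "x \<bullet> x"] by (intro mult_right_mono) auto
      then show "norm (S n (x \<bullet> x) * k (norm x) * (g x \<bullet> x)) \<le> \<bar>k (norm x) * (g x \<bullet> x)\<bar>" by (simp add: abs_mult mult_ac)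
    qed
  qed
  ultimately have "(\<integral>x. v x * d (norm x) \<partial>lebesgue) = - (\<integral>x. k (norm x) * (g x \<bullet> x) \<partial>lebesgue)"
    unfolding divergence_cutoff[OF w locv locg _ S, OF of_nat_0_less_iff[THEN iffD2, OF zero_less_Suc]]
    using tendsto_minus LIMSEQ_unique by blast
  then show ?thesis by simp
qed

text \<open>Cut off the field, not the potential: any radial field is a gradient, so the compactly
  supported field \<open>S * Q\<close> times \<open>x\<close> has an explicit radial potential. Thus
  no decay of the potential of \<open>k\<close> is involved.\<close>

lemma gradient_approximation:
  assumes i: "integrable lebesgue (\<lambda>x::real^3. (norm (k (norm x) *\<^sub>R x))\<^sup>2)"
  shows "\<exists>\<psi>s. (\<forall>n. test_fun (\<psi>s n)) \<and> (\<lambda>n. \<integral>x. (norm (cgrad (\<psi>s n) x - k (norm x) *\<^sub>R x))\<^sup>2 \<partial>lebesgue) \<longlonglongrightarrow> 0"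
proof -
  obtain C where C: "C \<ge> 0" "\<And>\<rho>. \<rho> > 0 \<Longrightarrow> \<exists>S S'. is_cutoff C \<rho> S S'" by (rule cutoff_exists) blast
  have "\<exists>S S'. is_cutoff C (real (Suc n)) S S'" for n by (rule C(2)) simp
  then obtain S S' where S: "\<And>n. is_cutoff C (real (Suc n)) (S n) (S' n)" by metis
  note SD = is_cutoffD[OF S]
  note [measurable] = SD(1)[THEN smooth1_measurable]
  define K where "K x = (norm (k (norm x) *\<^sub>R x))\<^sup>2" for x :: "real^3"
  have K: "integrable lebesgue K" unfolding K_def[abs_def] by (rule i)
  have Keq: "(norm (c *\<^sub>R x - k (norm x) *\<^sub>R x))\<^sup>2 = (c - k (norm x))\<^sup>2 * (x \<bullet> x)" for c and x :: "real^3"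
    by (simp add: scaleR_diff_left[symmetric] norm_sq_eq power_mult_distrib)
  have K': "K x = (k (norm x))\<^sup>2 * (x \<bullet> x)" for x by (simp add: K_def norm_sq_eq power_mult_distrib)
  have ae0: "AE x in lebesgue. x \<noteq> (0::real^3)" by (intro AE_completion AE_lborel_singleton)
  have outer: "(\<lambda>n. \<integral>x. (S n (x \<bullet> x) * k (norm x) - k (norm x))\<^sup>2 * (x \<bullet> (x::real^3)) \<partial>lebesgue) \<longlonglongrightarrow> integral\<^sup>L lebesgue (\<lambda>x::real^3. 0 :: real)"
  proof (rule integral_dominated_convergence[OF _ _ K])
    show "(\<lambda>x::real^3. (S n (x \<bullet> x) * k (norm x) - k (norm x))\<^sup>2 * (x \<bullet> x)) \<in> borel_measurable lebesgue" for n
      by (rule borel_measurable_lebesgueI) measurable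
    show "AE x::real^3 in lebesgue. (\<lambda>n. (S n (x \<bullet> x) * k (norm x) - k (norm x))\<^sup>2 * (x \<bullet> x)) \<longlonglongrightarrow> (0::real)"
    proof (intro AE_I2 tendsto_eventually)
      fix x :: "real^3"
      obtain n0 :: nat where n0: "norm x \<le> real n0" using real_arch_simple by blast
      have "x \<bullet> x \<le> (real (Suc n))\<^sup>2" if "n \<ge> n0" for n
        unfolding norm_sq_eq using n0 that by (intro power_mono) auto
      then show "\<forall>\<^sub>F n in sequentially. (S n (x \<bullet> x) * k (norm x) - k (norm x))\<^sup>2 * (x \<bullet> x) = 0"
        unfolding eventually_sequentially by (intro exI[of _ n0]) (simp add: SD(4))
    qed
    show "AE x in lebesgue. norm ((S n (x \<bullet> x) * k (norm x) - k (norm x))\<^sup>2 * (x \<bullet> x)) \<le> K x" for n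
    proof (intro AE_I2)
      fix x :: "real^3"
      have "\<bar>S n (x \<bullet> x) - 1\<bar> * \<bar>k (norm x)\<bar> \<le> 1 * \<bar>k (norm x)\<bar>"
        using SD(8,9)[of n "x \<bullet> x"] by (intro mult_right_mono) auto
      then have "\<bar>S n (x \<bullet> x) * k (norm x) - k (norm x)\<bar> \<le> \<bar>k (norm x)\<bar>"
        by (simp add: abs_mult[symmetric] left_diff_distrib)
      then have "(S n (x \<bullet> x) * k (norm x) - k (norm x))\<^sup>2 \<le> (k (norm x))\<^sup>2" by (simp add: abs_le_square_iff)
      then show "norm ((S n (x \<bullet> x) * k (norm x) - k (norm x))\<^sup>2 * (x \<bullet> x)) \<le> K x"
        unfolding K' by (simp add: mult_right_mono)
    qed
  qed simp
  have "\<exists>\<psi>. test_fun \<psi> \<and> (\<integral>x. (norm (cgrad \<psi> x - k (norm x) *\<^sub>R x))\<^sup>2 \<partial>lebesgue) < \<epsilon>" if "\<epsilon> > 0" for \<epsilon>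
  proof -
    obtain n where n: "(\<integral>x. (S n (x \<bullet> x) * k (norm x) - k (norm x))\<^sup>2 * (x \<bullet> (x::real^3)) \<partial>lebesgue) < \<epsilon>"
    proof -
      have "\<forall>\<^sub>F n in sequentially. (\<integral>x. (S n (x \<bullet> x) * k (norm x) - k (norm x))\<^sup>2 * (x \<bullet> (x::real^3)) \<partial>lebesgue) < \<epsilon>"
        by (rule order_tendstoD(2)[OF outer]) (use \<open>\<epsilon> > 0\<close> in simp)
      then show ?thesis using that eventually_happens'[OF sequentially_bot] by blast
    qed
    define \<rho> where "\<rho> = real (Suc n)"
    have \<rho>: "\<rho> > 0" by (simp add: \<rho>_def)
    define T where "T = 2 * \<rho>\<^sup>2"
    have T: "T > 0" using \<rho> by (simp add: T_def)
    obtain P Q Q' where Q: "\<And>j::nat. smooth1 (Q j)" "\<And>j t. (Q j has_real_derivative Q' j t) (at t)"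
      "\<And>j t. 3 * Q j t + 2 * t * Q' j t = P j t"
      "\<And>j r. 0 < r \<Longrightarrow> r\<^sup>2 \<le> T \<Longrightarrow> \<bar>P j (r\<^sup>2)\<bar> \<le> B + 1" "\<And>j r. 0 < r \<Longrightarrow> r\<^sup>2 \<le> T \<Longrightarrow> \<bar>Q j (r\<^sup>2)\<bar> \<le> B + 1"
      "\<And>r. 0 < r \<Longrightarrow> r\<^sup>2 \<le> T \<Longrightarrow> (\<lambda>j. Q j (r\<^sup>2)) \<longlonglongrightarrow> k r"
      "AE x::real^3 in lebesgue. x \<noteq> 0 \<longrightarrow> x \<bullet> x \<le> T \<longrightarrow> (\<lambda>j. P j (x \<bullet> x)) \<longlonglongrightarrow> d (norm x)"
      "\<And>j. P j \<in> borel_measurable borel" by (rule polynomial_flux_approximation[OF T]) blast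
    note [measurable] = Q(1)[THEN smooth1_measurable]
    have Sz: "S n t = 0" if "T \<le> t" for t using SD(6)[of n t] that by (simp add: T_def \<rho>_def)
    have "(\<lambda>j. \<integral>x. (S n (x \<bullet> x) * Q j (x \<bullet> x) - k (norm x))\<^sup>2 * (x \<bullet> (x::real^3)) \<partial>lebesgue)
        \<longlonglongrightarrow> (\<integral>x. (S n (x \<bullet> x) * k (norm x) - k (norm x))\<^sup>2 * (x \<bullet> (x::real^3)) \<partial>lebesgue)"
    proof (rule integral_dominated_convergence)
      show "(\<lambda>x::real^3. (S n (x \<bullet> x) * k (norm x) - k (norm x))\<^sup>2 * (x \<bullet> x)) \<in> borel_measurable lebesgue"
        by (rule borel_measurable_lebesgueI) measurable
      show "(\<lambda>x::real^3. (S n (x \<bullet> x) * Q j (x \<bullet> x) - k (norm x))\<^sup>2 * (x \<bullet> x)) \<in> borel_measurable lebesgue" for j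
        by (rule borel_measurable_lebesgueI) measurable
      show "integrable lebesgue (\<lambda>x. 2 * ((B + 1)\<^sup>2 * T) * indicator (cball (0::real^3) (2 * \<rho>)) x + 2 * K x)"
      proof (intro Bochner_Integration.integrable_add integrable_mult_right K)
        show "integrable lebesgue (indicator (cball (0::real^3) (2 * \<rho>)) :: _ \<Rightarrow> real)"
          by (rule integrable_lebesgue_Borel(1)[THEN iffD2, OF _ integrable_indicator_cball])
            (intro borel_measurable_indicator borel_closed closed_cball)
      qed
      show "AE x in lebesgue. (\<lambda>j. (S n (x \<bullet> x) * Q j (x \<bullet> x) - k (norm x))\<^sup>2 * (x \<bullet> x))
          \<longlonglongrightarrow> (S n (x \<bullet> x) * k (norm x) - k (norm x))\<^sup>2 * (x \<bullet> (x::real^3))"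
        using ae0
      proof eventually_elim
        case (elim x)
        show ?case
        proof (cases "x \<bullet> x \<le> T")
          case True
          then have "(\<lambda>j. Q j (x \<bullet> x)) \<longlonglongrightarrow> k (norm x)" using Q(6)[of "norm x"] elim by (simp add: norm_sq_eq)
          then show ?thesis by (intro tendsto_intros)
        qed (simp add: Sz)
      qed
      show "AE x in lebesgue. norm ((S n (x \<bullet> x) * Q j (x \<bullet> x) - k (norm x))\<^sup>2 * (x \<bullet> (x::real^3)))
          \<le> 2 * ((B + 1)\<^sup>2 * T) * indicator (cball 0 (2 * \<rho>)) x + 2 * K x" for j
        using ae0
      proof eventually_elim
        case (elim x)
        have sq: "(a - c)\<^sup>2 \<le> 2 * a\<^sup>2 + 2 * c\<^sup>2" for a c :: real
          using zero_le_power2[of "a + c"] by (simp add: power2_eq_square algebra_simps)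
        have "(S n (x \<bullet> x) * Q j (x \<bullet> x))\<^sup>2 * (x \<bullet> x) \<le> (B + 1)\<^sup>2 * T * indicator (cball 0 (2 * \<rho>)) x"
        proof (cases "x \<bullet> x \<le> T")
          case True
          have q: "\<bar>Q j (x \<bullet> x)\<bar> \<le> B + 1" using Q(5)[of "norm x" j] True elim by (simp add: norm_sq_eq)
          have "\<bar>S n (x \<bullet> x) * Q j (x \<bullet> x)\<bar> \<le> 1 * (B + 1)"
            unfolding abs_mult using SD(8,9)[of n "x \<bullet> x"] by (intro mult_mono q) auto
          then have "\<bar>S n (x \<bullet> x) * Q j (x \<bullet> x)\<bar>\<^sup>2 \<le> (B + 1)\<^sup>2" by (intro power_mono) auto
          then have "(S n (x \<bullet> x) * Q j (x \<bullet> x))\<^sup>2 * (x \<bullet> x) \<le> (B + 1)\<^sup>2 * T" using True by (intro mult_mono) auto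
          then show ?thesis using ball_of_square[OF True[unfolded T_def] \<rho>] by simp
        next
          case False then show ?thesis using T by (simp add: Sz)
        qed
        moreover have "(S n (x \<bullet> x) * Q j (x \<bullet> x) - k (norm x))\<^sup>2 * (x \<bullet> x)
            \<le> (2 * (S n (x \<bullet> x) * Q j (x \<bullet> x))\<^sup>2 + 2 * (k (norm x))\<^sup>2) * (x \<bullet> x)" by (intro mult_right_mono sq) auto
        ultimately show ?case unfolding K' by (simp add: algebra_simps)
      qed
    qed
    from order_tendstoD(2)[OF this n] obtain j where j:
      "(\<integral>x. (S n (x \<bullet> x) * Q j (x \<bullet> x) - k (norm x))\<^sup>2 * (x \<bullet> (x::real^3)) \<partial>lebesgue) < \<epsilon>"
      using eventually_happens'[OF sequentially_bot] by blast
    \<comment> \<open>The gradient of \<open>m (x \<bullet> x)\<close> is \<open>2 * m'\<close>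
      times \<open>x\<close>, hence the factor 1/2. Subtracting the value at \<open>T\<close> below
      makes the potential vanish beyond the support of the field.\<close>
    have sm: "smooth1 (\<lambda>t. (1/2) * (S n t * Q j t))" by (intro smooth1_cmult smooth1.mult SD(1) Q(1))
    obtain A where A: "smooth1 A" "\<And>t. (A has_real_derivative (1/2) * (S n t * Q j t)) (at t)"
      using smooth1_antiderivative[OF sm] by blast
    define m where "m t = A t + (- A T)" for t
    have m: "smooth1 m" unfolding m_def[abs_def] by (intro smooth1.add smooth1.const A(1))
    have m': "(m has_real_derivative (1/2) * (S n t * Q j t)) (at t)" for t
      unfolding m_def[abs_def] using DERIV_add[OF A(2) DERIV_const[of "- A T"]] by simp
    have "(A has_real_derivative 0) (at t within {T..})" if "t \<in> {T..}" for t
    proof -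
      have "(1/2) * (S n t * Q j t) = 0" using Sz[of t] that by simp
      with A(2)[of t] have "(A has_real_derivative 0) (at t)" by metis
      then show ?thesis by (rule has_field_derivative_at_within)
    qed
    from has_field_derivative_zero_constant[OF convex_real_interval(1) this]
    obtain c where c: "\<And>t. t \<in> {T..} \<Longrightarrow> A t = c" by blast
    have mz: "m t = 0" if "T \<le> t" for t using c[of t] c[of T] that by (simp add: m_def)
    define \<psi> where "\<psi> x = m (x \<bullet> x)" for x :: "real^3"
    have "test_fun \<psi>" using test_fun_cutoff[OF m mz smooth_class.const[of 1]] unfolding \<psi>_def[abs_def] by simp
    moreover have "cgrad \<psi> x = (S n (x \<bullet> x) * Q j (x \<bullet> x)) *\<^sub>R x" for x
      unfolding \<psi>_def[abs_def] cgrad_def partial_radial(1)[OF m'] by (simp add: vec_eq_iff)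
    ultimately show ?thesis using j by (intro exI[of _ \<psi>]) (simp add: Keq)
  qed
  then have "\<exists>\<psi>. test_fun \<psi> \<and> (\<integral>x. (norm (cgrad \<psi> x - k (norm x) *\<^sub>R x))\<^sup>2 \<partial>lebesgue) < 1 / real (Suc n)" for n by simp
  then have "\<forall>n. \<exists>\<psi>. test_fun \<psi> \<and> (\<integral>x. (norm (cgrad \<psi> x - k (norm x) *\<^sub>R x))\<^sup>2 \<partial>lebesgue) < 1 / real (Suc n)"
    by (rule allI)
  from choice[OF this] obtain \<psi>s where "\<forall>n. test_fun (\<psi>s n) \<and> (\<integral>x. (norm (cgrad (\<psi>s n) x - k (norm x) *\<^sub>R x))\<^sup>2 \<partial>lebesgue) < 1 / real (Suc n)"
    by (rule exE)
  then have \<psi>s: "test_fun (\<psi>s n)"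
    "(\<integral>x. (norm (cgrad (\<psi>s n) x - k (norm x) *\<^sub>R x))\<^sup>2 \<partial>lebesgue) < 1 / real (Suc n)" for n
    by (simp_all only: simp_thms)
  have "(\<lambda>n. \<integral>x. (norm (cgrad (\<psi>s n) x - k (norm x) *\<^sub>R x))\<^sup>2 \<partial>lebesgue) \<longlonglongrightarrow> 0"
  proof (rule Lim_null_comparison[OF _ LIMSEQ_Suc[OF lim_1_over_n]])
    show "\<forall>\<^sub>F n in sequentially. norm (\<integral>x. (norm (cgrad (\<psi>s n) x - k (norm x) *\<^sub>R x))\<^sup>2 \<partial>lebesgue) \<le> 1 / real (Suc n)"
      by (intro always_eventually allI) (simp only: real_norm_def abs_of_nonneg Bochner_Integration.integral_nonneg zero_le_power2 less_imp_le[OF \<psi>s(2)])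
  qed
  then show ?thesis using \<psi>s(1) by (intro exI[of _ \<psi>s] conjI allI)
qed

end

section \<open>Square integrability and derivatives of radial quantities\<close>

lemma integrable_mult_of_squares:
  fixes f g :: "'a \<Rightarrow> real"
  assumes "f \<in> borel_measurable M" "g \<in> borel_measurable M" "integrable M (\<lambda>x. (f x)\<^sup>2)" "integrable M (\<lambda>x. (g x)\<^sup>2)"
  shows "integrable M (\<lambda>x. f x * g x)"
proof (rule Bochner_Integration.integrable_bound)
  show "integrable M (\<lambda>x. (f x)\<^sup>2 + (g x)\<^sup>2)" using assms by simp
  show "AE x in M. norm (f x * g x) \<le> norm ((f x)\<^sup>2 + (g x)\<^sup>2)" using abs_mult_le_sum_squares by simp
qed (use assms in measurable)

lemma radial_square_integral:
  assumes [measurable]: "h \<in> borel_measurable borel" and L: "L2 (\<lambda>r. indicator {0..} r * (r * h r))"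
  shows "integrable lebesgue (\<lambda>x::real^3. (h (norm x))\<^sup>2)"
    and "(\<integral>x. (h (norm (x::real^3)))\<^sup>2 \<partial>lebesgue) = 4 * pi * (\<integral>r. (indicator {0..} r * (r * h r))\<^sup>2 \<partial>lborel)"
proof -
  have eq: "indicator {0..} r * (4 * pi * r\<^sup>2) * (h r)\<^sup>2 = 4 * pi * (indicator {0..} r * (r * h r))\<^sup>2" for r :: real
    by (auto simp: power_mult_distrib split: split_indicator)
  have m: "(\<lambda>r. (h r)\<^sup>2) \<in> borel_measurable borel" by measurable
  have m3: "(\<lambda>x::real^3. (h (norm x))\<^sup>2) \<in> borel_measurable borel" by measurable
  show "integrable lebesgue (\<lambda>x::real^3. (h (norm x))\<^sup>2)"
    unfolding integrable_lebesgue_Borel(1)[OF m3] radial_integrable_iff[OF m] eq using L2_integrable[OF L] by simp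
  show "(\<integral>x. (h (norm (x::real^3)))\<^sup>2 \<partial>lebesgue) = 4 * pi * (\<integral>r. (indicator {0..} r * (r * h r))\<^sup>2 \<partial>lborel)"
    unfolding integrable_lebesgue_Borel(2)[OF m3] radial_integral_eq[OF m] eq by simp
qed

text \<open>The integral is split at \<open>r / 2\<close>, since \<open>g\<close> is continuous only
  on the open half-line.\<close>

lemma integral_has_derivative_Ioi:
  fixes g :: "real \<Rightarrow> real"
  assumes m: "g \<in> borel_measurable borel" and c: "continuous_on {0<..} g"
    and i: "\<And>R. integrable lborel (\<lambda>s. indicator {0<..<R} s * g s)" and r: "r > 0"
  shows "((\<lambda>r. \<integral>s. indicator {0<..<r} s * g s \<partial>lborel) has_real_derivative g r) (at r)"
proof -
  define s where "s = r / 2"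
  have s: "0 < s" "s < r" using r by (auto simp: s_def)
  have cont: "continuous_on {s..r+1} g" using s by (intro continuous_on_subset[OF c]) auto
  have eq: "(\<integral>t. indicator {0<..<x} t * g t \<partial>lborel) = (\<integral>t. indicator {0<..<s} t * g t \<partial>lborel) + integral {s..x} g"
    if "x \<in> {s<..<r+1}" for x
  proof -
    have "continuous_on {s..x} g" by (rule continuous_on_subset[OF cont]) (use that in auto)
    then have si: "set_integrable lborel {s..x} g" by (intro borel_integrable_atLeastAtMost')
    have "(\<integral>t. indicator {0<..<x} t * g t \<partial>lborel) = (\<integral>t. indicator {0<..<s} t * g t + indicator {s..x} t * g t \<partial>lborel)"
    proof (rule integral_cong_AE)
      have "AE t in lborel. t \<noteq> x" by (rule AE_lborel_singleton)
      then show "AE t in lborel. indicator {0<..<x} t * g t = indicator {0<..<s} t * g t + indicator {s..x} t * g t"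
        by eventually_elim (use s that in \<open>auto split: split_indicator\<close>)
    qed (use m in measurable)
    also have "\<dots> = (\<integral>t. indicator {0<..<s} t * g t \<partial>lborel) + (\<integral>t. indicator {s..x} t * g t \<partial>lborel)"
      using i[of s] si by (intro Bochner_Integration.integral_add) (simp_all add: set_integrable_def)
    also have "(\<integral>t. indicator {s..x} t * g t \<partial>lborel) = integral {s..x} g"
      using set_borel_integral_eq_integral(2)[OF si] by (simp add: set_lebesgue_integral_def)
    finally show ?thesis .
  qed
  have "((\<lambda>x. integral {s..x} g) has_real_derivative g r) (at r within {s..r+1})"
    using s by (intro integral_has_real_derivative cont) auto
  then have "((\<lambda>x. integral {s..x} g) has_real_derivative g r) (at r)"
    using s by (subst (asm) at_within_interior) auto
  then have "((\<lambda>x. (\<integral>t. indicator {0<..<s} t * g t \<partial>lborel) + integral {s..x} g) has_real_derivative g r) (at r)"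
    using DERIV_add[OF DERIV_const] by fastforce
  moreover have "\<forall>\<^sub>F x in nhds r. (\<integral>t. indicator {0<..<s} t * g t \<partial>lborel) + integral {s..x} g = (\<integral>t. indicator {0<..<x} t * g t \<partial>lborel)"
    using s eq by (intro eventually_nhds_in_open[of "{s<..<r+1}", THEN eventually_mono]) auto
  ultimately show ?thesis by (subst (asm) DERIV_cong_ev[OF refl _ refl])
qed

text \<open>Split the kernel at \<open>s = x\<close> into the inner mass over \<open>x\<close> and
  the outer integral of \<open>g s / s\<close>. The boundary contributions \<open>g r / r\<close>
  cancel, and only the inner mass acts.\<close>

lemma pot_has_derivative:
  assumes g: "source A g" and c: "continuous_on {0<..} g" and r: "r > 0"
  shows "(pot g has_real_derivative - ((\<integral>s. indicator {0<..<r} s * g s \<partial>lborel) / r\<^sup>2)) (at r)"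
proof -
  note [measurable] = sourceD(1)[OF g]
  have gi: "integrable lborel (\<lambda>s. indicator {0<..<R} s * g s)" for R
    by (rule Bochner_Integration.integrable_bound[OF sourceD(4)[OF g]]) (auto split: split_indicator)
  have hi0: "integrable lborel (\<lambda>s. g s / s)"
  proof -
    have "g s / s = g s / max 0 s" for s using sourceD(2)[OF g, of s] by (cases "s \<le> 0") auto
    then have "(\<lambda>s. g s / s) = (\<lambda>s. g s / max 0 s)" by (rule ext)
    then show ?thesis using pot_integrable[OF g, of 0] by simp
  qed
  have hi: "integrable lborel (\<lambda>s. indicator {0<..<R} s * (g s / s))" for R
    by (rule Bochner_Integration.integrable_bound[OF hi0]) (auto split: split_indicator)
  have eq: "pot g x = (1 / x) * (\<integral>s. indicator {0<..<x} s * g s \<partial>lborel) + ((\<integral>s. g s / s \<partial>lborel) - (\<integral>s. indicator {0<..<x} s * (g s / s) \<partial>lborel))"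
    if "x > 0" for x
  proof -
    have "pot g x = (\<integral>s. (1 / x) * (indicator {0<..<x} s * g s) + (g s / s - indicator {0<..<x} s * (g s / s)) \<partial>lborel)"
      unfolding pot_def
    proof (rule Bochner_Integration.integral_cong[OF refl])
      fix s
      show "g s / max x s = (1 / x) * (indicator {0<..<x} s * g s) + (g s / s - indicator {0<..<x} s * (g s / s))"
        using that sourceD(2)[OF g, of s] by (cases "s \<le> 0") (auto simp: max_def split: split_indicator)
    qed
    also have "\<dots> = (1 / x) * (\<integral>s. indicator {0<..<x} s * g s \<partial>lborel) + ((\<integral>s. g s / s \<partial>lborel) - (\<integral>s. indicator {0<..<x} s * (g s / s) \<partial>lborel))"
      using gi[of x] hi[of x] hi0 by simp
    finally show ?thesis .
  qed
  have d1: "((\<lambda>x. \<integral>s. indicator {0<..<x} s * g s \<partial>lborel) has_real_derivative g r) (at r)"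
    by (rule integral_has_derivative_Ioi[OF _ c gi r]) measurable
  have d2: "((\<lambda>x. \<integral>s. indicator {0<..<x} s * (g s / s) \<partial>lborel) has_real_derivative g r / r) (at r)"
    by (rule integral_has_derivative_Ioi[OF _ _ hi r]) (measurable, intro continuous_intros c, auto)
  have "((\<lambda>x. (1 / x) * (\<integral>s. indicator {0<..<x} s * g s \<partial>lborel) + ((\<integral>s. g s / s \<partial>lborel) - (\<integral>s. indicator {0<..<x} s * (g s / s) \<partial>lborel)))
      has_real_derivative ((- (1 / r\<^sup>2)) * (\<integral>s. indicator {0<..<r} s * g s \<partial>lborel) + g r * (1 / r)) + (0 - g r / r)) (at r)"
    using r by (intro DERIV_add DERIV_mult DERIV_diff d1 d2 DERIV_const) (auto intro!: derivative_eq_intros simp: power2_eq_square)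
  then have "((\<lambda>x. (1 / x) * (\<integral>s. indicator {0<..<x} s * g s \<partial>lborel) + ((\<integral>s. g s / s \<partial>lborel) - (\<integral>s. indicator {0<..<x} s * (g s / s) \<partial>lborel)))
      has_real_derivative - ((\<integral>s. indicator {0<..<r} s * g s \<partial>lborel) / r\<^sup>2)) (at r)" by simp
  moreover have "\<forall>\<^sub>F x in nhds r. (1 / x) * (\<integral>s. indicator {0<..<x} s * g s \<partial>lborel) + ((\<integral>s. g s / s \<partial>lborel) - (\<integral>s. indicator {0<..<x} s * (g s / s) \<partial>lborel)) = pot g x"
    using r eq by (intro eventually_nhds_in_open[of "{0<..}", THEN eventually_mono]) auto
  ultimately show ?thesis by (subst (asm) DERIV_cong_ev[OF refl _ refl])
qed

text \<open>A bounded profile makes \<open>w r / r\<close> bounded up to the origin, which is what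
  bounds the divergences later.\<close>

lemma W_linear_bound:
  assumes "L2 p" "\<And>r. \<bar>p r\<bar> \<le> c" "r \<ge> 0" shows "\<bar>W p r\<bar> \<le> c * r"
proof -
  have le: "\<bar>kern r s * p s\<bar> \<le> c * indicator {0..r} s" for s
    using kern_bounds[of r s] assms(2)[of s] mult_mono[of "kern r s" 1 "\<bar>p s\<bar>" c]
    by (auto simp: abs_mult kern_def split: split_indicator)
  have "\<bar>W p r\<bar> \<le> (\<integral>s. \<bar>kern r s * p s\<bar> \<partial>lborel)" unfolding W_def by (rule integral_abs_bound)
  also have "\<dots> \<le> (\<integral>s. c * indicator {0..r} s \<partial>lborel)"
    using assms(3) by (intro integral_mono le integrable_abs[OF W_integrable[OF assms(1)]] integrable_mult_right integrable_real_indicator) auto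
  also have "\<dots> = c * r" using assms(3) by simp
  finally show ?thesis .
qed

lemma L2_weak_grad_wgrad: "L2_weak_grad u g \<Longrightarrow> L2_weak_grad u (wgrad u)"
  unfolding wgrad_def by (rule someI[where P="L2_weak_grad u"])

text \<open>\<open>wgrad\<close> is an arbitrary choice; uniqueness identifies it almost everywhere
  with any gradient known explicitly.\<close>

lemma wgrad_AE: assumes "L2_weak_grad u g" shows "AE x in lebesgue. wgrad u x = g x"
  using L2_weak_grad_wgrad[OF assms] assms weak_grad_unique unfolding L2_weak_grad_def by blast

lemma weak_grad_norm_measurable: "weak_grad u g \<Longrightarrow> (\<lambda>x. norm (g x)) \<in> borel_measurable lebesgue"
  by (rule measurable_compose[OF weak_gradD(2) borel_measurable_norm])

text \<open>\<open>\<bar>f x\<bar> \<le> 1 + \<bar>f x\<bar> ^ n\<close>. It is used with exponent 2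
  for Sobolev functions and gradients, and with exponent 6 for \<open>D12\<close>.\<close>

lemma integrable_ball_mult:
  fixes f :: "real^3 \<Rightarrow> real"
  assumes "f \<in> borel_measurable lebesgue" "integrable lebesgue (\<lambda>x. \<bar>f x\<bar> ^ n)" "n \<ge> 1"
  shows "integrable lebesgue (\<lambda>x. indicator (cball 0 r) x * f x)"
proof (rule Bochner_Integration.integrable_bound)
  have m: "(indicator (cball (0::real^3) r) :: _ \<Rightarrow> real) \<in> borel_measurable borel"
    by (intro borel_measurable_indicator borel_closed closed_cball)
  have i: "integrable lebesgue (indicator (cball (0::real^3) r) :: _ \<Rightarrow> real)"
    by (rule integrable_lebesgue_Borel(1)[THEN iffD2, OF m integrable_indicator_cball])
  show "integrable lebesgue (\<lambda>x. indicator (cball 0 r) x + \<bar>f x\<bar> ^ n)" by (rule Bochner_Integration.integrable_add[OF i assms(2)])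
  show "(\<lambda>x. indicator (cball 0 r) x * f x) \<in> borel_measurable lebesgue"
    by (rule borel_measurable_times[OF borel_measurable_lebesgueI[OF m] assms(1)])
  have "\<bar>f x\<bar> \<le> 1 + \<bar>f x\<bar> ^ n" for x
  proof (cases "\<bar>f x\<bar> \<le> 1")
    case False
    then have "\<bar>f x\<bar> ^ 1 \<le> \<bar>f x\<bar> ^ n" using assms(3) by (intro power_increasing) auto
    then show ?thesis by simp
  qed (simp add: add_increasing2)
  then show "AE x in lebesgue. norm (indicator (cball 0 r) x * f x) \<le> norm (indicator (cball 0 r) x + \<bar>f x\<bar> ^ n)"
    by (intro AE_I2) (auto split: split_indicator)
qed

lemma inner_measurable_lebesgue:
  assumes "g \<in> borel_measurable lebesgue" shows "(\<lambda>x::real^3. g x \<bullet> x) \<in> borel_measurable lebesgue"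
  by (rule borel_measurable_inner[OF assms borel_measurable_lebesgueI]) simp

context radial_flux
begin

lemma flux_inner_integrable:
  fixes g :: "real^3 \<Rightarrow> real^3"
  assumes gm: "g \<in> borel_measurable lebesgue" and g2: "integrable lebesgue (\<lambda>x. (norm (g x))\<^sup>2)"
    and L: "L2 (\<lambda>r. indicator {0..} r * (r * (k r * r)))"
  shows "integrable lebesgue (\<lambda>x. k (norm x) * (g x \<bullet> x))"
proof -
  have "integrable lebesgue (\<lambda>x. norm (g x) * (k (norm x) * norm x))"
    by (rule integrable_mult_of_squares[OF measurable_compose[OF gm borel_measurable_norm] borel_measurable_lebesgueI g2
          radial_square_integral(1)[OF _ L]]) measurable
  then show ?thesis
  proof (rule Bochner_Integration.integrable_bound)
    show "(\<lambda>x. k (norm x) * (g x \<bullet> x)) \<in> borel_measurable lebesgue"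
      by (rule borel_measurable_times[OF borel_measurable_lebesgueI inner_measurable_lebesgue[OF gm]]) measurable
    show "AE x in lebesgue. norm (k (norm x) * (g x \<bullet> x)) \<le> norm (norm (g x) * (k (norm x) * norm x))"
    proof (intro AE_I2)
      fix x
      have "\<bar>k (norm x)\<bar> * \<bar>g x \<bullet> x\<bar> \<le> \<bar>k (norm x)\<bar> * (norm (g x) * norm x)"
        by (intro mult_left_mono Cauchy_Schwarz_ineq2) auto
      then show "norm (k (norm x) * (g x \<bullet> x)) \<le> norm (norm (g x) * (k (norm x) * norm x))"
        by (simp add: abs_mult mult_ac)
    qed
  qed
qed

lemma norm_flux_square_integrable:
  assumes "L2 (\<lambda>r. indicator {0..} r * (r * (k r * r)))"
  shows "integrable lebesgue (\<lambda>x::real^3. (norm (k (norm x) *\<^sub>R x))\<^sup>2)"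
proof -
  have "integrable lebesgue (\<lambda>x::real^3. (k (norm x) * norm x)\<^sup>2)"
    by (rule radial_square_integral(1)[OF _ assms]) measurable
  then show ?thesis by (simp add: power_mult_distrib)
qed

text \<open>Dropping a factor \<open>r\<close> makes the function smaller beyond 1, and below 1 the
  bound on \<open>k\<close> suffices.\<close>

lemma L2_flux_weaken:
  assumes "L2 (\<lambda>r. indicator {0..} r * (r * (k r * r)))" shows "L2 (\<lambda>r. indicator {0..} r * (r * k r))"
proof -
  define f where "f r = B * indicator {0..1} r + \<bar>indicator {0..} r * (r * (k r * r))\<bar>" for r
  have "L2 (\<lambda>r. \<bar>indicator {0..} r * (r * (k r * r))\<bar>)" using assms unfolding L2_def by auto
  then have f: "L2 f" unfolding f_def[abs_def] by (intro L2_add L2_scale L2_indicator)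
  show ?thesis
  proof (rule L2_bound(1)[OF f, where C=1])
    fix r
    show "\<bar>indicator {0..} r * (r * k r)\<bar> \<le> 1 * \<bar>f r\<bar>"
    proof (cases "r < 0")
      case False
      have f0: "0 \<le> f r" using B_nonneg by (simp add: f_def)
      have "\<bar>r * k r\<bar> \<le> f r"
      proof (cases "r \<le> 1")
        case True
        have "\<bar>r\<bar> * \<bar>k r\<bar> \<le> 1 * B" using True False by (intro mult_mono k_bound) auto
        then show ?thesis using True False by (simp add: f_def abs_mult add_increasing2)
      next
        case r: False
        have "\<bar>r * k r\<bar> * 1 \<le> \<bar>r * k r\<bar> * r" using r by (intro mult_left_mono) auto
        then show ?thesis using r False by (simp add: f_def abs_mult mult_ac)
      qed
      then show ?thesis using f0 False by simp
    qed simp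
  qed measurable
qed

text \<open>The version for test functions in \<open>H1\<close>, where each integrability condition
  is a product of two square integrable functions.\<close>

lemma divergence_identity_L2:
  assumes w: "weak_grad v g" and v2: "integrable lebesgue (\<lambda>x. (v x)\<^sup>2)" and g2: "integrable lebesgue (\<lambda>x. (norm (g x))\<^sup>2)"
    and Lk: "L2 (\<lambda>r. indicator {0..} r * (r * (k r * r)))" and Ld: "L2 (\<lambda>r. indicator {0..} r * (r * d r))"
  shows "integrable lebesgue (\<lambda>x. v x * d (norm x))"
    and "(\<integral>x. k (norm x) * (g x \<bullet> x) \<partial>lebesgue) = - (\<integral>x. v x * d (norm x) \<partial>lebesgue)"
proof -
  note m = weak_gradD(1,2)[OF w]
  show vd: "integrable lebesgue (\<lambda>x. v x * d (norm x))"
    by (rule integrable_mult_of_squares[OF m(1) borel_measurable_lebesgueI v2 radial_square_integral(1)[OF _ Ld]]) measurable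
  have vk: "integrable lebesgue (\<lambda>x. v x * k (norm x))"
    by (rule integrable_mult_of_squares[OF m(1) borel_measurable_lebesgueI v2 radial_square_integral(1)[OF _ L2_flux_weaken[OF Lk]]]) measurable
  have "integrable lebesgue (\<lambda>x. indicator (cball 0 r) x * v x)" for r
    by (rule integrable_ball_mult[OF m(1), of 2]) (use v2 in auto)
  moreover have "integrable lebesgue (\<lambda>x. indicator (cball 0 r) x * norm (g x))" for r
    by (rule integrable_ball_mult[OF weak_grad_norm_measurable[OF w], of 2]) (use g2 in auto)
  ultimately show "(\<integral>x. k (norm x) * (g x \<bullet> x) \<partial>lebesgue) = - (\<integral>x. v x * d (norm x) \<partial>lebesgue)"
    by (rule divergence_identity[OF w _ _ vd vk flux_inner_integrable[OF m(2) g2 Lk]])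
qed

end

section \<open>From critical profiles to weak solutions\<close>

text \<open>The solution belonging to a critical profile is \<open>u x = w |x| / |x|\<close>, \<open>\<phi> x = V |x|\<close>; the functions
  \<open>du\<close> and \<open>dv\<close> are the Laplacians of \<open>u\<close> and \<open>\<phi>\<close> prescribed by the system.\<close>

locale critical_profile = reduced_system +
  fixes lam :: real and q :: profile
  assumes lam: "lam \<ge> 0" and critical: "grad lam q = 0"
begin

definition p where "p = prof q"
definition w where "w = W p"
definition h where "h = nl lam w"
definition N where "N = norm q"
definition c where "c = sqrt (\<integral>x. (h x)\<^sup>2 \<partial>lborel)"
definition Kh where "Kh = \<bar>lam\<bar> * M * Cf + 8 * pi * e\<^sup>2 * N\<^sup>2"
definition du where "du r = (w r - h r) / r"
definition dv where "dv r = - 4 * pi * e * (w r / r)\<^sup>2"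
definition V where "V r = 4 * pi * e * pot (\<lambda>s. (w s)\<^sup>2) r"

section \<open>Regularity of a critical profile and the two fluxes\<close>

lemma adm: "admissible N w" unfolding w_def N_def p_def by (rule admissible_W)
lemmas wD = admissibleD[OF adm]
lemma h_L2: "L2 h" unfolding h_def by (rule nl_L2[OF adm])
lemma p_L2: "L2 p" unfolding p_def by (rule prof)
lemma [measurable]: "w \<in> borel_measurable borel" "h \<in> borel_measurable borel" "p \<in> borel_measurable borel"
  using wD(3) L2_measurable[OF h_L2] L2_measurable[OF p_L2] by auto
text \<open>The Euler-Lagrange equation. It gains regularity: as an image of \<open>W_adj\<close>
  the profile is bounded, so \<open>w\<close> is at most linear near the origin.\<close>

lemma p_eq: "p = W_adj h"
proof -
  have "q = T lam w" using critical by (simp add: grad_def w_def p_def)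
  then show ?thesis unfolding p_def h_def by (metis prof_T[OF adm])
qed
lemma p_bound: "\<bar>p r\<bar> \<le> c" unfolding p_eq c_def by (rule W_adj_bound[OF h_L2])
lemma c_nonneg: "0 \<le> c" using p_bound[of 0] by linarith
lemma Kh_nonneg: "0 \<le> Kh" unfolding Kh_def using M Cf(1) by (intro add_nonneg_nonneg mult_nonneg_nonneg) auto
lemma w_linear: "r \<ge> 0 \<Longrightarrow> \<bar>w r\<bar> \<le> c * r" unfolding w_def by (rule W_linear_bound[OF p_L2 p_bound])
lemma w_derivative: "r > 0 \<Longrightarrow> (w has_real_derivative p r - w r) (at r)"
  unfolding w_def by (rule W_has_derivative[OF p_L2]) (simp_all add: p_def prof)
lemma h_le: "\<bar>h r\<bar> \<le> Kh * \<bar>w r\<bar>" unfolding h_def Kh_def by (rule nl_le[OF adm])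
lemma h_nonpos: "r \<le> 0 \<Longrightarrow> h r = 0" using h_le[of r] wD(5)[of r] by simp

lemma w_over_r: "\<bar>w r / r\<bar> \<le> c"
proof (cases "r > 0")
  case True then show ?thesis using w_linear[of r] by (simp add: abs_divide divide_le_eq)
qed (simp add: wD c_nonneg)

lemma du_bound: "\<bar>du r\<bar> \<le> (1 + Kh) * c"
proof (cases "r > 0")
  case True
  have "\<bar>w r - h r\<bar> \<le> (1 + Kh) * \<bar>w r\<bar>" using h_le[of r] by (simp add: distrib_right)
  also have "\<dots> \<le> (1 + Kh) * (c * r)" using True Kh_nonneg by (intro mult_left_mono w_linear) auto
  finally show ?thesis using True by (simp add: du_def abs_divide divide_le_eq mult_ac)
qed (use c_nonneg Kh_nonneg in \<open>simp add: du_def wD h_nonpos\<close>)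

lemma dv_bound: "\<bar>dv r\<bar> \<le> 4 * pi * e * c\<^sup>2"
proof -
  have "(w r / r)\<^sup>2 \<le> c\<^sup>2" using power_mono[OF w_over_r[of r], of 2] by (simp only: power2_abs abs_ge_zero)
  then show ?thesis using e by (simp add: dv_def abs_mult)
qed

sublocale U: radial_flux du "(1 + Kh) * c"
  by unfold_locales (unfold du_def[abs_def], measurable, fold du_def, rule du_bound)

sublocale P: radial_flux dv "4 * pi * e * c\<^sup>2"
  by unfold_locales (unfold dv_def[abs_def], measurable, fold dv_def, rule dv_bound)

lemma U_flux: assumes "r > 0" shows "U.\<Phi> r = r * p r - (r + 1) * w r"
proof -
  have eq: "indicator {0<..<r} s * (s\<^sup>2 * du s) = indicator {0<..<r} s * (s * (w s - h s))" for s
    by (simp add: du_def power2_eq_square)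
  show ?thesis unfolding U.\<Phi>_def eq using flux_identity[OF h_L2 assms] by (simp add: p_eq[symmetric] w_def[symmetric])
qed

lemma u_derivative: assumes "r > 0" shows "((\<lambda>r. w r / r) has_real_derivative U.k r * r) (at r)"
proof -
  have "((\<lambda>r. w r / r) has_real_derivative ((p r - w r) * r - w r * 1) / (r * r)) (at r)"
    using assms by (intro DERIV_divide w_derivative DERIV_ident) auto
  also have "((p r - w r) * r - w r * 1) / (r * r) = U.k r * r"
    using assms unfolding U.k_def U_flux[OF assms] by (simp add: power3_eq_cube divide_simps) (simp add: algebra_simps)
  finally show ?thesis .
qed

lemma source_w: "source (N\<^sup>2) (\<lambda>s. (w s)\<^sup>2)" by (rule source_square[OF adm])

lemma P_flux: "P.\<Phi> r = - 4 * pi * e * (\<integral>s. indicator {0<..<r} s * (w s)\<^sup>2 \<partial>lborel)"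
proof -
  have "indicator {0<..<r} s * (s\<^sup>2 * dv s) = (- 4 * pi * e) * (indicator {0<..<r} s * (w s)\<^sup>2)" for s
    by (simp add: dv_def power_divide)
  then show ?thesis by (simp add: P.\<Phi>_def)
qed

lemma P_flux_le: "\<bar>P.\<Phi> r\<bar> \<le> 4 * pi * e * N\<^sup>2"
proof -
  have "(\<integral>s. indicator {0<..<r} s * (w s)\<^sup>2 \<partial>lborel) \<le> (\<integral>s. (w s)\<^sup>2 \<partial>lborel)"
    by (rule integral_mono[OF _ L2_integrable[OF wD(2)]])
      (rule Bochner_Integration.integrable_bound[OF L2_integrable[OF wD(2)]], auto split: split_indicator)
  also have "\<dots> \<le> N\<^sup>2" by (rule wD(4))
  finally have "(\<integral>s. indicator {0<..<r} s * (w s)\<^sup>2 \<partial>lborel) \<le> N\<^sup>2" .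
  moreover have "0 \<le> (\<integral>s. indicator {0<..<r} s * (w s)\<^sup>2 \<partial>lborel)" by (rule Bochner_Integration.integral_nonneg) simp
  ultimately show ?thesis unfolding P_flux using e by (simp add: abs_mult)
qed

lemma V_derivative: assumes "r > 0" shows "(V has_real_derivative P.k r * r) (at r)"
proof -
  have "continuous_on {0<..} (\<lambda>s. (w s)\<^sup>2)" unfolding w_def by (intro continuous_intros W_continuous p_L2)
  from DERIV_cmult[OF pot_has_derivative[OF source_w this assms], of "4 * pi * e"]
  have "(V has_real_derivative 4 * pi * e * - ((\<integral>s. indicator {0<..<r} s * (w s)\<^sup>2 \<partial>lborel) / r\<^sup>2)) (at r)"
    unfolding V_def[abs_def] .
  also have "4 * pi * e * - ((\<integral>s. indicator {0<..<r} s * (w s)\<^sup>2 \<partial>lborel) / r\<^sup>2) = P.k r * r"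
    using assms unfolding P.k_def P_flux by (simp add: power2_eq_square power3_eq_cube)
  finally show ?thesis .
qed

lemma V_measurable [measurable]: "V \<in> borel_measurable borel" unfolding V_def[abs_def] by measurable

lemma V_bounds: "0 \<le> V r" "V r \<le> 8 * pi * e * N\<^sup>2" "r > 0 \<Longrightarrow> V r \<le> 4 * pi * e * N\<^sup>2 / r"
proof -
  have p: "0 \<le> pot (\<lambda>s. (w s)\<^sup>2) r" by (rule pot_nonneg) (auto simp: wD)
  then show "0 \<le> V r" using e by (simp add: V_def)
  have "4 * pi * e * pot (\<lambda>s. (w s)\<^sup>2) r \<le> 4 * pi * e * (2 * N\<^sup>2)"
    using pot_bound[OF source_w, of r] e p by (intro mult_left_mono) auto
  then show "V r \<le> 8 * pi * e * N\<^sup>2" by (simp add: V_def)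
  assume "r > 0"
  then have "4 * pi * e * pot (\<lambda>s. (w s)\<^sup>2) r \<le> 4 * pi * e * (N\<^sup>2 / r)"
    using pot_bound_inverse[OF source_w, of r] e p by (intro mult_left_mono) auto
  then show "V r \<le> 4 * pi * e * N\<^sup>2 / r" by (simp add: V_def)
qed

section \<open>The solution on three-space and its function spaces\<close>

definition u where "u x = w (norm x) / norm x" for x :: "real^3"
definition \<phi> where "\<phi> x = V (norm x)" for x :: "real^3"
definition gu where "gu x = U.k (norm x) *\<^sub>R x" for x :: "real^3"
definition g\<phi> where "g\<phi> x = P.k (norm x) *\<^sub>R x" for x :: "real^3"

lemma u_weak_grad: "weak_grad u gu"
  unfolding u_def[abs_def] gu_def[abs_def] by (rule U.weak_grad_radial[OF _ u_derivative]) measurable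

lemma \<phi>_weak_grad: "weak_grad \<phi> g\<phi>"
  unfolding \<phi>_def[abs_def] g\<phi>_def[abs_def] by (rule P.weak_grad_radial[OF _ V_derivative]) measurable

lemma L2_u: "L2 (\<lambda>r. indicator {0..} r * (r * (w r / r)))"
proof -
  have "(\<lambda>r. indicator {0..} r * (r * (w r / r))) = w" using wD(5) by (auto split: split_indicator)
  then show ?thesis using wD(2) by simp
qed

lemma L2_du: "L2 (\<lambda>r. indicator {0..} r * (r * du r))"
proof -
  have "(\<lambda>r. indicator {0..} r * (r * du r)) = (\<lambda>r. w r - h r)" using wD(5) h_nonpos
    by (auto simp: du_def split: split_indicator)
  then show ?thesis using L2_diff[OF wD(2) h_L2] by simp
qed

text \<open>On \<open>[0, 1]\<close> the field is bounded; beyond 1 the flux formula writes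
  \<open>r * (U.k r * r)\<close> as \<open>p r - (1 + 1 / r) * w r\<close>, and both
  \<open>p\<close> and \<open>w\<close> are square integrable.\<close>

lemma L2_gu: "L2 (\<lambda>r. indicator {0..} r * (r * (U.k r * r)))"
proof -
  define F where "F r = (1 + Kh) * c * indicator {0..1} r + (\<bar>p r\<bar> + 2 * \<bar>w r\<bar>)" for r
  have "L2 (\<lambda>r. \<bar>p r\<bar>)" "L2 (\<lambda>r. \<bar>w r\<bar>)" using p_L2 wD(2) by (auto simp: L2_def)
  then have F: "L2 F" unfolding F_def[abs_def] by (intro L2_add L2_scale L2_indicator)
  show ?thesis
  proof (rule L2_bound(1)[OF F, where C=1])
    fix r
    have F0: "0 \<le> F r" using c_nonneg Kh_nonneg by (simp add: F_def)
    show "\<bar>indicator {0..} r * (r * (U.k r * r))\<bar> \<le> 1 * \<bar>F r\<bar>"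
    proof (cases "r < 0")
      case False
      have "\<bar>r * (U.k r * r)\<bar> \<le> F r"
      proof (cases "r \<le> 1")
        case True
        have "\<bar>r\<bar> * (\<bar>U.k r\<bar> * \<bar>r\<bar>) \<le> 1 * (((1 + Kh) * c) * 1)"
          using True False c_nonneg Kh_nonneg by (intro mult_mono U.k_bound) auto
        then show ?thesis using True False by (simp add: F_def abs_mult)
      next
        case r: False
        then have "r * (U.k r * r) = p r - (1 + 1 / r) * w r"
          by (simp add: U.k_def U_flux power3_eq_cube field_simps)
        moreover have "\<bar>(1 + 1 / r) * w r\<bar> \<le> 2 * \<bar>w r\<bar>"
          unfolding abs_mult using r by (intro mult_right_mono) auto
        ultimately show ?thesis using r by (simp add: F_def)
      qed
      then show ?thesis using F0 False by simp
    qed (use F0 in simp)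
  qed measurable
qed

text \<open>The total mass of \<open>w\<^sup>2\<close> is finite, so beyond 1 the flux is bounded
  and the field decays like the inverse square of the distance.\<close>

lemma L2_g\<phi>: "L2 (\<lambda>r. indicator {0..} r * (r * (P.k r * r)))"
proof -
  define F where "F r = 4 * pi * e * c\<^sup>2 * indicator {0..1} r + 4 * pi * e * N\<^sup>2 * (indicator {1..} r * (1 / r))" for r
  have F: "L2 F" unfolding F_def[abs_def] by (intro L2_add L2_scale L2_indicator L2_inverse_tail)
  show ?thesis
  proof (rule L2_bound(1)[OF F, where C=1])
    fix r
    have F0: "0 \<le> F r" using e by (auto simp: F_def split: split_indicator)
    show "\<bar>indicator {0..} r * (r * (P.k r * r))\<bar> \<le> 1 * \<bar>F r\<bar>"
    proof (cases "r < 0")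
      case False
      have "\<bar>r * (P.k r * r)\<bar> \<le> F r"
      proof (cases "r \<le> 1")
        case True
        have "\<bar>r\<bar> * (\<bar>P.k r\<bar> * \<bar>r\<bar>) \<le> 1 * ((4 * pi * e * c\<^sup>2) * 1)"
          using True False e by (intro mult_mono P.k_bound) auto
        moreover have "0 \<le> 4 * pi * e * N\<^sup>2 * (indicator {1..} r * (1 / r))" using False e by simp
        ultimately show ?thesis using True False by (simp add: F_def abs_mult)
      next
        case r: False
        then have "\<bar>r * (P.k r * r)\<bar> = \<bar>P.\<Phi> r\<bar> / r" by (simp add: P.k_def power3_eq_cube abs_divide abs_mult)
        also have "\<dots> \<le> 4 * pi * e * N\<^sup>2 / r" using r by (intro divide_right_mono P_flux_le) auto
        finally show ?thesis using r by (simp add: F_def)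
      qed
      then show ?thesis using F0 False by simp
    qed (use F0 in simp)
  qed measurable
qed

lemma u_square: "integrable lebesgue (\<lambda>x. (u x)\<^sup>2)" "(\<integral>x. (u x)\<^sup>2 \<partial>lebesgue) \<le> 4 * pi * N\<^sup>2"
proof -
  have m: "(\<lambda>r. w r / r) \<in> borel_measurable borel" by measurable
  show "integrable lebesgue (\<lambda>x. (u x)\<^sup>2)" unfolding u_def by (rule radial_square_integral(1)[OF m L2_u])
  have "(indicator {0..} r * (r * (w r / r)))\<^sup>2 = (w r)\<^sup>2" for r using wD(5)[of r] by (auto split: split_indicator)
  then show "(\<integral>x. (u x)\<^sup>2 \<partial>lebesgue) \<le> 4 * pi * N\<^sup>2"
    unfolding u_def radial_square_integral(2)[OF m L2_u] using wD(4) by simp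
qed

lemma u_L2_weak_grad: "L2_weak_grad u gu"
  unfolding L2_weak_grad_def using u_weak_grad U.norm_flux_square_integrable[OF L2_gu] by (simp add: gu_def)

lemma \<phi>_L2_weak_grad: "L2_weak_grad \<phi> g\<phi>"
  unfolding L2_weak_grad_def using \<phi>_weak_grad P.norm_flux_square_integrable[OF L2_g\<phi>] by (simp add: g\<phi>_def)

lemma u_H1: "H1 u"
  unfolding H1_def using weak_gradD(1)[OF u_weak_grad] u_square(1) u_L2_weak_grad by blast

text \<open>The potential decays like \<open>1 / r\<close>, so its sixth power times
  \<open>r\<^sup>2\<close> decays like \<open>1 / r ^ 4\<close>.\<close>

lemma \<phi>_pow6: "integrable lebesgue (\<lambda>x. (\<phi> x) ^ 6)"
proof -
  have m: "(\<lambda>r. V r ^ 6) \<in> borel_measurable borel" by measurable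
  have m3: "(\<lambda>x. \<phi> x ^ 6) \<in> borel_measurable borel" unfolding \<phi>_def by measurable
  define A1 A2 where "A1 = 8 * pi * e * N\<^sup>2" and "A2 = 4 * pi * e * N\<^sup>2"
  have A: "A1 \<ge> 0" "A2 \<ge> 0" using e by (auto simp: A1_def A2_def)
  have "integrable lborel (\<lambda>r. indicator {0..} r * (4 * pi * r\<^sup>2) * V r ^ 6)"
  proof (rule Bochner_Integration.integrable_bound)
    show "integrable lborel (\<lambda>r. 4 * pi * A1 ^ 6 * indicator {0..1} r + 4 * pi * A2 ^ 6 * (indicator {1..} r * (1 / r :: real))\<^sup>2)"
      by (intro Bochner_Integration.integrable_add integrable_mult_right L2_integrable[OF L2_inverse_tail] integrable_real_indicator) auto
    show "AE r in lborel. norm (indicator {0..} r * (4 * pi * r\<^sup>2) * V r ^ 6)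
        \<le> norm (4 * pi * A1 ^ 6 * indicator {0..1} r + 4 * pi * A2 ^ 6 * (indicator {1..} r * (1 / r))\<^sup>2)"
    proof (intro AE_I2)
      fix r :: real
      have nn: "0 \<le> 4 * pi * A1 ^ 6 * indicator {0..1} r + 4 * pi * A2 ^ 6 * (indicator {1..} r * (1 / r))\<^sup>2"
        using A by simp
      consider "r < 0" | "0 \<le> r" "r \<le> 1" | "r > 1" by linarith
      then have "indicator {0..} r * (4 * pi * r\<^sup>2) * V r ^ 6 \<le> 4 * pi * A1 ^ 6 * indicator {0..1} r + 4 * pi * A2 ^ 6 * (indicator {1..} r * (1 / r))\<^sup>2"
      proof cases
        case 1 then show ?thesis using nn by simp
      next
        case 2
        have "V r ^ 6 \<le> A1 ^ 6" unfolding A1_def by (intro power_mono V_bounds)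
        moreover have "r\<^sup>2 \<le> 1" using 2 by (simp add: power_le_one)
        ultimately have "r\<^sup>2 * V r ^ 6 \<le> 1 * A1 ^ 6" by (intro mult_mono) auto
        then have "4 * pi * (r\<^sup>2 * V r ^ 6) \<le> 4 * pi * A1 ^ 6" by (intro mult_left_mono) auto
        then show ?thesis using 2 by (simp add: add_increasing2 mult.assoc)
      next
        case 3
        have "V r ^ 6 \<le> (A2 / r) ^ 6" unfolding A2_def using 3 by (intro power_mono V_bounds) auto
        then have "r\<^sup>2 * V r ^ 6 \<le> r\<^sup>2 * (A2 / r) ^ 6" by (intro mult_left_mono) auto
        also have "\<dots> = A2 ^ 6 * (1 / r) ^ 4" using 3 by (simp add: power_divide field_simps eval_nat_numeral)
        also have "\<dots> \<le> A2 ^ 6 * (1 / r)\<^sup>2" using 3 by (intro mult_left_mono power_decreasing) auto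
        finally have "4 * pi * (r\<^sup>2 * V r ^ 6) \<le> 4 * pi * (A2 ^ 6 * (1 / r)\<^sup>2)" by (intro mult_left_mono) auto
        then show ?thesis using 3 by simp
      qed
      then show "norm (indicator {0..} r * (4 * pi * r\<^sup>2) * V r ^ 6)
        \<le> norm (4 * pi * A1 ^ 6 * indicator {0..1} r + 4 * pi * A2 ^ 6 * (indicator {1..} r * (1 / r))\<^sup>2)"
        using V_bounds(1)[of r] nn by simp
    qed
  qed measurable
  then show ?thesis unfolding integrable_lebesgue_Borel(1)[OF m3] unfolding \<phi>_def radial_integrable_iff[OF m] .
qed

lemma \<phi>_D12: "D12 \<phi>"
  unfolding D12_def
proof (intro conjI exI[of _ g\<phi>])
  show "\<phi> \<in> borel_measurable lebesgue" by (rule weak_gradD(1)[OF \<phi>_weak_grad])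
  show "\<exists>\<psi>s. (\<forall>n. test_fun (\<psi>s n)) \<and> (\<lambda>n. \<integral>x. (norm (cgrad (\<psi>s n) x - g\<phi> x))\<^sup>2 \<partial>lebesgue) \<longlonglongrightarrow> 0"
    unfolding g\<phi>_def by (rule P.gradient_approximation[OF P.norm_flux_square_integrable[OF L2_g\<phi>]])
qed (rule \<phi>_pow6 \<phi>_L2_weak_grad)+

end

context reduced_system
begin

text \<open>Continuity turns equality almost everywhere into equality of the \<open>W\<close>, and
  \<open>q = w' + w\<close> recovers the profile. Distinct critical points thus give distinct
  solutions.\<close>

lemma profile_eqI:
  assumes "AE x::real^3 in lebesgue. W (prof p) (norm x) / norm x = W (prof q) (norm x) / norm x"
  shows "p = q"
proof -
  note [measurable] = L2_measurable[OF W_L2[OF prof(1)]]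
  define k where "k r = (W (prof p) r - W (prof q) r) / r" for r
  have km [measurable]: "k \<in> borel_measurable borel" unfolding k_def[abs_def] by measurable
  have eq: "indicator {0..} r * (r * k r) = W (prof p) r - W (prof q) r" for r
    by (cases "r = 0"; cases "r < 0") (auto simp: k_def W_nonpos)
  have L: "L2 (\<lambda>r. indicator {0..} r * (r * k r))" unfolding eq by (intro L2_diff W_L2 prof)
  have "(\<integral>x. (k (norm (x::real^3)))\<^sup>2 \<partial>lebesgue) = 0"
    using assms by (intro Bochner_Integration.integral_eq_zero_AE) (auto simp: k_def diff_divide_distrib elim: eventually_mono)
  then have "(\<integral>r. (W (prof p) r - W (prof q) r)\<^sup>2 \<partial>lborel) = 0"
    unfolding radial_square_integral(2)[OF km L] eq by simp
  then have "AE r in lborel. (W (prof p) r - W (prof q) r)\<^sup>2 = 0"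
    using L2_integrable[OF L[unfolded eq]] by (subst (asm) integral_nonneg_eq_0_iff_AE) auto
  then have "AE r in lborel. W (prof p) r - W (prof q) r = 0" by simp
  from continuous_AE_eq_0[OF open_UNIV _ this]
  have W: "W (prof p) r = W (prof q) r" for r by (simp add: continuous_on_diff W_continuous[OF prof(1)])
  have "prof p r = prof q r" for r
  proof (cases "r > 0")
    case True
    have "W (prof p) = W (prof q)" using W by (rule ext)
    with W_has_derivative[OF prof(1,2) True, of p] W_has_derivative[OF prof(1,2) True, of q]
    have "prof p r - W (prof q) r = prof q r - W (prof q) r" using DERIV_unique by metis
    then show ?thesis by simp
  qed (simp add: prof)
  then show ?thesis using prof_inject by blast
qed

end

section \<open>The weak equations and the norm bounds\<close>

context critical_profile
begin

text \<open>The divergence identity tests the radial field \<open>gu\<close> against an arbitrary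
  \<open>v\<close>, so that radial criticality yields the equation for all test functions.\<close>

lemma first_equation:
  assumes v: "H1 v" and \<alpha>: "\<alpha> \<in> borel_measurable lebesgue" "AE x in lebesgue. \<alpha> x = b (norm x)"
  shows "(\<integral>x. wgrad u x \<bullet> wgrad v x + u x * v x + e * \<phi> x * u x * v x \<partial>lebesgue)
       = lam * (\<integral>x. \<alpha> x * f (u x) * v x \<partial>lebesgue)"
proof -
  from v have v2: "integrable lebesgue (\<lambda>x. (v x)\<^sup>2)" and "\<exists>g. L2_weak_grad v g" by (auto simp: H1_def)
  then have "L2_weak_grad v (wgrad v)" using L2_weak_grad_wgrad by blast
  then have wg: "weak_grad v (wgrad v)" and g2: "integrable lebesgue (\<lambda>x. (norm (wgrad v x))\<^sup>2)"
    by (auto simp: L2_weak_grad_def)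
  note m = weak_gradD(1,2)[OF wg]
  note um = weak_gradD(1)[OF u_weak_grad] and pm = weak_gradD(1)[OF \<phi>_weak_grad]
  have wgu: "wgrad u \<in> borel_measurable lebesgue"
    using L2_weak_grad_wgrad[OF u_L2_weak_grad] weak_gradD(2) by (auto simp: L2_weak_grad_def)
  note D = U.divergence_identity_L2[OF wg v2 g2 L2_gu L2_du]
  \<comment> \<open>The terms of order zero as one radial weight; away from the origin
    \<open>s - du\<close> is exactly \<open>lam * b * f (w / r)\<close>.\<close>
  define s where "s r = w r / r + e * V r * (w r / r)" for r
  have sm [measurable]: "s \<in> borel_measurable borel" unfolding s_def[abs_def] by measurable
  have "L2 (\<lambda>r. indicator {0..} r * (r * s r))"
  proof (rule L2_bound(1)[OF wD(2), where C="1 + e * (8 * pi * e * N\<^sup>2)"])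
    fix r
    have "indicator {0..} r * (r * s r) = (1 + e * V r) * w r"
      using wD(5)[of r] by (auto simp: s_def distrib_left distrib_right split: split_indicator)
    moreover have "\<bar>1 + e * V r\<bar> \<le> 1 + e * (8 * pi * e * N\<^sup>2)"
      using V_bounds(1,2)[of r] e by (simp add: mult_left_mono)
    ultimately show "\<bar>indicator {0..} r * (r * s r)\<bar> \<le> (1 + e * (8 * pi * e * N\<^sup>2)) * \<bar>w r\<bar>"
      by (simp add: abs_mult mult_right_mono)
  qed measurable
  note s2 = radial_square_integral(1)[OF sm this]
  have i2: "integrable lebesgue (\<lambda>x. v x * s (norm x))"
    by (rule integrable_mult_of_squares[OF m(1) borel_measurable_lebesgueI v2 s2]) measurable
  have i1: "integrable lebesgue (\<lambda>x. U.k (norm x) * (wgrad v x \<bullet> x))"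
    by (rule U.flux_inner_integrable[OF m(2) g2 L2_gu])
  have ae0: "AE x in lebesgue. x \<noteq> (0::real^3)" by (intro AE_completion AE_lborel_singleton)
  have "(\<integral>x. wgrad u x \<bullet> wgrad v x + u x * v x + e * \<phi> x * u x * v x \<partial>lebesgue)
      = (\<integral>x. U.k (norm x) * (wgrad v x \<bullet> x) + v x * s (norm x) \<partial>lebesgue)"
  proof (rule integral_cong_AE)
    show "(\<lambda>x. wgrad u x \<bullet> wgrad v x + u x * v x + e * \<phi> x * u x * v x) \<in> borel_measurable lebesgue"
      by (intro borel_measurable_add borel_measurable_inner borel_measurable_times wgu m um pm borel_measurable_const)
    show "(\<lambda>x. U.k (norm x) * (wgrad v x \<bullet> x) + v x * s (norm x)) \<in> borel_measurable lebesgue"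
      using i1 i2 by auto
    show "AE x in lebesgue. wgrad u x \<bullet> wgrad v x + u x * v x + e * \<phi> x * u x * v x
        = U.k (norm x) * (wgrad v x \<bullet> x) + v x * s (norm x)"
      using wgrad_AE[OF u_L2_weak_grad]
      by eventually_elim (simp add: gu_def s_def u_def \<phi>_def inner_commute algebra_simps)
  qed
  also have "\<dots> = - (\<integral>x. v x * du (norm x) \<partial>lebesgue) + (\<integral>x. v x * s (norm x) \<partial>lebesgue)"
    using i1 i2 D(2) by simp
  also have "\<dots> = (\<integral>x. v x * s (norm x) - v x * du (norm x) \<partial>lebesgue)" using i2 D(1) by simp
  also have "\<dots> = (\<integral>x. lam * (\<alpha> x * f (u x) * v x) \<partial>lebesgue)"
  proof (rule integral_cong_AE)
    show "(\<lambda>x. v x * s (norm x) - v x * du (norm x)) \<in> borel_measurable lebesgue" using i2 D(1) by auto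
    have "(\<lambda>x. f (u x)) \<in> borel_measurable lebesgue" by (rule measurable_compose[OF um]) measurable
    then show "(\<lambda>x. lam * (\<alpha> x * f (u x) * v x)) \<in> borel_measurable lebesgue"
      by (intro borel_measurable_times borel_measurable_const m \<alpha>)
    show "AE x in lebesgue. v x * s (norm x) - v x * du (norm x) = lam * (\<alpha> x * f (u x) * v x)"
      using \<alpha>(2) ae0
    proof eventually_elim
      case (elim x)
      define r where "r = norm x"
      have r: "r > 0" using elim by (simp add: r_def)
      have hr: "h r = lam * (b r * (r * f (w r / r))) - 4 * pi * e\<^sup>2 * (pot (\<lambda>s. (w s)\<^sup>2) r * w r)"
        by (simp add: h_def nl_def)
      have Vr: "e * V r * (w r / r) = 4 * pi * e\<^sup>2 * (pot (\<lambda>s. (w s)\<^sup>2) r * w r) / r"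
        by (simp add: V_def power2_eq_square)
      have "s r - du r = lam * (b r * (r * f (w r / r))) / r"
        unfolding s_def du_def Vr hr by (simp add: diff_divide_distrib)
      then have "s r - du r = lam * (b r * f (w r / r))" using r by simp
      then have "v x * (s r - du r) = v x * (lam * (b r * f (w r / r)))" by simp
      then show ?case using elim(1) by (simp add: r_def u_def algebra_simps)
    qed
  qed
  finally show ?thesis by simp
qed

text \<open>The decay exponent 7/2 exceeds the dimension. This weight is what remains of the flux
  density in \<open>second_equation\<close> after part of it is charged to the sixth power of the
  test function.\<close>

lemma weight_integrable:
  defines "\<kappa> \<equiv> \<lambda>r. indicator {1..} r * (1 / (r ^ 3 * sqrt r))"
  shows "integrable lebesgue (\<lambda>x::real^3. \<kappa> (norm x))"
proof -
  have m: "\<kappa> \<in> borel_measurable borel" unfolding \<kappa>_def by measurable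
  have m3: "(\<lambda>x::real^3. \<kappa> (norm x)) \<in> borel_measurable borel" using m by measurable
  have lim: "((\<lambda>x::real. - (2 / sqrt x)) \<longlongrightarrow> 0) at_top" by real_asymp
  have "(\<integral>\<^sup>+x. ennreal (1 / (x * sqrt x)) * indicator {1..} x \<partial>lborel) = ennreal (0 - (- (2 / sqrt 1)))"
  proof (intro nn_integral_FTC_atLeast[OF _ _ _ lim])
    fix x :: real assume x: "1 \<le> x"
    have "((\<lambda>x. - (2 / sqrt x)) has_real_derivative - ((0 * sqrt x - 2 * (inverse (sqrt x) / 2)) / (sqrt x * sqrt x))) (at x)"
      using x by (intro DERIV_minus DERIV_divide DERIV_const DERIV_real_sqrt) auto
    also have "- ((0 * sqrt x - 2 * (inverse (sqrt x) / 2)) / (sqrt x * sqrt x)) = 1 / (x * sqrt x)"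
      using x by (simp add: field_simps)
    finally show "((\<lambda>x. - (2 / sqrt x)) has_real_derivative 1 / (x * sqrt x)) (at x)" .
  qed auto
  moreover have "(\<integral>\<^sup>+r. ennreal (norm (indicator {0..} r * (4 * pi * r\<^sup>2) * \<kappa> r)) \<partial>lborel)
      = (\<integral>\<^sup>+x. ennreal (4 * pi) * (ennreal (1 / (x * sqrt x)) * indicator {1..} x) \<partial>lborel)"
  proof (rule nn_integral_cong)
    fix r :: real
    show "ennreal (norm (indicator {0..} r * (4 * pi * r\<^sup>2) * \<kappa> r)) = ennreal (4 * pi) * (ennreal (1 / (r * sqrt r)) * indicator {1..} r)"
    proof (cases "r \<ge> 1")
      case True
      then have "r\<^sup>2 * (1 / (r ^ 3 * sqrt r)) = 1 / (r * sqrt r)" by (simp add: power2_eq_square power3_eq_cube)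
      moreover have "indicator {0..} r * (4 * pi * r\<^sup>2) * \<kappa> r = 4 * pi * (r\<^sup>2 * (1 / (r ^ 3 * sqrt r)))"
        using True by (simp add: \<kappa>_def)
      ultimately have "indicator {0..} r * (4 * pi * r\<^sup>2) * \<kappa> r = 4 * pi * (1 / (r * sqrt r))" by (simp only:)
      moreover have "0 \<le> 1 / (r * sqrt r)" using True by simp
      ultimately show ?thesis using True by (simp add: ennreal_mult[symmetric])
    qed (simp add: \<kappa>_def)
  qed
  ultimately have "integrable lborel (\<lambda>r. indicator {0..} r * (4 * pi * r\<^sup>2) * \<kappa> r)"
    using m by (intro integrableI_bounded) (auto simp: nn_integral_cmult ennreal_mult_less_top)
  then show ?thesis unfolding integrable_lebesgue_Borel(1)[OF m3] radial_integrable_iff[OF m] .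
qed

text \<open>A function in \<open>D12\<close> is known to lie in L6 only, so Cauchy-Schwarz is
  replaced by Young-type splittings against its sixth power.\<close>

lemma second_equation:
  assumes \<psi>: "D12 \<psi>"
  shows "(\<integral>x. wgrad \<phi> x \<bullet> wgrad \<psi> x \<partial>lebesgue) = 4 * pi * e * (\<integral>x. (u x)\<^sup>2 * \<psi> x \<partial>lebesgue)"
proof -
  from \<psi> have p6: "integrable lebesgue (\<lambda>x. \<psi> x ^ 6)" and "\<exists>g. L2_weak_grad \<psi> g" by (auto simp: D12_def)
  then have "L2_weak_grad \<psi> (wgrad \<psi>)" using L2_weak_grad_wgrad by blast
  then have wg: "weak_grad \<psi> (wgrad \<psi>)" and g2: "integrable lebesgue (\<lambda>x. (norm (wgrad \<psi> x))\<^sup>2)"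
    by (auto simp: L2_weak_grad_def)
  note m = weak_gradD(1,2)[OF wg]
  have wgp: "wgrad \<phi> \<in> borel_measurable lebesgue"
    using L2_weak_grad_wgrad[OF \<phi>_L2_weak_grad] weak_gradD(2) by (auto simp: L2_weak_grad_def)
  \<comment> \<open>For \<open>t \<le> 1 + C\<close> the second term suffices; otherwise
    \<open>s \<le> t \<le> t ^ 5\<close>, and the sixth power takes over.\<close>
  have young: "t * s \<le> t ^ 6 + (1 + C) * s" if "0 \<le> t" "0 \<le> s" "s \<le> C" for t s C :: real
  proof (cases "t \<le> 1 + C")
    case True
    have "t * s \<le> (1 + C) * s" using True that by (intro mult_right_mono)
    then show ?thesis by (simp add: add_increasing that)
  next
    case False
    then have "1 \<le> t" "s \<le> t" using that by auto
    then have "s \<le> t ^ 5" using power_increasing[of 1 5 t] by simp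
    then have "t * s \<le> t * t ^ 5" using that by (intro mult_left_mono) auto
    also have "\<dots> = t ^ 6" by (simp add: eval_nat_numeral)
    finally show ?thesis using that by (simp add: add_increasing2)
  qed
  define C where "C = 4 * pi * e * c\<^sup>2"
  have C0: "C \<ge> 0" using e by (simp add: C_def)
  define D where "D = 4 * pi * e * N\<^sup>2"
  have D0: "D \<ge> 0" using e by (simp add: D_def)
  have vd: "integrable lebesgue (\<lambda>x. \<psi> x * dv (norm x))"
  proof (rule Bochner_Integration.integrable_bound)
    show "integrable lebesgue (\<lambda>x. \<psi> x ^ 6 + (1 + C) * (4 * pi * e * (u x)\<^sup>2))"
      by (intro Bochner_Integration.integrable_add p6 integrable_mult_right u_square)
    show "(\<lambda>x. \<psi> x * dv (norm x)) \<in> borel_measurable lebesgue"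
      by (rule borel_measurable_times[OF m(1) borel_measurable_lebesgueI]) measurable
    show "AE x in lebesgue. norm (\<psi> x * dv (norm x)) \<le> norm (\<psi> x ^ 6 + (1 + C) * (4 * pi * e * (u x)\<^sup>2))"
    proof (intro AE_I2)
      fix x
      have eq: "\<bar>dv (norm x)\<bar> = 4 * pi * e * (u x)\<^sup>2" using e by (simp add: dv_def u_def abs_mult)
      have "\<bar>\<psi> x\<bar> * \<bar>dv (norm x)\<bar> \<le> \<bar>\<psi> x\<bar> ^ 6 + (1 + C) * \<bar>dv (norm x)\<bar>"
        by (rule young) (simp_all add: C_def dv_bound)
      then show "norm (\<psi> x * dv (norm x)) \<le> norm (\<psi> x ^ 6 + (1 + C) * (4 * pi * e * (u x)\<^sup>2))"
        unfolding eq using C0 e by (simp add: abs_mult eq)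
    qed
  qed
  have vk: "integrable lebesgue (\<lambda>x. \<psi> x * P.k (norm x))"
  proof (rule Bochner_Integration.integrable_bound)
    have mi: "(indicator (cball (0::real^3) 1) :: _ \<Rightarrow> real) \<in> borel_measurable borel"
      by (intro borel_measurable_indicator borel_closed closed_cball)
    have i: "integrable lebesgue (indicator (cball (0::real^3) 1) :: _ \<Rightarrow> real)"
      by (rule integrable_lebesgue_Borel(1)[THEN iffD2, OF mi integrable_indicator_cball])
    show "integrable lebesgue (\<lambda>x. (1 + D) * \<psi> x ^ 6 + ((1 + C) * C * indicator (cball 0 1) x + D * (indicator {1..} (norm x) * (1 / (norm x ^ 3 * sqrt (norm x))))))"
      by (intro Bochner_Integration.integrable_add p6 integrable_mult_right i weight_integrable)
    show "(\<lambda>x. \<psi> x * P.k (norm x)) \<in> borel_measurable lebesgue"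
      by (rule borel_measurable_times[OF m(1) borel_measurable_lebesgueI]) measurable
    show "AE x in lebesgue. norm (\<psi> x * P.k (norm x)) \<le> norm ((1 + D) * \<psi> x ^ 6 + ((1 + C) * C * indicator (cball 0 1) x + D * (indicator {1..} (norm x) * (1 / (norm x ^ 3 * sqrt (norm x))))))"
    proof (intro AE_I2)
      fix x :: "real^3"
      define t r where "t = \<bar>\<psi> x\<bar>" and "r = norm x"
      have t6: "t ^ 6 = \<psi> x ^ 6" by (simp add: t_def)
      have t0: "0 \<le> t" by (simp add: t_def)
      have nn: "0 \<le> D * (indicator {1..} r * (1 / (r ^ 3 * sqrt r)))" using D0 by (auto simp: r_def)
      have tk: "t * \<bar>P.k r\<bar> \<le> (1 + D) * t ^ 6 + ((1 + C) * C * indicator (cball 0 1) x + D * (indicator {1..} r * (1 / (r ^ 3 * sqrt r))))"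
      proof (cases "r \<le> 1")
        case True
        have k: "\<bar>P.k r\<bar> \<le> C" unfolding C_def by (rule P.k_bound)
        have "t * \<bar>P.k r\<bar> \<le> t ^ 6 + (1 + C) * \<bar>P.k r\<bar>" by (rule young) (simp_all add: t0 k)
        also have "\<dots> \<le> (1 + D) * t ^ 6 + (1 + C) * C"
          using k C0 D0 t0 by (intro add_mono mult_left_mono) (auto simp: mult_le_cancel_right1 distrib_right)
        finally show ?thesis using True nn by (simp add: r_def)
      next
        case False
        have "\<bar>P.k r\<bar> = \<bar>P.\<Phi> r\<bar> / r ^ 3" using False by (simp add: P.k_def abs_divide)
        also have "\<dots> \<le> D / r ^ 3" unfolding D_def using False by (intro divide_right_mono P_flux_le) auto
        finally have k: "\<bar>P.k r\<bar> \<le> D / r ^ 3" .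
        have sr: "1 \<le> sqrt r" "sqrt r * sqrt r = r" using False by auto
        \<comment> \<open>The threshold is \<open>t = 1 / sqrt r\<close>: above it
          \<open>1 / r ^ 3 = (1 / sqrt r) ^ 6 \<le> t ^ 5\<close>, below it the product is at most
          the integrable weight.\<close>
        have "t * (1 / r ^ 3) \<le> t ^ 6 + 1 / (r ^ 3 * sqrt r)"
        proof (cases "1 / sqrt r \<le> t")
          case True
          have "(1 / sqrt r) ^ 6 = 1 / r ^ 3"
          proof -
            have "sqrt r ^ 6 = (sqrt r * sqrt r) ^ 3" by (simp add: eval_nat_numeral mult_ac)
            then show ?thesis using sr(2) by (simp add: power_divide)
          qed
          then have "1 / r ^ 3 \<le> (1 / sqrt r) ^ 5" using power_decreasing[of 5 6 "1 / sqrt r"] sr by simp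
          also have "\<dots> \<le> t ^ 5" using True sr by (intro power_mono) auto
          finally have "t * (1 / r ^ 3) \<le> t * t ^ 5" using t0 by (intro mult_left_mono)
          then have "t * (1 / r ^ 3) \<le> t ^ 6" by (simp add: eval_nat_numeral)
          then show ?thesis using False by (simp add: add_increasing2)
        next
          case t: False
          then have "t * (1 / r ^ 3) \<le> (1 / sqrt r) * (1 / r ^ 3)" using False by (intro mult_right_mono) auto
          then show ?thesis using t0 by (simp add: add_increasing mult.commute)
        qed
        then have D_le: "D * (t * (1 / r ^ 3)) \<le> D * (t ^ 6 + 1 / (r ^ 3 * sqrt r))" using D0 by (intro mult_left_mono)
        have ind: "indicator {1..} r = (1 :: real)" using False by simp
        have "t * \<bar>P.k r\<bar> \<le> t * (D / r ^ 3)" by (intro mult_left_mono k t0)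
        also have "\<dots> = D * (t * (1 / r ^ 3))" by simp
        also note D_le
        also have "D * (t ^ 6 + 1 / (r ^ 3 * sqrt r)) \<le> t ^ 6 + (1 + C) * C * indicator (cball 0 1) x + D * (t ^ 6 + 1 / (r ^ 3 * sqrt r))"
          using t0 C0 by simp
        also have "\<dots> = (1 + D) * t ^ 6 + ((1 + C) * C * indicator (cball 0 1) x + D * (indicator {1..} r * (1 / (r ^ 3 * sqrt r))))"
          unfolding ind by (simp only: distrib_left distrib_right mult_1 add_ac)
        finally show ?thesis .
      qed
      have nk: "norm (\<psi> x * P.k r) = t * \<bar>P.k r\<bar>" by (simp add: t_def abs_mult)
      have le: "norm (\<psi> x * P.k r) \<le> (1 + D) * \<psi> x ^ 6 + ((1 + C) * C * indicator (cball 0 1) x + D * (indicator {1..} r * (1 / (r ^ 3 * sqrt r))))"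
        unfolding t6[symmetric] nk by (rule tk)
      show "norm (\<psi> x * P.k (norm x)) \<le> norm ((1 + D) * \<psi> x ^ 6 + ((1 + C) * C * indicator (cball 0 1) x + D * (indicator {1..} (norm x) * (1 / (norm x ^ 3 * sqrt (norm x))))))"
        using order_trans[OF le abs_ge_self] unfolding r_def real_norm_def .
    qed
  qed
  have locv: "integrable lebesgue (\<lambda>x. indicator (cball 0 r) x * \<psi> x)" for r
    by (rule integrable_ball_mult[OF m(1), of 6]) (use p6 in auto)
  have locg: "integrable lebesgue (\<lambda>x. indicator (cball 0 r) x * norm (wgrad \<psi> x))" for r
    by (rule integrable_ball_mult[OF weak_grad_norm_measurable[OF wg], of 2]) (use g2 in auto)
  have "(\<integral>x. wgrad \<phi> x \<bullet> wgrad \<psi> x \<partial>lebesgue) = (\<integral>x. P.k (norm x) * (wgrad \<psi> x \<bullet> x) \<partial>lebesgue)"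
  proof (rule integral_cong_AE)
    show "(\<lambda>x. wgrad \<phi> x \<bullet> wgrad \<psi> x) \<in> borel_measurable lebesgue" by (intro borel_measurable_inner wgp m)
    show "(\<lambda>x. P.k (norm x) * (wgrad \<psi> x \<bullet> x)) \<in> borel_measurable lebesgue"
      using P.flux_inner_integrable[OF m(2) g2 L2_g\<phi>] by auto
    show "AE x in lebesgue. wgrad \<phi> x \<bullet> wgrad \<psi> x = P.k (norm x) * (wgrad \<psi> x \<bullet> x)"
      using wgrad_AE[OF \<phi>_L2_weak_grad] by eventually_elim (simp add: g\<phi>_def inner_commute)
  qed
  also have "\<dots> = - (\<integral>x. \<psi> x * dv (norm x) \<partial>lebesgue)"
    by (rule P.divergence_identity[OF wg locv locg vd vk P.flux_inner_integrable[OF m(2) g2 L2_g\<phi>]])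
  also have "(\<integral>x. \<psi> x * dv (norm x) \<partial>lebesgue) = (\<integral>x. (- 4 * pi * e) * ((u x)\<^sup>2 * \<psi> x) \<partial>lebesgue)"
    by (rule Bochner_Integration.integral_cong) (auto simp: dv_def u_def)
  finally show ?thesis by simp
qed

lemma weak_solution:
  assumes "\<alpha> \<in> borel_measurable lebesgue" "AE x in lebesgue. \<alpha> x = b (norm x)"
  shows "weak_solution e lam \<alpha> f u \<phi>"
  unfolding weak_solution_def using u_H1 \<phi>_D12 first_equation[OF _ assms] second_equation by blast

text \<open>Test the first equation with \<open>u\<close> itself and discard the non-negative
  potential term.\<close>

lemma H1_norm_le:
  fixes \<alpha> :: "real^3 \<Rightarrow> real"
  assumes \<alpha>: "\<alpha> \<in> borel_measurable lebesgue" "AE x in lebesgue. \<alpha> x = b (norm x)"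
  shows "H1_norm u \<le> sqrt (lam * (M * Cf * (4 * pi * N\<^sup>2)))"
  unfolding H1_norm_def
proof (rule real_sqrt_le_mono)
  note um = weak_gradD(1)[OF u_weak_grad] and pm = weak_gradD(1)[OF \<phi>_weak_grad]
  have g2: "integrable lebesgue (\<lambda>x. (norm (wgrad u x))\<^sup>2)"
    using L2_weak_grad_wgrad[OF u_L2_weak_grad] by (simp add: L2_weak_grad_def)
  have V8: "\<bar>V r\<bar> \<le> 8 * pi * e * N\<^sup>2" for r using V_bounds(1,2)[of r] by simp
  have i3: "integrable lebesgue (\<lambda>x. e * \<phi> x * u x * u x)"
  proof (rule Bochner_Integration.integrable_bound)
    show "integrable lebesgue (\<lambda>x. e * (8 * pi * e * N\<^sup>2) * (u x)\<^sup>2)" by (intro integrable_mult_right u_square)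
    show "(\<lambda>x. e * \<phi> x * u x * u x) \<in> borel_measurable lebesgue"
      by (intro borel_measurable_times borel_measurable_const um pm)
    show "AE x in lebesgue. norm (e * \<phi> x * u x * u x) \<le> norm (e * (8 * pi * e * N\<^sup>2) * (u x)\<^sup>2)"
    proof (intro AE_I2)
      fix x
      have "\<bar>V (norm x)\<bar> * (e * (u x)\<^sup>2) \<le> 8 * pi * e * N\<^sup>2 * (e * (u x)\<^sup>2)"
        using e by (intro mult_right_mono V8) auto
      then show "norm (e * \<phi> x * u x * u x) \<le> norm (e * (8 * pi * e * N\<^sup>2) * (u x)\<^sup>2)"
        using e by (simp add: \<phi>_def abs_mult power2_eq_square mult_ac)
    qed
  qed
  have "(\<integral>x. (norm (wgrad u x))\<^sup>2 + (u x)\<^sup>2 \<partial>lebesgue) \<le> (\<integral>x. wgrad u x \<bullet> wgrad u x + u x * u x + e * \<phi> x * u x * u x \<partial>lebesgue)"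
  proof (rule integral_mono)
    show "integrable lebesgue (\<lambda>x. (norm (wgrad u x))\<^sup>2 + (u x)\<^sup>2)" using g2 u_square(1) by simp
    show "integrable lebesgue (\<lambda>x. wgrad u x \<bullet> wgrad u x + u x * u x + e * \<phi> x * u x * u x)"
      using g2 u_square(1) i3 by (simp add: power2_norm_eq_inner power2_eq_square[of "u _"])
    fix x :: "real^3"
    have "0 \<le> e * \<phi> x * (u x * u x)" using e V_bounds(1) by (simp add: \<phi>_def)
    then show "(norm (wgrad u x))\<^sup>2 + (u x)\<^sup>2 \<le> wgrad u x \<bullet> wgrad u x + u x * u x + e * \<phi> x * u x * u x"
      unfolding power2_norm_eq_inner power2_eq_square[of "u _"] by (simp add: mult.assoc)
  qed
  also have "\<dots> = lam * (\<integral>x. \<alpha> x * f (u x) * u x \<partial>lebesgue)" by (rule first_equation[OF u_H1 \<alpha>])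
  also have "\<dots> \<le> lam * (\<integral>x. M * Cf * (u x)\<^sup>2 \<partial>lebesgue)"
  proof (intro mult_left_mono lam integral_mono_AE)
    show i: "integrable lebesgue (\<lambda>x. M * Cf * (u x)\<^sup>2)" by (intro integrable_mult_right u_square)
    have le: "AE x in lebesgue. \<bar>\<alpha> x * f (u x) * u x\<bar> \<le> M * Cf * (u x)\<^sup>2"
      using \<alpha>(2)
    proof eventually_elim
      case (elim x)
      have "\<bar>\<alpha> x\<bar> * \<bar>f (u x)\<bar> \<le> M * (Cf * \<bar>u x\<bar>)" unfolding elim using b(2,3)[of "norm x"] M
        by (intro mult_mono Cf(2)) auto
      then have "\<bar>\<alpha> x\<bar> * \<bar>f (u x)\<bar> * \<bar>u x\<bar> \<le> M * (Cf * \<bar>u x\<bar>) * \<bar>u x\<bar>" by (intro mult_right_mono) auto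
      then show ?case by (simp add: abs_mult power2_eq_square mult.assoc)
    qed
    have fm: "(\<lambda>x. f (u x)) \<in> borel_measurable lebesgue" by (rule measurable_compose[OF um]) measurable
    show "integrable lebesgue (\<lambda>x. \<alpha> x * f (u x) * u x)"
      by (rule Bochner_Integration.integrable_bound[OF i]) (use le fm \<alpha>(1) um in \<open>auto elim: eventually_mono\<close>)
    show "AE x in lebesgue. \<alpha> x * f (u x) * u x \<le> M * Cf * (u x)\<^sup>2" using le by eventually_elim auto
  qed
  also have "\<dots> = lam * (M * Cf * (\<integral>x. (u x)\<^sup>2 \<partial>lebesgue))" by simp
  also have "\<dots> \<le> lam * (M * Cf * (4 * pi * N\<^sup>2))"
    using M Cf(1) by (intro mult_left_mono lam u_square) auto
  finally show "(\<integral>x. (norm (wgrad u x))\<^sup>2 + (u x)\<^sup>2 \<partial>lebesgue) \<le> lam * (M * Cf * (4 * pi * N\<^sup>2))" .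
qed

text \<open>Test the second equation with \<open>\<phi>\<close> itself and bound
  \<open>\<phi>\<close> by its supremum.\<close>

lemma D12_norm_le: "D12_norm \<phi> \<le> sqrt (4 * pi * e * (8 * pi * e * N\<^sup>2 * (4 * pi * N\<^sup>2)))"
  unfolding D12_norm_def
proof (rule real_sqrt_le_mono)
  note um = weak_gradD(1)[OF u_weak_grad] and pm = weak_gradD(1)[OF \<phi>_weak_grad]
  have V8: "(u x)\<^sup>2 * \<phi> x \<le> 8 * pi * e * N\<^sup>2 * (u x)\<^sup>2" "0 \<le> (u x)\<^sup>2 * \<phi> x" for x
    using mult_left_mono[OF V_bounds(2), of "(u x)\<^sup>2" "norm x"] V_bounds(1)[of "norm x"]
    unfolding \<phi>_def by (simp_all add: mult.commute)
  have i: "integrable lebesgue (\<lambda>x. 8 * pi * e * N\<^sup>2 * (u x)\<^sup>2)" by (intro integrable_mult_right u_square)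
  have i': "integrable lebesgue (\<lambda>x. (u x)\<^sup>2 * \<phi> x)"
    by (rule Bochner_Integration.integrable_bound[OF i]) (use V8 um pm in \<open>auto intro!: AE_I2 order_trans[OF _ abs_ge_self]\<close>)
  have "(\<integral>x. (norm (wgrad \<phi> x))\<^sup>2 \<partial>lebesgue) = 4 * pi * e * (\<integral>x. (u x)\<^sup>2 * \<phi> x \<partial>lebesgue)"
    using second_equation[OF \<phi>_D12] by (simp add: power2_norm_eq_inner)
  also have "\<dots> \<le> 4 * pi * e * (\<integral>x. 8 * pi * e * N\<^sup>2 * (u x)\<^sup>2 \<partial>lebesgue)"
    using e by (intro mult_left_mono integral_mono[OF i' i V8(1)]) auto
  also have "\<dots> = 4 * pi * e * (8 * pi * e * N\<^sup>2 * (\<integral>x. (u x)\<^sup>2 \<partial>lebesgue))" by simp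
  also have "\<dots> \<le> 4 * pi * e * (8 * pi * e * N\<^sup>2 * (4 * pi * N\<^sup>2))"
    using e by (intro mult_left_mono u_square) auto
  finally show "(\<integral>x. (norm (wgrad \<phi> x))\<^sup>2 \<partial>lebesgue) \<le> 4 * pi * e * (8 * pi * e * N\<^sup>2 * (4 * pi * N\<^sup>2))" .
qed

end

section \<open>Existence of two solutions\<close>

text \<open>Interpolation between the bound \<open>M\<close> and exponent \<open>p\<close>: the
  square is the power \<open>2 - p\<close>, which is bounded, times the power
  \<open>p\<close>.\<close>

lemma square_integrable_of_powr:
  fixes \<alpha> :: "'a \<Rightarrow> real"
  assumes \<alpha>: "\<alpha> \<in> borel_measurable N" "AE x in N. \<bar>\<alpha> x\<bar> \<le> M" and p: "0 < p" "p \<le> 2"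
    and i: "integrable N (\<lambda>x. \<bar>\<alpha> x\<bar> powr p)"
  shows "integrable N (\<lambda>x. (\<alpha> x)\<^sup>2)"
proof (rule Bochner_Integration.integrable_bound)
  show "integrable N (\<lambda>x. \<bar>M\<bar> powr (2 - p) * \<bar>\<alpha> x\<bar> powr p)" using i by simp
  show "(\<lambda>x. (\<alpha> x)\<^sup>2) \<in> borel_measurable N" using \<alpha>(1) by measurable
  show "AE x in N. norm ((\<alpha> x)\<^sup>2) \<le> norm (\<bar>M\<bar> powr (2 - p) * \<bar>\<alpha> x\<bar> powr p)"
    using \<alpha>(2)
  proof eventually_elim
    case (elim x)
    show ?case
    proof (cases "\<alpha> x = 0")
      case False
      have "(\<alpha> x)\<^sup>2 = \<bar>\<alpha> x\<bar> powr 2" using False by (simp add: powr_numeral)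
      also have "\<dots> = \<bar>\<alpha> x\<bar> powr (2 - p) * \<bar>\<alpha> x\<bar> powr p" by (simp add: powr_add[symmetric])
      also have "\<dots> \<le> \<bar>M\<bar> powr (2 - p) * \<bar>\<alpha> x\<bar> powr p"
        using elim p by (intro mult_right_mono powr_mono2) auto
      finally show ?thesis by simp
    qed simp
  qed
qed

text \<open>If the integral vanished for every radius, \<open>b\<close> would be zero at almost
  every positive radius, hence almost everywhere on three-space.\<close>

lemma radial_weight_positive:
  fixes b :: "real \<Rightarrow> real"
  assumes b: "b \<in> borel_measurable borel" "\<And>r. 0 \<le> b r" "L2 (\<lambda>r. b r * r)"
    and nz: "\<not> (AE x::real^3 in lebesgue. b (norm x) = 0)"
  obtains R where "R > 0" "(\<integral>r. indicator {0..R} r * (b r * r\<^sup>2) \<partial>lborel) > 0"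
proof (rule ccontr)
  assume "\<not> thesis"
  then have neg: "\<not> (\<integral>r. indicator {0..real (Suc n)} r * (b r * r\<^sup>2) \<partial>lborel) > 0" for n using that by (meson of_nat_0_less_iff zero_less_Suc)
  have "AE r in lborel. indicator {0..real (Suc n)} r * (b r * r\<^sup>2) = 0" for n
  proof -
    have "L2 (\<lambda>r. indicator {0..real (Suc n)} r * r)"
      by (rule L2_bound(1)[OF L2_indicator[of 0 "real (Suc n)"], where C="real (Suc n)"]) (auto split: split_indicator)
    from L2_mult[OF this b(3)] have "integrable lborel (\<lambda>r. indicator {0..real (Suc n)} r * (b r * r\<^sup>2))"
      by (simp add: power2_eq_square mult_ac)
    moreover have nn: "0 \<le> indicator {0..real (Suc n)} r * (b r * r\<^sup>2)" for r using b(2) by simp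
    moreover have "(\<integral>r. indicator {0..real (Suc n)} r * (b r * r\<^sup>2) \<partial>lborel) = 0"
    proof -
      have "0 \<le> (\<integral>r. indicator {0..real (Suc n)} r * (b r * r\<^sup>2) \<partial>lborel)"
        by (intro Bochner_Integration.integral_nonneg nn)
      then show ?thesis using neg[of n] by linarith
    qed
    ultimately show ?thesis using nn by (subst (asm) integral_nonneg_eq_0_iff_AE) auto
  qed
  then have "AE r in lborel. \<forall>n. indicator {0..real (Suc n)} r * (b r * r\<^sup>2) = 0" by (subst AE_all_countable) blast
  then have "AE r in lborel. r > 0 \<longrightarrow> b r = 0"
  proof eventually_elim
    case (elim r)
    show ?case
    proof
      assume r: "r > 0"
      obtain n where "r \<le> real n" using real_arch_simple by blast
      then have "indicator {0..real (Suc n)} r = (1::real)" using r by simp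
      with elim[rule_format, of n] r show "b r = 0" by simp
    qed
  qed
  from AE_radial[OF this] have "AE x::real^3 in lebesgue. x \<noteq> 0 \<longrightarrow> b (norm x) = 0" by (rule AE_completion)
  moreover have "AE x in lebesgue. x \<noteq> (0::real^3)" by (intro AE_completion AE_lborel_singleton)
  ultimately have "AE x::real^3 in lebesgue. b (norm x) = 0" by eventually_elim simp
  with nz show False by blast
qed

theorem theorem1p2:
  fixes e q :: real and f :: "real \<Rightarrow> real" and \<alpha> :: "real^3 \<Rightarrow> real"
  assumes e_pos: "e > 0"
    and f_cont: "continuous_on UNIV f"
    and f1: "((\<lambda>s. f s / s) \<longlongrightarrow> 0) at_infinity"
    and f2: "((\<lambda>s. f s / s) \<longlongrightarrow> 0) (at 0)"
    and f3: "\<exists>s0::real. (LBINT t=ereal 0..ereal s0. f t) > 0"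
    and q: "0 < q" "q < 1"
    and \<alpha>_meas: "\<alpha> \<in> borel_measurable lebesgue"
    and \<alpha>_Linf: "\<exists>M. AE x in lebesgue. \<bar>\<alpha> x\<bar> \<le> M"
    and \<alpha>_Lp: "integrable lebesgue (\<lambda>x. \<bar>\<alpha> x\<bar> powr (6 / (5 - q)))"
    and \<alpha>_nonneg: "\<forall>x. \<alpha> x \<ge> 0"
    and \<alpha>_nonzero: "\<not> (AE x in lebesgue. \<alpha> x = 0)"
    and \<alpha>_radial: "radial \<alpha>"
  shows "\<exists>a b \<nu>. a < b \<and> {a<..<b} \<subseteq> {1 / (Linf_norm \<alpha> * c_const e f)<..} \<and> \<nu> > 0 \<and>
           (\<forall>lam\<in>{a<..<b}. \<exists>u1 \<phi>1 u2 \<phi>2.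
              weak_solution e lam \<alpha> f u1 \<phi>1 \<and> weak_solution e lam \<alpha> f u2 \<phi>2 \<and>
              \<not> (AE x in lebesgue. u1 x = u2 x \<and> \<phi>1 x = \<phi>2 x) \<and>
              radial u1 \<and> radial \<phi>1 \<and> radial u2 \<and> radial \<phi>2 \<and>
              \<not> (AE x in lebesgue. u1 x = 0 \<and> \<phi>1 x = 0) \<and>
              \<not> (AE x in lebesgue. u2 x = 0 \<and> \<phi>2 x = 0) \<and>
              H1_norm u1 \<le> \<nu> \<and> D12_norm \<phi>1 \<le> \<nu> \<and>
              H1_norm u2 \<le> \<nu> \<and> D12_norm \<phi>2 \<le> \<nu>)"
proof -
  from \<alpha>_Linf obtain M0 where M0: "AE x in lebesgue. \<bar>\<alpha> x\<bar> \<le> M0" by blast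
  \<comment> \<open>The maximum with 1 guarantees the strict positivity that
    \<open>reduced_system\<close> assumes.\<close>
  define M where "M = max 1 M0"
  have M: "M > 0" by (simp add: M_def)
  have M_abs: "AE x in lebesgue. \<bar>\<alpha> x\<bar> \<le> M" using M0 by eventually_elim (simp add: M_def)
  then have "AE x in lebesgue. \<alpha> x \<le> M" by eventually_elim simp
  then obtain b where b: "b \<in> borel_measurable borel" "\<And>r. 0 \<le> b r" "\<And>r. b r \<le> M" "\<And>r. r \<le> 0 \<Longrightarrow> b r = 0"
    and \<alpha>b: "AE x in lebesgue. \<alpha> x = b (norm x)"
    using radial_Borel_representative[OF \<alpha>_meas \<alpha>_radial \<alpha>_nonneg[rule_format] _ less_imp_le[OF M]] by blast
  have p: "0 < 6 / (5 - q)" "6 / (5 - q) \<le> 2" using q by (auto simp: divide_simps)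
  have bm: "(\<lambda>r. (b r)\<^sup>2) \<in> borel_measurable borel" using b(1) by measurable
  then have bm3: "(\<lambda>x::real^3. (b (norm x))\<^sup>2) \<in> borel_measurable borel" by measurable
  have L2b: "L2 (\<lambda>r. b r * r)"
  proof -
    have "integrable lebesgue (\<lambda>x. (\<alpha> x)\<^sup>2)" by (rule square_integrable_of_powr[OF \<alpha>_meas M_abs p \<alpha>_Lp])
    moreover have "(\<lambda>x::real^3. (b (norm x))\<^sup>2) \<in> borel_measurable lebesgue" by (rule borel_measurable_lebesgueI[OF bm3])
    ultimately have "integrable lebesgue (\<lambda>x::real^3. (b (norm x))\<^sup>2)"
      using \<alpha>_meas \<alpha>b by (subst integrable_cong_AE[where g="\<lambda>x. (\<alpha> x)\<^sup>2"]) (auto elim: eventually_mono)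
    then have "integrable lborel (\<lambda>r. indicator {0..} r * (4 * pi * r\<^sup>2) * (b r)\<^sup>2)"
      unfolding integrable_lebesgue_Borel(1)[OF bm3] radial_integrable_iff[OF bm] .
    then have "integrable lborel (\<lambda>r. 1 / (4 * pi) * (indicator {0..} r * (4 * pi * r\<^sup>2) * (b r)\<^sup>2))"
      by (intro integrable_mult_right)
    moreover have "1 / (4 * pi) * (indicator {0..} r * (4 * pi * r\<^sup>2) * (b r)\<^sup>2) = (b r * r)\<^sup>2" for r
      using b(4)[of r] by (cases "r < 0") (auto simp: power_mult_distrib)
    ultimately have "integrable lborel (\<lambda>r. (b r * r)\<^sup>2)" by (simp only:)
    moreover have "(\<lambda>r. b r * r) \<in> borel_measurable borel" using b(1) by measurable
    ultimately show ?thesis by (simp add: L2_def)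
  qed
  obtain F where F: "\<And>s. (F has_real_derivative f s) (at s)" "F 0 = 0" "\<And>s. (LBINT t=ereal 0..ereal s. f t) = F s"
    using continuous_primitive[OF f_cont] by blast
  from f3 obtain s0 where s0: "F s0 > 0" unfolding F(3) by blast
  interpret reduced_system e M f F b
    by unfold_locales (use e_pos f_cont f1 f2 F b L2b M in auto)
  have "\<not> (AE x::real^3 in lebesgue. b (norm x) = 0)"
  proof
    assume "AE x::real^3 in lebesgue. b (norm x) = 0"
    with \<alpha>b have "AE x in lebesgue. \<alpha> x = 0" by eventually_elim simp
    with \<alpha>_nonzero show False by blast
  qed
  from radial_weight_positive[OF b(1,2) L2b this] obtain R where
    "R > 0" "(\<integral>r. indicator {0..R} r * (b r * r\<^sup>2) \<partial>lborel) > 0" by blast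
  from J_pos_witness[OF s0 this] obtain q0 where "J (W (prof q0)) > 0" by blast
  from energy_negative[OF this] obtain L where L: "\<And>lam. lam > L \<Longrightarrow> energy lam q0 < 0" by blast
  \<comment> \<open>The three entries give \<open>lam \<ge> 0\<close>, negative energy at
    \<open>q0\<close>, and the lower bound demanded of the interval.\<close>
  define a where "a = max 0 (max L (1 / (Linf_norm \<alpha> * c_const e f)))"
  have a: "0 \<le> a" "L \<le> a" "1 / (Linf_norm \<alpha> * c_const e f) \<le> a" by (auto simp: a_def)
  obtain B where B: "B \<ge> 0" "\<And>lam q. 0 \<le> lam \<Longrightarrow> lam \<le> a + 1 \<Longrightarrow> grad lam q = 0 \<Longrightarrow> norm q \<le> B"
    using critical_point_bound[of "a + 1"] a(1) by auto
  \<comment> \<open>\<open>x1\<close> and \<open>x2\<close> are the bounds of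
    \<open>H1_norm_le\<close> and \<open>D12_norm_le\<close> with \<open>lam\<close> replaced by
    \<open>a + 1\<close> and the norm of the profile by \<open>B\<close>.\<close>
  define x1 where "x1 = sqrt ((a + 1) * (M * Cf * (4 * pi * B\<^sup>2)))"
  define x2 where "x2 = sqrt (4 * pi * e * (8 * pi * e * B\<^sup>2 * (4 * pi * B\<^sup>2)))"
  define \<nu> where "\<nu> = 1 + x1 + x2"
  have x: "0 \<le> x1" "0 \<le> x2"
    unfolding x1_def x2_def using a M Cf(1) e_pos by (auto intro!: mult_nonneg_nonneg add_nonneg_nonneg)
  have AE0: "\<not> (AE x::real^3 in lebesgue. W (prof p) (norm x) / norm x = 0)" if "p \<noteq> 0" for p
    using profile_eqI[of p 0] that by (auto simp: zero_profile.rep_eq W_def)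
  have solution: "\<exists>\<phi>. weak_solution e lam \<alpha> f (\<lambda>x. W (prof q) (norm x) / norm x) \<phi> \<and> radial \<phi> \<and>
      H1_norm (\<lambda>x. W (prof q) (norm x) / norm x) \<le> \<nu> \<and> D12_norm \<phi> \<le> \<nu>"
    if lam: "0 \<le> lam" "lam \<le> a + 1" and crit: "grad lam q = 0" for lam q
  proof -
    interpret C: critical_profile e M f F b lam q by unfold_locales (use lam crit in auto)
    have u: "C.u = (\<lambda>x. W (prof q) (norm x) / norm x)" by (rule ext) (simp add: C.u_def C.w_def C.p_def)
    have N: "0 \<le> C.N" "C.N \<le> B" using B(2)[OF lam crit] by (auto simp: C.N_def)
    then have N2: "C.N\<^sup>2 \<le> B\<^sup>2" by (intro power_mono)
    have "H1_norm C.u \<le> x1"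
    proof (rule order_trans[OF C.H1_norm_le[OF \<alpha>_meas \<alpha>b]])
      show "sqrt (lam * (M * Cf * (4 * pi * C.N\<^sup>2))) \<le> x1" unfolding x1_def
        using lam a M Cf(1) N2 by (intro real_sqrt_le_mono mult_mono) auto
    qed
    moreover have "D12_norm C.\<phi> \<le> x2"
    proof (rule order_trans[OF C.D12_norm_le])
      show "sqrt (4 * pi * e * (8 * pi * e * C.N\<^sup>2 * (4 * pi * C.N\<^sup>2))) \<le> x2" unfolding x2_def
        using e_pos N2 by (intro real_sqrt_le_mono mult_mono) auto
    qed
    moreover have "radial C.\<phi>" by (simp add: radial_def C.\<phi>_def)
    moreover note C.weak_solution[OF \<alpha>_meas \<alpha>b]
    ultimately show ?thesis using x unfolding u \<nu>_def by (intro exI[of _ C.\<phi>]) auto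
  qed
  show ?thesis
  proof (rule exI[of _ a], rule exI[of _ "a + 1"], rule exI[of _ \<nu>], intro conjI ballI)
    show "a < a + 1" by simp
    show "{a<..<a + 1} \<subseteq> {1 / (Linf_norm \<alpha> * c_const e f)<..}" using a(3) by auto
    show "\<nu> > 0" using x by (simp add: \<nu>_def)
  next
    fix lam assume "lam \<in> {a<..<a + 1}"
    then have lam: "0 \<le> lam" "lam \<le> a + 1" "energy lam q0 < 0" using a L by auto
    from critical_points[OF lam(1,3)] obtain p1 p2 where
      cr: "grad lam p1 = 0" "grad lam p2 = 0" and ne: "p1 \<noteq> p2" "p1 \<noteq> 0" "p2 \<noteq> 0" by blast
    let ?u = "\<lambda>p x. W (prof p) (norm (x :: real^3)) / norm x"
    obtain \<phi>1 where 1: "weak_solution e lam \<alpha> f (?u p1) \<phi>1" "radial \<phi>1" "H1_norm (?u p1) \<le> \<nu>" "D12_norm \<phi>1 \<le> \<nu>"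
      using solution[OF lam(1,2) cr(1)] by blast
    obtain \<phi>2 where 2: "weak_solution e lam \<alpha> f (?u p2) \<phi>2" "radial \<phi>2" "H1_norm (?u p2) \<le> \<nu>" "D12_norm \<phi>2 \<le> \<nu>"
      using solution[OF lam(1,2) cr(2)] by blast
    have r: "radial (?u p)" for p by (simp add: radial_def)
    \<comment> \<open>The first components already differ, so nothing has to be known about the
      potentials.\<close>
    have "\<not> (AE x in lebesgue. ?u p1 x = ?u p2 x \<and> \<phi>1 x = \<phi>2 x)"
      using profile_eqI[of p1 p2] ne(1) by (auto elim: eventually_mono)
    moreover have "\<not> (AE x in lebesgue. ?u p1 x = 0 \<and> \<phi>1 x = 0)" "\<not> (AE x in lebesgue. ?u p2 x = 0 \<and> \<phi>2 x = 0)"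
      using AE0[OF ne(2)] AE0[OF ne(3)] by (auto elim: eventually_mono)
    ultimately show "\<exists>u1 \<phi>1 u2 \<phi>2.
        weak_solution e lam \<alpha> f u1 \<phi>1 \<and> weak_solution e lam \<alpha> f u2 \<phi>2 \<and>
        \<not> (AE x in lebesgue. u1 x = u2 x \<and> \<phi>1 x = \<phi>2 x) \<and>
        radial u1 \<and> radial \<phi>1 \<and> radial u2 \<and> radial \<phi>2 \<and>
        \<not> (AE x in lebesgue. u1 x = 0 \<and> \<phi>1 x = 0) \<and>
        \<not> (AE x in lebesgue. u2 x = 0 \<and> \<phi>2 x = 0) \<and>
        H1_norm u1 \<le> \<nu> \<and> D12_norm \<phi>1 \<le> \<nu> \<and>
        H1_norm u2 \<le> \<nu> \<and> D12_norm \<phi>2 \<le> \<nu>"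
      using 1 2 r by (intro exI[of _ "?u p1"] exI[of _ \<phi>1] exI[of _ "?u p2"] exI[of _ \<phi>2]) simp
  qed
qed

end
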